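(* Fix a Courant algebroid $E\to M$, a Dirac structure $A\subset E$, and a complementary isotropic subbundle $K$ (so $E=A\oplus K$). Let $\mathcal{M}=T^*[2]A[1]$ and let $(L,\mathfrak{a},P,\Delta)$ be the quadruple $L=C(\mathcal{M})[2]$ with its Poisson bracket, $\mathfrak{a}=pr^*(C(A[1]))[2]\cong\Gamma(\wedge A^* )[2]$, $P:L\to\mathfrak{a}$ evaluation on the base $A[1]$, and $\Delta=-\varphi+h_{d_A}+F^*(h_{d_{A^*}})-\psi$. For all $\tilde\Delta\in C(\mathcal{M})_3$ and $\tilde\Phi\in\Gamma(\wedge^2A^* )$: $$\begin{cases}\Delta+\tilde\Delta\text{ defines a new Courant algebroid structure on the vector bundle }E \text{ (with the same symmetric pairing), and}\\ \mathrm{graph}(-\tilde\Phi)\text{ is a Dirac structure there}\end{cases}\iff(\tilde\Delta[3],\tilde\Phi[2])\in MC\big((L[1]\oplus\mathfrak{a})^P_\Delta\big).$$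
   Context: Courant algebroid: a vector bundle $E\to M$ with non-degenerate symmetric fiberwise pairing $\langle\cdot,\cdot\rangle$, a bilinear operation $[\![\cdot,\cdot]\!]$ on $\Gamma(E)$ and a bundle map $\rho:E\to TM$ with $[\![e_1,[\![e_2,e_3]\!]]\!]=[\![[\![e_1,e_2]\!],e_3]\!]+[\![e_2,[\![e_1,e_3]\!]]\!]$, $\rho(e_1)\langle e_2,e_3\rangle=\langle[\![e_1,e_2]\!],e_3\rangle+\langle e_2,[\![e_1,e_3]\!]\rangle$, $\langle[\![e,e]\!],e'\rangle=\frac12\rho(e')\langle e,e\rangle$. Dirac structure: a subbundle equal to its own orthogonal whose sections are closed under $[\![\cdot,\cdot]\!]$. Let $E=A\oplus K$ with $A,K$ maximal isotropic (each equal to its orthogonal); identify $K\cong A^*$ via the pairing. Define $\psi\in\Gamma(\wedge^3A)$ by $\psi(\eta_1,\eta_2,\cdot)=pr_A[\![(0,\eta_1),(0,\eta_2)]\!]$ and $\varphi\in\Gamma(\wedge^3A^* )$ by $\varphi(a_1,a_2,\cdot)=pr_{A^*}[\![(a_1,0),(a_2,0)]\!]$; $[\cdot,\cdot]_A=pr_A[\![\cdot,\cdot]\!]|_A$, $[\cdot,\cdot]_{A^*}=pr_{A^*}[\![\cdot,\cdot]\!]|_{A^*}$. $d_A$ is the degree 1 derivation of $\Gamma(\wedge A^* )$ given by $[\cdot,\cdot]_A,\rho|_A$ through the usual formulas $(d_Af)(a)=\rho(a)f$, $(d_A\eta)(a_1,a_2)=\rho(a_1)\eta(a_2)-\rho(a_2)\eta(a_1)-\eta([a_1,a_2]_A)$;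 $d_{A^*}$ on $\Gamma(\wedge A)$ is defined likewise from $[\cdot,\cdot]_{A^*},\rho|_{A^*}$. $\mathcal{M}=T^*[2]A[1]$ is the graded manifold with functions $C(\mathcal{M})$ locally generated by coordinates $x_i$ on $M$ (degree 0), a frame $\xi_a$ of $A^*$ (degree 1, fiber coordinates of $A[1]$), the dual frame $\theta_a$ of $A$ (degree 1) and $P_i$ (degree 2), with degree $-2$ Poisson bracket $\{P_i,x_j\}_{\mathcal M}=\delta_{ij}$, $\{\theta_a,\xi_b\}_{\mathcal M}=\delta_{ab}$, other brackets of generators zero; $pr:\mathcal{M}\to A[1]$ is the projection; $P$ sets $P_i=0,\theta_a=0$. $\Gamma(\wedge A^* )$, $\Gamma(\wedge A)$ are contained in $C(\mathcal{M})$. $h_{d_A}\in C_3(\mathcal M)$ is the fiberwise linear function (linear in $P_i,\theta_a$) with $\{h_{d_A},f\}_{\mathcal M}=d_Af$ for $f\in\Gamma(\wedge A^* )$. $F:T^*[2]A[1]\to T^*[2]A^*[1]$ is the canonical (Legendre) symplectomorphism, exchanging the roles of $\xi$ and $\theta$; $F^*(h_{d_{A^*}})$ is the function linear in the fiber coordinates ($P_i,\xi_a$) of $T^*[2]A^*[1]\to A^*[1]$ with $\{F^*(h_{d_{A^*}}),g\}_{\mathcal M}=d_{A^*}g$ for $g\in\Gamma(\wedge A)$. Roytenberg's correspondence: degree 3 functions $\Theta$ with $\{\Theta,\Theta\}_{\mathcal M}=0$ correspond bijectively to Courant algebroid structures on $(E,\langle\cdot,\cdot\rangle)$ via $\Gamma(E)=C_1(\mathcal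 M)$, $\rho(e)f=\{\{\Theta,e\}_{\mathcal M},f\}_{\mathcal M}$, $[\![e_1,e_2]\!]=\{\{\Theta,e_1\}_{\mathcal M},e_2\}_{\mathcal M}$; $\Delta$ corresponds to the given structure. "$\Theta$ defines a Courant algebroid structure" means $\{\Theta,\Theta\}_{\mathcal M}=0$ with this structure. $\mathrm{graph}(-\tilde\Phi)=\{X-\iota_X\tilde\Phi:X\in A\}\subset A\oplus A^*=E$. $V[n]_i=V_{i+n}$. $L$ is a graded Lie algebra with bracket $[\cdot,\cdot]:=\{\cdot,\cdot\}_{\mathcal M}$. $(L[1]\oplus\mathfrak{a})^P_\Delta$ is the $L_\infty[1]$-algebra (Voronov) with, for $D=[\Delta,\cdot]$, $x,y\in L$, $a_i\in\mathfrak a$, $n\ge1$: $d(x[1],a)=(-(Dx)[1],P(x+Da))$, $\{x[1],y[1]\}=(-1)^{|x|}[x,y][1]$, $\{x[1],a_1,\dots,a_n\}=P[\dots[x,a_1],\dots,a_n]$, $\{a_1,\dots,a_n\}=P[\dots[Da_1,a_2],\dots,a_n]$, other multibrackets zero up to permutation. An $L_\infty[1]$-algebra is a graded vector space with graded symmetric degree 1 multibrackets $m_k$, $k\ge1$, satisfying $\sum_{i+j=n+1}\sum_{\sigma\in S_{(i,n-i)}}\epsilon(\sigma)m_j(m_i(v_{\sigma(1)},\dots,v_{\sigma(i)}),v_{\sigma(i+1)},\dots,v_{\sigma(n)})=0$ for all $n\ge1$ (sum over $i,j\ge1$ and unshuffles, $\epsilon$ the Koszul sign). $MC$ is the set of degree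 0 elements $\alpha$ with $\sum_{n\ge1}\frac1{n!}\{\alpha,\dots,\alpha\}=0$. *)

theory Defs
  imports "HOL-Analysis.Analysis" "HOL-Library.Function_Algebras" "HOL-Library.Multiset"
begin

instantiation "fun" :: (type, real_vector) real_vector
begin

definition scaleR_fun_def: "scaleR r f = (\<lambda>x. r *\<^sub>R f x)"

instance
  by standard (simp_all add: scaleR_fun_def fun_eq_iff scaleR_add_right scaleR_add_left)

end


section \<open>Smooth manifolds and vector bundles\<close>

text \<open>
  The manifold is the whole type \<open>'m\<close>. Charts take values in
  \<^const>\<open>Euclidean_space\<close>, so that the dimension \<open>n\<close> is an arbitrary natural number,
  0 included. \<open>pd U x i f\<close> is the partial derivative of \<open>f\<close> in the \<open>i\<close>-th coordinate of
  the chart \<open>(U, x)\<close>.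
\<close>

definition pd :: "'m set \<Rightarrow> ('m \<Rightarrow> nat \<Rightarrow> real) \<Rightarrow> nat \<Rightarrow> ('m \<Rightarrow> real) \<Rightarrow> 'm \<Rightarrow> real" where
  "pd U x i f p = deriv (\<lambda>t. f (inv_into U x ((x p)(i := t)))) (x p i)"

primrec pds :: "'m set \<Rightarrow> ('m \<Rightarrow> nat \<Rightarrow> real) \<Rightarrow> nat list \<Rightarrow> ('m \<Rightarrow> real) \<Rightarrow> 'm \<Rightarrow> real" where
  "pds U x [] f = f"
| "pds U x (i # js) f = pd U x i (pds U x js f)"

text \<open>On the open set \<open>U \<inter> W\<close>, all iterated partial derivatives exist and are continuous.\<close>

definition smooth_in_chart ::
  "nat \<Rightarrow> 'm::topological_space set \<Rightarrow> ('m \<Rightarrow> nat \<Rightarrow> real) \<Rightarrow> 'm set \<Rightarrow> ('m \<Rightarrow> real) \<Rightarrow> bool" where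
  "smooth_in_chart n U x W f \<longleftrightarrow>
    (\<forall>js. set js \<subseteq> {..<n} \<longrightarrow>
      continuous_on (U \<inter> W) (pds U x js f) \<and>
      (\<forall>i<n. \<forall>p\<in>U \<inter> W.
        (\<lambda>t. pds U x js f (inv_into U x ((x p)(i := t)))) differentiable (at (x p i))))"

definition smooth_atlas ::
  "nat \<Rightarrow> ('m::topological_space set \<times> ('m \<Rightarrow> nat \<Rightarrow> real)) set \<Rightarrow> bool" where
  "smooth_atlas n At \<longleftrightarrow>
    (\<forall>(U, x)\<in>At. open U \<and> openin (Euclidean_space n) (x ` U) \<and>
       homeomorphism U (x ` U) x (inv_into U x)) \<and>
    (\<Union>(fst ` At)) = UNIV \<and>
    (\<forall>(U, x)\<in>At. \<forall>(V, y)\<in>At. \<forall>i<n. smooth_in_chart n U x V (\<lambda>p. y p i))"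

text \<open>
  A vector bundle over a manifold, with a fibrewise pairing. The fibres \<open>fib B p\<close> are subspaces
  of an ambient real vector space \<open>'e\<close> which carries no topology; the smooth structure of the
  bundle is given by the family \<open>frames B\<close> of local frames. The rank of the bundle is
  \<open>2 * hrk B\<close>: a bundle with a non-degenerate pairing and a subbundle equal to its own orthogonal
  has even rank.
\<close>

record ('m, 'e) qbundle =
  bdim :: nat
  atlas :: "('m set \<times> ('m \<Rightarrow> nat \<Rightarrow> real)) set"
  hrk :: nat
  fib :: "'m \<Rightarrow> 'e set"
  frames :: "('m set \<times> (nat \<Rightarrow> 'm \<Rightarrow> 'e)) set"
  pair :: "'m \<Rightarrow> 'e \<Rightarrow> 'e \<Rightarrow> real"

definition smooth :: "('m::topological_space, 'e) qbundle \<Rightarrow> 'm set \<Rightarrow> ('m \<Rightarrow> real) \<Rightarrow> bool" where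
  "smooth B W f \<longleftrightarrow> (\<forall>(U, x)\<in>atlas B. smooth_in_chart (bdim B) U x W f)"

definition basis_of :: "nat \<Rightarrow> (nat \<Rightarrow> 'e::real_vector) \<Rightarrow> 'e set \<Rightarrow> bool" where
  "basis_of k b V \<longleftrightarrow>
    inj_on b {..<k} \<and> independent (b ` {..<k}) \<and> span (b ` {..<k}) = V"

definition vector_bundle ::
  "('m::{t2_space,second_countable_topology}, 'e::real_vector) qbundle \<Rightarrow> bool" where
  "vector_bundle B \<longleftrightarrow>
    smooth_atlas (bdim B) (atlas B) \<and>
    (\<forall>(W, e)\<in>frames B. open W \<and> (\<forall>p\<in>W. basis_of (2 * hrk B) (\<lambda>i. e i p) (fib B p))) \<and>
    (\<Union>(fst ` frames B)) = UNIV \<and>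
    (\<forall>(W, e)\<in>frames B. \<forall>(W', e')\<in>frames B. \<exists>g.
       (\<forall>i<2 * hrk B. \<forall>j<2 * hrk B. smooth B (W \<inter> W') (g i j)) \<and>
       (\<forall>p\<in>W \<inter> W'. \<forall>j<2 * hrk B. e' j p = (\<Sum>i<2 * hrk B. g i j p *\<^sub>R e i p)))"

definition local_section ::
  "('m::topological_space, 'e::real_vector) qbundle \<Rightarrow> 'm set \<Rightarrow> ('m \<Rightarrow> 'e) \<Rightarrow> bool" where
  "local_section B W s \<longleftrightarrow>
    (\<forall>p\<in>W. s p \<in> fib B p) \<and>
    (\<forall>(V, e)\<in>frames B. \<exists>g. (\<forall>i<2 * hrk B. smooth B (V \<inter> W) (g i)) \<and>
       (\<forall>p\<in>V \<inter> W. s p = (\<Sum>i<2 * hrk B. g i p *\<^sub>R e i p)))"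

definition sections ::
  "('m::topological_space, 'e::real_vector) qbundle \<Rightarrow> ('m \<Rightarrow> 'e set) \<Rightarrow> ('m \<Rightarrow> 'e) set" where
  "sections B D = {s. local_section B UNIV s \<and> (\<forall>p. s p \<in> D p)}"

definition subbundle ::
  "('m::topological_space, 'e::real_vector) qbundle \<Rightarrow> ('m \<Rightarrow> 'e set) \<Rightarrow> bool" where
  "subbundle B D \<longleftrightarrow>
    (\<exists>k. \<forall>p. \<exists>W s. open W \<and> p \<in> W \<and> (\<forall>i<k. local_section B W (s i)) \<and>
       (\<forall>q\<in>W. basis_of k (\<lambda>i. s i q) (D q)))"

definition smooth_pairing ::
  "('m::topological_space, 'e::real_vector) qbundle \<Rightarrow> bool" where
  "smooth_pairing B \<longleftrightarrow>
    (\<forall>p. \<forall>u\<in>fib B p. \<forall>v\<in>fib B p. pair B p u v = pair B p v u) \<and>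
    (\<forall>p. \<forall>u\<in>fib B p. \<forall>v\<in>fib B p. \<forall>w\<in>fib B p. \<forall>a b.
       pair B p (a *\<^sub>R u + b *\<^sub>R v) w = a * pair B p u w + b * pair B p v w) \<and>
    (\<forall>p. \<forall>u\<in>fib B p. (\<forall>v\<in>fib B p. pair B p u v = 0) \<longrightarrow> u = 0) \<and>
    (\<forall>(W, e)\<in>frames B. \<forall>i<2 * hrk B. \<forall>j<2 * hrk B. smooth B W (\<lambda>p. pair B p (e i p) (e j p)))"

text \<open>
  Tangent vectors at \<open>p\<close> are the combinations of the coordinate derivations at \<open>p\<close>, acting on
  smooth functions.
\<close>

definition tangent_space ::
  "('m::topological_space, 'e) qbundle \<Rightarrow> 'm \<Rightarrow> (('m \<Rightarrow> real) \<Rightarrow> real) set" where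
  "tangent_space B p = {v. \<forall>(U, x)\<in>atlas B. p \<in> U \<longrightarrow>
     (\<exists>c. \<forall>f. smooth B UNIV f \<longrightarrow> v f = (\<Sum>i<bdim B. c i * pd U x i f p))}"

type_synonym ('m, 'e) anchor = "'m \<Rightarrow> 'e \<Rightarrow> ('m \<Rightarrow> real) \<Rightarrow> real"
type_synonym ('m, 'e) sbracket = "('m \<Rightarrow> 'e) \<Rightarrow> ('m \<Rightarrow> 'e) \<Rightarrow> ('m \<Rightarrow> 'e)"

definition act :: "('m, 'e) anchor \<Rightarrow> ('m \<Rightarrow> 'e) \<Rightarrow> ('m \<Rightarrow> real) \<Rightarrow> 'm \<Rightarrow> real" where
  "act \<rho> e f = (\<lambda>p. \<rho> p (e p) f)"

definition bundle_map_to_tangent ::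
  "('m::topological_space, 'e::real_vector) qbundle \<Rightarrow> ('m, 'e) anchor \<Rightarrow> bool" where
  "bundle_map_to_tangent B \<rho> \<longleftrightarrow>
    (\<forall>p. \<forall>u\<in>fib B p. \<rho> p u \<in> tangent_space B p) \<and>
    (\<forall>p. \<forall>u\<in>fib B p. \<forall>v\<in>fib B p. \<forall>a b f. smooth B UNIV f \<longrightarrow>
       \<rho> p (a *\<^sub>R u + b *\<^sub>R v) f = a * \<rho> p u f + b * \<rho> p v f) \<and>
    (\<forall>e\<in>sections B (fib B). \<forall>f. smooth B UNIV f \<longrightarrow> smooth B UNIV (act \<rho> e f))"

definition spair ::
  "('m, 'e) qbundle \<Rightarrow> ('m \<Rightarrow> 'e) \<Rightarrow> ('m \<Rightarrow> 'e) \<Rightarrow> 'm \<Rightarrow> real" where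
  "spair B e1 e2 = (\<lambda>p. pair B p (e1 p) (e2 p))"

definition courant_algebroid ::
  "('m::{t2_space,second_countable_topology}, 'e::real_vector) qbundle
    \<Rightarrow> ('m, 'e) anchor \<Rightarrow> ('m, 'e) sbracket \<Rightarrow> bool" where
  "courant_algebroid B \<rho> br \<longleftrightarrow>
    vector_bundle B \<and> smooth_pairing B \<and> bundle_map_to_tangent B \<rho> \<and>
    (let \<Gamma> = sections B (fib B) in
      (\<forall>e1\<in>\<Gamma>. \<forall>e2\<in>\<Gamma>. br e1 e2 \<in> \<Gamma>) \<and>
      (\<forall>e1\<in>\<Gamma>. \<forall>e2\<in>\<Gamma>. \<forall>e3\<in>\<Gamma>. \<forall>a b.
         br (a *\<^sub>R e1 + b *\<^sub>R e2) e3 = a *\<^sub>R br e1 e3 + b *\<^sub>R br e2 e3 \<and>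
         br e3 (a *\<^sub>R e1 + b *\<^sub>R e2) = a *\<^sub>R br e3 e1 + b *\<^sub>R br e3 e2) \<and>
      (\<forall>e1\<in>\<Gamma>. \<forall>e2\<in>\<Gamma>. \<forall>e3\<in>\<Gamma>.
         br e1 (br e2 e3) = br (br e1 e2) e3 + br e2 (br e1 e3)) \<and>
      (\<forall>e1\<in>\<Gamma>. \<forall>e2\<in>\<Gamma>. \<forall>e3\<in>\<Gamma>.
         act \<rho> e1 (spair B e2 e3) = spair B (br e1 e2) e3 + spair B e2 (br e1 e3)) \<and>
      (\<forall>e\<in>\<Gamma>. \<forall>e'\<in>\<Gamma>. spair B (br e e) e' = (1 / 2) *\<^sub>R act \<rho> e' (spair B e e)))"

definition dirac_structure ::
  "('m::topological_space, 'e::real_vector) qbundle \<Rightarrow> ('m, 'e) sbracket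
    \<Rightarrow> ('m \<Rightarrow> 'e set) \<Rightarrow> bool" where
  "dirac_structure B br D \<longleftrightarrow>
    subbundle B D \<and>
    (\<forall>p. D p = {v \<in> fib B p. \<forall>w\<in>D p. pair B p v w = 0}) \<and>
    (\<forall>e1\<in>sections B D. \<forall>e2\<in>sections B D. br e1 e2 \<in> sections B D)"

definition isotropic_complement ::
  "('m::topological_space, 'e::real_vector) qbundle \<Rightarrow> ('m \<Rightarrow> 'e set) \<Rightarrow> ('m \<Rightarrow> 'e set) \<Rightarrow> bool" where
  "isotropic_complement B A K \<longleftrightarrow>
    subbundle B K \<and>
    (\<forall>p. \<forall>u\<in>K p. \<forall>v\<in>K p. pair B p u v = 0) \<and>
    (\<forall>p. A p \<inter> K p = {0} \<and> fib B p = {u + v |u v. u \<in> A p \<and> v \<in> K p})"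

definition proj_along :: "'e::real_vector set \<Rightarrow> 'e set \<Rightarrow> 'e \<Rightarrow> 'e" where
  "proj_along V W v = (THE u. u \<in> V \<and> v - u \<in> W)"

text \<open>
  Smooth sections of \<open>\<wedge>\<^sup>k D\<^sup>*\<close>, as fibrewise alternating multilinear functions of \<open>k\<close> arguments
  (a list of length \<open>k\<close>). With \<open>K\<close> identified with \<open>A\<^sup>*\<close> by the pairing, the sections of
  \<open>\<wedge>\<^sup>k A\<close> are the forms on \<open>K\<close>.
\<close>

definition forms ::
  "('m::topological_space, 'e::real_vector) qbundle \<Rightarrow> ('m \<Rightarrow> 'e set) \<Rightarrow> nat
    \<Rightarrow> ('m \<Rightarrow> 'e list \<Rightarrow> real) set" where
  "forms B D k = {\<omega>.
    (\<forall>p vs i u v a b. length vs = k \<and> set vs \<subseteq> D p \<and> i < k \<and> u \<in> D p \<and> v \<in> D p \<longrightarrow>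
       \<omega> p (vs[i := a *\<^sub>R u + b *\<^sub>R v]) = a * \<omega> p (vs[i := u]) + b * \<omega> p (vs[i := v])) \<and>
    (\<forall>p vs. length vs = k \<and> set vs \<subseteq> D p \<and> \<not> distinct vs \<longrightarrow> \<omega> p vs = 0) \<and>
    (\<forall>W ss. open W \<and> length ss = k \<and>
       (\<forall>s\<in>set ss. local_section B W s \<and> (\<forall>p\<in>W. s p \<in> D p)) \<longrightarrow>
       smooth B W (\<lambda>p. \<omega> p (map (\<lambda>s. s p) ss)))}"


section \<open>Local functions on the graded manifold\<close>

text \<open>
  A function on \<open>T\<^sup>*[2]A[1]\<close> in local coordinates is a polynomial in the even variables \<open>P\<^sub>i\<close> and
  the odd variables \<open>\<xi>\<^sub>a\<close>, \<open>\<theta>\<^sub>a\<close> whose coefficients are functions on \<open>M\<close>. The odd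
  variables are numbered by natural numbers, \<open>\<xi>\<^sub>a\<close> being \<open>xi a\<close> and \<open>\<theta>\<^sub>a\<close> being \<open>th a\<close>.
  \<open>F (m, S)\<close> is the coefficient of the monomial \<open>P\<^sup>m \<zeta>\<^sub>S\<close>, where \<open>\<zeta>\<^sub>S\<close> is the product of the
  odd variables with numbers in \<open>S\<close>, in increasing order.
\<close>

type_synonym 'm lfun = "nat multiset \<times> nat set \<Rightarrow> 'm \<Rightarrow> real"

definition xi :: "nat \<Rightarrow> nat" where "xi a = 2 * a"
definition th :: "nat \<Rightarrow> nat" where "th a = 2 * a + 1"

definition lone :: "'m lfun" where
  "lone = (\<lambda>(m, S) p. if m = {#} \<and> S = {} then 1 else 0)"

definition levenvar :: "nat \<Rightarrow> 'm lfun" where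
  "levenvar i = (\<lambda>(m, S) p. if m = {#i#} \<and> S = {} then 1 else 0)"

definition loddvar :: "nat \<Rightarrow> 'm lfun" where
  "loddvar s = (\<lambda>(m, S) p. if m = {#} \<and> S = {s} then 1 else 0)"

definition lcoef :: "('m \<Rightarrow> real) \<Rightarrow> 'm lfun \<Rightarrow> 'm lfun" where
  "lcoef h F = (\<lambda>mS p. h p * F mS p)"

definition lmul :: "'m lfun \<Rightarrow> 'm lfun \<Rightarrow> 'm lfun" where
  "lmul F G = (\<lambda>(m, S) p. \<Sum>m'\<in>{m'. m' \<subseteq># m}. \<Sum>T\<in>Pow S.
     (-1) ^ card {(s, t). s \<in> T \<and> t \<in> S - T \<and> t < s} * F (m', T) p * G (m - m', S - T) p)"

definition lprod :: "'m lfun list \<Rightarrow> 'm lfun" where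
  "lprod Fs = foldr lmul Fs lone"

definition ldP :: "nat \<Rightarrow> 'm lfun \<Rightarrow> 'm lfun" where
  "ldP i F = (\<lambda>(m, S) p. real (count m i + 1) * F (add_mset i m, S) p)"

text \<open>Left and right derivative with respect to the odd variable number \<open>s\<close>.\<close>

definition ldl :: "nat \<Rightarrow> 'm lfun \<Rightarrow> 'm lfun" where
  "ldl s F = (\<lambda>(m, S) p. if s \<in> S then 0 else (-1) ^ card {t\<in>S. t < s} * F (m, insert s S) p)"

definition ldr :: "nat \<Rightarrow> 'm lfun \<Rightarrow> 'm lfun" where
  "ldr s F = (\<lambda>(m, S) p. if s \<in> S then 0 else (-1) ^ card {t\<in>S. s < t} * F (m, insert s S) p)"


section \<open>Global functions and the Poisson bracket\<close>

text \<open>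
  An adapted chart consists of a coordinate chart of \<open>M\<close> and, on its domain, a frame of \<open>A\<close>
  (the variables \<open>\<theta>\<^sub>a\<close>) with its dual frame of \<open>K = A\<^sup>*\<close> (the variables \<open>\<xi>\<^sub>a\<close>).
\<close>

record ('m, 'e) achart =
  cdom :: "'m set"
  coord :: "'m \<Rightarrow> nat \<Rightarrow> real"
  frA :: "nat \<Rightarrow> 'm \<Rightarrow> 'e"
  frK :: "nat \<Rightarrow> 'm \<Rightarrow> 'e"

definition acharts ::
  "('m::topological_space, 'e::real_vector) qbundle \<Rightarrow> ('m \<Rightarrow> 'e set) \<Rightarrow> ('m \<Rightarrow> 'e set)
    \<Rightarrow> ('m, 'e) achart set" where
  "acharts B A K = {c.
    open (cdom c) \<and> (\<exists>U. (U, coord c) \<in> atlas B \<and> cdom c \<subseteq> U) \<and>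
    (\<forall>a<hrk B. local_section B (cdom c) (frA c a) \<and> local_section B (cdom c) (frK c a)) \<and>
    (\<forall>p\<in>cdom c. basis_of (hrk B) (\<lambda>a. frA c a p) (A p) \<and>
       basis_of (hrk B) (\<lambda>a. frK c a p) (K p) \<and>
       (\<forall>a<hrk B. \<forall>b<hrk B. pair B p (frA c a p) (frK c b p) = (if a = b then 1 else 0)))}"

abbreviation ldx :: "('m, 'e) achart \<Rightarrow> nat \<Rightarrow> ('m \<Rightarrow> real) \<Rightarrow> 'm \<Rightarrow> real" where
  "ldx c \<equiv> pd (cdom c) (coord c)"

text \<open>
  The generators of the chart \<open>c'\<close>, written in the generators of the chart \<open>c\<close>. The
  odd ones are transformed like the frames. For \<open>P'\<^sub>j\<close> the formula is that of the cotangent lift,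
  \<open>P'\<^sub>j = \<Sum>\<^sub>i (\<partial>x\<^sub>i/\<partial>x'\<^sub>j) P\<^sub>i + \<Sum>\<^sub>a (\<partial>\<xi>\<^sub>a/\<partial>x'\<^sub>j) \<theta>\<^sub>a\<close>,
  where \<open>\<xi>\<^sub>a = \<Sum>\<^sub>b \<langle>k\<^sub>a, a'\<^sub>b\<rangle> \<xi>'\<^sub>b\<close> is differentiated as a function of \<open>(x', \<xi>')\<close> and
  then \<open>\<xi>'\<^sub>b = \<Sum>\<^sub>e \<langle>k'\<^sub>b, a\<^sub>e\<rangle> \<xi>\<^sub>e\<close> is inserted.
\<close>

definition new_odd ::
  "('m, 'e) qbundle \<Rightarrow> ('m, 'e) achart \<Rightarrow> ('m, 'e) achart \<Rightarrow> nat \<Rightarrow> 'm lfun" where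
  "new_odd B c c' s =
    (if even s
     then \<Sum>a<hrk B. lcoef (\<lambda>p. pair B p (frK c' (s div 2) p) (frA c a p)) (loddvar (xi a))
     else \<Sum>a<hrk B. lcoef (\<lambda>p. pair B p (frA c' (s div 2) p) (frK c a p)) (loddvar (th a)))"

definition new_P ::
  "('m, 'e) qbundle \<Rightarrow> ('m, 'e) achart \<Rightarrow> ('m, 'e) achart \<Rightarrow> nat \<Rightarrow> 'm lfun" where
  "new_P B c c' j =
    (\<Sum>i<bdim B. lcoef (ldx c' j (\<lambda>q. coord c q i)) (levenvar i)) +
    (\<Sum>a<hrk B. \<Sum>b<hrk B. \<Sum>e<hrk B.
       lcoef (\<lambda>p. ldx c' j (\<lambda>q. pair B q (frK c a q) (frA c' b q)) p
                  * pair B p (frK c' b p) (frA c e p))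
         (lmul (loddvar (xi e)) (loddvar (th a))))"

definition transition ::
  "('m, 'e) qbundle \<Rightarrow> ('m, 'e) achart \<Rightarrow> ('m, 'e) achart \<Rightarrow> 'm lfun \<Rightarrow> 'm lfun" where
  "transition B c c' F =
    (\<Sum>(m, S)\<in>{mS. F mS \<noteq> 0}. lcoef (F (m, S))
       (lmul (lprod (map (new_P B c c') (sorted_list_of_multiset m)))
             (lprod (map (new_odd B c c') (sorted_list_of_set S)))))"

text \<open>
  A global function is a family of local functions, one for each adapted chart, which agree on
  the overlaps. Local functions are continued by 0 outside of the domain of the chart, so that
  equality of global functions is equality of families.
\<close>

type_synonym ('m, 'e) gfun = "('m, 'e) achart \<Rightarrow> 'm lfun"

definition Cfun ::
  "('m::topological_space, 'e::real_vector) qbundle \<Rightarrow> ('m \<Rightarrow> 'e set) \<Rightarrow> ('m \<Rightarrow> 'e set)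
    \<Rightarrow> int \<Rightarrow> ('m, 'e) gfun set" where
  "Cfun B A K k = {f.
    (\<forall>c. c \<notin> acharts B A K \<longrightarrow> f c = 0) \<and>
    (\<forall>c\<in>acharts B A K. \<forall>m S.
       smooth B (cdom c) (f c (m, S)) \<and> (\<forall>p. p \<notin> cdom c \<longrightarrow> f c (m, S) p = 0) \<and>
       (f c (m, S) \<noteq> 0 \<longrightarrow>
          set_mset m \<subseteq> {..<bdim B} \<and> S \<subseteq> {..<2 * hrk B} \<and> int (2 * size m + card S) = k)) \<and>
    (\<forall>c\<in>acharts B A K. \<forall>c'\<in>acharts B A K. \<forall>p\<in>cdom c \<inter> cdom c'. \<forall>mS.
       f c mS p = transition B c c' (f c') mS p)}"

definition gmul :: "('m, 'e) gfun \<Rightarrow> ('m, 'e) gfun \<Rightarrow> ('m, 'e) gfun" where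
  "gmul f g = (\<lambda>c. lmul (f c) (g c))"

text \<open>
  The bracket with \<open>{P\<^sub>i, x\<^sub>j} = \<delta>\<^sub>i\<^sub>j\<close>, \<open>{\<theta>\<^sub>a, \<xi>\<^sub>b} = \<delta>\<^sub>a\<^sub>b\<close> and the Leibniz rule
  \<open>{f, g h} = {f, g} h \<plusminus> g {f, h}\<close>, where the sign is \<open>-\<close> if \<open>f\<close> and \<open>g\<close> are both odd.
\<close>

definition pb :: "('m, 'e) qbundle \<Rightarrow> ('m, 'e) gfun \<Rightarrow> ('m, 'e) gfun \<Rightarrow> ('m, 'e) gfun" where
  "pb B f g = (\<lambda>c.
    (\<Sum>i<bdim B. lmul (ldP i (f c)) (\<lambda>mS. ldx c i (g c mS))
               - lmul (\<lambda>mS. ldx c i (f c mS)) (ldP i (g c))) +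
    (\<Sum>a<hrk B. lmul (ldr (th a) (f c)) (ldl (xi a) (g c))
              + lmul (ldr (xi a) (f c)) (ldl (th a) (g c))))"

text \<open>
  The identification of \<open>\<Gamma>(E)\<close> with the functions of degree 1: a section
  \<open>e = \<Sum>\<^sub>a \<langle>e, k\<^sub>a\<rangle> a\<^sub>a + \<langle>e, a\<^sub>a\<rangle> k\<^sub>a\<close> is the function
  \<open>\<Sum>\<^sub>a \<langle>e, k\<^sub>a\<rangle> \<theta>\<^sub>a + \<langle>e, a\<^sub>a\<rangle> \<xi>\<^sub>a\<close>.
\<close>

definition sec ::
  "('m::topological_space, 'e::real_vector) qbundle \<Rightarrow> ('m \<Rightarrow> 'e set) \<Rightarrow> ('m \<Rightarrow> 'e set)
    \<Rightarrow> ('m \<Rightarrow> 'e) \<Rightarrow> ('m, 'e) gfun" where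
  "sec B A K e = (\<lambda>c mS p. if c \<in> acharts B A K \<and> p \<in> cdom c
     then \<Sum>a<hrk B. pair B p (e p) (frK c a p) * loddvar (th a) mS p
                     + pair B p (e p) (frA c a p) * loddvar (xi a) mS p
     else 0)"

text \<open>
  The functions of degree \<open>k\<close> which depend only on \<open>x\<close> and the odd variables of one kind:
  \<open>\<xi>\<close> for \<open>q = 0\<close>, i.e. the pullbacks of functions on \<open>A[1]\<close>, and \<open>\<theta>\<close> for \<open>q = 1\<close>.
  \<open>emb B A K q k\<close> is the inclusion of \<open>\<Gamma>(\<wedge>\<^sup>k A\<^sup>*)\<close>, respectively \<open>\<Gamma>(\<wedge>\<^sup>k A)\<close>, with the convention
  \<open>\<omega> = \<Sum> \<omega>(a\<^sub>i, a\<^sub>j, \<dots>) \<xi>\<^sub>i \<xi>\<^sub>j \<dots>\<close>, the sum being over \<open>i < j < \<dots>\<close>.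
\<close>

definition basic ::
  "('m::topological_space, 'e::real_vector) qbundle \<Rightarrow> ('m \<Rightarrow> 'e set) \<Rightarrow> ('m \<Rightarrow> 'e set)
    \<Rightarrow> nat \<Rightarrow> int \<Rightarrow> ('m, 'e) gfun set" where
  "basic B A K q k = {f\<in>Cfun B A K k. \<forall>c m S. f c (m, S) \<noteq> 0 \<longrightarrow> m = {#} \<and> (\<forall>s\<in>S. s mod 2 = q)}"

definition emb ::
  "('m::topological_space, 'e::real_vector) qbundle \<Rightarrow> ('m \<Rightarrow> 'e set) \<Rightarrow> ('m \<Rightarrow> 'e set)
    \<Rightarrow> nat \<Rightarrow> nat \<Rightarrow> ('m \<Rightarrow> 'e list \<Rightarrow> real) \<Rightarrow> ('m, 'e) gfun" where
  "emb B A K q k \<omega> = (\<lambda>c (m, S) p.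
     if c \<in> acharts B A K \<and> p \<in> cdom c \<and> m = {#} \<and> S \<subseteq> {..<2 * hrk B} \<and>
        (\<forall>s\<in>S. s mod 2 = q) \<and> card S = k
     then \<omega> p (map (\<lambda>s. (if q = 0 then frA c else frK c) (s div 2) p) (sorted_list_of_set S))
     else 0)"

text \<open>Evaluation on the base \<open>A[1]\<close>, i.e. \<open>P\<^sub>i = 0\<close>, \<open>\<theta>\<^sub>a = 0\<close>.\<close>

definition base_proj :: "('m, 'e) gfun \<Rightarrow> ('m, 'e) gfun" where
  "base_proj f = (\<lambda>c (m, S). if m = {#} \<and> (\<forall>s\<in>S. even s) then f c (m, S) else 0)"


section \<open>The function \<open>\<Delta>\<close>\<close>

text \<open>
  \<open>algebroid_differential B A K \<rho> br q D D' d\<close>: \<open>d\<close> is the degree 1 derivation of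
  \<open>\<Gamma>(\<wedge> D\<^sup>*)\<close> determined by \<open>\<rho>\<close> and the bracket of sections of \<open>D\<close> projected to \<open>D\<close> along \<open>D'\<close>.
  It is used with \<open>(q, D, D') = (0, A, K)\<close> and with \<open>(1, K, A)\<close>.
\<close>

definition algebroid_differential ::
  "('m::topological_space, 'e::real_vector) qbundle \<Rightarrow> ('m \<Rightarrow> 'e set) \<Rightarrow> ('m \<Rightarrow> 'e set)
    \<Rightarrow> ('m, 'e) anchor \<Rightarrow> ('m, 'e) sbracket
    \<Rightarrow> nat \<Rightarrow> ('m \<Rightarrow> 'e set) \<Rightarrow> ('m \<Rightarrow> 'e set)
    \<Rightarrow> (('m, 'e) gfun \<Rightarrow> ('m, 'e) gfun) \<Rightarrow> bool" where
  "algebroid_differential B A K \<rho> br q D D' d \<longleftrightarrow>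
    (\<forall>k. \<forall>f\<in>basic B A K q k. d f \<in> basic B A K q (k + 1)) \<and>
    (\<forall>k. \<forall>f\<in>basic B A K q k. \<forall>g\<in>basic B A K q k. \<forall>a b.
       d (a *\<^sub>R f + b *\<^sub>R g) = a *\<^sub>R d f + b *\<^sub>R d g) \<and>
    (\<forall>k l. \<forall>f\<in>basic B A K q k. \<forall>g\<in>basic B A K q l.
       d (gmul f g) = gmul (d f) g + (if even k then 1 else -1 :: real) *\<^sub>R gmul f (d g)) \<and>
    (\<forall>f. smooth B UNIV f \<longrightarrow>
       d (emb B A K q 0 (\<lambda>p _. f p)) = emb B A K q 1 (\<lambda>p vs. \<rho> p (hd vs) f)) \<and>
    (\<forall>\<eta>\<in>forms B D 1. \<exists>\<omega>\<in>forms B D 2.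
       d (emb B A K q 1 \<eta>) = emb B A K q 2 \<omega> \<and>
       (\<forall>a1\<in>sections B D. \<forall>a2\<in>sections B D. \<forall>p.
          \<omega> p [a1 p, a2 p] =
            act \<rho> a1 (\<lambda>x. \<eta> x [a2 x]) p - act \<rho> a2 (\<lambda>x. \<eta> x [a1 x]) p
            - \<eta> p [proj_along (D p) (D' p) (br a1 a2 p)]))"

text \<open>
  The fibrewise linear function of degree 3 with \<open>{h, f} = d f\<close>; the fibre coordinates are \<open>P\<close>
  and \<open>\<theta>\<close> for \<open>q = 0\<close>, and \<open>P\<close> and \<open>\<xi>\<close> for \<open>q = 1\<close>.
\<close>

definition hamiltonian_of ::
  "('m::topological_space, 'e::real_vector) qbundle \<Rightarrow> ('m \<Rightarrow> 'e set) \<Rightarrow> ('m \<Rightarrow> 'e set)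
    \<Rightarrow> nat \<Rightarrow> (('m, 'e) gfun \<Rightarrow> ('m, 'e) gfun) \<Rightarrow> ('m, 'e) gfun \<Rightarrow> bool" where
  "hamiltonian_of B A K q d h \<longleftrightarrow>
    h \<in> Cfun B A K 3 \<and>
    (\<forall>c m S. h c (m, S) \<noteq> 0 \<longrightarrow> size m + card {s\<in>S. s mod 2 \<noteq> q} = 1) \<and>
    (\<forall>k. \<forall>f\<in>basic B A K q k. pb B h f = d f)"

text \<open>The 3-form \<open>\<omega>\<close> on \<open>D\<close> with \<open>\<omega>(e\<^sub>1, e\<^sub>2, \<cdot>)\<close> the \<open>D'\<close>-component of the bracket,
  where \<open>D'\<close> is identified with \<open>D\<^sup>*\<close>.\<close>

definition curvature_form ::
  "('m::topological_space, 'e::real_vector) qbundle \<Rightarrow> ('m, 'e) sbracket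
    \<Rightarrow> ('m \<Rightarrow> 'e set) \<Rightarrow> ('m \<Rightarrow> 'e set) \<Rightarrow> ('m \<Rightarrow> 'e list \<Rightarrow> real) \<Rightarrow> bool" where
  "curvature_form B br D D' \<omega> \<longleftrightarrow>
    \<omega> \<in> forms B D 3 \<and>
    (\<forall>e1\<in>sections B D. \<forall>e2\<in>sections B D. \<forall>p. \<forall>v\<in>D p.
       \<omega> p [e1 p, e2 p, v] = pair B p (proj_along (D' p) (D p) (br e1 e2 p)) v)"


section \<open>Courant algebroid structures from functions of degree 3\<close>

text \<open>
  By Roytenberg's theorem the functions \<open>\<Theta>\<close> of degree 3 with \<open>{\<Theta>, \<Theta>} = 0\<close> are the Courant
  algebroid structures on the bundle with its pairing. The bracket of sections is the derived
  bracket \<open>{{\<Theta>, e\<^sub>1}, e\<^sub>2}\<close>, a function of degree 1, read as a section.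
\<close>

definition defines_courant ::
  "('m::topological_space, 'e::real_vector) qbundle \<Rightarrow> ('m \<Rightarrow> 'e set) \<Rightarrow> ('m \<Rightarrow> 'e set)
    \<Rightarrow> ('m, 'e) gfun \<Rightarrow> bool" where
  "defines_courant B A K \<Theta> \<longleftrightarrow> \<Theta> \<in> Cfun B A K 3 \<and> pb B \<Theta> \<Theta> = 0"

definition derived_bracket ::
  "('m::topological_space, 'e::real_vector) qbundle \<Rightarrow> ('m \<Rightarrow> 'e set) \<Rightarrow> ('m \<Rightarrow> 'e set)
    \<Rightarrow> ('m, 'e) gfun \<Rightarrow> ('m, 'e) sbracket" where
  "derived_bracket B A K \<Theta> e1 e2 =
    the_inv_into (sections B (fib B)) (sec B A K)
      (pb B (pb B \<Theta> (sec B A K e1)) (sec B A K e2))"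

text \<open>\<open>{X + \<iota>\<^sub>X \<Phi>}\<close>, where \<open>\<iota>\<^sub>X \<Phi> = \<Phi>(X, \<cdot>) \<in> A\<^sup>* = K\<close>.\<close>

definition graph_of ::
  "('m, 'e::real_vector) qbundle \<Rightarrow> ('m \<Rightarrow> 'e set) \<Rightarrow> ('m \<Rightarrow> 'e set)
    \<Rightarrow> ('m \<Rightarrow> 'e list \<Rightarrow> real) \<Rightarrow> 'm \<Rightarrow> 'e set" where
  "graph_of B A K \<Phi> p =
    {X + \<kappa> |X \<kappa>. X \<in> A p \<and> \<kappa> \<in> K p \<and> (\<forall>Y\<in>A p. pair B p \<kappa> Y = \<Phi> p [X, Y])}"


section \<open>Graded vector spaces, Voronov's brackets and Maurer-Cartan elements\<close>

text \<open>
  A graded vector space is the family of its homogeneous components. The multibrackets are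
  given on homogeneous elements: the argument is the list of the pairs of degree and element.
\<close>

definition shift :: "int \<Rightarrow> (int \<Rightarrow> 'v set) \<Rightarrow> int \<Rightarrow> 'v set" where
  "shift n V = (\<lambda>i. V (i + n))"

record 'v linf =
  comp :: "int \<Rightarrow> 'v set"
  mbr :: "(int \<times> 'v) list \<Rightarrow> 'v"

text \<open>
  Here \<open>(i, x, a)\<close> is the element \<open>(x[1], a)\<close> of degree \<open>i\<close>, so that \<open>x\<close> has degree \<open>i + 1\<close> in
  \<open>L\<close>. The bracket of \<open>n \<ge> 2\<close> arguments \<open>(x\<^sub>j[1], a\<^sub>j)\<close> is expanded by multilinearity; the term
  \<open>{a\<^sub>0, \<dots>, x\<^sub>j[1], \<dots>}\<close> is \<open>{x\<^sub>j[1], a\<^sub>0, \<dots>}\<close> up to the Koszul sign.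
\<close>

fun voronov_bracket ::
  "('v::real_vector \<Rightarrow> 'v \<Rightarrow> 'v) \<Rightarrow> ('v \<Rightarrow> 'v) \<Rightarrow> 'v \<Rightarrow> (int \<times> 'v \<times> 'v) list \<Rightarrow> 'v \<times> 'v" where
  "voronov_bracket br P \<Delta> [] = 0"
| "voronov_bracket br P \<Delta> [(i, x, a)] = (- br \<Delta> x, P (x + br \<Delta> a))"
| "voronov_bracket br P \<Delta> (u # v # ws) =
    (let us = u # v # ws;
         dg = (\<lambda>j. fst (us ! j));
         el = (\<lambda>j. fst (snd (us ! j)));
         as = map (\<lambda>w. snd (snd w)) us
     in (if ws = [] then (if even (dg 0 + 1) then 1 else -1 :: real) *\<^sub>R br (el 0) (el 1) else 0,
         (\<Sum>j<length us. (if even (dg j * (\<Sum>l<j. dg l)) then 1 else -1 :: real) *\<^sub>R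
            P (foldl br (el j) (take j as @ drop (Suc j) as)))
         + P (foldl br (br \<Delta> (hd as)) (tl as))))"

definition voronov ::
  "(int \<Rightarrow> 'v::real_vector set) \<Rightarrow> ('v \<Rightarrow> 'v \<Rightarrow> 'v) \<Rightarrow> (int \<Rightarrow> 'v set) \<Rightarrow> ('v \<Rightarrow> 'v) \<Rightarrow> 'v
    \<Rightarrow> ('v \<times> 'v) linf" where
  "voronov L br \<aa> P \<Delta> =
    \<lparr>comp = (\<lambda>i. shift 1 L i \<times> \<aa> i), mbr = voronov_bracket br P \<Delta>\<rparr>"

text \<open>There is no topology: the infinite sum means that the partial sums are finally 0.\<close>

definition MC :: "'v::real_vector linf \<Rightarrow> 'v set" where
  "MC V = {\<alpha>\<in>comp V 0. \<exists>N. \<forall>m\<ge>N.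
     (\<Sum>n = 1..m. (1 / fact n :: real) *\<^sub>R mbr V (replicate n (0, \<alpha>))) = 0}"

end

theory Submission
 imports Defs "HOL-Computational_Algebra.Polynomial"
begin

text \<open>
 A function \<open>\<Theta>\<close> of degree 3 is determined by its coefficients \<open>R\<close> at \<open>P\<^sub>i \<zeta>\<^sub>s\<close> and \<open>C\<close> at
 \<open>\<zeta>\<^sub>s \<zeta>\<^sub>t \<zeta>\<^sub>u\<close>; the derived bracket of \<open>\<Theta>\<close> has anchor \<open>R\<close> and, on a frame with constant pairings,
 the structure functions \<open>- C\<close>. For \<open>\<Delta>\<close> these are the anchor and the bracket of the given Courant
 algebroid, and the three components of \<open>{\<Delta>, \<Delta>} = 0\<close> are \<open>\<rho> \<rho>\<^sup>* = 0\<close>, the compatibility of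
 \<open>\<rho>\<close> with the brackets, and the Jacobi identity. Hence the first component of the Maurer-Cartan equation
 is \<open>{\<Delta> + \<Delta>', \<Delta> + \<Delta>'} = 0\<close>. The second is \<open>P (exp {\<cdot>, \<Phi>} (\<Delta> + \<Delta>')) = 0\<close>. Since
 \<open>exp {\<cdot>, \<Phi>}\<close> substitutes \<open>\<theta> - \<Phi>(\<theta>)\<close> for \<open>\<theta>\<close>, its coefficients are up to sign
 \<open>\<langle>[e\<^sub>1, e\<^sub>2], e\<^sub>3\<rangle>\<close> for \<open>e\<^sub>i\<close> in the frame of \<open>graph (- \<Phi>)\<close>. This
 subbundle is equal to its own orthogonal, so their vanishing says that its sections are closed under the
 bracket.
\<close>

section \<open>Coordinate charts and smooth functions\<close>

text \<open>The obstacle is the mismatch between global axioms and local coefficients. The given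
  bracket and anchor act on global sections and globally smooth functions, so local frames have to
  be cut off by bump functions. That the anchor respects brackets, and that it kills gradients, is
  derived from the axioms on functions that are pairings of sections. The coordinates are therefore
  written as pairings, x_l = <x_l a, k> for a dual pair a, k, which takes positive rank; rank 0 is
  treated apart. Conversely, the derived bracket is computed chart by chart and must be one global
  section. Its pairing with a vector is shown not to depend on the chart: a change of frame M
  contributes the antisymmetric matrix (dM) M^(-1), the \<xi> \<theta> term in the transformation of
  P contributes the same matrix, and the two cancel. Identities between functions of degree at most
  4 are checked on words, i.e. iterated derivatives evaluated at a point; homogeneity discards most
  terms. On an isotropic subbundle <[e1, e2], e3> is linear over functions, so closedness of the
  graph is tested on its frame.\<close>

lemma Euclidean_space_open_box:
 assumes "openin (Euclidean_space n) S" "a \<in> S"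
 shows "\<exists>\<epsilon>>0. \<forall>y. (\<forall>i<n. \<bar>y i - a i\<bar> < \<epsilon>) \<and> (\<forall>i\<ge>n. y i = 0) \<longrightarrow> y \<in> S"
proof -
 obtain T where T: "openin (powertop_real UNIV) T" "S = T \<inter> {y. \<forall>i\<ge>n. y i = 0}"
  using assms(1) unfolding Euclidean_space_def openin_subtopology by auto
 have a0: "a i = 0" if "i \<ge> n" for i using assms(2) T that by auto
 obtain X where X: "a \<in> Pi\<^sub>E UNIV X" "\<And>i. open (X i)" "Pi\<^sub>E UNIV X \<subseteq> T"
  using product_topology_open_contains_basis[OF T(1), of a] assms(2) T(2) by auto
 have "\<forall>i. \<exists>e>0. \<forall>t. \<bar>t - a i\<bar> < e \<longrightarrow> t \<in> X i"
 proof
  fix i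
  have "a i \<in> X i" using X(1) by auto
  then obtain e where "e > 0" "ball (a i) e \<subseteq> X i"
   using X(2) open_contains_ball by blast
  then show "\<exists>e>0. \<forall>t. \<bar>t - a i\<bar> < e \<longrightarrow> t \<in> X i"
   by (intro exI[of _ e]) (auto simp: dist_real_def abs_minus_commute)
 qed
 then obtain e where e: "\<And>i. e i > 0" "\<And>i t. \<bar>t - a i\<bar> < e i ==> t \<in> X i" by metis
 \<comment> \<open>Coordinates from n on are 0 both at a and at y, so only n of the radii count and
   a minimum exists; the 1 keeps the set nonempty for n = 0.\<close>
 define \<epsilon> where "\<epsilon> = Min (insert 1 (e ` {..<n}))"
 have "\<epsilon> > 0" unfolding \<epsilon>_def using e(1) by (subst Min_gr_iff) auto
 moreover have "y \<in> S" if y: "\<forall>i<n. \<bar>y i - a i\<bar> < \<epsilon>" "\<forall>i\<ge>n. y i = 0" for y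
 proof -
  have "y i \<in> X i" for i
  proof (cases "i < n")
   case True
   then have "\<epsilon> \<le> e i" unfolding \<epsilon>_def by (intro Min_le) auto
   then show ?thesis using y(1) True e(2) by force
  next
   case False
   then show ?thesis using y(2) a0[of i] e(2)[of "y i" i] e(1)[of i] by simp
  qed
  then have "y \<in> T" using X(3) by auto
  then show ?thesis using T(2) y(2) by auto
 qed
 ultimately show ?thesis by blast
qed

lemma homeomorphism_imp_inj_on:
 assumes "homeomorphism U (x ` U) x (inv_into U x)"
 shows "inj_on x U"
 by (rule inj_on_inverseI[of _ "inv_into U x"]) (rule homeomorphism_apply1[OF assms])

locale coord_chart =
 fixes n :: nat and U :: "'m::t2_space set" and x :: "'m => nat => real"
 assumes open_U: "open U"
  and open_image: "openin (Euclidean_space n) (x ` U)"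
  and homeo: "homeomorphism U (x ` U) x (inv_into U x)"
begin

lemma inj: "inj_on x U"
 using homeo by (rule homeomorphism_imp_inj_on)

lemma image_zero: "p \<in> U ==> i \<ge> n ==> x p i = 0"
 using openin_subset[OF open_image] by (auto simp: topspace_Euclidean_space)

lemma inv_x [simp]: "p \<in> U ==> inv_into U x (x p) = p"
 using inj by simp

text \<open>Combines the openness of the image with the continuity of the inverse chart. Later
  arguments along coordinate lines use the topology in this form.\<close>

lemma open_box:
 assumes "open W" "p \<in> W" "p \<in> U"
 shows "\<exists>\<epsilon>>0. \<forall>y. (\<forall>i<n. \<bar>y i - x p i\<bar> < \<epsilon>) \<and> (\<forall>i\<ge>n. y i = 0)
  \<longrightarrow> y \<in> x ` U \<and> inv_into U x y \<in> W"
proof -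
 have "continuous_on (x ` U) (inv_into U x)" using homeo unfolding homeomorphism_def by blast
 then obtain T where T: "open T" "T \<inter> x ` U = inv_into U x -` W \<inter> x ` U"
  using continuous_on_open_invariant[THEN iffD1, rule_format, OF _ assms(1)] by metis
 have "openin (powertop_real UNIV) T"
  using T(1) by (simp add: euclidean_product_topology)
 then have "openin (Euclidean_space n) (T \<inter> {y. \<forall>i\<ge>n. y i = 0})"
  unfolding Euclidean_space_def openin_subtopology by (metis (lifting))
 then have "openin (Euclidean_space n) (T \<inter> {y. \<forall>i\<ge>n. y i = 0} \<inter> x ` U)"
  using open_image by (rule openin_Int)
 moreover have "T \<inter> {y. \<forall>i\<ge>n. y i = 0} \<inter> x ` U = inv_into U x -` W \<inter> x ` U"
  using T(2) image_zero by auto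
 ultimately have o: "openin (Euclidean_space n) (inv_into U x -` W \<inter> x ` U)" by simp
 have "x p \<in> inv_into U x -` W \<inter> x ` U" using assms by auto
 from Euclidean_space_open_box[OF o this] show ?thesis by auto
qed

definition cline :: "'m => nat => real => 'm" where
 "cline p i t = inv_into U x ((x p)(i := t))"

lemma cline_self [simp]: "p \<in> U ==> cline p i (x p i) = p"
 by (simp add: cline_def)

lemma cline_eventually:
 assumes "open W" "p \<in> W" "p \<in> U" "i < n"
 shows "eventually (\<lambda>t. cline p i t \<in> U \<inter> W \<and> x (cline p i t) = (x p)(i := t)) (nhds (x p i))"
proof -
 obtain \<epsilon> where \<epsilon>: "\<epsilon> > 0" "\<And>y. (\<forall>i<n. \<bar>y i - x p i\<bar> < \<epsilon>) ==> (\<forall>i\<ge>n. y i = 0)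
  ==> y \<in> x ` U \<and> inv_into U x y \<in> W"
  using open_box[OF assms(1-3)] by blast
 have "\<forall>t. dist t (x p i) < \<epsilon> \<longrightarrow> cline p i t \<in> U \<inter> W \<and> x (cline p i t) = (x p)(i := t)"
 proof (intro allI impI)
  fix t assume "dist t (x p i) < \<epsilon>"
  then have "(x p)(i := t) \<in> x ` U \<and> inv_into U x ((x p)(i := t)) \<in> W"
   using \<epsilon>(1) assms(3,4) image_zero by (intro \<epsilon>(2)) (auto simp: dist_real_def)
  then show "cline p i t \<in> U \<inter> W \<and> x (cline p i t) = (x p)(i := t)"
   unfolding cline_def by (auto simp: inv_into_into f_inv_into_f)
 qed
 then show ?thesis using \<epsilon>(1) unfolding eventually_nhds_metric by blast
qed

definition has_pd :: "nat => ('m => real) => 'm => real => bool" where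
 "has_pd i f p D \<longleftrightarrow> ((\<lambda>t. f (cline p i t)) has_real_derivative D) (at (x p i))"

definition pdiff :: "nat => ('m => real) => 'm => bool" where
 "pdiff i f p \<longleftrightarrow> (\<lambda>t. f (cline p i t)) differentiable (at (x p i))"

lemma pd_cline: "pd U x i f p = deriv (\<lambda>t. f (cline p i t)) (x p i)"
 by (simp add: pd_def cline_def)

lemma has_pd_pd: "pdiff i f p ==> has_pd i f p (pd U x i f p)"
 unfolding has_pd_def pdiff_def pd_cline
 by (simp add: DERIV_deriv_iff_real_differentiable)

lemma has_pd_imp: "has_pd i f p D ==> pd U x i f p = D" "has_pd i f p D ==> pdiff i f p"
 unfolding has_pd_def pdiff_def pd_cline
 by (auto intro: DERIV_imp_deriv simp: real_differentiable_def)

lemma has_pd_const: "has_pd i (\<lambda>_. k) p 0"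
 by (simp add: has_pd_def)

lemma has_pd_add: "has_pd i f p D ==> has_pd i g p E ==> has_pd i (\<lambda>q. f q + g q) p (D + E)"
 unfolding has_pd_def by (rule DERIV_add)

lemma has_pd_mult:
 assumes "p \<in> U" "has_pd i f p D" "has_pd i g p E"
 shows "has_pd i (\<lambda>q. f q * g q) p (D * g p + f p * E)"
 using DERIV_mult[OF assms(2,3)[unfolded has_pd_def]] assms(1)
 unfolding has_pd_def by (simp add: algebra_simps)

lemma has_pd_compose:
 assumes "p \<in> U" "has_pd i f p D" "(h has_real_derivative E) (at (f p))"
 shows "has_pd i (\<lambda>q. h (f q)) p (E * D)"
 using DERIV_chain2[of h E "\<lambda>t. f (cline p i t)" "x p i" D UNIV] assms
 unfolding has_pd_def by simp

lemma has_pd_cong: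
 assumes "open W" "p \<in> W" "p \<in> U" "i < n" "\<And>q. q \<in> U \<inter> W ==> f q = g q" "has_pd i f p D"
 shows "has_pd i g p D"
 unfolding has_pd_def
 by (rule DERIV_cong_ev[THEN iffD1, OF refl _ refl assms(6)[unfolded has_pd_def]],
   rule eventually_mono[OF cline_eventually[OF assms(1-4)]], use assms(5) in auto)

lemma pd_cong:
 assumes "open W" "p \<in> W" "p \<in> U" "i < n" "\<And>q. q \<in> U \<inter> W ==> f q = g q"
 shows "pd U x i f p = pd U x i g p" "pdiff i f p \<longleftrightarrow> pdiff i g p"
proof -
 have "eventually (\<lambda>t. f (cline p i t) = g (cline p i t)) (nhds (x p i))"
  by (rule eventually_mono[OF cline_eventually[OF assms(1-4)]], use assms(5) in auto)
 then show "pd U x i f p = pd U x i g p"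
  unfolding pd_cline by (rule deriv_cong_ev) simp
 show "pdiff i f p \<longleftrightarrow> pdiff i g p"
 proof
  assume "pdiff i f p"
  then have "has_pd i g p (pd U x i f p)" by (intro has_pd_cong[OF assms] has_pd_pd)
  then show "pdiff i g p" by (rule has_pd_imp(2))
 next
  assume "pdiff i g p"
  then have "has_pd i f p (pd U x i g p)"
   by (intro has_pd_cong[OF assms(1-4) assms(5)[symmetric]] has_pd_pd)
  then show "pdiff i f p" by (rule has_pd_imp(2))
 qed
qed

lemma has_pd_coord:
 assumes "p \<in> U" "i < n"
 shows "has_pd i (\<lambda>q. x q j) p (if i = j then 1 else 0)"
proof -
 have "eventually (\<lambda>t. x (cline p i t) j = ((x p)(i := t)) j) (nhds (x p i))"
  by (rule eventually_mono[OF cline_eventually[of UNIV]], use assms in auto)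
 moreover have "((\<lambda>t. ((x p)(i := t)) j) has_real_derivative (if i = j then 1 else 0)) (at (x p i))"
  by auto
 ultimately show ?thesis unfolding has_pd_def
  by (subst DERIV_cong_ev[OF refl _ refl])
qed

end

lemma coord_chart_restrict:
 assumes "coord_chart n U x" "open V" "V \<subseteq> U"
 shows "coord_chart n V x"
proof -
 interpret coord_chart n U x by fact
 \<comment> \<open>Off the image of V the two inverses may differ, because \<open>inv_into\<close>
   is arbitrary there.\<close>
 have eq: "inv_into V x y = inv_into U x y" if "y \<in> x ` V" for y
  using that assms(3) inj by (metis imageE inv_into_f_f inj_on_subset subsetD)
 show ?thesis
 proof
  show "open V" by fact
  have 1: "\<exists>\<epsilon>>0. \<forall>y. (\<forall>i<n. \<bar>y i - a i\<bar> < \<epsilon>) \<and> (\<forall>i\<ge>n. y i = 0) \<longrightarrow> y \<in> x ` V"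
   if a: "a \<in> x ` V" for a
  proof -
   obtain p where p: "p \<in> V" "a = x p" using a by auto
   have "p \<in> U" using p assms(3) by blast
   from open_box[OF assms(2) p(1) this]
   obtain \<epsilon> where e: "\<epsilon>>0" "\<forall>y. (\<forall>i<n. \<bar>y i - x p i\<bar> < \<epsilon>) \<and> (\<forall>i\<ge>n. y i = 0)
    \<longrightarrow> y \<in> x ` U \<and> inv_into U x y \<in> V"
    by blast
   show ?thesis
   proof (intro exI[of _ \<epsilon>] conjI allI impI)
    fix y assume "(\<forall>i<n. \<bar>y i - a i\<bar> < \<epsilon>) \<and> (\<forall>i\<ge>n. y i = 0)"
    then have "y \<in> x ` U" "inv_into U x y \<in> V" using e p by auto
    then show "y \<in> x ` V" by (metis f_inv_into_f image_eqI)
   qed (rule e)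
  qed
  have "x ` V = \<Union>{T. openin (Euclidean_space n) T \<and> T \<subseteq> x ` V}"
  proof -
   have "\<exists>T. openin (Euclidean_space n) T \<and> a \<in> T \<and> T \<subseteq> x ` V" if a: "a \<in> x ` V" for a
   proof -
    obtain \<epsilon> where e: "\<epsilon>>0" "\<forall>y. (\<forall>i<n. \<bar>y i - a i\<bar> < \<epsilon>) \<and> (\<forall>i\<ge>n. y i = 0) \<longrightarrow> y \<in> x ` V"
     using 1[OF a] by auto
    define S where "S = {y. \<forall>i<n. \<bar>y i - a i\<bar> < \<epsilon>}"
    have "S = (\<Inter>i\<in>{..<n}. {y. \<bar>y i - a i\<bar> < \<epsilon>})" by (auto simp: S_def)
    moreover have "open {y::nat => real. \<bar>y i - a i\<bar> < \<epsilon>}" for i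
     by (intro open_Collect_less continuous_intros continuous_on_product_coordinates)
    ultimately have "open S" by (simp add: open_INT)
    then have "openin (powertop_real UNIV) S"
     by (simp add: euclidean_product_topology)
    then have "openin (Euclidean_space n) (S \<inter> {y. \<forall>i\<ge>n. y i = 0})"
     unfolding Euclidean_space_def openin_subtopology by auto
    moreover have "a \<in> S \<inter> {y. \<forall>i\<ge>n. y i = 0}"
     using a assms(3) e(1) image_zero by (auto simp: S_def)
    ultimately show ?thesis using e(2) by (intro exI[of _ "S \<inter> {y. \<forall>i\<ge>n. y i = 0}"]) (auto simp: S_def)
   qed
   then show ?thesis by blast
  qed
  then show "openin (Euclidean_space n) (x ` V)"
   by (metis (no_types, lifting) mem_Collect_eq openin_Union)
  have h: "continuous_on U x" "continuous_on (x ` U) (inv_into U x)"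
   using homeo unfolding homeomorphism_def by auto
  show "homeomorphism V (x ` V) x (inv_into V x)"
  proof (rule homeomorphismI)
   show "continuous_on V x" using h(1) assms(3) by (rule continuous_on_subset)
   have "continuous_on (x ` V) (inv_into U x)"
    using h(2) by (rule continuous_on_subset) (use assms(3) in auto)
   then show "continuous_on (x ` V) (inv_into V x)"
    by (rule continuous_on_eq) (simp add: eq)
   show "x ` V \<subseteq> x ` V" "inv_into V x ` x ` V \<subseteq> V" by (auto intro: inv_into_into)
   show "inv_into V x (x p) = p" if "p \<in> V" for p
    using that assms(3) inj by (meson inj_on_subset inv_into_f_f)
   show "x (inv_into V x y) = y" if "y \<in> x ` V" for y
    using that by (rule f_inv_into_f)
  qed
 qed
qed

text \<open>Adapted charts live on open subsets of the charts of the atlas. \<open>pd\<close> refers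
  to the inverse on its own domain, so a smaller domain changes the function that is differentiated,
  but not near the base point.\<close>

lemma pd_restrict:
 assumes "coord_chart n U x" "open V" "V \<subseteq> U" "p \<in> V" "i < n"
 shows "pd V x i f p = pd U x i f p"
proof -
 interpret coord_chart n U x by fact
 have eq: "inv_into V x (x q) = q" if "q \<in> V" for q
  using that assms(3) inj by (meson inj_on_subset inv_into_f_f)
 have pU: "p \<in> U" using assms by blast
 have "eventually (\<lambda>t. f (inv_into V x ((x p)(i := t))) = f (cline p i t)) (nhds (x p i))"
  using cline_eventually[OF assms(2,4) pU assms(5)]
  by (elim eventually_mono) (metis Int_iff eq subsetD cline_def inv_x)
 then show ?thesis unfolding pd_def cline_def by (rule deriv_cong_ev) simp
qed

section \<open>Functions of class C^k in a chart\<close>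

context coord_chart begin

text \<open>Recursion on the order makes closure under sums, products and composition an induction
  over k with the function arbitrary, for which the lists of indices in
  \<open>smooth_in_chart\<close> are awkward. Smooth means \<open>ck\<close> for every k.\<close>

primrec ck :: "'m set => nat => ('m => real) => bool" where
 "ck W 0 f \<longleftrightarrow> continuous_on W f"
| "ck W (Suc k) f \<longleftrightarrow> continuous_on W f \<and> (\<forall>i<n. (\<forall>p\<in>W. pdiff i f p) \<and> ck W k (pd U x i f))"

lemma pds_append: "pds U x js (pds U x is f) = pds U x (js @ is) f"
 by (induction js) auto

lemma ck_continuous: "ck W k f ==> continuous_on W f"
 by (cases k) auto

lemma ck_pdiff: "ck W (Suc k) f ==> i < n ==> p \<in> W ==> pdiff i f p"
 by simp

lemma ck_pd: "ck W (Suc k) f ==> i < n ==> ck W k (pd U x i f)"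
 by simp

lemma smooth_in_chart_ck: "smooth_in_chart n U x W f \<longleftrightarrow> (\<forall>k. ck (U \<inter> W) k f)"
proof
 assume "smooth_in_chart n U x W f"
 then show "\<forall>k. ck (U \<inter> W) k f"
 proof (intro allI)
  fix k show "ck (U \<inter> W) k f" if "smooth_in_chart n U x W f"
   using that
  proof (induction k arbitrary: f)
   case 0
   then have "continuous_on (U \<inter> W) (pds U x [] f)"
    unfolding smooth_in_chart_def by (metis empty_set empty_subsetI)
   then show ?case by simp
  next
   case (Suc k)
   have s: "set js \<subseteq> {..<n} ==> continuous_on (U \<inter> W) (pds U x js f) \<and>
     (\<forall>i<n. \<forall>p\<in>U \<inter> W. pdiff i (pds U x js f) p)" for js
    using Suc.prems unfolding smooth_in_chart_def pdiff_def cline_def by blast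
   have "smooth_in_chart n U x W (pd U x i f)" if "i < n" for i
    unfolding smooth_in_chart_def
   proof (intro allI impI)
    fix js assume "set js \<subseteq> {..<n}"
    \<comment> \<open>In \<open>pds\<close> the derivative taken first is the last entry of the
      list, so the index i goes to the end.\<close>
    then have "set (js @ [i]) \<subseteq> {..<n}" using that by auto
    from s[OF this] show "continuous_on (U \<inter> W) (pds U x js (pd U x i f)) \<and>
     (\<forall>ia<n. \<forall>p\<in>U \<inter> W. (\<lambda>t. pds U x js (pd U x i f) (inv_into U x ((x p)(ia := t))))
      differentiable at (x p ia))"
     using pds_append[of js "[i]" f] by (simp add: pdiff_def cline_def)
   qed
   then show ?case using s[of "[]"] Suc.IH by simp
  qed
 qed
next
 assume f: "\<forall>k. ck (U \<inter> W) k f"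
 have "\<forall>k. ck (U \<inter> W) k (pds U x js f)" if "set js \<subseteq> {..<n}" for js
  using that
 proof (induction js)
  case (Cons i js)
  then have 1: "ck (U \<inter> W) (Suc k) (pds U x js f)" "i < n" for k
   by (simp_all del: ck.simps)
  show ?case using ck_pd[OF 1] by simp
 qed (simp add: f)
 then have "ck (U \<inter> W) (Suc 0) (pds U x js f)" if "set js \<subseteq> {..<n}" for js using that by blast
 then show "smooth_in_chart n U x W f"
  unfolding smooth_in_chart_def by (simp add: pdiff_def cline_def)
qed

lemma ck_mono: "ck W (Suc k) f ==> ck W k f"
 by (induction k arbitrary: f) auto

lemma ck_subset: "ck W k f ==> V \<subseteq> W ==> ck V k f"
 by (induction k arbitrary: f) (auto intro: continuous_on_subset)

lemma ck_cong:
 assumes "open W" "W \<subseteq> U" "\<And>q. q \<in> W ==> f q = g q" "ck W k f"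
 shows "ck W k g"
 using assms(3,4)
proof (induction k arbitrary: f g)
 case 0
 then show ?case using continuous_on_cong[of W W f g] by simp
next
 case (Suc k)
 have *: "pd U x i f p = pd U x i g p" "pdiff i f p \<longleftrightarrow> pdiff i g p" if "i < n" "p \<in> W" for i p
  using pd_cong[OF assms(1) that(2) _ that(1), of f g] assms(2) that Suc.prems(1) by auto
 have "continuous_on W g" using Suc.prems continuous_on_cong[of W W f g] by simp
 moreover have "ck W k (pd U x i g)" if "i < n" for i
  by (rule Suc.IH[of "pd U x i f"]) (use * Suc.prems that in auto)
 ultimately show ?case using Suc.prems(2) * by auto
qed

lemma ck_local:
 assumes "\<And>p. p \<in> W ==> \<exists>V. open V \<and> p \<in> V \<and> V \<subseteq> W \<and> ck V k f"
 shows "ck W k f"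
 using assms
proof (induction k arbitrary: f)
 case 0
 have "continuous (at p within W) f" if p: "p \<in> W" for p
 proof -
  obtain V where "open V" "p \<in> V" "continuous_on V f" using 0[OF p] by auto
  then show ?thesis by (simp add: continuous_at_imp_continuous_at_within continuous_on_eq_continuous_at)
 qed
 then show ?case by (simp add: continuous_on_eq_continuous_within)
next
 case (Suc k)
 have "continuous (at p within W) f" if p: "p \<in> W" for p
 proof -
  obtain V where "open V" "p \<in> V" "continuous_on V f" using Suc.prems[OF p] by auto
  then show ?thesis by (simp add: continuous_at_imp_continuous_at_within continuous_on_eq_continuous_at)
 qed
 then have "continuous_on W f" by (simp add: continuous_on_eq_continuous_within)
 moreover have "pdiff i f p" if "i < n" "p \<in> W" for i p
  using Suc.prems[OF that(2)] that(1) by auto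
 moreover have "ck W k (pd U x i f)" if "i < n" for i
  by (rule Suc.IH) (use Suc.prems that in fastforce)
 ultimately show ?case by simp
qed

lemma ck_const: "ck W k (\<lambda>_. c)"
proof (induction k arbitrary: c)
 case (Suc k)
 have "pd U x i (\<lambda>_. c) = (\<lambda>_. 0)" for i
  by (rule ext, rule has_pd_imp[OF has_pd_const])
 then show ?case using Suc has_pd_imp(2)[OF has_pd_const] by simp
qed simp

lemma ck_add:
 assumes "open W" "W \<subseteq> U" "ck W k f" "ck W k g"
 shows "ck W k (\<lambda>q. f q + g q)"
 using assms(3,4)
proof (induction k arbitrary: f g)
 case (Suc k)
 have *: "has_pd i (\<lambda>q. f q + g q) p (pd U x i f p + pd U x i g p)" if "i < n" "p \<in> W" for i p
  using Suc.prems that by (intro has_pd_add has_pd_pd) auto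
 have "ck W k (pd U x i (\<lambda>q. f q + g q))" if "i < n" for i
  by (rule ck_cong[OF assms(1,2) _ Suc.IH[of "pd U x i f" "pd U x i g"]])
    (use Suc.prems that in \<open>auto simp: has_pd_imp(1)[OF *]\<close>)
 then show ?case using Suc.prems has_pd_imp(2)[OF *] by (auto intro!: continuous_on_add)
qed (auto intro: continuous_on_add)

lemma ck_mult:
 assumes "open W" "W \<subseteq> U" "ck W k f" "ck W k g"
 shows "ck W k (\<lambda>q. f q * g q)"
 using assms(3,4)
proof (induction k arbitrary: f g)
 case (Suc k)
 have *: "has_pd i (\<lambda>q. f q * g q) p (pd U x i f p * g p + f p * pd U x i g p)"
  if "i < n" "p \<in> W" for i p
  using Suc.prems that assms(2) by (intro has_pd_mult has_pd_pd) auto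
 have "ck W k (pd U x i (\<lambda>q. f q * g q))" if "i < n" for i
  by (rule ck_cong[OF assms(1,2) _ ck_add[OF assms(1,2)
     Suc.IH[of "pd U x i f" g] Suc.IH[of f "pd U x i g"]]])
    (use Suc.prems that in \<open>auto simp: has_pd_imp(1)[OF *] intro: ck_mono\<close>)
 then show ?case using Suc.prems has_pd_imp(2)[OF *] by (auto intro!: continuous_on_mult)
qed (auto intro: continuous_on_mult)

lemma ck_sum:
 assumes "open W" "W \<subseteq> U" "\<And>j. j \<in> J ==> ck W k (f j)"
 shows "ck W k (\<lambda>q. \<Sum>j\<in>J. f j q)"
 using assms(3) by (induction J rule: infinite_finite_induct) (auto intro!: ck_add assms(1,2) ck_const)

text \<open>The whole sequence D of successive derivatives is part of the hypothesis, so that the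
  induction can pass from \<open>D m\<close> to \<open>D (Suc m)\<close>. It is applied to the
  reciprocal and to the flat function.\<close>

lemma ck_compose:
 assumes "open W" "W \<subseteq> U" "ck W k f"
  and "\<And>m t. t \<in> I ==> (D m has_real_derivative D (Suc m) t) (at t)"
  and "\<And>q. q \<in> W ==> f q \<in> I"
 shows "ck W k (\<lambda>q. D m (f q))"
 using assms(3)
proof (induction k arbitrary: m)
 case 0
 have "continuous_on I (D m)"
  by (rule DERIV_continuous_on[of _ _ "D (Suc m)"]) (use assms(4) has_field_derivative_at_within in blast)
 then show ?case using 0 assms(5) by (simp add: continuous_on_compose2[of I] image_subset_iff)
next
 case (Suc k)
 have *: "has_pd i (\<lambda>q. D m (f q)) p (D (Suc m) (f p) * pd U x i f p)"
  if "i < n" "p \<in> W" for i p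
  using Suc.prems that assms(2,5) by (intro has_pd_compose has_pd_pd assms(4)) auto
 have "ck W k (pd U x i (\<lambda>q. D m (f q)))" if "i < n" for i
  by (rule ck_cong[OF assms(1,2) _ ck_mult[OF assms(1,2)
     Suc.IH[of "Suc m"], of "pd U x i f"]])
    (use Suc.prems that in \<open>auto simp: has_pd_imp(1)[OF *] intro: ck_mono[OF Suc.prems]\<close>)
 moreover have "continuous_on W (\<lambda>q. D m (f q))"
 proof -
  have "continuous_on I (D m)"
   by (rule DERIV_continuous_on[of _ _ "D (Suc m)"]) (use assms(4) has_field_derivative_at_within in blast)
  then show ?thesis using Suc.prems assms(5) by (simp add: continuous_on_compose2[of I] image_subset_iff)
 qed
 ultimately show ?case using has_pd_imp(2)[OF *] by auto
qed

text \<open>Total differentiability of a function with continuous partial derivatives, by moving one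
 coordinate after the other.\<close>

lemma increment_bound:
 assumes W: "open W" "p \<in> W" "W \<subseteq> U"
  and f: "\<And>i q. i < n ==> q \<in> W ==> pdiff i f q" "\<And>i. i < n ==> continuous_on W (pd U x i f)"
  and "\<eta> > 0"
 shows "\<exists>\<delta>>0. \<forall>y. (\<forall>i<n. \<bar>y i - x p i\<bar> < \<delta>) \<and> (\<forall>i\<ge>n. y i = 0) \<longrightarrow>
  \<bar>f (inv_into U x y) - f p - (\<Sum>i<n. (y i - x p i) * pd U x i f p)\<bar> \<le> \<eta> * (\<Sum>i<n. \<bar>y i - x p i\<bar>)"
proof -
 \<comment> \<open>Neighbourhood on which all partial derivatives differ from their values at p by
   less than \<eta>.\<close>
 define W' where "W' = W \<inter> (\<Inter>i\<in>{..<n}. {q\<in>W. \<bar>pd U x i f q - pd U x i f p\<bar> < \<eta>})"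
 have "open {q\<in>W. \<bar>pd U x i f q - pd U x i f p\<bar> < \<eta>}" if "i < n" for i
 proof -
  have "{q\<in>W. \<bar>pd U x i f q - pd U x i f p\<bar> < \<eta>} = W \<inter> pd U x i f -` ball (pd U x i f p) \<eta>"
   by (auto simp: dist_real_def)
  then show ?thesis using continuous_on_open_vimage[OF W(1)] f(2)[OF that] by (metis inf_commute open_ball)
 qed
 then have "open W'" unfolding W'_def using W(1) by (intro open_Int open_INT) auto
 moreover have "p \<in> W'" using W(2) assms(6) by (auto simp: W'_def)
 ultimately obtain \<delta> where d: "\<delta> > 0" "\<And>y. (\<forall>i<n. \<bar>y i - x p i\<bar> < \<delta>) \<and> (\<forall>i\<ge>n. y i = 0)
   ==> y \<in> x ` U \<and> inv_into U x y \<in> W'"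
  using open_box[of W' p] W by blast
 have key: "\<bar>f (inv_into U x y) - f p - (\<Sum>i<m. (y i - x p i) * pd U x i f p)\<bar>
   \<le> \<eta> * (\<Sum>i<m. \<bar>y i - x p i\<bar>)"
  if "m \<le> n" "\<forall>i<n. \<bar>y i - x p i\<bar> < \<delta>" "\<forall>i\<ge>n. y i = 0" "\<forall>i\<ge>m. y i = x p i" for m y
  using that
 proof (induction m arbitrary: y)
  case 0
  then have "y = x p" by auto
  then show ?case using W by auto
 next
  case (Suc m)
  define y' where "y' = y(m := x p m)"
  \<comment> \<open>Subtracting the linear part leaves a function of one variable whose derivative
    is at most \<eta> in absolute value; the mean value inequality bounds its increment.\<close>
  define g where "g = (\<lambda>s. f (inv_into U x (y'(m := s))) - s * pd U x m f p)"
  define S where "S = ball (x p m) \<delta>"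
  have gd: "(g has_real_derivative (pd U x m f (inv_into U x (y'(m := s))) - pd U x m f p)) (at s)
    \<and> \<bar>pd U x m f (inv_into U x (y'(m := s))) - pd U x m f p\<bar> \<le> \<eta>" if s: "s \<in> S" for s
  proof -
   have q: "y'(m := s) \<in> x ` U \<and> inv_into U x (y'(m := s)) \<in> W'"
    by (rule d(2)) (use Suc.prems s d(1) in \<open>auto simp: y'_def S_def dist_real_def abs_minus_commute\<close>)
   then have xq: "x (inv_into U x (y'(m := s))) = y'(m := s)" by (simp add: f_inv_into_f)
   have "pdiff m f (inv_into U x (y'(m := s)))"
    using f(1) q Suc.prems(1) by (auto simp: W'_def)
   from has_pd_pd[OF this]
   have "((\<lambda>t. f (inv_into U x (y'(m := t)))) has_real_derivative
     pd U x m f (inv_into U x (y'(m := s)))) (at s)"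
    unfolding has_pd_def cline_def xq by simp
   then have "(g has_real_derivative (pd U x m f (inv_into U x (y'(m := s))) - 1 * pd U x m f p)) (at s)"
    unfolding g_def by (auto intro!: derivative_eq_intros)
   moreover have "\<bar>pd U x m f (inv_into U x (y'(m := s))) - pd U x m f p\<bar> \<le> \<eta>"
    using q Suc.prems(1) by (auto simp: W'_def less_imp_le)
   ultimately show ?thesis by simp
  qed
  have "norm (g (y m) - g (x p m)) \<le> \<eta> * norm (y m - x p m)"
  proof (rule field_differentiable_bound[of S g])
   show "convex S" by (simp add: S_def)
   show "y m \<in> S" "x p m \<in> S" using Suc.prems d(1) by (auto simp: S_def dist_real_def abs_minus_commute)
   show "(g has_field_derivative pd U x m f (inv_into U x (y'(m := s))) - pd U x m f p) (at s within S)"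
    if "s \<in> S" for s
    using gd[OF that] by (blast intro: has_field_derivative_at_within)
   show "norm (pd U x m f (inv_into U x (y'(m := s))) - pd U x m f p) \<le> \<eta>" if "s \<in> S" for s
    using gd[OF that] by simp
  qed
  moreover have "y'(m := y m) = y" "y'(m := x p m) = y'" by (auto simp: y'_def)
  ultimately have 1: "\<bar>f (inv_into U x y) - f (inv_into U x y') - (y m - x p m) * pd U x m f p\<bar>
    \<le> \<eta> * \<bar>y m - x p m\<bar>"
   by (simp add: g_def algebra_simps)
  have 2: "\<bar>f (inv_into U x y') - f p - (\<Sum>i<m. (y' i - x p i) * pd U x i f p)\<bar>
   \<le> \<eta> * (\<Sum>i<m. \<bar>y' i - x p i\<bar>)"
   by (rule Suc.IH) (use Suc.prems d(1) in \<open>auto simp: y'_def\<close>)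
  have 3: "(\<Sum>i<m. (y' i - x p i) * pd U x i f p) = (\<Sum>i<m. (y i - x p i) * pd U x i f p)"
   "(\<Sum>i<m. \<bar>y' i - x p i\<bar>) = (\<Sum>i<m. \<bar>y i - x p i\<bar>)"
   by (auto simp: y'_def intro!: sum.cong)
  show ?case using 1 2 unfolding 3 by (simp add: algebra_simps)
 qed
 show ?thesis
 proof (intro exI[of _ \<delta>] conjI allI impI d(1))
  fix y assume y: "(\<forall>i<n. \<bar>y i - x p i\<bar> < \<delta>) \<and> (\<forall>i\<ge>n. y i = 0)"
  have "\<forall>i\<ge>n. y i = x p i" using y image_zero W by auto
  then show "\<bar>f (inv_into U x y) - f p - (\<Sum>i<n. (y i - x p i) * pd U x i f p)\<bar>
    \<le> \<eta> * (\<Sum>i<n. \<bar>y i - x p i\<bar>)"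
   using key[of n y] y by blast
 qed
qed

text \<open>The increment bound is divided by t - t0: the difference quotients of the coordinates of
  \<gamma> stay bounded near t0, so the error in the quotient becomes arbitrarily small.\<close>

lemma chain_rule:
 assumes W: "open W" "p \<in> W" "W \<subseteq> U"
  and f: "ck W (Suc 0) f"
  and \<gamma>: "\<gamma> t0 = p" "eventually (\<lambda>t. \<gamma> t \<in> U) (at t0)"
   "\<And>i. i < n ==> ((\<lambda>t. x (\<gamma> t) i) has_real_derivative c i) (at t0)"
 shows "((\<lambda>t. f (\<gamma> t)) has_real_derivative (\<Sum>i<n. c i * pd U x i f p)) (at t0)"
proof -
 define h where "h = (\<lambda>i t. (x (\<gamma> t) i - x p i) / (t - t0))"
 have h: "(h i \<longlongrightarrow> c i) (at t0)" if "i < n" for i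
  using \<gamma>(3)[OF that] \<gamma>(1) unfolding has_field_derivative_iff h_def by simp
 \<comment> \<open>Bound for the sum of the difference quotients near t0; the 1 makes it strict and
   positive.\<close>
 define B where "B = (\<Sum>i<n. \<bar>c i\<bar>) + 1"
 have B: "B > 0" unfolding B_def by (intro add_nonneg_pos sum_nonneg) auto
 have hB: "eventually (\<lambda>t. (\<Sum>i<n. \<bar>h i t\<bar>) < B) (at t0)"
 proof -
  have "((\<lambda>t. \<Sum>i<n. \<bar>h i t\<bar>) \<longlongrightarrow> (\<Sum>i<n. \<bar>c i\<bar>)) (at t0)"
   using h by (intro tendsto_sum tendsto_rabs) auto
  then show ?thesis by (rule order_tendstoD(2)) (simp add: B_def)
 qed
 define E where "E = (\<lambda>t. (f (\<gamma> t) - f p) / (t - t0) - (\<Sum>i<n. h i t * pd U x i f p))"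
 have "(E \<longlongrightarrow> 0) (at t0)"
 proof (rule tendstoI)
  fix e :: real assume e: "e > 0"
  have "e / B > 0" using e B by simp
  with increment_bound[OF W, of f "e / B"] f
  obtain \<delta> where d: "\<delta> > 0" "\<And>y. (\<forall>i<n. \<bar>y i - x p i\<bar> < \<delta>) \<and> (\<forall>i\<ge>n. y i = 0) ==>
   \<bar>f (inv_into U x y) - f p - (\<Sum>i<n. (y i - x p i) * pd U x i f p)\<bar> \<le> e / B * (\<Sum>i<n. \<bar>y i - x p i\<bar>)"
   by auto
  have "eventually (\<lambda>t. \<forall>i\<in>{..<n}. \<bar>x (\<gamma> t) i - x p i\<bar> < \<delta>) (at t0)"
  proof (rule eventually_ball_finite, simp, intro ballI)
   fix i assume "i \<in> {..<n}"
   then have "((\<lambda>t. x (\<gamma> t) i) \<longlongrightarrow> x p i) (at t0)"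
    using \<gamma>(1) DERIV_isCont[OF \<gamma>(3)] by (auto simp: isCont_def)
   from tendstoD[OF this d(1)] show "eventually (\<lambda>t. \<bar>x (\<gamma> t) i - x p i\<bar> < \<delta>) (at t0)"
    by (simp add: dist_real_def)
  qed
  moreover have "eventually (\<lambda>t. t \<noteq> t0) (at t0)" by (simp add: eventually_at_filter)
  ultimately show "eventually (\<lambda>t. dist (E t) 0 < e) (at t0)"
   using hB \<gamma>(2)
  proof eventually_elim
   case (elim t)
   have "(\<forall>i<n. \<bar>x (\<gamma> t) i - x p i\<bar> < \<delta>) \<and> (\<forall>i\<ge>n. x (\<gamma> t) i = 0)"
    using elim image_zero by auto
   from d(2)[OF this] have "\<bar>f (\<gamma> t) - f p - (\<Sum>i<n. (x (\<gamma> t) i - x p i) * pd U x i f p)\<bar>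
    \<le> e / B * (\<Sum>i<n. \<bar>x (\<gamma> t) i - x p i\<bar>)" using elim by simp
   then have "\<bar>f (\<gamma> t) - f p - (\<Sum>i<n. (x (\<gamma> t) i - x p i) * pd U x i f p)\<bar> / \<bar>t - t0\<bar>
    \<le> (e / B * (\<Sum>i<n. \<bar>x (\<gamma> t) i - x p i\<bar>)) / \<bar>t - t0\<bar>"
    by (intro divide_right_mono) auto
   also have "\<dots> = e / B * (\<Sum>i<n. \<bar>h i t\<bar>)"
    by (simp add: h_def sum_divide_distrib[symmetric] abs_divide)
   also have "\<dots> < e / B * B" using elim e B by (intro mult_strict_left_mono) auto
   also have "\<dots> = e" using B by simp
   finally have "\<bar>(f (\<gamma> t) - f p - (\<Sum>i<n. (x (\<gamma> t) i - x p i) * pd U x i f p)) / (t - t0)\<bar> < e"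
    by (simp add: abs_divide)
   moreover have "(f (\<gamma> t) - f p - (\<Sum>i<n. (x (\<gamma> t) i - x p i) * pd U x i f p)) / (t - t0) = E t"
    by (simp add: E_def h_def diff_divide_distrib[of "_ - _"] sum_divide_distrib)
   ultimately show ?case by simp
  qed
 qed
 moreover have "((\<lambda>t. \<Sum>i<n. h i t * pd U x i f p) \<longlongrightarrow> (\<Sum>i<n. c i * pd U x i f p)) (at t0)"
  using h by (intro tendsto_sum tendsto_mult tendsto_const) auto
 ultimately have "((\<lambda>t. E t + (\<Sum>i<n. h i t * pd U x i f p)) \<longlongrightarrow> 0 + (\<Sum>i<n. c i * pd U x i f p)) (at t0)"
  by (rule tendsto_add)
 then show ?thesis unfolding has_field_derivative_iff E_def using \<gamma>(1) by simp
qed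

end

lemma chart_change_pd:
 assumes "coord_chart n U x" "coord_chart n V y" "open W" "p \<in> W" "W \<subseteq> U \<inter> V" "j < n"
  and f: "coord_chart.ck n U x W (Suc 0) f"
  and y: "\<And>i. i < n ==> coord_chart.pdiff V y j (\<lambda>q. x q i) p"
 shows "coord_chart.has_pd V y j f p (\<Sum>i<n. pd V y j (\<lambda>q. x q i) p * pd U x i f p)"
proof -
 interpret U: coord_chart n U x by fact
 interpret V: coord_chart n V y by fact
 have p: "p \<in> V" "p \<in> U" using assms by auto
 have "eventually (\<lambda>t. V.cline p j t \<in> U) (nhds (y p j))"
  using V.cline_eventually[OF assms(3,4) p(1) assms(6)] by eventually_elim (use assms(5) in auto)
 then have "eventually (\<lambda>t. V.cline p j t \<in> U) (at (y p j))"
  by (rule filter_leD[OF at_within_le_nhds])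
 then show ?thesis unfolding V.has_pd_def
  using assms p y V.has_pd_pd
  by (intro U.chain_rule[of W]) (auto simp: V.has_pd_def simp del: U.ck.simps)
qed

text \<open>By the chain rule a derivative in the chart y is a sum of products of derivatives of f
  in the chart x with derivatives of the transition functions, and the latter are of class C^k for
  every k.\<close>

lemma ck_chart_change:
 assumes "coord_chart n U x" "coord_chart n V y" "open W" "W \<subseteq> U \<inter> V"
  and y: "\<And>i k. i < n ==> coord_chart.ck n V y W k (\<lambda>q. x q i)"
  and f: "coord_chart.ck n U x W k f"
 shows "coord_chart.ck n V y W k f"
proof -
 interpret U: coord_chart n U x by fact
 interpret V: coord_chart n V y by fact
 show ?thesis using f
 proof (induction k arbitrary: f)
  case (Suc k)
  have f1: "U.ck W (Suc 0) f"
   using Suc.prems by (auto intro: U.ck_continuous)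
  have *: "V.has_pd j f p (\<Sum>i<n. pd V y j (\<lambda>q. x q i) p * pd U x i f p)"
   if "j < n" "p \<in> W" for j p
   by (rule chart_change_pd[OF assms(1-3) that(2) assms(4) that(1) f1])
     (rule V.ck_pdiff[OF y that])
  have "V.ck W k (pd V y j f)" if "j < n" for j
  proof (rule V.ck_cong)
   show "V.ck W k (\<lambda>p. \<Sum>i<n. pd V y j (\<lambda>q. x q i) p * pd U x i f p)"
   proof (rule V.ck_sum[OF assms(3)])
    fix i assume "i \<in> {..<n}"
    then have i: "i < n" by simp
    show "V.ck W k (\<lambda>p. pd V y j (\<lambda>q. x q i) p * pd U x i f p)"
     by (rule V.ck_mult[OF assms(3) _ V.ck_pd[OF y[OF i] that] Suc.IH[OF U.ck_pd[OF Suc.prems i]]])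
       (use assms(4) in auto)
   qed (use assms(4) in auto)
  qed (use assms(3,4) V.has_pd_imp(1)[OF *] that in auto)
  then show ?case using * V.has_pd_imp(2)[OF *] U.ck_continuous[OF f1] by simp
 qed simp
qed

section \<open>Smooth functions on the manifold\<close>

locale manifold =
 fixes B :: "('m::{t2_space,second_countable_topology}, 'e::real_vector) qbundle"
 assumes atlas: "smooth_atlas (bdim B) (atlas B)"
begin

lemma chart: "(U, x) \<in> atlas B ==> coord_chart (bdim B) U x"
 using atlas unfolding smooth_atlas_def coord_chart_def by blast

lemma chart_cover: "\<exists>U x. (U, x) \<in> atlas B \<and> p \<in> U"
proof -
 have "\<Union>(fst ` atlas B) = UNIV" using atlas unfolding smooth_atlas_def by (elim conjE)
 then have "p \<in> \<Union>(fst ` atlas B)" by simp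
 then show ?thesis by force
qed

lemma chart_trans:
 assumes "(U, x) \<in> atlas B" "(V, y) \<in> atlas B" "i < bdim B"
 shows "coord_chart.ck (bdim B) U x (U \<inter> V) k (\<lambda>p. y p i)"
 using assms coord_chart.smooth_in_chart_ck[OF chart[OF assms(1)], of V "\<lambda>p. y p i"] atlas
 unfolding smooth_atlas_def by blast

lemma smooth_ck:
 assumes "smooth B W f" "(U, x) \<in> atlas B"
 shows "coord_chart.ck (bdim B) U x (U \<inter> W) k f"
 using assms coord_chart.smooth_in_chart_ck[OF chart[OF assms(2)]] unfolding smooth_def by fast

text \<open>Smoothness refers to all charts of the atlas, but by change of charts one chart around
  each point is enough. Chart and neighbourhood may even depend on the order k.\<close>

lemma smoothI:
 assumes "\<And>p k. p \<in> W ==> \<exists>U x V. (U, x) \<in> atlas B \<and> open V \<and> p \<in> V \<and> V \<subseteq> U \<inter> W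
  \<and> coord_chart.ck (bdim B) U x V k f"
 shows "smooth B W f"
 unfolding smooth_def
proof clarify
 fix U x assume U: "(U, x) \<in> atlas B"
 interpret U: coord_chart "bdim B" U x by (rule chart[OF U])
 have "U.ck (U \<inter> W) k f" for k
 proof (rule U.ck_local)
  fix p assume p: "p \<in> U \<inter> W"
  then have "p \<in> W" by simp
  from assms[OF this, of k]
  obtain U' x' V where V: "(U', x') \<in> atlas B" "open V" "p \<in> V" "V \<subseteq> U' \<inter> W"
   "coord_chart.ck (bdim B) U' x' V k f" by (elim exE conjE)
  interpret U': coord_chart "bdim B" U' x' by (rule chart[OF V(1)])
  have "U.ck (V \<inter> U) k f"
  proof (rule ck_chart_change[OF U'.coord_chart_axioms U.coord_chart_axioms])
   show "open (V \<inter> U)" using V(2) U.open_U by auto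
   show "V \<inter> U \<subseteq> U' \<inter> U" using V(4) by auto
   show "U.ck (V \<inter> U) k (\<lambda>q. x' q i)" if "i < bdim B" for i k
    by (rule U.ck_subset[OF chart_trans[OF U V(1) that]]) (use V(4) in auto)
   show "U'.ck (V \<inter> U) k f" by (rule U'.ck_subset[OF V(5)]) auto
  qed
  then show "\<exists>V. open V \<and> p \<in> V \<and> V \<subseteq> U \<inter> W \<and> U.ck V k f"
   using V p U.open_U by (intro exI[of _ "V \<inter> U"]) auto
 qed
 then show "smooth_in_chart (bdim B) U x W f" by (simp add: U.smooth_in_chart_ck)
qed

lemma smooth_chartI:
 assumes "(U, x) \<in> atlas B" "open W" "W \<subseteq> U" "\<And>k. coord_chart.ck (bdim B) U x W k f"
 shows "smooth B W f"
 by (rule smoothI) (use assms in blast)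

lemma smooth_subset:
 assumes "smooth B W f" "V \<subseteq> W"
 shows "smooth B V f"
 unfolding smooth_def
proof clarify
 fix U x assume U: "(U, x) \<in> atlas B"
 interpret U: coord_chart "bdim B" U x by (rule chart[OF U])
 have "U \<inter> V \<subseteq> U \<inter> W" using assms(2) by auto
 then show "smooth_in_chart (bdim B) U x V f"
  using U.ck_subset[OF smooth_ck[OF assms(1) U]] by (simp add: U.smooth_in_chart_ck)
qed

lemma smooth_ckD:
 assumes "smooth B W f" "(U, x) \<in> atlas B" "V \<subseteq> U \<inter> W"
 shows "coord_chart.ck (bdim B) U x V k f"
 by (rule coord_chart.ck_subset[OF chart[OF assms(2)] smooth_ck[OF assms(1,2)] assms(3)])

lemma smooth_pointwise:
 assumes "open W"
  and "\<And>U x V k. (U, x) \<in> atlas B ==> open V ==> V \<subseteq> U ==> V \<subseteq> W ==> coord_chart.ck (bdim B) U x V k f"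
 shows "smooth B W f"
proof (rule smoothI)
 fix p k assume p: "p \<in> W"
 obtain U x where U: "(U, x) \<in> atlas B" "p \<in> U" using chart_cover by blast
 have "open U" using chart[OF U(1)] coord_chart.open_U by blast
 show "\<exists>U x V. (U, x) \<in> atlas B \<and> open V \<and> p \<in> V \<and> V \<subseteq> U \<inter> W \<and> coord_chart.ck (bdim B) U x V k f"
  by (rule exI[of _ U], rule exI[of _ x], rule exI[of _ "U \<inter> W"]) (use assms(1) assms(2)[OF U(1) open_Int[OF \<open>open U\<close> assms(1)]] U p \<open>open U\<close> in auto)
qed

lemma smooth_local:
 assumes "\<And>p. p \<in> W ==> \<exists>V. open V \<and> p \<in> V \<and> smooth B V f" "open W"
 shows "smooth B W f"
proof (rule smoothI)
 fix p k assume p: "p \<in> W"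
 obtain V where V: "open V" "p \<in> V" "smooth B V f" using assms(1)[OF p] by blast
 obtain U x where U: "(U, x) \<in> atlas B" "p \<in> U" using chart_cover by blast
 have "open U" using chart[OF U(1)] coord_chart.open_U by blast
 show "\<exists>U x V. (U, x) \<in> atlas B \<and> open V \<and> p \<in> V \<and> V \<subseteq> U \<inter> W \<and> coord_chart.ck (bdim B) U x V k f"
  by (rule exI[of _ U], rule exI[of _ x], rule exI[of _ "U \<inter> V \<inter> W"])
    (use V U p assms(2) \<open>open U\<close> smooth_ckD[OF V(3) U(1), of "U \<inter> V \<inter> W"] in auto)
qed

lemma smooth_cong:
 assumes "open W" "smooth B W f" "\<And>q. q \<in> W ==> f q = g q"
 shows "smooth B W g"
 by (rule smooth_pointwise[OF assms(1)], rule coord_chart.ck_cong[where f = f, OF chart])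
   (use assms smooth_ckD[OF assms(2)] in auto)

lemma smooth_const: "open W ==> smooth B W (\<lambda>_. c)"
 by (rule smooth_pointwise) (auto intro: coord_chart.ck_const[OF chart])

lemma smooth_add: "open W ==> smooth B W f ==> smooth B W g ==> smooth B W (\<lambda>q. f q + g q)"
 by (rule smooth_pointwise) (auto intro!: coord_chart.ck_add[OF chart] intro: smooth_ckD)

lemma smooth_mult: "open W ==> smooth B W f ==> smooth B W g ==> smooth B W (\<lambda>q. f q * g q)"
 by (rule smooth_pointwise) (auto intro!: coord_chart.ck_mult[OF chart] intro: smooth_ckD)

lemma smooth_uminus: "open W ==> smooth B W f ==> smooth B W (\<lambda>q. - f q)"
 using smooth_mult[OF _ smooth_const[of W "-1"], of f] by simp

lemma smooth_diff: "open W ==> smooth B W f ==> smooth B W g ==> smooth B W (\<lambda>q. f q - g q)"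
 using smooth_add[OF _ _ smooth_uminus, of W f g] by simp

lemma smooth_sum:
 assumes "open W" "\<And>j. j \<in> J ==> smooth B W (f j)"
 shows "smooth B W (\<lambda>q. \<Sum>j\<in>J. f j q)"
 using assms(2) by (induction J rule: infinite_finite_induct) (auto intro!: smooth_add smooth_const assms(1))

lemma smooth_compose:
 assumes "open W" "smooth B W f"
  and "\<And>m t. t \<in> I ==> (D m has_real_derivative D (Suc m) t) (at t)"
  and "\<And>q. q \<in> W ==> f q \<in> I"
 shows "smooth B W (\<lambda>q. D 0 (f q))"
 by (rule smooth_pointwise[OF assms(1)], rule coord_chart.ck_compose[where D = D and I = I and f = f, OF chart])
   (use assms smooth_ckD[OF assms(2)] in auto)

lemma smooth_inverse:
 assumes "open W" "smooth B W f" "\<And>q. q \<in> W ==> f q \<noteq> 0"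
 shows "smooth B W (\<lambda>q. inverse (f q))"
proof -
 \<comment> \<open>\<open>D m\<close> is the m-th derivative of the reciprocal.\<close>
 define D where "D = (\<lambda>m t. (-1) ^ m * fact m * inverse t ^ Suc m :: real)"
 have "(D m has_real_derivative D (Suc m) t) (at t)" if "t \<in> - {0}" for m t
  unfolding D_def using that
  by (auto intro!: derivative_eq_intros simp: field_simps power_Suc[symmetric] simp del: power_Suc)
    (auto simp: field_simps)
 from smooth_compose[where D = D and I = "- {0}", OF assms(1,2) this] assms(3) show ?thesis by (simp add: D_def)
qed

lemma smooth_coord:
 assumes "(U, x) \<in> atlas B"
 shows "smooth B U (\<lambda>p. x p i)"
proof (cases "i < bdim B")
 case True
 show ?thesis
  by (rule smooth_chartI[OF assms _ order_refl])
    (use chart_trans[OF assms assms True] coord_chart.open_U[OF chart[OF assms]] in auto)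
next
 case False
 have o: "open U" using coord_chart.open_U[OF chart[OF assms]] .
 show ?thesis
  by (rule smooth_cong[OF o smooth_const[OF o, of 0]])
    (use coord_chart.image_zero[OF chart[OF assms]] False in auto)
qed

end

section \<open>Flat functions and bump functions\<close>

primrec flat_poly :: "nat => real poly" where
 "flat_poly 0 = 1"
| "flat_poly (Suc k) = [:0, 0, 1:] * (flat_poly k - pderiv (flat_poly k))"

text \<open>The k-th derivative of exp (- 1 / t), continued by 0. With s = 1 / t, the derivative of
  q(s) exp (- s) with respect to t is s^2 (q - q')(s) exp (- s), which is the recursion of
  \<open>flat_poly\<close>.\<close>

definition flat :: "nat => real => real" where
 "flat k t = (if t > 0 then poly (flat_poly k) (1 / t) * exp (- (1 / t)) else 0)"

lemma poly_exp_tendsto_0: "((\<lambda>s::real. poly p s * exp (- s)) \<longlongrightarrow> 0) at_top"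
proof -
 have "((\<lambda>s::real. s ^ i * exp (- s)) \<longlongrightarrow> 0) at_top" for i
  using tendsto_power_div_exp_0[of i] by (simp add: exp_minus divide_inverse)
 then have "((\<lambda>s::real. \<Sum>i\<le>degree p. coeff p i * (s ^ i * exp (- s))) \<longlongrightarrow> (\<Sum>i\<le>degree p. coeff p i * 0)) at_top"
  by (intro tendsto_sum tendsto_mult tendsto_const) auto
 then show ?thesis by (simp add: poly_altdef sum_distrib_right mult.assoc)
qed

lemma flat_has_derivative: "(flat k has_real_derivative flat (Suc k) t) (at t)"
proof -
 consider "t > 0" | "t < 0" | "t = 0" by linarith
 then show ?thesis
 proof cases
  case 1
  have d: "((\<lambda>t. poly (flat_poly k) (1 / t) * exp (- (1 / t))) has_real_derivative flat (Suc k) t) (at t)"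
   using 1 by (auto intro!: derivative_eq_intros poly_DERIV[THEN DERIV_chain2]
     simp: flat_def field_simps power2_eq_square)
  have "eventually (\<lambda>s. s > 0) (nhds t)" using 1 by (rule order_tendstoD(1)[OF filterlim_ident])
  then have "eventually (\<lambda>s. flat k s = poly (flat_poly k) (1 / s) * exp (- (1 / s))) (nhds t)"
   by eventually_elim (simp add: flat_def)
  from DERIV_cong_ev[OF refl this refl] d show ?thesis by blast
 next
  case 2
  have "eventually (\<lambda>s. s < 0) (nhds t)" using 2 by (rule order_tendstoD(2)[OF filterlim_ident])
  then have "eventually (\<lambda>s. flat k s = 0) (nhds t)" by eventually_elim (simp add: flat_def)
  from DERIV_cong_ev[OF refl this refl, of 0] 2 show ?thesis by (simp add: flat_def[of "Suc k" t])
 next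
  case 3
  have "((\<lambda>h. flat k h / h) \<longlongrightarrow> 0) (at_right 0)"
  proof -
   \<comment> \<open>With s = 1 / h the difference quotient at 0 is s q(s) exp (- s), again a
     polynomial times exp (- s), and tends to 0 as s grows.\<close>
   have "((\<lambda>h::real. poly (pCons 0 (flat_poly k)) (inverse h) * exp (- inverse h)) \<longlongrightarrow> 0) (at_right 0)"
    by (rule filterlim_compose[OF poly_exp_tendsto_0 filterlim_inverse_at_top_right])
   moreover have "eventually (\<lambda>h. poly (pCons 0 (flat_poly k)) (inverse h) * exp (- inverse h) = flat k h / h)
     (at_right 0)"
    using eventually_at_right_less[of 0] by eventually_elim (simp add: flat_def field_simps)
   ultimately show ?thesis by (rule Lim_transform_eventually)
  qed
  moreover have "((\<lambda>h. flat k h / h) \<longlongrightarrow> 0) (at_left 0)"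
  proof (rule Lim_transform_eventually[OF tendsto_const])
   have "eventually (\<lambda>h::real. h < 0) (at_left 0)" by (simp add: eventually_at_filter)
   then show "eventually (\<lambda>h. 0 = flat k h / h) (at_left 0)"
    by eventually_elim (simp add: flat_def)
  qed
  ultimately have "((\<lambda>h. flat k h / h) \<longlongrightarrow> 0) (at 0)" by (simp add: filterlim_split_at)
  then show ?thesis using 3 by (simp add: has_field_derivative_iff flat_def)
 qed
qed

lemma flat_pos: "t > 0 ==> flat 0 t > 0" and flat_nonpos: "t \<le> 0 ==> flat 0 t = 0"
 and flat_nonneg: "flat 0 t \<ge> 0"
 by (auto simp: flat_def)

context manifold begin

lemma smooth_flat: "open W ==> smooth B W f ==> smooth B W (\<lambda>q. flat 0 (f q))"
 by (rule smooth_compose[where D = flat and I = UNIV]) (auto intro: flat_has_derivative)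

text \<open>The closed set C is exported along with h: W and the complement of C cover the manifold
  and h is 0 on the latter, so anything smooth on W can be multiplied by h and continued by
  0.\<close>

lemma bump_function:
 assumes "open W" "p \<in> W"
 shows "\<exists>h V C. open V \<and> p \<in> V \<and> V \<subseteq> W \<and> closed C \<and> C \<subseteq> W \<and> smooth B UNIV h \<and>
  (\<forall>q\<in>V. h q = 1) \<and> (\<forall>q. q \<notin> C \<longrightarrow> h q = 0)"
proof -
 obtain U x where U: "(U, x) \<in> atlas B" "p \<in> U" using chart_cover by blast
 interpret U: coord_chart "bdim B" U x by (rule chart[OF U(1)])
 let ?n = "bdim B"
 obtain \<epsilon> where e: "\<epsilon> > 0" "\<And>y. (\<forall>i<?n. \<bar>y i - x p i\<bar> < \<epsilon>) \<and> (\<forall>i\<ge>?n. y i = 0)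
   ==> y \<in> x ` U \<and> inv_into U x y \<in> W"
  using U.open_box[OF assms U(2)] by blast
 \<comment> \<open>A closed coordinate cube, compact as a product of compact sets. Its image C under
   the inverse chart is compact, hence closed because the manifold is Hausdorff.\<close>
 define Q where "Q = PiE UNIV (\<lambda>i. if i < ?n then cball (x p i) (\<epsilon> / 2) else {0})"
 have Q: "y \<in> Q \<longleftrightarrow> (\<forall>i<?n. \<bar>y i - x p i\<bar> \<le> \<epsilon> / 2) \<and> (\<forall>i\<ge>?n. y i = 0)" for y
 proof -
  have "y i \<in> (if i < ?n then cball (x p i) (\<epsilon> / 2) else {0}) \<longleftrightarrow>
   (i < ?n \<longrightarrow> \<bar>y i - x p i\<bar> \<le> \<epsilon> / 2) \<and> (i \<ge> ?n \<longrightarrow> y i = 0)" for i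
   by (cases "i < ?n") (simp_all add: dist_real_def abs_minus_commute)
  then show ?thesis unfolding Q_def PiE_UNIV_domain Pi_iff by blast
 qed
 have Qin: "y \<in> x ` U \<and> inv_into U x y \<in> W" if "y \<in> Q" for y
 proof (rule e(2), intro conjI allI impI)
  fix i assume "i < ?n"
  then have "\<bar>y i - x p i\<bar> \<le> \<epsilon> / 2" using that by (simp add: Q)
  then show "\<bar>y i - x p i\<bar> < \<epsilon>" using e(1) by simp
 qed (use that in \<open>simp add: Q\<close>)
 have "compactin (powertop_real UNIV) Q"
  unfolding Q_def compactin_PiE by (auto simp: compactin_euclidean_iff)
 then have "compact Q" by (simp add: euclidean_product_topology compactin_euclidean_iff)
 define C where "C = inv_into U x ` Q"
 have "continuous_on Q (inv_into U x)"
  by (rule continuous_on_subset[of "x ` U"]) (use U.homeo Qin in \<open>auto simp: homeomorphism_def\<close>)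
 then have "compact C" unfolding C_def using \<open>compact Q\<close> by (rule compact_continuous_image)
 then have clC: "closed C" by (rule compact_imp_closed)
 have CW: "C \<subseteq> W" using Qin by (auto simp: C_def)
 define r where "r = (\<lambda>q. \<Sum>i<?n. (x q i - x p i) * (x q i - x p i))"
 define b where "b = (\<epsilon> / 2)\<^sup>2"
 \<comment> \<open>With r the squared coordinate distance from p, this is 1 for r \<le> b / 2 and 0
   for r \<ge> b. The denominator is positive because b - r and r - b / 2 are never both \<le>
   0.\<close>
 define f where "f = (\<lambda>q. flat 0 (b - r q) * inverse (flat 0 (b - r q) + flat 0 (r q - b / 2)))"
 define h where "h = (\<lambda>q. if q \<in> U then f q else 0)"
 have b: "b > 0" using e(1) by (simp add: b_def)
 have sr: "smooth B U r" unfolding r_def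
  by (intro smooth_sum smooth_mult smooth_diff smooth_const smooth_coord U.open_U U(1))
 have pos: "flat 0 (b - t) + flat 0 (t - b / 2) > 0" for t
 proof (cases "t < b")
  case True
  then show ?thesis by (intro add_pos_nonneg flat_pos flat_nonneg) simp
 next
  case False
  then show ?thesis using b by (intro add_nonneg_pos flat_pos flat_nonneg) simp
 qed
 have sf: "smooth B U f" unfolding f_def
  by (intro smooth_mult smooth_inverse smooth_add smooth_flat smooth_diff smooth_const sr U.open_U
    pos[THEN less_imp_neq, THEN not_sym])
 have out: "h q = 0" if "q \<notin> C" for q
 proof (cases "q \<in> U")
  case True
  have "x q \<notin> Q" using that True unfolding C_def by (metis U.inv_x imageI)
  then obtain i where i: "i < ?n" "\<bar>x q i - x p i\<bar> > \<epsilon> / 2" using U.image_zero[OF True] by (force simp: Q)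
  have "b \<le> \<bar>x q i - x p i\<bar>\<^sup>2" unfolding b_def using i(2) e(1) by (intro power_mono) auto
  also have "\<dots> = (x q i - x p i) * (x q i - x p i)" by (simp add: power2_eq_square)
  also have "\<dots> \<le> r q" unfolding r_def using i(1) by (intro member_le_sum) auto
  finally show ?thesis by (simp add: h_def f_def flat_nonpos)
 qed (simp add: h_def)
 have "smooth B UNIV h"
 proof (rule smooth_local)
  fix q
  show "\<exists>V. open V \<and> q \<in> V \<and> smooth B V h"
  proof (cases "q \<in> U")
   case True
   have "smooth B U h" by (rule smooth_cong[OF U.open_U sf]) (simp add: h_def)
   then show ?thesis using True U.open_U by blast
  next
   case False
   have "q \<in> - C" using False Qin by (auto simp: C_def inv_into_into)
   moreover have "smooth B (- C) h"
    by (rule smooth_cong[OF _ smooth_const[of "- C" 0]]) (use out clC in auto)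
   ultimately show ?thesis using clC by blast
  qed
 qed simp
 define V where "V = {q\<in>U. r q < b / 2} \<inter> W"
 have "continuous_on U r"
  using smooth_ckD[OF sr U(1), of U 0] by simp
 then have "open {q\<in>U. r q < b / 2}"
  using continuous_on_open_vimage[OF U.open_U, of r] by (auto simp: vimage_def Int_def conj_commute dest!: spec[of _ "{..<b/2}"])
 then have "open V" unfolding V_def using assms(1) by (rule open_Int)
 moreover have "p \<in> V" using U(2) b assms(2) by (simp add: V_def r_def)
 moreover have "h q = 1" if "q \<in> V" for q
  using that b pos[of "r q"] by (simp add: V_def h_def f_def flat_nonpos)
 moreover have "V \<subseteq> W" by (simp add: V_def)
 ultimately have "open V \<and> p \<in> V \<and> V \<subseteq> W \<and> closed C \<and> C \<subseteq> W \<and> smooth B UNIV h \<and>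
  (\<forall>q\<in>V. h q = 1) \<and> (\<forall>q. q \<notin> C \<longrightarrow> h q = 0)"
  using clC CW out \<open>smooth B UNIV h\<close> by blast
 then show ?thesis by (intro exI)
qed

end

section \<open>Sections and adapted charts\<close>

definition indep_family :: "nat => (nat => 'e::real_vector) => bool" where
 "indep_family k b \<longleftrightarrow> (\<forall>c. (\<Sum>i<k. c i *\<^sub>R b i) = 0 \<longrightarrow> (\<forall>i<k. c i = 0))"

lemma indep_familyD: "indep_family k b ==> (\<Sum>i<k. c i *\<^sub>R b i) = 0 ==> i < k ==> c i = 0"
 by (auto simp: indep_family_def)

lemma indep_family_iff: "indep_family k b \<longleftrightarrow> inj_on b {..<k} \<and> independent (b ` {..<k})"
proof
 assume b: "indep_family k b"
 have inj: "inj_on b {..<k}"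
 proof (rule inj_onI, rule ccontr)
  fix i j assume ij: "i \<in> {..<k}" "j \<in> {..<k}" "b i = b j" "i \<noteq> j"
  have "(\<Sum>l<k. (if l = i then 1 else if l = j then -1 else 0) *\<^sub>R b l)
   = (\<Sum>l<k. (if l = i then b i else 0) - (if l = j then b j else 0))"
   using ij by (intro sum.cong) auto
  also have "\<dots> = 0" using ij by (simp add: sum_subtractf)
  finally show False using indep_familyD[OF b, of _ i] ij by fastforce
 qed
 moreover have "independent (b ` {..<k})"
 proof (rule independent_if_scalars_zero)
  fix f v assume f: "(\<Sum>w\<in>b ` {..<k}. f w *\<^sub>R w) = 0" and "v \<in> b ` {..<k}"
  then obtain i where i: "i < k" "v = b i" by auto
  have "(\<Sum>i<k. f (b i) *\<^sub>R b i) = 0" using f by (simp add: sum.reindex[OF inj])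
  from indep_familyD[OF b this i(1)] show "f v = 0" by (simp add: i)
 qed simp
 ultimately show "inj_on b {..<k} \<and> independent (b ` {..<k})" by blast
next
 assume b: "inj_on b {..<k} \<and> independent (b ` {..<k})"
 show "indep_family k b" unfolding indep_family_def
 proof (intro allI impI)
  fix c i assume c: "(\<Sum>i<k. c i *\<^sub>R b i) = 0" and i: "i < k"
  define u where "u = (\<lambda>v. c (inv_into {..<k} b v))"
  have "(\<Sum>v\<in>b ` {..<k}. u v *\<^sub>R v) = (\<Sum>i<k. u (b i) *\<^sub>R b i)"
   using b by (simp add: sum.reindex)
  also have "\<dots> = (\<Sum>i<k. c i *\<^sub>R b i)" using b by (intro sum.cong) (auto simp: u_def)
  finally have "(\<Sum>v\<in>b ` {..<k}. u v *\<^sub>R v) = 0" using c by simp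
  then have "\<forall>v\<in>b ` {..<k}. u v = 0" using b independentD[of "b ` {..<k}"] by blast
  then show "c i = 0" using i b by (auto simp: u_def)
 qed
qed

lemma span_family: "span (b ` {..<k}) = {\<Sum>i<k. c i *\<^sub>R b i | c. True}" for b :: "nat => 'e::real_vector"
proof
 show "{\<Sum>i<k. c i *\<^sub>R b i | c. True} \<subseteq> span (b ` {..<k})"
  by (clarify, intro span_sum span_scale span_base) auto
 show "span (b ` {..<k}) \<subseteq> {\<Sum>i<k. c i *\<^sub>R b i | c. True}"
 proof (rule span_minimal)
  have "b i = (\<Sum>j<k. (if j = i then 1 else 0) *\<^sub>R b j)" if "i < k" for i
  proof -
   have "(\<Sum>j<k. (if j = i then 1 else 0) *\<^sub>R b j) = (\<Sum>j<k. if j = i then b j else 0)"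
    by (rule sum.cong) auto
   then show ?thesis using that by simp
  qed
  then show "b ` {..<k} \<subseteq> {\<Sum>i<k. c i *\<^sub>R b i | c. True}"
   by (intro subsetI, elim imageE, intro CollectI exI conjI TrueI) (erule trans, simp only: lessThan_iff)
  show "subspace {\<Sum>i<k. c i *\<^sub>R b i | c. True}"
  proof (rule subspaceI)
   show "0 \<in> {\<Sum>i<k. c i *\<^sub>R b i | c. True}" by (auto intro!: exI[of _ "\<lambda>_. 0"])
   fix u v and t :: real
   assume "u \<in> {\<Sum>i<k. c i *\<^sub>R b i | c. True}"
   then obtain c where c: "u = (\<Sum>i<k. c i *\<^sub>R b i)" by auto
   show "t *\<^sub>R u \<in> {\<Sum>i<k. c i *\<^sub>R b i | c. True}"
    by (auto intro!: exI[of _ "\<lambda>i. t * c i"] simp: c scaleR_sum_right)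
   assume "v \<in> {\<Sum>i<k. c i *\<^sub>R b i | c. True}"
   then obtain d where d: "v = (\<Sum>i<k. d i *\<^sub>R b i)" by auto
   show "u + v \<in> {\<Sum>i<k. c i *\<^sub>R b i | c. True}"
    by (auto intro!: exI[of _ "\<lambda>i. c i + d i"] simp: c d scaleR_add_left sum.distrib)
  qed
 qed
qed

lemma basis_of_iff: "basis_of k b V \<longleftrightarrow> indep_family k b \<and> V = {\<Sum>i<k. c i *\<^sub>R b i | c. True}"
 unfolding basis_of_def indep_family_iff span_family by auto

lemma basis_ofD:
 assumes "basis_of k b V"
 shows "subspace V" "i < k ==> b i \<in> V" "v \<in> V ==> \<exists>c. v = (\<Sum>i<k. c i *\<^sub>R b i)"
  "(\<Sum>i<k. c i *\<^sub>R b i) = (\<Sum>i<k. d i *\<^sub>R b i) ==> i < k ==> c i = d i"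
  "(\<Sum>i<k. c i *\<^sub>R b i) \<in> V"
proof -
 have V: "V = span (b ` {..<k})" using assms by (simp add: basis_of_def)
 show "subspace V" by (simp add: V)
 show "i < k ==> b i \<in> V" by (simp add: V span_base)
 show "v \<in> V ==> \<exists>c. v = (\<Sum>i<k. c i *\<^sub>R b i)" "(\<Sum>i<k. c i *\<^sub>R b i) \<in> V"
  using assms by (auto simp: basis_of_iff)
 assume "(\<Sum>i<k. c i *\<^sub>R b i) = (\<Sum>i<k. d i *\<^sub>R b i)" "i < k"
 then have "(\<Sum>i<k. (c i - d i) *\<^sub>R b i) = 0" by (simp add: scaleR_diff_left sum_subtractf)
 then show "c i = d i" using assms indep_familyD[of k b "\<lambda>i. c i - d i" i] \<open>i < k\<close>
  by (simp add: basis_of_iff)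
qed

lemma indep_family_le:
 assumes "indep_family l v" "\<And>j. j < l ==> v j \<in> span (w ` {..<k})"
 shows "l \<le> k"
proof -
 have "card (v ` {..<l}) \<le> card (w ` {..<k})"
  using independent_span_bound[of "w ` {..<k}" "v ` {..<l}"] assms by (auto simp: indep_family_iff)
 also have "\<dots> \<le> k" using card_image_le[of "{..<k}" w] by simp
 also have "card (v ` {..<l}) = l" using assms(1) by (simp add: indep_family_iff card_image)
 finally show ?thesis .
qed

text \<open>The values of the k functionals place the l vectors in real k-space, realised as
  functions on the naturals that vanish from k on. By hypothesis no nonzero combination is lost, so
  the images are independent in the span of k unit vectors.\<close>

lemma jointly_injective_functionals:
 fixes v :: "nat => 'e::real_vector"
 assumes "indep_family l v"
  and "\<And>c. (\<And>i. i < k ==> (\<Sum>j<l. c j * F i (v j)) = 0) ==> (\<Sum>j<l. c j *\<^sub>R v j) = 0"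
 shows "l \<le> k"
proof -
 define g where "g = (\<lambda>j i. if i < k then F i (v j) else (0::real))"
 define w where "w = (\<lambda>(m::nat) (i::nat). if i = m then 1 else (0::real))"
 have "indep_family l g" unfolding indep_family_def
 proof (intro allI impI)
  fix c j assume c: "(\<Sum>j<l. c j *\<^sub>R g j) = 0" and j: "j < l"
  have "(\<Sum>j<l. c j *\<^sub>R g j) i = (\<Sum>j<l. c j * g j i)" for i
   by (induction l) (auto simp: scaleR_fun_def)
  then have *: "(\<Sum>j<l. c j * g j i) = 0" for i using c by (simp add: fun_eq_iff)
  have "(\<Sum>j<l. c j * F i (v j)) = 0" if "i < k" for i
   using that *[of i] by (simp add: g_def)
  from assms(2)[OF this] show "c j = 0" using indep_familyD[OF assms(1) _ j] by blast
 qed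
 moreover have "g j \<in> span (w ` {..<k})" for j
 proof -
  have "(\<Sum>m<k. F m (v j) *\<^sub>R w m) i = (\<Sum>m<k. F m (v j) * w m i)" for i
   by (induction k) (auto simp: scaleR_fun_def)
  also have "(\<Sum>m<k. F m (v j) * w m i) = g j i" for i
   by (simp add: w_def g_def if_distrib cong: if_cong)
  finally have "g j = (\<Sum>m<k. F m (v j) *\<^sub>R w m)" by auto
  then show ?thesis by (auto simp: span_family)
 qed
 ultimately show ?thesis by (rule indep_family_le)
qed

text \<open>The number of the conjugate variable, i.e. \<open>dual\<close> exchanges \<open>xi a\<close> and \<open>th a\<close>.\<close>

definition dual :: "nat => nat" where
 "dual s = (if even s then s + 1 else s - 1)"

lemma dual_dual [simp]: "dual (dual s) = s"
 by (auto simp: dual_def)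

lemma dual_parity [simp]: "even (dual s) \<longleftrightarrow> odd s"
 by (auto simp: dual_def)

lemma dual_less [simp]: "dual s < 2 * r \<longleftrightarrow> s < 2 * r"
 unfolding dual_def by (cases "even s"; presburger)

lemma dual_eq_iff [simp]: "dual s = dual t \<longleftrightarrow> s = t"
 by (metis dual_dual)

lemma dual_xi [simp]: "dual (xi a) = th a" and dual_th [simp]: "dual (th a) = xi a"
 by (simp_all add: dual_def xi_def th_def)

lemma dual_div2 [simp]: "dual s div 2 = s div 2"
 unfolding dual_def by presburger

lemma sum_dual: "(\<Sum>s<2 * r. f (dual s)) = (\<Sum>s<2 * r. f s)"
 by (rule sum.reindex_bij_witness[of _ dual dual]) auto

lemma sum_even_odd: "(\<Sum>s<2 * r. f s) = (\<Sum>a<r. f (xi a) + f (th a))"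
 by (induction r) (auto simp: xi_def th_def add.assoc)

section \<open>Linear algebra of the splitting of E\<close>

locale split_bundle =
 fixes B :: "('m::{t2_space,second_countable_topology}, 'e::real_vector) qbundle"
  and A K :: "'m => 'e set"
 assumes vb: "vector_bundle B" and sp: "smooth_pairing B"
  and subA: "subbundle B A"
  and perpA: "\<And>p. A p = {v \<in> fib B p. \<forall>w\<in>A p. pair B p v w = 0}"
  and ic: "isotropic_complement B A K"
begin

sublocale manifold B
 using vb by unfold_locales (simp add: vector_bundle_def)

abbreviation r :: nat where "r \<equiv> hrk B"

lemma frameD: "(W, e) \<in> frames B ==> open W" "(W, e) \<in> frames B ==> p \<in> W ==> basis_of (2 * r) (\<lambda>i. e i p) (fib B p)"
 using vb unfolding vector_bundle_def by blast+

lemma frame_cover: "\<exists>W e. (W, e) \<in> frames B \<and> p \<in> W"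
proof -
 have "\<Union>(fst ` frames B) = UNIV" using vb unfolding vector_bundle_def by (elim conjE)
 then have "p \<in> \<Union>(fst ` frames B)" by simp
 then show ?thesis by force
qed

lemma fib_subspace: "subspace (fib B p)"
 using frame_cover[of p] frameD(2) basis_ofD(1) by blast

lemma subbundle_subspace: "subbundle B D ==> subspace (D p)"
 unfolding subbundle_def using basis_ofD(1) by blast

lemma A_subspace: "subspace (A p)" using subA by (rule subbundle_subspace)

lemma subK: "subbundle B K" using ic by (simp add: isotropic_complement_def)

lemma K_subspace: "subspace (K p)" using subK by (rule subbundle_subspace)

lemma A_fib: "v \<in> A p ==> v \<in> fib B p" using perpA by blast

lemma A_Int_K: "v \<in> A p ==> v \<in> K p ==> v = 0"
 using ic unfolding isotropic_complement_def by blast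

lemma fib_eq: "fib B p = {u + v |u v. u \<in> A p \<and> v \<in> K p}"
 using ic by (simp add: isotropic_complement_def)

lemma fib_split: "v \<in> fib B p ==> \<exists>a k. v = a + k \<and> a \<in> A p \<and> k \<in> K p"
 unfolding fib_eq by auto

lemma K_fib: "v \<in> K p ==> v \<in> fib B p"
proof -
 assume "v \<in> K p"
 moreover have "0 \<in> A p" using A_subspace by (rule subspace_0)
 ultimately have "0 + v \<in> {u + v |u v. u \<in> A p \<and> v \<in> K p}" by blast
 then show ?thesis by (simp add: fib_eq)
qed

lemma A_iso: "v \<in> A p ==> w \<in> A p ==> pair B p v w = 0" using perpA by blast

lemma K_iso: "v \<in> K p ==> w \<in> K p ==> pair B p v w = 0"
 using ic by (simp add: isotropic_complement_def)

lemma pair_sym: "v \<in> fib B p ==> w \<in> fib B p ==> pair B p v w = pair B p w v"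
 using sp[unfolded smooth_pairing_def, THEN conjunct1] by blast

lemma pair_lin: "u \<in> fib B p ==> v \<in> fib B p ==> w \<in> fib B p ==>
  pair B p (a *\<^sub>R u + b *\<^sub>R v) w = a * pair B p u w + b * pair B p v w"
 using sp[unfolded smooth_pairing_def, THEN conjunct2, THEN conjunct1] by blast

lemma nondeg: "v \<in> fib B p ==> (\<And>w. w \<in> fib B p ==> pair B p v w = 0) ==> v = 0"
 using sp[unfolded smooth_pairing_def, THEN conjunct2, THEN conjunct2, THEN conjunct1] by blast

lemma pair_add: "u \<in> fib B p ==> v \<in> fib B p ==> w \<in> fib B p ==>
  pair B p (u + v) w = pair B p u w + pair B p v w"
 using pair_lin[of u p v w 1 1] by simp

lemma pair_scale: "u \<in> fib B p ==> w \<in> fib B p ==> pair B p (a *\<^sub>R u) w = a * pair B p u w"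
 using pair_lin[of u p u w a 0] by simp

lemma pair_diff: "u \<in> fib B p ==> v \<in> fib B p ==> w \<in> fib B p ==>
  pair B p (u - v) w = pair B p u w - pair B p v w"
 using pair_lin[of u p v w 1 "-1"] by simp

lemma pair_zero: "w \<in> fib B p ==> pair B p 0 w = 0"
 using pair_scale[of w p w 0] by simp

lemma pair_sum: "(\<And>i. i \<in> I ==> v i \<in> fib B p) ==> w \<in> fib B p ==>
  pair B p (\<Sum>i\<in>I. c i *\<^sub>R v i) w = (\<Sum>i\<in>I. c i * pair B p (v i) w)"
proof (induction I rule: infinite_finite_induct)
 case (insert i I)
 then have "(\<Sum>i\<in>I. c i *\<^sub>R v i) \<in> fib B p" "c i *\<^sub>R v i \<in> fib B p"
  by (auto intro!: subspace_sum subspace_scale fib_subspace)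
 then show ?case using insert by (simp add: pair_add pair_scale)
qed (auto simp: pair_zero)

lemma pair_sum_right: "(\<And>i. i \<in> I ==> v i \<in> fib B p) ==> w \<in> fib B p ==>
  pair B p w (\<Sum>i\<in>I. c i *\<^sub>R v i) = (\<Sum>i\<in>I. c i * pair B p w (v i))"
 using pair_sum[of I v p w c] pair_sym[of w p]
 by (simp add: subspace_sum[OF fib_subspace] subspace_scale[OF fib_subspace])

lemma nondeg_A: "v \<in> A p ==> (\<And>w. w \<in> K p ==> pair B p v w = 0) ==> v = 0"
proof (rule nondeg[OF A_fib], assumption)
 fix w assume v: "v \<in> A p" "\<And>w. w \<in> K p ==> pair B p v w = 0" and w: "w \<in> fib B p"
 obtain a k where ak: "w = a + k" "a \<in> A p" "k \<in> K p" using fib_split[OF w] by blast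
 have "pair B p v w = pair B p w v" using pair_sym v A_fib w by blast
 also have "\<dots> = pair B p a v + pair B p k v" unfolding ak(1) by (intro pair_add A_fib K_fib ak v)
 also have "\<dots> = 0" using A_iso[OF ak(2) v(1)] v(2)[OF ak(3)] pair_sym[OF K_fib[OF ak(3)] A_fib[OF v(1)]] by simp
 finally show "pair B p v w = 0" .
qed

lemma nondeg_K: "v \<in> K p ==> (\<And>w. w \<in> A p ==> pair B p v w = 0) ==> v = 0"
proof (rule nondeg[OF K_fib], assumption)
 fix w assume v: "v \<in> K p" "\<And>w. w \<in> A p ==> pair B p v w = 0" and w: "w \<in> fib B p"
 obtain a k where ak: "w = a + k" "a \<in> A p" "k \<in> K p" using fib_split[OF w] by blast
 have "pair B p v w = pair B p w v" using pair_sym v K_fib w by blast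
 also have "\<dots> = pair B p a v + pair B p k v" unfolding ak(1) by (intro pair_add A_fib K_fib ak v)
 also have "\<dots> = 0" using K_iso[OF ak(3) v(1)] v(2)[OF ak(2)] pair_sym[OF A_fib[OF ak(2)] K_fib[OF v(1)]] by simp
 finally show "pair B p v w = 0" .
qed

text \<open>\<open>A p\<close> and \<open>K p\<close> are isotropic and span the fibre together, so
  the pairing between them is nondegenerate and each dimension bounds the other. The two bases
  together form a basis of the fibre, whose dimension is 2 r.\<close>

lemma rank_eq:
 assumes a: "basis_of k a (A p)" and b: "basis_of l b (K p)"
 shows "k = r" "l = r"
proof -
 have af: "i < k ==> a i \<in> A p" "i < l ==> b i \<in> K p" for i
  using basis_ofD(2)[OF a] basis_ofD(2)[OF b] by auto
 then have ff: "i < k ==> a i \<in> fib B p" "i < l ==> b i \<in> fib B p" for i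
  using A_fib K_fib by auto
 have 1: "l \<le> k"
 proof (rule jointly_injective_functionals[where F = "\<lambda>i v. pair B p v (a i)"])
  show "indep_family l b" using b by (simp add: basis_of_iff)
  fix c assume c: "\<And>i. i < k ==> (\<Sum>j<l. c j * pair B p (b j) (a i)) = 0"
  have "pair B p (\<Sum>j<l. c j *\<^sub>R b j) w = 0" if w: "w \<in> A p" for w
  proof -
   obtain d where d: "w = (\<Sum>i<k. d i *\<^sub>R a i)" using basis_ofD(3)[OF a w] by blast
   have "(\<Sum>j<l. c j *\<^sub>R b j) \<in> fib B p" using basis_ofD(5)[OF b] K_fib by blast
   then have "pair B p (\<Sum>j<l. c j *\<^sub>R b j) w = (\<Sum>i<k. d i * pair B p (\<Sum>j<l. c j *\<^sub>R b j) (a i))"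
    unfolding d using ff by (intro pair_sum_right) auto
   also have "\<dots> = 0"
   proof (intro sum.neutral ballI)
    fix i assume "i \<in> {..<k}"
    then have "pair B p (\<Sum>j<l. c j *\<^sub>R b j) (a i) = (\<Sum>j<l. c j * pair B p (b j) (a i))"
     using ff by (intro pair_sum) auto
    then show "d i * pair B p (\<Sum>j<l. c j *\<^sub>R b j) (a i) = 0" using c \<open>i \<in> _\<close> by simp
   qed
   finally show ?thesis .
  qed
  then show "(\<Sum>j<l. c j *\<^sub>R b j) = 0" using nondeg_K basis_ofD(5)[OF b] by blast
 qed
 have 2: "k \<le> l"
 proof (rule jointly_injective_functionals[where F = "\<lambda>i v. pair B p v (b i)"])
  show "indep_family k a" using a by (simp add: basis_of_iff)
  fix c assume c: "\<And>i. i < l ==> (\<Sum>j<k. c j * pair B p (a j) (b i)) = 0"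
  have "pair B p (\<Sum>j<k. c j *\<^sub>R a j) w = 0" if w: "w \<in> K p" for w
  proof -
   obtain d where d: "w = (\<Sum>i<l. d i *\<^sub>R b i)" using basis_ofD(3)[OF b w] by blast
   have "(\<Sum>j<k. c j *\<^sub>R a j) \<in> fib B p" using basis_ofD(5)[OF a] A_fib by blast
   then have "pair B p (\<Sum>j<k. c j *\<^sub>R a j) w = (\<Sum>i<l. d i * pair B p (\<Sum>j<k. c j *\<^sub>R a j) (b i))"
    unfolding d using ff by (intro pair_sum_right) auto
   also have "\<dots> = 0"
   proof (intro sum.neutral ballI)
    fix i assume "i \<in> {..<l}"
    then have "pair B p (\<Sum>j<k. c j *\<^sub>R a j) (b i) = (\<Sum>j<k. c j * pair B p (a j) (b i))"
     using ff by (intro pair_sum) auto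
    then show "d i * pair B p (\<Sum>j<k. c j *\<^sub>R a j) (b i) = 0" using c \<open>i \<in> _\<close> by simp
   qed
   finally show ?thesis .
  qed
  then show "(\<Sum>j<k. c j *\<^sub>R a j) = 0" using nondeg_A basis_ofD(5)[OF a] by blast
 qed
 define ab where "ab = (\<lambda>i. if i < k then a i else b (i - k))"
 have split: "(\<Sum>i<k + l. c i *\<^sub>R ab i) = (\<Sum>i<k. c i *\<^sub>R a i) + (\<Sum>i<l. c (k + i) *\<^sub>R b i)" for c
 proof -
  have eq: "{..<k + l} = {..<k} \<union> {k..<k + l}" by auto
  have "(\<Sum>i<k + l. c i *\<^sub>R ab i) = (\<Sum>i<k. c i *\<^sub>R ab i) + (\<Sum>i=k..<k + l. c i *\<^sub>R ab i)"
   unfolding eq by (rule sum.union_disjoint) auto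
  also have "(\<Sum>i=k..<k + l. c i *\<^sub>R ab i) = (\<Sum>i<l. c (k + i) *\<^sub>R b i)"
   by (rule sum.reindex_bij_witness[of _ "\<lambda>i. k + i" "\<lambda>i. i - k"]) (auto simp: ab_def)
  also have "(\<Sum>i<k. c i *\<^sub>R ab i) = (\<Sum>i<k. c i *\<^sub>R a i)" by (simp add: ab_def)
  finally show ?thesis .
 qed
 have iab: "indep_family (k + l) ab" unfolding indep_family_def
 proof (intro allI impI)
  fix c i assume "(\<Sum>i<k + l. c i *\<^sub>R ab i) = 0" and i: "i < k + l"
  then have eq: "(\<Sum>i<k. c i *\<^sub>R a i) + (\<Sum>i<l. c (k + i) *\<^sub>R b i) = 0" by (simp add: split)
  then have "(\<Sum>i<k. c i *\<^sub>R a i) = - (\<Sum>i<l. c (k + i) *\<^sub>R b i)" by (simp add: add_eq_0_iff2)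
  moreover have "- (\<Sum>i<l. c (k + i) *\<^sub>R b i) \<in> K p"
   using K_subspace basis_ofD(5)[OF b] by (intro subspace_neg) auto
  ultimately have z: "(\<Sum>i<k. c i *\<^sub>R a i) = 0" using A_Int_K basis_ofD(5)[OF a] by metis
  then have "(\<Sum>i<l. c (k + i) *\<^sub>R b i) = 0" using eq by simp
  then have "j < l ==> c (k + j) = 0" for j
   using b indep_familyD[of l b "\<lambda>i. c (k + i)" j] by (simp add: basis_of_iff)
  moreover have "j < k ==> c j = 0" for j
   using a indep_familyD[of k a c j] z by (simp add: basis_of_iff)
  ultimately show "c i = 0" using i by (metis add_diff_inverse_nat nat_add_left_cancel_less)
 qed
 obtain W e where e: "(W, e) \<in> frames B" "p \<in> W" using frame_cover by blast
 have eb: "basis_of (2 * r) (\<lambda>i. e i p) (fib B p)" by (rule frameD(2)[OF e])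
 have 3: "k + l \<le> 2 * r"
 proof (rule indep_family_le[OF iab])
  fix j assume "j < k + l"
  then have "ab j \<in> fib B p" using af A_fib K_fib by (auto simp: ab_def)
  then show "ab j \<in> span ((\<lambda>i. e i p) ` {..<2 * r})" using eb by (simp add: basis_of_def)
 qed
 have 4: "2 * r \<le> k + l"
 proof (rule indep_family_le)
  show "indep_family (2 * r) (\<lambda>i. e i p)" using eb by (simp add: basis_of_iff)
  fix j assume "j < 2 * r"
  then have "e j p \<in> fib B p" using basis_ofD(2)[OF eb] by auto
  then obtain u v where uv: "e j p = u + v" "u \<in> A p" "v \<in> K p" using fib_split by blast
  obtain c d where cd: "u = (\<Sum>i<k. c i *\<^sub>R a i)" "v = (\<Sum>i<l. d i *\<^sub>R b i)"
   using basis_ofD(3)[OF a uv(2)] basis_ofD(3)[OF b uv(3)] by blast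
  have "e j p = (\<Sum>i<k + l. (if i < k then c i else d (i - k)) *\<^sub>R ab i)"
   unfolding split uv(1) cd by simp
  then show "e j p \<in> span (ab ` {..<k + l})" by (auto simp: span_family)
 qed
 from 1 2 3 4 show "k = r" "l = r" by auto
qed

end

section \<open>Smooth local sections\<close>

context split_bundle begin

lemma pair_frame_smooth: "(W, e) \<in> frames B ==> i < 2 * r ==> j < 2 * r ==>
  smooth B W (\<lambda>p. pair B p (e i p) (e j p))"
 using sp[unfolded smooth_pairing_def, THEN conjunct2, THEN conjunct2, THEN conjunct2] by blast

lemma local_section_fib: "local_section B W s ==> p \<in> W ==> s p \<in> fib B p"
 by (simp add: local_section_def)

abbreviation coeffs where
 "coeffs V W e s g \<equiv> (\<forall>i<2 * r. smooth B (V \<inter> W) (g i)) \<and>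
  (\<forall>p. p \<in> V \<longrightarrow> p \<in> W \<longrightarrow> s p = (\<Sum>i<2 * r. g i p *\<^sub>R e i p))"

lemma local_section_iff: "local_section B W s \<longleftrightarrow>
  (\<forall>p\<in>W. s p \<in> fib B p) \<and> (\<forall>V e. (V, e) \<in> frames B \<longrightarrow> (\<exists>g. coeffs V W e s g))"
 unfolding local_section_def by (simp add: Ball_def imp_conjL)

lemma local_section_ex: "local_section B W s ==> (V, e) \<in> frames B ==> \<exists>g. coeffs V W e s g"
 unfolding local_section_iff by fast

lemma local_sectionI:
 "(\<And>p. p \<in> W ==> s p \<in> fib B p) ==> (\<And>V e. (V, e) \<in> frames B ==> \<exists>g. coeffs V W e s g) ==> local_section B W s"
 unfolding local_section_iff by fast

lemma local_section_subset:
 assumes "local_section B W s" "V \<subseteq> W"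
 shows "local_section B V s"
proof (rule local_sectionI)
 show "s p \<in> fib B p" if "p \<in> V" for p using local_section_fib[OF assms(1)] assms(2) that by auto
 fix V' e assume e: "(V', e) \<in> frames B"
 obtain g where g': "coeffs V' W e s g"
  by (rule exE[OF local_section_ex[OF assms(1) e]])
 note g = g'[THEN conjunct1, rule_format] g'[THEN conjunct2, rule_format]
 have "V' \<inter> V \<subseteq> V' \<inter> W" using assms(2) by auto
 then show "\<exists>g. coeffs V' V e s g"
  using assms(2) by (intro exI[of _ g]) (auto intro: smooth_subset[OF g(1)] simp: g(2))
qed

lemma local_section_add:
 assumes "open W" "local_section B W s" "local_section B W t"
 shows "local_section B W (\<lambda>p. s p + t p)"
proof (rule local_sectionI)
 show "s p + t p \<in> fib B p" if "p \<in> W" for p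
  using local_section_fib[OF assms(2) that] local_section_fib[OF assms(3) that] fib_subspace
  by (intro subspace_add)
 fix V e assume e: "(V, e) \<in> frames B"
 have o: "open (V \<inter> W)" using frameD(1)[OF e] assms(1) by (rule open_Int)
 obtain g where g': "coeffs V W e s g"
  by (rule exE[OF local_section_ex[OF assms(2) e]])
 note g = g'[THEN conjunct1, rule_format] g'[THEN conjunct2, rule_format]
 obtain h where h': "coeffs V W e t h"
  by (rule exE[OF local_section_ex[OF assms(3) e]])
 note h = h'[THEN conjunct1, rule_format] h'[THEN conjunct2, rule_format]
 show "\<exists>g. coeffs V W e (\<lambda>p. s p + t p) g"
  by (intro exI[of _ "\<lambda>i p. g i p + h i p"] conjI allI impI ballI smooth_add[OF o] g(1) h(1))
    (simp_all add: g(2) h(2) scaleR_add_left sum.distrib)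
qed

lemma local_section_scale:
 assumes "open W" "smooth B W f" "local_section B W s"
 shows "local_section B W (\<lambda>p. f p *\<^sub>R s p)"
proof (rule local_sectionI)
 show "f p *\<^sub>R s p \<in> fib B p" if "p \<in> W" for p
  using local_section_fib[OF assms(3) that] fib_subspace by (intro subspace_scale)
 fix V e assume e: "(V, e) \<in> frames B"
 have o: "open (V \<inter> W)" using frameD(1)[OF e] assms(1) by (rule open_Int)
 obtain g where g': "coeffs V W e s g"
  by (rule exE[OF local_section_ex[OF assms(3) e]])
 note g = g'[THEN conjunct1, rule_format] g'[THEN conjunct2, rule_format]
 have f: "smooth B (V \<inter> W) f" by (rule smooth_subset[OF assms(2)]) simp
 show "\<exists>g. coeffs V W e (\<lambda>p. f p *\<^sub>R s p) g"
  by (intro exI[of _ "\<lambda>i p. f p * g i p"] conjI allI impI ballI smooth_mult[OF o f] g(1))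
    (simp_all add: g(2) scaleR_sum_right)
qed

lemma local_section_zero: "open W ==> local_section B W (\<lambda>_. 0)"
proof (rule local_sectionI)
 show "0 \<in> fib B p" for p by (rule subspace_0[OF fib_subspace])
 fix V e assume o: "open W" and e: "(V, e) \<in> frames B"
 have o: "open (V \<inter> W)" using frameD(1)[OF e] o by (rule open_Int)
 show "\<exists>g. coeffs V W e (\<lambda>p. 0) g"
  by (intro exI[of _ "\<lambda>_ _. 0"] conjI allI impI ballI smooth_const[OF o]) simp
qed

lemma local_section_sum:
 assumes "open W" "\<And>i. i \<in> I ==> local_section B W (s i)"
 shows "local_section B W (\<lambda>p. \<Sum>i\<in>I. s i p)"
 using assms(2)
proof (induction I rule: infinite_finite_induct)
 case (insert i I)
 then show ?case using local_section_add[OF assms(1), of "s i" "\<lambda>p. \<Sum>i\<in>I. s i p"] by simp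
qed (simp_all add: local_section_zero assms(1))

lemma local_section_cong:
 assumes "local_section B W s" "\<And>p. p \<in> W ==> s p = t p"
 shows "local_section B W t"
proof (rule local_sectionI)
 show "t p \<in> fib B p" if "p \<in> W" for p using local_section_fib[OF assms(1)] assms(2) that by metis
 fix V e assume e: "(V, e) \<in> frames B"
 obtain g where g': "coeffs V W e s g"
  by (rule exE[OF local_section_ex[OF assms(1) e]])
 note g = g'[THEN conjunct1, rule_format] g'[THEN conjunct2, rule_format]
 show "\<exists>g. coeffs V W e t g"
  by (intro exI[of _ g] conjI allI impI ballI g(1)) (simp_all add: g(2)[symmetric] assms(2))
qed

text \<open>Frame coefficients are unique, so the coefficients chosen pointwise coincide near each
  point with smooth ones.\<close>

lemma local_section_local:
 assumes "open W" "\<And>p. p \<in> W ==> \<exists>V. open V \<and> p \<in> V \<and> local_section B V s"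
 shows "local_section B W s"
proof (rule local_sectionI)
 show f: "s p \<in> fib B p" if "p \<in> W" for p using assms(2)[OF that] local_section_fib by blast
 fix V e assume e: "(V, e) \<in> frames B"
 have "\<exists>c. s p = (\<Sum>i<2 * r. c i *\<^sub>R e i p)" if "p \<in> V \<inter> W" for p
  using basis_ofD(3)[OF frameD(2)[OF e]] f that by blast
 then obtain G where G: "\<And>p. p \<in> V \<inter> W ==> s p = (\<Sum>i<2 * r. G p i *\<^sub>R e i p)" by metis
 have "smooth B (V \<inter> W) (\<lambda>p. G p i)" if i: "i < 2 * r" for i
 proof (rule smooth_local)
  show o: "open (V \<inter> W)" using frameD(1)[OF e] assms(1) by (rule open_Int)
  fix p assume p: "p \<in> V \<inter> W"
  then obtain V' where V': "open V'" "p \<in> V'" "local_section B V' s" using assms(2) by blast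
  obtain g where g': "coeffs V V' e s g"
  by (rule exE[OF local_section_ex[OF V'(3) e]])
 note g = g'[THEN conjunct1, rule_format] g'[THEN conjunct2, rule_format]
  have o': "open (V \<inter> W \<inter> V')" using o V'(1) by (rule open_Int)
  have "g i q = G q i" if q: "q \<in> V \<inter> W \<inter> V'" for q
   by (rule basis_ofD(4)[OF frameD(2)[OF e, of q] _ i]) (use q g(2)[of q] G[of q] in auto)
  then have "smooth B (V \<inter> W \<inter> V') (\<lambda>p. G p i)"
   by (intro smooth_cong[OF o' smooth_subset[OF g(1)[OF i]]]) auto
  then show "\<exists>V. open V \<and> p \<in> V \<and> smooth B V (\<lambda>p. G p i)"
   using o' p V'(2) by (intro exI[of _ "V \<inter> W \<inter> V'"]) auto
 qed
 then show "\<exists>g. coeffs V W e s g"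
  using G by (intro exI[of _ "\<lambda>i p. G p i"]) simp
qed

lemma pair_smooth:
 assumes "open W" "local_section B W s" "local_section B W t"
 shows "smooth B W (\<lambda>p. pair B p (s p) (t p))"
proof (rule smooth_local)
 fix p assume p: "p \<in> W"
 obtain V e where e: "(V, e) \<in> frames B" "p \<in> V" using frame_cover by blast
 have o: "open (V \<inter> W)" using frameD(1)[OF e(1)] assms(1) by (rule open_Int)
 obtain g where g': "coeffs V W e s g"
  by (rule exE[OF local_section_ex[OF assms(2) e(1)]])
 note g = g'[THEN conjunct1, rule_format] g'[THEN conjunct2, rule_format]
 obtain h where h': "coeffs V W e t h"
  by (rule exE[OF local_section_ex[OF assms(3) e(1)]])
 note h = h'[THEN conjunct1, rule_format] h'[THEN conjunct2, rule_format]
 have eq: "(\<Sum>i<2 * r. g i q * (\<Sum>j<2 * r. h j q * pair B q (e i q) (e j q))) = pair B q (s q) (t q)"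
  if q: "q \<in> V \<inter> W" for q
 proof -
  have ef: "e i q \<in> fib B q" if "i < 2 * r" for i using basis_ofD(2)[OF frameD(2)[OF e(1)] that] q by blast
  have "pair B q (s q) (t q) = (\<Sum>i<2 * r. g i q * pair B q (e i q) (t q))"
   using q ef local_section_fib[OF assms(3)] by (simp add: g(2)) (intro pair_sum; auto)
  also have "\<dots> = (\<Sum>i<2 * r. g i q * (\<Sum>j<2 * r. h j q * pair B q (e i q) (e j q)))"
  proof (rule sum.cong[OF refl])
   fix i assume i: "i \<in> {..<2 * r}"
   have "pair B q (e i q) (t q) = (\<Sum>j<2 * r. h j q * pair B q (e i q) (e j q))"
    using q ef i h(2)[of q] by (simp only: Int_iff) (intro pair_sum_right; auto)
   then show "g i q * pair B q (e i q) (t q) = g i q * (\<Sum>j<2 * r. h j q * pair B q (e i q) (e j q))" by simp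
  qed
  finally show ?thesis by simp
 qed
 have "smooth B (V \<inter> W) (\<lambda>p. pair B p (s p) (t p))"
 proof (rule smooth_cong[OF o _ eq])
  show "smooth B (V \<inter> W) (\<lambda>q. \<Sum>i<2 * r. g i q * (\<Sum>j<2 * r. h j q * pair B q (e i q) (e j q)))"
   by (intro smooth_sum smooth_mult g h o smooth_subset[OF pair_frame_smooth[OF e(1)]]) auto
 qed
 then show "\<exists>V. open V \<and> p \<in> V \<and> smooth B V (\<lambda>p. pair B p (s p) (t p))"
  using o p e(2) by (intro exI[of _ "V \<inter> W"]) auto
qed (rule assms(1))

lemma local_section_extend_zero:
 assumes "open W" "local_section B W s" "smooth B UNIV h" "closed C" "C \<subseteq> W" "\<And>q. q \<notin> C ==> h q = 0"
 shows "local_section B UNIV (\<lambda>q. if q \<in> W then h q *\<^sub>R s q else 0)"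
proof (rule local_section_local[OF open_UNIV])
 fix p
 show "\<exists>V. open V \<and> p \<in> V \<and> local_section B V (\<lambda>q. if q \<in> W then h q *\<^sub>R s q else 0)"
 proof (cases "p \<in> W")
  case True
  have "local_section B W (\<lambda>q. h q *\<^sub>R s q)"
   by (rule local_section_scale[OF assms(1) smooth_subset[OF assms(3)] assms(2)]) simp
  then have "local_section B W (\<lambda>q. if q \<in> W then h q *\<^sub>R s q else 0)"
   by (rule local_section_cong) simp
  then show ?thesis using True assms(1) by blast
 next
  case False
  have o: "open (- C)" using assms(4) by auto
  have "local_section B (- C) (\<lambda>q. if q \<in> W then h q *\<^sub>R s q else 0)"
   by (rule local_section_cong[OF local_section_zero[OF o]]) (use assms(6) in auto)
  then show ?thesis using False assms(5) o by blast
 qed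
qed

lemma sectionsI: "local_section B UNIV s ==> (\<And>p. s p \<in> D p) ==> s \<in> sections B D"
 by (simp add: sections_def)

lemma sectionsD: "s \<in> sections B D ==> s p \<in> D p" "s \<in> sections B D ==> local_section B W s"
 by (auto simp: sections_def intro: local_section_subset)

text \<open>The given bracket takes global sections, so local frames are multiplied by a bump
  function. V and \<open>ext\<close> are chosen before the section, so that one neighbourhood serves
  a whole frame; as \<open>ext\<close> only rescales, it keeps sections inside any family of
  subspaces.\<close>

lemma extend_section:
 assumes "open W" "p \<in> W"
 shows "\<exists>V ext. open V \<and> p \<in> V \<and> V \<subseteq> W \<and>
  (\<forall>s D. local_section B W s \<longrightarrow> (\<forall>q\<in>W. s q \<in> D q) \<longrightarrow> (\<forall>q. subspace (D q)) \<longrightarrow>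
    ext s \<in> sections B D) \<and>
  (\<forall>s. \<forall>q\<in>V. ext s q = s q)"
proof -
 obtain h V C where c: "open V" "p \<in> V" "V \<subseteq> W" "closed C" "C \<subseteq> W" "smooth B UNIV h"
  "\<forall>q\<in>V. h q = 1" "\<forall>q. q \<notin> C \<longrightarrow> h q = 0"
  using bump_function[OF assms(1,2)] by (elim exE conjE)
 define ext where "ext = (\<lambda>(s :: 'm => 'e) q. if q \<in> W then h q *\<^sub>R s q else 0)"
 have 1: "ext s \<in> sections B D"
  if s: "local_section B W s" "\<forall>q\<in>W. s q \<in> D q" "\<forall>q. subspace (D q)" for s D
 proof -
  have "local_section B UNIV (ext s)" unfolding ext_def
   by (rule local_section_extend_zero[OF assms(1) s(1) c(6,4,5)]) (use c(8) in auto)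
  moreover have "ext s q \<in> D q" for q
   using s(2) subspace_scale[OF s(3)[rule_format, of q]] subspace_0[OF s(3)[rule_format, of q]]
   by (simp add: ext_def)
  ultimately show ?thesis by (rule sectionsI)
 qed
 have 2: "ext s q = s q" if "q \<in> V" for s q
  using c(3,7) that by (auto simp: ext_def)
 show ?thesis
  by (rule exI[of _ V], rule exI[of _ ext]) (simp add: c(1-3) 1 2)
qed

text \<open>One step of a Gram-Schmidt process with parameters: the frame of A stays fixed and the
  frame of K is made dual to one more of its vectors. The last hypothesis, that the
  \<open>k j\<close> separate \<open>A p\<close>, guarantees a pivot and is carried through the
  step.\<close>

lemma dual_frame_step:
 assumes "open W" "p \<in> W" "m < r"
  and a: "\<And>i. i < r ==> local_section B W (a i)" "\<And>q. q \<in> W ==> basis_of r (\<lambda>i. a i q) (A q)"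
  and k: "\<And>j. j < r ==> local_section B W (k j)" "\<And>j q. j < r ==> q \<in> W ==> k j q \<in> K q"
  and orth: "\<And>i j q. i < m ==> j < r ==> q \<in> W ==> pair B q (a i q) (k j q) = (if i = j then 1 else 0)"
  and gen: "\<And>v. v \<in> A p ==> (\<And>j. j < r ==> pair B p v (k j p) = 0) ==> v = 0"
 obtains V k' where "open V" "p \<in> V" "V \<subseteq> W"
  "\<And>j. j < r ==> local_section B V (k' j)" "\<And>j q. j < r ==> q \<in> V ==> k' j q \<in> K q"
  "\<And>i j q. i < Suc m ==> j < r ==> q \<in> V ==> pair B q (a i q) (k' j q) = (if i = j then 1 else 0)"
  "\<And>v. v \<in> A p ==> (\<And>j. j < r ==> pair B p v (k' j p) = 0) ==> v = 0"
proof -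
 have aA: "i < r ==> q \<in> W ==> a i q \<in> A q" for i q using basis_ofD(2)[OF a(2)] by blast
 have aF: "i < r ==> q \<in> W ==> a i q \<in> fib B q" for i q using aA A_fib by blast
 have kF: "i < r ==> q \<in> W ==> k i q \<in> fib B q" for i q using k(2) K_fib by blast
 have "\<exists>s<r. s \<ge> m \<and> pair B p (a m p) (k s p) \<noteq> 0"
 proof (rule ccontr)
  assume "\<not> ?thesis"
  then have z: "pair B p (a m p) (k s p) = 0" if "s < r" "s \<ge> m" for s using that by blast
  \<comment> \<open>Coefficients of \<open>a m\<close> minus its part along the earlier vectors.
    Without a pivot this nonzero vector would pair to 0 with every \<open>k j\<close>.\<close>
  define c where "c = (\<lambda>i. if i = m then 1 else if i < m then - pair B p (a m p) (k i p) else 0)"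
  define v where "v = (\<Sum>i<r. c i *\<^sub>R a i p)"
  have "v \<in> A p" unfolding v_def using basis_ofD(5)[OF a(2)[OF assms(2)]] by blast
  moreover have "pair B p v (k j p) = 0" if j: "j < r" for j
  proof -
   have "pair B p v (k j p) = (\<Sum>i<r. c i * pair B p (a i p) (k j p))"
    unfolding v_def using aF kF j assms(2) by (intro pair_sum) auto
   also have "\<dots> = (\<Sum>i<r. (if i = m then pair B p (a m p) (k j p) else 0)
     + (if i = j then (if j < m then - pair B p (a m p) (k j p) else 0) else 0))"
    using orth[OF _ j assms(2)] by (intro sum.cong) (auto simp: c_def)
   also have "\<dots> = 0" using j assms(3) z by (simp add: sum.distrib)
   finally show ?thesis .
  qed
  ultimately have "v = 0" by (rule gen)
  then have "(\<Sum>i<r. c i *\<^sub>R a i p) = 0" by (simp add: v_def)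
  then have "c m = 0" using a(2)[OF assms(2)] assms(3) indep_familyD by (fastforce simp: basis_of_iff)
  then show False by (simp add: c_def)
 qed
 then obtain s where s: "s < r" "m \<le> s" "pair B p (a m p) (k s p) \<noteq> 0" by blast
 define u where "u = (\<lambda>q. pair B q (a m q) (k s q))"
 have su: "smooth B W u" unfolding u_def by (rule pair_smooth[OF assms(1) a(1)[OF assms(3)] k(1)[OF s(1)]])
 define V where "V = W \<inter> {q. q \<in> W \<and> u q \<noteq> 0}"
 have cu: "continuous_on W u"
 proof -
  have "continuous (at q within W) u" if q: "q \<in> W" for q
  proof -
   obtain U x where U: "(U, x) \<in> atlas B" "q \<in> U" using chart_cover by blast
   have oU: "open U" using coord_chart.open_U[OF chart[OF U(1)]] .
   have "continuous_on (U \<inter> W) u"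
    using coord_chart.ck_continuous[OF chart[OF U(1)] smooth_ck[OF su U(1), of 0]] .
   then have "continuous (at q) u"
    using continuous_on_eq_continuous_at[OF open_Int[OF oU assms(1)]] U(2) q by blast
   then show ?thesis by (rule continuous_at_imp_continuous_at_within)
  qed
  then show ?thesis by (simp add: continuous_on_eq_continuous_within)
 qed
 have "V = W \<inter> u -` (- {0})" by (auto simp: V_def)
 then have oV: "open V" using continuous_open_preimage[OF cu assms(1), of "- {0}"] by auto
 have pV: "p \<in> V" using assms(2) s(3) by (simp add: V_def u_def)
 have VW: "V \<subseteq> W" by (auto simp: V_def)
 have u0: "q \<in> V ==> u q \<noteq> 0" for q by (auto simp: V_def)
 \<comment> \<open>Exchanges the pivot s with m: the normalised \<open>k s\<close> takes place m and
   the old \<open>k m\<close> takes place s. As s \<ge> m, the pivot already pairs to 0 with the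
   earlier \<open>a i\<close>.\<close>
 define \<pi> where "\<pi> = (\<lambda>j. if j = s then m else j)"
 define km where "km = (\<lambda>q. inverse (u q) *\<^sub>R k s q)"
 define k' where "k' = (\<lambda>j q. if j = m then km q else
   k (\<pi> j) q + (- pair B q (a m q) (k (\<pi> j) q)) *\<^sub>R km q)"
 have pi: "j < r ==> \<pi> j < r" for j using assms(3) by (simp add: \<pi>_def)
 have lm: "local_section B V km" unfolding km_def
  by (intro local_section_scale smooth_inverse oV smooth_subset[OF su VW] u0 local_section_subset[OF k(1) VW] s)
 have kmK: "q \<in> V ==> km q \<in> K q" for q
  unfolding km_def using k(2)[OF s(1)] VW by (intro subspace_scale[OF K_subspace]) auto
 have lk: "local_section B V (k' j)" if j: "j < r" for j
 proof (cases "j = m")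
  case False
  have "local_section B V (\<lambda>q. k (\<pi> j) q + (- pair B q (a m q) (k (\<pi> j) q)) *\<^sub>R km q)"
   by (intro local_section_add local_section_scale oV lm smooth_uminus pair_smooth
     local_section_subset[OF k(1) VW] local_section_subset[OF a(1) VW] pi j assms(3))
  then show ?thesis using False by (simp add: k'_def)
 qed (simp add: k'_def lm)
 have kK: "k' j q \<in> K q" if j: "j < r" "q \<in> V" for j q
  using kmK[OF that(2)] k(2)[OF pi[OF j(1)], of q] VW j
  by (auto simp: k'_def intro!: subspace_diff[OF K_subspace] subspace_scale[OF K_subspace])
 have pk: "pair B q v (k' j q) = (if j = m then inverse (u q) * pair B q v (k s q) else
   pair B q v (k (\<pi> j) q) - pair B q (a m q) (k (\<pi> j) q) * (inverse (u q) * pair B q v (k s q)))"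
  if j: "j < r" "q \<in> V" "v \<in> fib B q" for j q v
 proof -
  have q: "q \<in> W" using j VW by auto
  have f: "k s q \<in> fib B q" "k (\<pi> j) q \<in> fib B q" "km q \<in> fib B q"
   using kF[OF s(1) q] kF[OF pi[OF j(1)] q] kmK[OF j(2)] K_fib by auto
  have 1: "pair B q v (km q) = inverse (u q) * pair B q v (k s q)"
   unfolding km_def pair_sym[OF j(3) subspace_scale[OF fib_subspace f(1)]]
   by (simp add: pair_scale f j pair_sym[OF j(3) f(1)])
  have 2: "pair B q v (k (\<pi> j) q + t *\<^sub>R km q) = pair B q v (k (\<pi> j) q) + t * pair B q v (km q)" for t
   unfolding pair_sym[OF j(3) subspace_add[OF fib_subspace f(2) subspace_scale[OF fib_subspace f(3)]]]
   using pair_lin[OF f(2,3) j(3), of 1 t] pair_sym[OF j(3) f(2)] pair_sym[OF j(3) f(3)] by simp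
  show ?thesis using 2[of "- pair B q (a m q) (k (\<pi> j) q)"] by (simp add: k'_def 1)
 qed
 show ?thesis
 proof (rule that[OF oV pV VW lk kK])
  fix i j q assume ij: "i < Suc m" "j < r" "q \<in> V"
  then have q: "q \<in> W" using VW by auto
  have ir: "i < r" using ij assms(3) by simp
  show "pair B q (a i q) (k' j q) = (if i = j then 1 else 0)"
  proof (cases "i = m")
   case True
   then show ?thesis unfolding pk[OF ij(2,3) aF[OF ir q]] using u0[OF ij(3)] True by (auto simp: u_def)
  next
   case False
   then have "i < m" using ij by simp
   then show ?thesis unfolding pk[OF ij(2,3) aF[OF ir q]]
    using orth[OF \<open>i < m\<close> s(1) q] orth[OF \<open>i < m\<close> pi[OF ij(2)] q] s(2) by (auto simp: \<pi>_def)
  qed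
 next
  fix v assume v: "v \<in> A p" "\<And>j. j < r ==> pair B p v (k' j p) = 0"
  have vf: "v \<in> fib B p" using A_fib v(1) .
  have z: "pair B p v (k s p) = 0" using v(2)[OF assms(3)] pk[OF assms(3) pV vf] u0[OF pV] by simp
  show "v = 0"
  proof (rule gen[OF v(1)])
   fix j assume j: "j < r"
   show "pair B p v (k j p) = 0"
   proof (cases "j = s")
    case False
    \<comment> \<open>The place at which the old \<open>k j\<close> is found after the
      exchange.\<close>
    have "\<pi> (if j = m then s else j) = j" "(if j = m then s else j) \<noteq> m" "(if j = m then s else j) < r"
     using False j s by (auto simp: \<pi>_def)
    then show ?thesis
     using v(2)[of "if j = m then s else j"] pk[OF _ pV vf, of "if j = m then s else j"] z by simp
   qed (simp add: z)
  qed
 qed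
qed

end

lemma has_pd_restrict:
 assumes "coord_chart n U x" "open V" "V \<subseteq> U" "p \<in> V" "i < n"
 shows "coord_chart.has_pd V x i f p D \<longleftrightarrow> coord_chart.has_pd U x i f p D"
proof -
 interpret coord_chart n U x by fact
 interpret V: coord_chart n V x by (rule coord_chart_restrict[OF assms(1-3)])
 have pU: "p \<in> U" using assms by blast
 have "eventually (\<lambda>t. f (V.cline p i t) = f (cline p i t)) (nhds (x p i))"
  using cline_eventually[OF assms(2,4) pU assms(5)]
 proof eventually_elim
  case (elim t)
  have "V.cline p i t = inv_into V x (x (cline p i t))" using elim by (simp add: V.cline_def)
  also have "\<dots> = cline p i t" by (rule V.inv_x) (use elim in blast)
  finally show ?case by simp
 qed
 then show ?thesis unfolding has_pd_def V.has_pd_def by (rule DERIV_cong_ev[OF refl _ refl])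
qed

lemma ck_restrict:
 assumes "coord_chart n U x" "open V" "V \<subseteq> U" "open W" "W \<subseteq> V"
 shows "coord_chart.ck n V x W k f \<longleftrightarrow> coord_chart.ck n U x W k f"
proof -
 interpret coord_chart n U x by fact
 interpret V: coord_chart n V x by (rule coord_chart_restrict[OF assms(1-3)])
 have WU: "W \<subseteq> U" using assms by blast
 have pd: "pd V x i g p = pd U x i g p" if "p \<in> W" "i < n" for p i g
  using pd_restrict[OF assms(1-3) _ that(2)] that(1) assms(5) by blast
 have pdf: "V.pdiff i g p \<longleftrightarrow> pdiff i g p" if "p \<in> W" "i < n" for p i g
 proof
  have pV: "p \<in> V" using that assms(5) by blast
  show "pdiff i g p" if "V.pdiff i g p"
   using V.has_pd_pd[OF that] has_pd_restrict[OF assms(1-3) pV \<open>i < n\<close>] has_pd_imp(2) by blast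
  show "V.pdiff i g p" if "pdiff i g p"
   using has_pd_pd[OF that] has_pd_restrict[OF assms(1-3) pV \<open>i < n\<close>] V.has_pd_imp(2) by blast
 qed
 show ?thesis
 proof (induction k arbitrary: f)
  case (Suc k)
  have "V.ck W k (pd V x i f) \<longleftrightarrow> ck W k (pd U x i f)" if i: "i < n" for i
   using V.ck_cong[OF assms(4,5), of "pd V x i f" "pd U x i f" k]
    V.ck_cong[OF assms(4,5), of "pd U x i f" "pd V x i f" k] pd[OF _ i] Suc.IH by metis
  then show ?case using pdf by auto
 qed simp
qed

text \<open>Numbering both frames like the odd variables makes the pairing of \<open>fr c s\<close>
  with \<open>fr c t\<close> equal to 1 exactly for \<open>t = dual s\<close>. Sums over A and K
  then become one sum over s < 2 r.\<close>

definition fr :: "('m, 'e) achart => nat => 'm => 'e" where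
 "fr c s = (if even s then frK c (s div 2) else frA c (s div 2))"

context split_bundle begin

lemma adapted_chart_ex: "\<exists>c\<in>acharts B A K. p \<in> cdom c"
proof -
 obtain k where k: "\<forall>p. \<exists>W s. open W \<and> p \<in> W \<and> (\<forall>i<k. local_section B W (s i)) \<and>
    (\<forall>q\<in>W. basis_of k (\<lambda>i. s i q) (A q))"
  using subA unfolding subbundle_def by (elim exE)
 obtain W1 a where a: "open W1" "p \<in> W1" "\<forall>i<k. local_section B W1 (a i)"
    "\<forall>q\<in>W1. basis_of k (\<lambda>i. a i q) (A q)"
  using k[THEN spec, of p] by (elim exE conjE)
 obtain l where l: "\<forall>p. \<exists>W s. open W \<and> p \<in> W \<and> (\<forall>i<l. local_section B W (s i)) \<and>
    (\<forall>q\<in>W. basis_of l (\<lambda>i. s i q) (K q))"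
  using subK unfolding subbundle_def by (elim exE)
 obtain W2 b where b: "open W2" "p \<in> W2" "\<forall>i<l. local_section B W2 (b i)"
    "\<forall>q\<in>W2. basis_of l (\<lambda>i. b i q) (K q)"
  using l[THEN spec, of p] by (elim exE conjE)
 have kl: "k = r" "l = r"
  using rank_eq[OF a(4)[rule_format, OF a(2)] b(4)[rule_format, OF b(2)]] by auto
 obtain U x where U: "(U, x) \<in> atlas B" "p \<in> U" using chart_cover by blast
 have oU: "open U" using coord_chart.open_U[OF chart[OF U(1)]] .
 define W where "W = W1 \<inter> W2 \<inter> U"
 have W: "open W" "p \<in> W" using a b U oU by (auto simp: W_def)
 have sub: "W \<subseteq> W1" "W \<subseteq> W2" by (auto simp: W_def)
 have aW: "i < r ==> local_section B W (a i)" for i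
  using a(3) kl local_section_subset[OF _ sub(1)] by blast
 have bW: "i < r ==> local_section B W (b i)" for i
  using b(3) kl local_section_subset[OF _ sub(2)] by blast
 have aB: "q \<in> W ==> basis_of r (\<lambda>i. a i q) (A q)" for q using a(4) kl sub by blast
 have bB: "q \<in> W ==> basis_of r (\<lambda>i. b i q) (K q)" for q using b(4) kl sub by blast
 \<comment> \<open>Induction over the number m of vectors of the A-frame that already have their
   dual partner; the neighbourhood may shrink at each step.\<close>
 have "\<exists>V k. open V \<and> p \<in> V \<and> V \<subseteq> W \<and> (\<forall>j<r. local_section B V (k j) \<and> (\<forall>q\<in>V. k j q \<in> K q)) \<and>
  (\<forall>i<m. \<forall>j<r. \<forall>q\<in>V. pair B q (a i q) (k j q) = (if i = j then 1 else 0)) \<and>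
  (\<forall>v. v \<in> A p \<longrightarrow> (\<forall>j<r. pair B p v (k j p) = 0) \<longrightarrow> v = 0)" if "m \<le> r" for m
  using that
 proof (induction m)
  case 0
  have "v = 0" if v: "v \<in> A p" "\<forall>j<r. pair B p v (b j p) = 0" for v
  proof (rule nondeg_A[OF v(1)])
   fix w assume "w \<in> K p"
   then obtain c where c: "w = (\<Sum>i<r. c i *\<^sub>R b i p)" using basis_ofD(3)[OF bB[OF W(2)]] by blast
   have "pair B p v w = (\<Sum>i<r. c i * pair B p v (b i p))" unfolding c
    using basis_ofD(2)[OF bB[OF W(2)]] K_fib A_fib v(1) by (intro pair_sum_right) auto
   then show "pair B p v w = 0" using v(2) by simp
  qed
  then show ?case using W bW basis_ofD(2)[OF bB] by (intro exI[of _ W], intro exI[of _ b]) simp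
 next
  case (Suc m)
  then have "m \<le> r" by simp
  from Suc.IH[OF this] obtain V k where V: "open V" "p \<in> V" "V \<subseteq> W"
   "\<forall>j<r. local_section B V (k j) \<and> (\<forall>q\<in>V. k j q \<in> K q)"
   "\<forall>i<m. \<forall>j<r. \<forall>q\<in>V. pair B q (a i q) (k j q) = (if i = j then 1 else 0)"
   "\<forall>v. v \<in> A p \<longrightarrow> (\<forall>j<r. pair B p v (k j p) = 0) \<longrightarrow> v = 0"
   by (elim exE conjE)
  have m: "m < r" using Suc.prems by simp
  show ?case
  proof (rule dual_frame_step[OF V(1,2) m, of a k])
   fix V' k' assume V': "open V'" "p \<in> V'" "V' \<subseteq> V"
    "\<And>j. j < r ==> local_section B V' (k' j)" "\<And>j q. j < r ==> q \<in> V' ==> k' j q \<in> K q"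
    "\<And>i j q. i < Suc m ==> j < r ==> q \<in> V' ==> pair B q (a i q) (k' j q) = (if i = j then 1 else 0)"
    "\<And>v. v \<in> A p ==> (\<And>j. j < r ==> pair B p v (k' j p) = 0) ==> v = 0"
   show ?case
    by (rule exI[of _ V'], rule exI[of _ k'])
      (use V'(1,2) order_trans[OF V'(3) V(3)] V'(4-7) in \<open>simp del: less_Suc_eq\<close>)
  next
   show "local_section B V (a i)" if "i < r" for i using local_section_subset[OF aW[OF that] V(3)] .
   show "basis_of r (\<lambda>i. a i q) (A q)" if "q \<in> V" for q using aB V(3) that by blast
  qed (use V(4-6) in \<open>simp_all\<close>)
 qed
 from this[OF order_refl] obtain V k where V: "open V" "p \<in> V" "V \<subseteq> W"
   "\<forall>j<r. local_section B V (k j) \<and> (\<forall>q\<in>V. k j q \<in> K q)"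
   "\<forall>i<r. \<forall>j<r. \<forall>q\<in>V. pair B q (a i q) (k j q) = (if i = j then 1 else 0)"
  by (elim exE conjE)
 \<comment> \<open>Duality alone makes the new sections a basis: subtracting from v its expansion
   with coefficients \<open>pair B q (a i q) v\<close> leaves a vector of K that pairs to 0 with
   A.\<close>
 have kB: "basis_of r (\<lambda>j. k j q) (K q)" if q: "q \<in> V" for q
 proof -
  have kK: "j < r ==> k j q \<in> K q" for j using V(4) q by blast
  have aA: "j < r ==> a j q \<in> A q" for j using basis_ofD(2)[OF aB] q V(3) by blast
  have pk: "pair B q (a i q) (\<Sum>j<r. c j *\<^sub>R k j q) = c i" if i: "i < r" for c i
  proof -
   have "pair B q (a i q) (\<Sum>j<r. c j *\<^sub>R k j q) = (\<Sum>j<r. c j * pair B q (a i q) (k j q))"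
    using kK aA K_fib A_fib i by (intro pair_sum_right) auto
   also have "\<dots> = (\<Sum>j<r. if i = j then c j else 0)"
    using V(5) i q by (intro sum.cong) auto
   finally show ?thesis using i by simp
  qed
  show ?thesis unfolding basis_of_iff
  proof (intro conjI)
   show "indep_family r (\<lambda>j. k j q)" unfolding indep_family_def
   proof (intro allI impI)
    fix c i assume "(\<Sum>j<r. c j *\<^sub>R k j q) = 0" "i < r"
    then show "c i = 0" using pk[of i c] pair_zero[of "a i q" q] pair_sym[of "a i q" q 0] A_fib aA
     subspace_0[OF fib_subspace] by metis
   qed
   have cK: "(\<Sum>i<r. c i *\<^sub>R k i q) \<in> K q" for c
    by (intro subspace_sum[OF K_subspace] subspace_scale[OF K_subspace] kK) simp
   have "\<exists>c. v = (\<Sum>i<r. c i *\<^sub>R k i q)" if v: "v \<in> K q" for v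
   proof -
    define c where "c = (\<lambda>i. pair B q (a i q) v)"
    let ?u = "\<Sum>i<r. c i *\<^sub>R k i q"
    have "v - ?u = 0"
    proof (rule nondeg_K)
     show vu: "v - ?u \<in> K q" using v cK by (intro subspace_diff[OF K_subspace])
     fix w assume "w \<in> A q"
     then obtain d where d: "w = (\<Sum>i<r. d i *\<^sub>R a i q)"
      using basis_ofD(3)[OF aB] q V(3) by blast
     have "pair B q (v - ?u) w = (\<Sum>i<r. d i * pair B q (v - ?u) (a i q))" unfolding d
      using aA A_fib K_fib[OF vu] by (intro pair_sum_right) auto
     also have "\<dots> = 0"
     proof (intro sum.neutral ballI)
      fix i assume i: "i \<in> {..<r}"
      then have ai: "a i q \<in> fib B q" using aA A_fib by auto
      have "pair B q (v - ?u) (a i q) = pair B q v (a i q) - pair B q ?u (a i q)"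
       using ai K_fib v cK by (intro pair_diff) auto
      also have "\<dots> = 0"
       using pk[of i c] i pair_sym[OF ai K_fib[OF cK]] pair_sym[OF ai K_fib[OF v]] by (simp add: c_def)
      finally show "d i * pair B q (v - ?u) (a i q) = 0" by simp
     qed
     finally show "pair B q (v - ?u) w = 0" .
    qed
    then show ?thesis by auto
   qed
   then show "K q = {\<Sum>i<r. c i *\<^sub>R k i q | c. True}" using cK by auto
  qed
 qed
 define c where "c = \<lparr>cdom = V, coord = x, frA = a, frK = k\<rparr>"
 have "\<exists>U. (U, coord c) \<in> atlas B \<and> cdom c \<subseteq> U"
  using U(1) V(3) by (intro exI[of _ U]) (auto simp: c_def W_def)
 moreover have "\<forall>i<r. local_section B V (a i)" using local_section_subset[OF aW V(3)] by blast
 ultimately have "c \<in> acharts B A K"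
  unfolding acharts_def using V aB kB by (simp add: c_def) blast
 then show ?thesis using V(2) by (intro bexI[of _ c]) (simp_all add: c_def)
qed

end

section \<open>Calculus in one adapted chart\<close>

locale adapted_chart = split_bundle B A K
 for B :: "('m::{t2_space,second_countable_topology}, 'e::real_vector) qbundle"
  and A K :: "'m => 'e set" +
 fixes c :: "('m, 'e) achart"
 assumes c: "c \<in> acharts B A K"
begin

abbreviation Oc where "Oc \<equiv> cdom c"
abbreviation nn where "nn \<equiv> bdim B"

lemma cdata: "open Oc" "\<exists>U. (U, coord c) \<in> atlas B \<and> Oc \<subseteq> U"
 "a < r ==> local_section B Oc (frA c a)" "a < r ==> local_section B Oc (frK c a)"
 "p \<in> Oc ==> basis_of r (\<lambda>a. frA c a p) (A p)" "p \<in> Oc ==> basis_of r (\<lambda>a. frK c a p) (K p)"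
 "p \<in> Oc ==> a < r ==> b < r ==> pair B p (frA c a p) (frK c b p) = (if a = b then 1 else 0)"
 using c unfolding acharts_def mem_Collect_eq by simp_all

sublocale C: coord_chart nn Oc "coord c"
proof -
 obtain U where "(U, coord c) \<in> atlas B" "Oc \<subseteq> U" using cdata(2) by blast
 then show "coord_chart nn Oc (coord c)" using coord_chart_restrict[OF chart cdata(1)] by blast
qed

lemma smooth_ckC:
 assumes "smooth B W f" "open W" "W \<subseteq> Oc"
 shows "C.ck W k f"
proof -
 obtain U where U: "(U, coord c) \<in> atlas B" "Oc \<subseteq> U" using cdata(2) by blast
 show ?thesis
  using ck_restrict[OF chart[OF U(1)] cdata(1) U(2) assms(2,3)] smooth_ckD[OF assms(1) U(1)] U(2) assms(3)
  by blast
qed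

lemma smooth_ckCI:
 assumes "\<And>k. C.ck W k f" "open W" "W \<subseteq> Oc"
 shows "smooth B W f"
proof -
 obtain U where U: "(U, coord c) \<in> atlas B" "Oc \<subseteq> U" using cdata(2) by blast
 show ?thesis
  using ck_restrict[OF chart[OF U(1)] cdata(1) U(2) assms(2,3)] smooth_chartI[OF U(1) assms(2)] U(2) assms
  by blast
qed

lemma smooth_ldx: "smooth B W f ==> open W ==> W \<subseteq> Oc ==> i < nn ==> smooth B W (ldx c i f)"
 by (rule smooth_ckCI) (auto intro: C.ck_pd[OF smooth_ckC])

lemma smooth_pdiffC:
 assumes "smooth B W f" "open W" "p \<in> W" "p \<in> Oc" "i < nn"
 shows "C.pdiff i f p"
proof -
 have "smooth B (W \<inter> Oc) f" by (rule smooth_subset[OF assms(1)]) simp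
 then have "C.ck (W \<inter> Oc) (Suc 0) f" using cdata(1) assms(2) by (intro smooth_ckC) auto
 then show ?thesis using C.ck_pdiff assms by blast
qed

lemma ldx_add: "p \<in> Oc ==> C.pdiff i f p ==> C.pdiff i g p ==>
  ldx c i (\<lambda>q. f q + g q) p = ldx c i f p + ldx c i g p"
 by (rule C.has_pd_imp(1), rule C.has_pd_add) (rule C.has_pd_pd; assumption)+

lemma ldx_mult: "p \<in> Oc ==> C.pdiff i f p ==> C.pdiff i g p ==>
  ldx c i (\<lambda>q. f q * g q) p = ldx c i f p * g p + f p * ldx c i g p"
 by (rule C.has_pd_imp(1), rule C.has_pd_mult) (assumption | rule C.has_pd_pd)+

lemma pdiff_add: "C.pdiff i f p ==> C.pdiff i g p ==> C.pdiff i (\<lambda>q. f q + g q) p"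
 by (rule C.has_pd_imp(2), rule C.has_pd_add) (rule C.has_pd_pd; assumption)+

lemma pdiff_mult: "p \<in> Oc ==> C.pdiff i f p ==> C.pdiff i g p ==> C.pdiff i (\<lambda>q. f q * g q) p"
 by (rule C.has_pd_imp(2), rule C.has_pd_mult) (assumption | rule C.has_pd_pd)+

lemma ldx_const: "ldx c i (\<lambda>_. k) p = 0" and pdiff_const: "C.pdiff i (\<lambda>_. k) p"
 using C.has_pd_imp[OF C.has_pd_const] by auto

lemma ldx_cmult: "p \<in> Oc ==> C.pdiff i f p ==> ldx c i (\<lambda>q. k * f q) p = k * ldx c i f p"
 by (simp add: ldx_mult pdiff_const ldx_const)

lemma ldx_uminus: "p \<in> Oc ==> C.pdiff i f p ==> ldx c i (\<lambda>q. - f q) p = - ldx c i f p"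
 using ldx_cmult[of p i f "-1"] by simp

lemma pdiff_sum: "(\<And>j. j \<in> J ==> C.pdiff i (f j) p) ==> C.pdiff i (\<lambda>q. \<Sum>j\<in>J. f j q) p"
 by (induction J rule: infinite_finite_induct) (auto intro: pdiff_add pdiff_const)

lemma ldx_sum: "p \<in> Oc ==> (\<And>j. j \<in> J ==> C.pdiff i (f j) p) ==>
  ldx c i (\<lambda>q. \<Sum>j\<in>J. f j q) p = (\<Sum>j\<in>J. ldx c i (f j) p)"
 by (induction J rule: infinite_finite_induct) (auto simp: ldx_const ldx_add pdiff_sum)

lemma ldx_cong:
 assumes "open W" "p \<in> W" "p \<in> Oc" "i < nn" "\<And>q. q \<in> W ==> q \<in> Oc ==> f q = g q"
 shows "ldx c i f p = ldx c i g p"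
 by (rule C.pd_cong(1)[OF assms(1-4)]) (use assms(5) in auto)

lemma ldx_coord: "p \<in> Oc ==> i < nn ==> ldx c i (\<lambda>q. coord c q j) p = (if i = j then 1 else 0)"
 by (rule C.has_pd_imp(1)[OF C.has_pd_coord])

lemma smooth_coordC: "smooth B Oc (\<lambda>q. coord c q i)"
proof -
 obtain U where U: "(U, coord c) \<in> atlas B" "Oc \<subseteq> U" using cdata(2) by blast
 show ?thesis by (rule smooth_subset[OF smooth_coord[OF U(1)] U(2)])
qed

lemma fr_A: "p \<in> Oc ==> s < 2 * r ==> odd s ==> fr c s p \<in> A p"
 using basis_ofD(2)[OF cdata(5), of p "s div 2"] by (simp add: fr_def)

lemma fr_K: "p \<in> Oc ==> s < 2 * r ==> even s ==> fr c s p \<in> K p"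
 using basis_ofD(2)[OF cdata(6), of p "s div 2"] by (simp add: fr_def)

lemma fr_fib: "p \<in> Oc ==> s < 2 * r ==> fr c s p \<in> fib B p"
 using fr_A fr_K A_fib K_fib by blast

lemma fr_section: "s < 2 * r ==> local_section B Oc (fr c s)"
 using cdata(3,4)[of "s div 2"] by (simp add: fr_def)

lemma fr_pair:
 assumes "p \<in> Oc" "s < 2 * r" "t < 2 * r"
 shows "pair B p (fr c s p) (fr c t p) = (if t = dual s then 1 else 0)"
proof (cases "even s"; cases "even t")
 assume "even s" "even t"
 then show ?thesis using K_iso[OF fr_K fr_K] assms by (auto simp: dual_def)
next
 assume e: "odd s" "odd t"
 then have "t \<noteq> dual s" by (auto simp: dual_def)
 then show ?thesis using A_iso[OF fr_A fr_A] assms e by simp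
next
 assume e: "odd s" "even t"
 have "t = dual s \<longleftrightarrow> s div 2 = t div 2" using e unfolding dual_def by simp presburger
 then show ?thesis using cdata(7)[OF assms(1), of "s div 2" "t div 2"] assms e by (simp add: fr_def)
next
 assume e: "even s" "odd t"
 have "t = dual s \<longleftrightarrow> t div 2 = s div 2" using e unfolding dual_def by simp presburger
 then show ?thesis using cdata(7)[OF assms(1), of "t div 2" "s div 2"] assms e
  pair_sym[OF fr_fib fr_fib, of p s t] by (simp add: fr_def)
qed

lemma fr_pair_sum:
 assumes "p \<in> Oc" "t < 2 * r"
 shows "pair B p (\<Sum>s<2 * r. k s *\<^sub>R fr c s p) (fr c t p) = k (dual t)"
proof -
 have "pair B p (\<Sum>s<2 * r. k s *\<^sub>R fr c s p) (fr c t p) = (\<Sum>s<2 * r. k s * pair B p (fr c s p) (fr c t p))"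
  by (rule pair_sum) (use fr_fib assms in auto)
 also have "\<dots> = (\<Sum>s<2 * r. if s = dual t then k s else 0)"
  by (rule sum.cong) (auto simp: fr_pair assms)
 finally show ?thesis using assms by simp
qed

lemma fr_sum_fib: "p \<in> Oc ==> (\<Sum>s<2 * r. k s *\<^sub>R fr c s p) \<in> fib B p"
 by (intro subspace_sum[OF fib_subspace] subspace_scale[OF fib_subspace] fr_fib) auto

lemma fr_zero_test:
 assumes "p \<in> Oc" "v \<in> fib B p" "\<And>s. s < 2 * r ==> pair B p v (fr c s p) = 0"
 shows "v = 0"
proof (rule nondeg[OF assms(2)])
 fix w assume w: "w \<in> fib B p"
 obtain a k where ak: "w = a + k" "a \<in> A p" "k \<in> K p" using fib_split[OF w] by blast
 obtain d where d: "a = (\<Sum>i<r. d i *\<^sub>R frA c i p)" using basis_ofD(3)[OF cdata(5)[OF assms(1)] ak(2)] by blast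
 obtain e where e: "k = (\<Sum>i<r. e i *\<^sub>R frK c i p)" using basis_ofD(3)[OF cdata(6)[OF assms(1)] ak(3)] by blast
 have fA: "frA c i p = fr c (th i) p" "frK c i p = fr c (xi i) p" for i by (simp_all add: fr_def th_def xi_def)
 have l: "th i < 2 * r" "xi i < 2 * r" if "i < r" for i using that by (auto simp: th_def xi_def)
 have "pair B p v a = (\<Sum>i<r. d i * pair B p v (frA c i p))" unfolding d
  by (rule pair_sum_right) (use fr_fib[OF assms(1)] l assms(2) in \<open>auto simp: fA\<close>)
 also have "\<dots> = 0" using assms(3) l by (simp add: fA)
 finally have 1: "pair B p v a = 0" .
 have "pair B p v k = (\<Sum>i<r. e i * pair B p v (frK c i p))" unfolding e
  by (rule pair_sum_right) (use fr_fib[OF assms(1)] l assms(2) in \<open>auto simp: fA\<close>)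
 also have "\<dots> = 0" using assms(3) l by (simp add: fA)
 finally have 2: "pair B p v k = 0" .
 have "pair B p v w = pair B p w v" using pair_sym w assms(2) by blast
 also have "\<dots> = pair B p a v + pair B p k v" unfolding ak(1)
  by (intro pair_add A_fib K_fib ak assms(2))
 also have "\<dots> = 0" using 1 2 pair_sym[OF A_fib[OF ak(2)] assms(2)] pair_sym[OF K_fib[OF ak(3)] assms(2)] by simp
 finally show "pair B p v w = 0" .
qed

lemma fr_expand:
 assumes "p \<in> Oc" "v \<in> fib B p"
 shows "v = (\<Sum>s<2 * r. pair B p v (fr c (dual s) p) *\<^sub>R fr c s p)"
proof -
 let ?u = "\<Sum>s<2 * r. pair B p v (fr c (dual s) p) *\<^sub>R fr c s p"
 have "v - ?u = 0"
 proof (rule fr_zero_test[OF assms(1)])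
  show "v - ?u \<in> fib B p" using assms fr_sum_fib by (intro subspace_diff[OF fib_subspace])
  fix t assume t: "t < 2 * r"
  have "pair B p (v - ?u) (fr c t p) = pair B p v (fr c t p) - pair B p ?u (fr c t p)"
   using assms fr_sum_fib fr_fib t by (intro pair_diff) auto
  then show "pair B p (v - ?u) (fr c t p) = 0"
   by (simp add: fr_pair_sum[OF assms(1) t])
 qed
 then show ?thesis by simp
qed

lemma pair_expand:
 assumes "p \<in> Oc" "v \<in> fib B p" "w \<in> fib B p"
 shows "pair B p v w = (\<Sum>s<2 * r. pair B p v (fr c (dual s) p) * pair B p w (fr c s p))"
proof -
 have "pair B p v w = pair B p (\<Sum>s<2 * r. pair B p v (fr c (dual s) p) *\<^sub>R fr c s p) w"
  using fr_expand[OF assms(1,2)] by simp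
 also have "\<dots> = (\<Sum>s<2 * r. pair B p v (fr c (dual s) p) * pair B p (fr c s p) w)"
  by (rule pair_sum) (use fr_fib assms in auto)
 also have "\<dots> = (\<Sum>s<2 * r. pair B p v (fr c (dual s) p) * pair B p w (fr c s p))"
  by (rule sum.cong) (use pair_sym fr_fib assms in auto)
 finally show ?thesis .
qed

lemma comp_smooth: "open W ==> W \<subseteq> Oc ==> local_section B W e ==> s < 2 * r ==>
  smooth B W (\<lambda>q. pair B q (e q) (fr c s q))"
 by (rule pair_smooth[OF _ _ local_section_subset[OF fr_section]])

lemma fr_combination_section:
 assumes "open W" "W \<subseteq> Oc" "\<And>s. s < 2 * r ==> smooth B W (g s)"
 shows "local_section B W (\<lambda>q. \<Sum>s<2 * r. g s q *\<^sub>R fr c s q)"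
 by (intro local_section_sum[OF assms(1)] local_section_scale[OF assms(1) assms(3)]
   local_section_subset[OF fr_section assms(2)]) auto

end

context split_bundle begin

lemma ldx_chain:
 assumes "c \<in> acharts B A K" "c' \<in> acharts B A K" "p \<in> cdom c" "p \<in> cdom c'"
  and "open W" "p \<in> W" "smooth B W f" "j < bdim B"
 shows "ldx c' j f p = (\<Sum>i<bdim B. ldx c' j (\<lambda>q. coord c q i) p * ldx c i f p)"
proof -
 interpret c: adapted_chart B A K c using assms(1) by unfold_locales
 interpret c': adapted_chart B A K c' using assms(2) by unfold_locales
 let ?W = "W \<inter> (cdom c \<inter> cdom c')"
 have W: "open ?W" "p \<in> ?W" "?W \<subseteq> cdom c \<inter> cdom c'" using assms c.cdata(1) c'.cdata(1) by auto
 have "c.C.ck ?W (Suc 0) f"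
  by (rule c.smooth_ckC[OF smooth_subset[OF assms(7)] W(1)]) (use W in auto)
 from chart_change_pd[OF c.C.coord_chart_axioms c'.C.coord_chart_axioms W(1,2,3) assms(8) this]
 have "c'.C.has_pd j f p (\<Sum>i<bdim B. ldx c' j (\<lambda>q. coord c q i) p * ldx c i f p)"
  using c'.smooth_pdiffC[OF c.smooth_coordC c.cdata(1) assms(3,4,8)] by blast
 then show ?thesis by (rule c'.C.has_pd_imp(1))
qed

end

section \<open>Coefficients of local functions\<close>

definition ev :: "'m lfun => 'm => real" where
 "ev F = F ({#}, {})"

text \<open>The parity automorphism, which collects the sign of moving an odd variable past a
  factor. It is 0 on infinite S, where products vanish too because the power set is
  infinite.\<close>

definition par :: "'m lfun => 'm lfun" where
 "par F = (\<lambda>(m, S) p. if finite S then (-1) ^ card S * F (m, S) p else 0)"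

definition ldxf :: "('m, 'e) achart => nat => 'm lfun => 'm lfun" where
 "ldxf c i F = (\<lambda>mS. ldx c i (F mS))"

definition inversions :: "nat set => nat set => nat" where
 "inversions T R = card {(s, t). s \<in> T \<and> t \<in> R \<and> t < s}"

definition above :: "nat => nat set => nat" where
 "above s S = card {t\<in>S. s < t}"

definition below :: "nat => nat set => nat" where
 "below s S = card {t\<in>S. t < s}"

lemma ldr_alt: "ldr s F (m, S) p = (if s \<in> S then 0 else (-1) ^ above s S * F (m, insert s S) p)"
 by (simp add: ldr_def above_def)

lemma inversions_insert_left:
 assumes "finite T" "finite R" "s \<notin> T"
 shows "inversions (insert s T) R = inversions T R + below s R"
proof -
 have "{(a, t). a \<in> insert s T \<and> t \<in> R \<and> t < a} =
  {(a, t). a \<in> T \<and> t \<in> R \<and> t < a} \<union> Pair s ` {t\<in>R. t < s}" by auto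
 moreover have "{(a, t). a \<in> T \<and> t \<in> R \<and> t < a} \<inter> Pair s ` {t\<in>R. t < s} = {}" using assms(3) by auto
 moreover have "finite {(a, t). a \<in> T \<and> t \<in> R \<and> t < a}"
  by (rule finite_subset[of _ "T \<times> R"]) (use assms in auto)
 moreover have "card (Pair s ` {t\<in>R. t < s}) = card {t\<in>R. t < s}" by (intro card_image inj_onI) simp
 ultimately show ?thesis unfolding inversions_def below_def using assms(2) by (simp add: card_Un_disjoint)
qed

lemma inversions_insert_right:
 assumes "finite T" "finite R" "s \<notin> R"
 shows "inversions T (insert s R) = inversions T R + above s T"
proof -
 have "{(a, t). a \<in> T \<and> t \<in> insert s R \<and> t < a} =
  {(a, t). a \<in> T \<and> t \<in> R \<and> t < a} \<union> (\<lambda>t. (t, s)) ` {t\<in>T. s < t}" by auto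
 moreover have "{(a, t). a \<in> T \<and> t \<in> R \<and> t < a} \<inter> (\<lambda>t. (t, s)) ` {t\<in>T. s < t} = {}" using assms(3) by auto
 moreover have "finite {(a, t). a \<in> T \<and> t \<in> R \<and> t < a}"
  by (rule finite_subset[of _ "T \<times> R"]) (use assms in auto)
 moreover have "card ((\<lambda>t. (t, s)) ` {t\<in>T. s < t}) = card {t\<in>T. s < t}" by (intro card_image inj_onI) simp
 ultimately show ?thesis unfolding inversions_def above_def using assms(1) by (simp add: card_Un_disjoint)
qed

lemma lmul_eq: "lmul F G (m, S) p = (\<Sum>m'\<in>{m'. m' \<subseteq># m}. \<Sum>T\<in>Pow S.
   (-1) ^ inversions T (S - T) * F (m', T) p * G (m - m', S - T) p)"
 by (simp add: lmul_def inversions_def)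

lemma card_lt_gt:
 fixes R :: "nat set"
 assumes "finite R" "s \<notin> R"
 shows "below s R + above s R = card R"
proof -
 have "card R = card ({t\<in>R. t < s} \<union> {t\<in>R. s < t})"
  by (rule arg_cong[where f = card]) (use assms(2) in \<open>auto simp: not_less_iff_gr_or_eq\<close>)
 then show ?thesis using assms(1) by (simp add: card_Un_disjoint disjoint_iff below_def above_def)
qed

lemma card_split_gt:
 fixes S :: "nat set"
 assumes "finite S" "T \<subseteq> S"
 shows "above s S = above s T + above s (S - T)"
proof -
 have eq: "{t\<in>S. s < t} = {t\<in>T. s < t} \<union> {t\<in>S - T. s < t}" using assms(2) by auto
 show ?thesis unfolding above_def eq
  by (rule card_Un_disjoint) (use assms finite_subset[OF assms(2,1)] in auto)
qed

lemma sum_Pow_insert: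
 fixes f :: "nat set => real"
 assumes "finite S" "s \<notin> S"
 shows "(\<Sum>T\<in>Pow (insert s S). f T) = (\<Sum>T\<in>Pow S. f T + f (insert s T))"
proof -
 have "(\<Sum>T\<in>Pow (insert s S). f T) = (\<Sum>T\<in>Pow S. f T) + (\<Sum>T\<in>insert s ` Pow S. f T)"
  unfolding Pow_insert by (rule sum.union_disjoint) (use assms in auto)
 also have "(\<Sum>T\<in>insert s ` Pow S. f T) = (\<Sum>T\<in>Pow S. f (insert s T))"
  by (subst sum.reindex) (use assms in \<open>auto simp: inj_on_def\<close>)
 finally show ?thesis by (simp add: sum.distrib)
qed

text \<open>A right derivative meets the last factor first. To reach F the variable has to pass G,
  which produces the parity of G.\<close>

lemma ldr_lmul: "ldr s (lmul F G) = lmul F (ldr s G) + lmul (ldr s F) (par G)"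
proof (intro ext, clarify)
 fix m :: "nat multiset" and S :: "nat set" and p
 let ?M = "{m'. m' \<subseteq># m}"
 show "ldr s (lmul F G) (m, S) p = (lmul F (ldr s G) + lmul (ldr s F) (par G)) (m, S) p"
 proof (cases "finite S")
  case False
  then have "infinite (Pow S)" "infinite (Pow (insert s S))" by (auto simp: finite_Pow_iff)
  then show ?thesis by (auto simp: ldr_def lmul_eq)
 next
  case fin: True
  show ?thesis
  proof (cases "s \<in> S")
   case True
   define Q where "Q = S - {s}"
   have Q: "finite Q" "s \<notin> Q" "S = insert s Q" using fin True by (auto simp: Q_def)
   \<comment> \<open>If s occurs in S, the left side is 0. On the right, T without s and
     \<open>insert s T\<close> give the same product of coefficients with opposite signs.\<close>
   let ?f = "\<lambda>m' T. (-1) ^ inversions T (S - T) * F (m', T) p * ldr s G (m - m', S - T) p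
     + (-1) ^ inversions T (S - T) * ldr s F (m', T) p * par G (m - m', S - T) p"
   have 1: "?f m' T + ?f m' (insert s T) = 0" if T: "T \<in> Pow Q" for m' T
   proof -
    have fT: "finite T" "s \<notin> T" "finite (Q - T)" "s \<notin> Q - T"
     using T Q finite_subset by auto
    have d: "S - T = insert s (Q - T)" "S - insert s T = Q - T" using T Q by auto
    have i1: "inversions T (insert s (Q - T)) = inversions T (Q - T) + above s T"
     by (rule inversions_insert_right) (use fT in auto)
    have i2: "inversions (insert s T) (Q - T) = inversions T (Q - T) + below s (Q - T)"
     by (rule inversions_insert_left) (use fT in auto)
    have i3: "below s (Q - T) + above s (Q - T) = card (Q - T)"
     by (rule card_lt_gt) (use fT in auto)
    have i4: "card (insert s (Q - T)) = Suc (card (Q - T))" using fT by simp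
    have e1: "(-1 :: real) ^ inversions (insert s T) (Q - T) * (-1) ^ above s (Q - T)
      = (-1) ^ inversions T (Q - T) * (-1) ^ card (Q - T)"
     unfolding i2 i3[symmetric] power_add by (simp add: algebra_simps)
    have e2: "(-1 :: real) ^ inversions T (insert s (Q - T)) * (-1) ^ above s T = (-1) ^ inversions T (Q - T)"
     unfolding i1 by (simp add: power_add mult.assoc flip: power_mult_distrib)
    have "?f m' T + ?f m' (insert s T) = ((-1) ^ inversions T (insert s (Q - T)) * (-1) ^ above s T)
       * F (m', insert s T) p * ((-1) ^ Suc (card (Q - T)) * G (m - m', insert s (Q - T)) p)
      + ((-1) ^ inversions (insert s T) (Q - T) * (-1) ^ above s (Q - T))
       * F (m', insert s T) p * G (m - m', insert s (Q - T)) p"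
     using fT by (simp add: d i4 ldr_alt par_def del: power_Suc)
    also have "\<dots> = 0" unfolding e1 e2 by simp
    finally show ?thesis .
   qed
   have "(lmul F (ldr s G) + lmul (ldr s F) (par G)) (m, S) p = (\<Sum>m'\<in>?M. \<Sum>T\<in>Pow S. ?f m' T)"
    by (simp add: lmul_eq sum.distrib)
   also have "\<dots> = (\<Sum>m'\<in>?M. \<Sum>T\<in>Pow Q. ?f m' T + ?f m' (insert s T))"
    unfolding arg_cong[OF Q(3), of Pow] by (intro sum.cong refl sum_Pow_insert Q)
   also have "\<dots> = 0" by (intro sum.neutral ballI 1)
   finally show ?thesis using True by (simp add: ldr_def)
  next
   case False
   let ?g = "\<lambda>m' T. (-1) ^ inversions T (insert s S - T) * F (m', T) p * G (m - m', insert s S - T) p"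
   have "ldr s (lmul F G) (m, S) p = (\<Sum>m'\<in>?M. (-1) ^ above s S * (\<Sum>T\<in>Pow (insert s S). ?g m' T))"
    using False by (simp add: ldr_alt lmul_eq sum_distrib_left)
   also have "\<dots> = (\<Sum>m'\<in>?M. (\<Sum>T\<in>Pow S. (-1) ^ above s S * ?g m' T + (-1) ^ above s S * ?g m' (insert s T)))"
    by (intro sum.cong refl) (simp only: sum_Pow_insert[OF fin False] sum_distrib_left distrib_left)
   also have "\<dots> = (\<Sum>m'\<in>?M. \<Sum>T\<in>Pow S. (-1) ^ inversions T (S - T) * F (m', T) p * ldr s G (m - m', S - T) p
     + (-1) ^ inversions T (S - T) * ldr s F (m', T) p * par G (m - m', S - T) p)"
   proof (intro sum.cong refl)
    fix m' T assume T: "T \<in> Pow S"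
    have fT: "finite T" "s \<notin> T" "finite (S - T)" "s \<notin> S - T"
     using T fin False finite_subset by auto
    have d: "insert s S - T = insert s (S - T)" "insert s S - insert s T = S - T" using T False by auto
    have i1: "inversions T (insert s (S - T)) = inversions T (S - T) + above s T"
     by (rule inversions_insert_right) (use fT in auto)
    have i2: "inversions (insert s T) (S - T) = inversions T (S - T) + below s (S - T)"
     by (rule inversions_insert_left) (use fT in auto)
    have i3: "below s (S - T) + above s (S - T) = card (S - T)"
     by (rule card_lt_gt) (use fT in auto)
    have i4: "above s S = above s T + above s (S - T)"
     by (rule card_split_gt) (use fin T in auto)
    have sq: "(-1 :: real) ^ a * (-1) ^ a = 1" for a by (simp flip: power_mult_distrib)
    have e1: "(-1 :: real) ^ above s S * (-1) ^ inversions T (insert s (S - T)) =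
     (-1) ^ inversions T (S - T) * (-1) ^ above s (S - T)"
     unfolding i1 i4 power_add using sq[of "above s T"] by (simp add: algebra_simps)
    have e2: "(-1 :: real) ^ above s S * (-1) ^ inversions (insert s T) (S - T) =
     (-1) ^ inversions T (S - T) * (-1) ^ above s T * (-1) ^ card (S - T)"
     unfolding i2 i4 i3[symmetric] power_add by (simp add: algebra_simps)
    have "(-1) ^ above s S * ?g m' T = ((-1) ^ above s S * (-1) ^ inversions T (insert s (S - T)))
      * F (m', T) p * G (m - m', insert s (S - T)) p"
     unfolding d by (simp only: mult.assoc)
    also have "\<dots> = (-1) ^ inversions T (S - T) * F (m', T) p * ldr s G (m - m', S - T) p"
     unfolding e1 using fT(4) by (simp only: ldr_alt if_False mult_ac)
    finally have 1: "(-1) ^ above s S * ?g m' T =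
     (-1) ^ inversions T (S - T) * F (m', T) p * ldr s G (m - m', S - T) p" .
    have "(-1) ^ above s S * ?g m' (insert s T) = ((-1) ^ above s S * (-1) ^ inversions (insert s T) (S - T))
      * F (m', insert s T) p * G (m - m', S - T) p"
     unfolding d by (simp only: mult.assoc)
    also have "\<dots> = (-1) ^ inversions T (S - T) * ldr s F (m', T) p * par G (m - m', S - T) p"
     unfolding e2 using fT(2) by (simp only: ldr_alt par_def prod.case if_False if_True fT(3) mult_ac)
    finally have 2: "(-1) ^ above s S * ?g m' (insert s T) =
     (-1) ^ inversions T (S - T) * ldr s F (m', T) p * par G (m - m', S - T) p" .
    show "(-1) ^ above s S * ?g m' T + (-1) ^ above s S * ?g m' (insert s T)
     = (-1) ^ inversions T (S - T) * F (m', T) p * ldr s G (m - m', S - T) p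
     + (-1) ^ inversions T (S - T) * ldr s F (m', T) p * par G (m - m', S - T) p"
     unfolding 1 2 ..
   qed
   also have "\<dots> = (lmul F (ldr s G) + lmul (ldr s F) (par G)) (m, S) p"
    by (simp add: lmul_eq sum.distrib)
   finally show ?thesis .
  qed
 qed
qed

lemma finite_submultisets [simp]: "finite {m'. m' \<subseteq># m}"
proof (induction m)
 case (add x m)
 have "{m'. m' \<subseteq># add_mset x m} \<subseteq> {m'. m' \<subseteq># m} \<union> add_mset x ` {m'. m' \<subseteq># m}"
 proof
  fix m' assume m': "m' \<in> {m'. m' \<subseteq># add_mset x m}"
  show "m' \<in> {m'. m' \<subseteq># m} \<union> add_mset x ` {m'. m' \<subseteq># m}"
  proof (cases "x \<in># m'")
   case True
   then obtain k where "m' = add_mset x k" by (metis multi_member_split)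
   then show ?thesis using m' by auto
  next
   case False
   then have "m' \<subseteq># m" using m' by (auto simp: subseteq_mset_def not_in_iff) (metis not_in_iff zero_le)
   then show ?thesis by auto
  qed
 qed
 then show ?case by (rule finite_subset) (use add in auto)
qed simp

lemma sum_submultisets_left:
 fixes h :: "nat multiset => real"
 shows "(\<Sum>m'\<in>{m'. m' \<subseteq># add_mset i m}. real (count m' i) * h m') =
  (\<Sum>m'\<in>{m'. m' \<subseteq># m}. real (count m' i + 1) * h (add_mset i m'))"
proof -
 have "(\<Sum>m'\<in>{m'. m' \<subseteq># add_mset i m}. real (count m' i) * h m') =
  (\<Sum>m'\<in>add_mset i ` {m'. m' \<subseteq># m}. real (count m' i) * h m')"
 proof (rule sum.mono_neutral_right)
  show "\<forall>m'\<in>{m'. m' \<subseteq># add_mset i m} - add_mset i ` {m'. m' \<subseteq># m}. real (count m' i) * h m' = 0"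
  proof
   fix m' assume m': "m' \<in> {m'. m' \<subseteq># add_mset i m} - add_mset i ` {m'. m' \<subseteq># m}"
   have "i \<notin># m'"
   proof
    assume "i \<in># m'"
    then obtain k where "m' = add_mset i k" by (metis multi_member_split)
    then show False using m' by auto
   qed
   then show "real (count m' i) * h m' = 0" by (simp add: not_in_iff)
  qed
 qed auto
 also have "\<dots> = (\<Sum>m'\<in>{m'. m' \<subseteq># m}. real (count m' i + 1) * h (add_mset i m'))"
  by (subst sum.reindex) (auto simp: inj_on_def)
 finally show ?thesis .
qed

lemma sum_submultisets_right:
 fixes h :: "nat multiset => nat multiset => real"
 shows "(\<Sum>m'\<in>{m'. m' \<subseteq># add_mset i m}. real (count (add_mset i m - m') i) * h m' (add_mset i m - m')) =
  (\<Sum>m'\<in>{m'. m' \<subseteq># m}. real (count (m - m') i + 1) * h m' (add_mset i (m - m')))"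
proof -
 have "(\<Sum>m'\<in>{m'. m' \<subseteq># add_mset i m}. real (count (add_mset i m - m') i) * h m' (add_mset i m - m')) =
  (\<Sum>m'\<in>{m'. m' \<subseteq># m}. real (count (add_mset i m - m') i) * h m' (add_mset i m - m'))"
 proof (rule sum.mono_neutral_right)
  show "{m'. m' \<subseteq># m} \<subseteq> {m'. m' \<subseteq># add_mset i m}" by (auto intro: subset_mset.order_trans)
  show "\<forall>m'\<in>{m'. m' \<subseteq># add_mset i m} - {m'. m' \<subseteq># m}. real (count (add_mset i m - m') i) * h m' (add_mset i m - m') = 0"
  proof
   fix m' assume m': "m' \<in> {m'. m' \<subseteq># add_mset i m} - {m'. m' \<subseteq># m}"
   have "count (add_mset i m - m') i = 0"
   proof (rule ccontr)
    assume a: "count (add_mset i m - m') i \<noteq> 0"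
    have "m' \<subseteq># m"
    proof (rule mset_subset_eqI)
     fix j
     have "m' \<subseteq># add_mset i m" using m' by simp
     then have "count m' j \<le> count (add_mset i m) j" by (rule mset_subset_eq_count)
     then show "count m' j \<le> count m j" using a by (cases "j = i") auto
    qed
    then show False using m' by simp
   qed
   then show "real (count (add_mset i m - m') i) * h m' (add_mset i m - m') = 0" by simp
  qed
 qed simp
 also have "\<dots> = (\<Sum>m'\<in>{m'. m' \<subseteq># m}. real (count (m - m') i + 1) * h m' (add_mset i (m - m')))"
 proof (rule sum.cong[OF refl])
  fix m' assume "m' \<in> {m'. m' \<subseteq># m}"
  then obtain k where "m = m' + k" by (auto simp: mset_subset_eq_exists_conv)
  then have "add_mset i m - m' = add_mset i (m - m')" by simp
  then show "real (count (add_mset i m - m') i) * h m' (add_mset i m - m') =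
   real (count (m - m') i + 1) * h m' (add_mset i (m - m'))" by simp
 qed
 finally show ?thesis .
qed

text \<open>The weight \<open>count m i + 1\<close> of the derivative splits into the multiplicities
  of i in the two parts of the multiset. Each of the two resulting sums loses the terms of
  multiplicity 0 and becomes a shift of one part.\<close>

lemma ldP_lmul: "ldP i (lmul F G) = lmul (ldP i F) G + lmul F (ldP i G)"
proof (intro ext, clarify)
 fix m :: "nat multiset" and S :: "nat set" and p
 define H where "H = (\<lambda>m1 m2. \<Sum>T\<in>Pow S. (-1) ^ inversions T (S - T) * F (m1, T) p * G (m2, S - T) p)"
 have "ldP i (lmul F G) (m, S) p = (\<Sum>m'\<in>{m'. m' \<subseteq># add_mset i m}. real (count m i + 1) * H m' (add_mset i m - m'))"
  by (simp add: ldP_def lmul_eq H_def sum_distrib_left)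
 also have "\<dots> = (\<Sum>m'\<in>{m'. m' \<subseteq># add_mset i m}. real (count m' i) * H m' (add_mset i m - m')
   + real (count (add_mset i m - m') i) * H m' (add_mset i m - m'))"
 proof (rule sum.cong[OF refl])
  fix m' assume "m' \<in> {m'. m' \<subseteq># add_mset i m}"
  then have "m' \<subseteq># add_mset i m" by simp
  then have "count m' i \<le> count (add_mset i m) i" by (rule mset_subset_eq_count)
  then have "count m i + 1 = count m' i + count (add_mset i m - m') i" by simp
  then show "real (count m i + 1) * H m' (add_mset i m - m') = real (count m' i) * H m' (add_mset i m - m')
   + real (count (add_mset i m - m') i) * H m' (add_mset i m - m')"
   by (simp add: algebra_simps flip: of_nat_add)
 qed
 also have "\<dots> = (\<Sum>m'\<in>{m'. m' \<subseteq># m}. real (count m' i + 1) * H (add_mset i m') (m - m'))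
   + (\<Sum>m'\<in>{m'. m' \<subseteq># m}. real (count (m - m') i + 1) * H m' (add_mset i (m - m')))"
  unfolding sum.distrib sum_submultisets_right
  using sum_submultisets_left[of i "\<lambda>m'. H m' (add_mset i m - m')" m] by simp
 also have "\<dots> = (lmul (ldP i F) G + lmul F (ldP i G)) (m, S) p"
  by (simp add: lmul_eq H_def ldP_def sum_distrib_left sum_distrib_right mult_ac)
 finally show "ldP i (lmul F G) (m, S) p = (lmul (ldP i F) G + lmul F (ldP i G)) (m, S) p" .
qed

lemma ev_lmul: "ev (lmul F G) p = ev F p * ev G p"
 by (simp add: ev_def lmul_eq inversions_def)

lemma ev_par [simp]: "ev (par F) = ev F"
 by (auto simp: ev_def par_def)

lemma ev_add [simp]: "ev (F + G) = ev F + ev G" and ev_diff [simp]: "ev (F - G) = ev F - ev G"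
 and ev_minus [simp]: "ev (- F) = - ev F" and ev_zero [simp]: "ev 0 = 0"
 by (auto simp: ev_def fun_eq_iff)

lemma fun_sum_apply: "(\<Sum>j\<in>J. F j) x = (\<Sum>j\<in>J. F j x)"
 by (induction J rule: infinite_finite_induct) auto

lemma ev_sum: "ev (\<Sum>j\<in>J. F j) p = (\<Sum>j\<in>J. ev (F j) p)"
 by (simp add: ev_def fun_sum_apply)

lemma ldr_add: "ldr s (F + G) = ldr s F + ldr s G"
 and ldr_diff: "ldr s (F - G) = ldr s F - ldr s G"
 and ldr_minus: "ldr s (- F) = - ldr s F"
 and ldr_zero [simp]: "ldr s 0 = 0"
 by (auto simp: ldr_def fun_eq_iff algebra_simps)

lemma ldr_sum: "ldr s (\<Sum>j\<in>J. F j) = (\<Sum>j\<in>J. ldr s (F j))"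
 by (auto simp: ldr_def fun_eq_iff fun_sum_apply sum_distrib_left)

lemma ldP_add: "ldP i (F + G) = ldP i F + ldP i G"
 and ldP_diff: "ldP i (F - G) = ldP i F - ldP i G"
 and ldP_minus: "ldP i (- F) = - ldP i F"
 and ldP_zero [simp]: "ldP i 0 = 0"
 by (auto simp: ldP_def fun_eq_iff algebra_simps)

lemma ldP_sum: "ldP i (\<Sum>j\<in>J. F j) = (\<Sum>j\<in>J. ldP i (F j))"
 by (auto simp: ldP_def fun_eq_iff fun_sum_apply sum_distrib_left)

lemma par_add: "par (F + G) = par F + par G" and par_minus: "par (- F) = - par F"
 and par_zero [simp]: "par 0 = 0"
 by (auto simp: par_def fun_eq_iff algebra_simps)

lemma ldr_par: "ldr s (par F) = - par (ldr s F)"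
 by (auto simp: par_def ldr_alt fun_eq_iff)

lemma ldP_par: "ldP i (par F) = par (ldP i F)"
 by (auto simp: par_def ldP_def fun_eq_iff)

text \<open>At an infinite S the product is 0 whatever the factors are, and at a finite S only
  finite subsets enter.\<close>

lemma lmul_cong_finite:
 assumes "\<And>m S. finite S ==> G (m, S) = G' (m, S)"
 shows "lmul F G = lmul F G'"
proof (intro ext, clarify)
 fix m :: "nat multiset" and S :: "nat set" and p
 show "lmul F G (m, S) p = lmul F G' (m, S) p"
 proof (cases "finite S")
  case True
  then show ?thesis unfolding lmul_eq by (intro sum.cong refl) (simp add: assms)
 next
  case False
  then have "infinite (Pow S)" by (simp add: finite_Pow_iff)
  then show ?thesis by (simp add: lmul_eq)
 qed
qed

lemma lmul_par_par: "lmul F (par (par G)) = lmul F G"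
 by (rule lmul_cong_finite) (auto simp: par_def fun_eq_iff simp flip: power_mult_distrib mult.assoc)

lemma ldl_alt: "ldl s F (m, S) p = (if s \<in> S then 0 else (-1) ^ below s S * F (m, insert s S) p)"
 by (simp add: ldl_def below_def)

text \<open>Carrying s from the right end to the left end passes every element of S, those above and
  those below. The bracket can thus be written with right derivatives only.\<close>

lemma ldl_eq_ldr: "finite S ==> ldl s F (m, S) p = par (ldr s F) (m, S) p"
proof (cases "s \<in> S")
 case False
 assume fin: "finite S"
 have "(-1 :: real) ^ card S * (-1) ^ above s S = (-1) ^ below s S"
  unfolding card_lt_gt[OF fin False, symmetric] power_add by (simp add: mult.assoc flip: power_mult_distrib)
 then show ?thesis using False fin by (simp add: ldl_alt ldr_alt par_def flip: mult.assoc)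
qed (simp add: ldl_def ldr_def par_def)

lemma lmul_ldl: "lmul F (ldl s G) = lmul F (par (ldr s G))"
 by (rule lmul_cong_finite) (auto simp: fun_eq_iff ldl_eq_ldr)

lemma above_insert:
 assumes "finite S" "a \<notin> S"
 shows "above s (insert a S) = above s S + (if s < a then 1 else 0)"
proof -
 have "{t\<in>insert a S. s < t} = (if s < a then insert a {t\<in>S. s < t} else {t\<in>S. s < t})" by auto
 then show ?thesis unfolding above_def using assms by simp
qed

lemma ldr_ldr: "finite S ==> ldr s (ldr t F) (m, S) p = - ldr t (ldr s F) (m, S) p"
 by (cases s t rule: linorder_cases) (auto simp: ldr_alt above_insert insert_commute)

lemma ldr_ldP: "ldr s (ldP i F) = ldP i (ldr s F)"
 by (auto simp: ldr_def ldP_def fun_eq_iff)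

lemma ldr_top: "(\<And>t. t \<in> S ==> t < s) ==> F (m, insert s S) = ldr s F (m, S)"
proof
 fix p assume "\<And>t. t \<in> S ==> t < s"
 then have "{t\<in>S. s < t} = {}" "s \<notin> S" by force+
 then show "F (m, insert s S) p = ldr s F (m, S) p" by (simp only: ldr_def prod.case) simp
qed

lemma lmul_add: "lmul (F + F') G = lmul F G + lmul F' G" "lmul F (G + G') = lmul F G + lmul F G'"
 and lmul_minus: "lmul (- F) G = - lmul F G" "lmul F (- G) = - lmul F G"
 and lmul_zero [simp]: "lmul 0 G = 0" "lmul F 0 = 0"
 by (auto simp: fun_eq_iff lmul_eq algebra_simps sum.distrib sum_negf)

section \<open>Support conditions and degree\<close>

definition supp :: "(nat multiset => nat set => bool) => 'm lfun => bool" where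
 "supp Q F \<longleftrightarrow> (\<forall>m S. F (m, S) \<noteq> 0 \<longrightarrow> Q m S)"

lemma suppD: "supp Q F ==> \<not> Q m S ==> F (m, S) = 0"
 unfolding supp_def by blast

lemma suppD': "supp Q F ==> F (m, S) p \<noteq> 0 ==> Q m S"
 unfolding supp_def by (metis zero_fun_apply)

lemma suppI:
 assumes "\<And>m S p. F (m, S) p \<noteq> 0 ==> Q m S"
 shows "supp Q F"
 unfolding supp_def
proof (intro allI impI)
 fix m S assume "F (m, S) \<noteq> 0"
 then obtain p where "F (m, S) p \<noteq> 0" by (auto simp: fun_eq_iff)
 then show "Q m S" by (rule assms)
qed

lemma supp_add:
 assumes "supp Q F" "supp Q G"
 shows "supp Q (F + G)"
proof (rule suppI)
 fix m S p assume "(F + G) (m, S) p \<noteq> 0"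
 then have "F (m, S) p \<noteq> 0 \<or> G (m, S) p \<noteq> 0" by auto
 then show "Q m S" using suppD'[OF assms(1)] suppD'[OF assms(2)] by blast
qed

lemma supp_diff:
 assumes "supp Q F" "supp Q G"
 shows "supp Q (F - G)"
proof (rule suppI)
 fix m S p assume "(F - G) (m, S) p \<noteq> 0"
 then have "F (m, S) p \<noteq> 0 \<or> G (m, S) p \<noteq> 0" by auto
 then show "Q m S" using suppD'[OF assms(1)] suppD'[OF assms(2)] by blast
qed

lemma supp_sum:
 assumes "\<And>j. j \<in> J ==> supp Q (F j)"
 shows "supp Q (\<Sum>j\<in>J. F j)"
proof (rule suppI)
 fix m S p assume "(\<Sum>j\<in>J. F j) (m, S) p \<noteq> 0"
 then obtain j where "j \<in> J" "F j (m, S) p \<noteq> 0"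
  unfolding fun_sum_apply by (meson sum.not_neutral_contains_not_neutral)
 then show "Q m S" using suppD'[OF assms] by blast
qed

lemma supp_par: "supp Q F ==> supp Q (par F)"
 by (rule suppI) (auto simp: par_def dest: suppD' split: if_splits)

lemma supp_mono: "supp Q F ==> (\<And>m S. Q m S ==> Q' m S) ==> supp Q' F"
 by (auto simp: supp_def)

lemma supp_ldP: "supp Q F ==> (\<And>m S. Q (add_mset i m) S ==> Q' m S) ==> supp Q' (ldP i F)"
 by (rule suppI) (auto simp: ldP_def dest: suppD')

lemma supp_ldr: "supp Q F ==> (\<And>m S. s \<notin> S ==> Q m (insert s S) ==> Q' m S) ==> supp Q' (ldr s F)"
 by (rule suppI) (auto simp: ldr_def dest: suppD' split: if_splits)

lemma supp_ldxf: "supp Q F ==> supp Q (ldxf c i F)"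
proof (rule suppI, rule ccontr)
 fix m S p assume F: "supp Q F" and nz: "ldxf c i F (m, S) p \<noteq> 0" and "\<not> Q m S"
 then have "F (m, S) = (\<lambda>_. 0)" by (auto dest: suppD simp: fun_eq_iff)
 then show False using nz by (simp add: ldxf_def pd_def)
qed

lemma supp_lmul:
 assumes "supp Q1 F" "supp Q2 G"
  and "\<And>m1 m2 S1 S2. finite S1 ==> finite S2 ==> S1 \<inter> S2 = {} ==> Q1 m1 S1 ==> Q2 m2 S2 ==> Q (m1 + m2) (S1 \<union> S2)"
 shows "supp Q (lmul F G)"
proof (rule suppI)
 fix m S p assume nz: "lmul F G (m, S) p \<noteq> 0"
 have fin: "finite S"
 proof (rule ccontr)
  assume "infinite S"
  then have "infinite (Pow S)" by (simp add: finite_Pow_iff)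
  then show False using nz by (simp add: lmul_eq)
 qed
 obtain m' where m0: "m' \<in> {m'. m' \<subseteq># m}"
  "(\<Sum>T\<in>Pow S. (-1) ^ inversions T (S - T) * F (m', T) p * G (m - m', S - T) p) \<noteq> 0"
  using nz unfolding lmul_eq by (rule sum.not_neutral_contains_not_neutral)
 obtain T where T: "T \<in> Pow S" "(-1) ^ inversions T (S - T) * F (m', T) p * G (m - m', S - T) p \<noteq> 0"
  using m0(2) by (rule sum.not_neutral_contains_not_neutral)
 have m': "m' \<subseteq># m" using m0(1) by simp
 have nF: "F (m', T) p \<noteq> 0" "G (m - m', S - T) p \<noteq> 0" using T(2) by auto
 have "T \<subseteq> S" using T(1) by simp
 have "Q (m' + (m - m')) (T \<union> (S - T))"
  by (rule assms(3)[OF finite_subset[OF \<open>T \<subseteq> S\<close> fin] finite_Diff[OF fin] _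
     suppD'[OF assms(1) nF(1)] suppD'[OF assms(2) nF(2)]]) auto
 moreover have "m' + (m - m') = m" using m'(1) by simp
 moreover have "T \<union> (S - T) = S" using T(1) by auto
 ultimately show "Q m S" by simp
qed

text \<open>Finiteness is stated explicitly because an infinite set has \<open>card\<close> 0.
  Degree, range of the variables and absence of P are all support conditions, so one set of closure
  lemmas serves them all.\<close>

abbreviation hom :: "int => 'm lfun => bool" where
 "hom k \<equiv> supp (\<lambda>m S. finite S \<and> int (2 * size m + card S) = k)"

lemma hom_lmul: "hom k F ==> hom l G ==> hom (k + l) (lmul F G)"
 by (erule supp_lmul, assumption) (auto simp: card_Un_disjoint)

lemma hom_ldP: "hom k F ==> hom (k - 2) (ldP i F)"
 by (erule supp_ldP) auto

lemma hom_ldr: "hom k F ==> hom (k - 1) (ldr s F)"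
 by (erule supp_ldr) auto

lemma hom_ev: "hom k F ==> k \<noteq> 0 ==> ev F p = 0"
 using suppD[of _ F "{#}" "{}"] unfolding ev_def by fastforce

lemma hom_ldxf: "hom k F ==> hom k (ldxf c i F)"
 by (rule supp_ldxf)

lemma hom_par: "hom k F ==> hom k (par F)"
 by (rule supp_par)

text \<open>Each \<open>ldr\<close> lowers the degree by 1, each \<open>ldP\<close> by 2, and
  \<open>ev\<close> sees degree 0 only. The cases are written out so that the simplifier can discard
  the terms of the wrong degree when a word is expanded.\<close>

lemma hom_zero:
 assumes "hom k F"
 shows "k \<noteq> 0 ==> ev F p = 0" "k \<noteq> 1 ==> ev (ldr s F) p = 0" "k \<noteq> 2 ==> ev (ldr s (ldr t F)) p = 0"
  "k \<noteq> 3 ==> ev (ldr s (ldr t (ldr u F))) p = 0"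
  "k \<noteq> 4 ==> ev (ldr s (ldr t (ldr u (ldr v F)))) p = 0"
  "k \<noteq> 5 ==> ev (ldr s (ldr t (ldr u (ldr v (ldr w F))))) p = 0"
  "k \<noteq> 2 ==> ev (ldP i F) p = 0" "k \<noteq> 3 ==> ev (ldP i (ldr s F)) p = 0"
  "k \<noteq> 4 ==> ev (ldP i (ldr s (ldr t F))) p = 0"
  "k \<noteq> 5 ==> ev (ldP i (ldr s (ldr t (ldr u F)))) p = 0"
  "k \<noteq> 6 ==> ev (ldP i (ldr s (ldr t (ldr u (ldr v F))))) p = 0"
  "k \<noteq> 4 ==> ev (ldP i (ldP j F)) p = 0" "k \<noteq> 5 ==> ev (ldP i (ldP j (ldr s F))) p = 0"
  "k \<noteq> 6 ==> ev (ldP i (ldP j (ldr s (ldr t F)))) p = 0"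
  "k \<noteq> 7 ==> ev (ldP i (ldP j (ldr s (ldr t (ldr u F))))) p = 0"
  "k \<noteq> 6 ==> ev (ldP i (ldP j (ldP l F))) p = 0"
  "k \<noteq> 7 ==> ev (ldP i (ldP j (ldP l (ldr s F)))) p = 0"
  "k \<noteq> 8 ==> ev (ldP i (ldP j (ldP l (ldr s (ldr t F))))) p = 0"
 by (rule hom_ev, (rule hom_ldP hom_ldr assms)+, simp)+

text \<open>A normal form for words: products are expanded, \<open>ldP\<close> stands outside
  \<open>ldr\<close>, and \<open>par\<close> moves outwards, where \<open>ev\<close> removes
  it.\<close>

lemmas lcalc = ldr_lmul ldP_lmul ldr_add ldr_diff ldr_minus ldP_add ldP_diff ldP_minus ldr_ldP
 ldr_par ldP_par lmul_par_par lmul_minus par_minus par_add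

lemma ev_pointwise: "ev (F + G) p = ev F p + ev G p" "ev (F - G) p = ev F p - ev G p"
 "ev (- F) p = - ev F p"
 by simp_all

lemma ev_ldr: "ev (ldr s F) = F ({#}, {s})"
 by (auto simp: ev_def ldr_def fun_eq_iff)

lemma ev_ldP: "ev (ldP i F) = F ({#i#}, {})"
 by (auto simp: ev_def ldP_def fun_eq_iff)

lemma ev_ldr_swap: "ev (ldr s (ldr t F)) p = - ev (ldr t (ldr s F)) p"
 unfolding ev_def by (rule ldr_ldr) simp

lemma ev_ldr_swap3: "ev (ldr s (ldr t (ldr u F))) p = - ev (ldr s (ldr u (ldr t F))) p"
 unfolding ev_ldr[of s] by (rule ldr_ldr) simp

lemma ev_ldr_same: "ev (ldr s (ldr s F)) p = 0" "ev (ldr s (ldr t (ldr t F))) p = 0" "ev (ldr s (ldr t (ldr s F))) p = 0"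
 using ev_ldr_swap[of s s F p] ev_ldr_swap3[of s t t F p] ev_ldr_swap3[of s t s F p] ev_ldr_swap[of s s "ldr t F" p]
 by simp_all

lemma ordered_coeff2: "s < t ==> F (m, {s, t}) = ldr s (ldr t F) (m, {})"
 using ldr_top[of "{s}" t F m] ldr_top[of "{}" s "ldr t F" m] by (simp add: insert_commute)

lemma ordered_coeff3: "s < t ==> t < u ==> F (m, {s, t, u}) = ldr s (ldr t (ldr u F)) (m, {})"
proof -
 assume st: "s < t" "t < u"
 have "{s, t, u} = insert u {s, t}" by auto
 moreover have "F (m, insert u {s, t}) = ldr u F (m, {s, t})" by (rule ldr_top) (use st in auto)
 ultimately show ?thesis using ordered_coeff2[OF st(1), of "ldr u F" m] by simp
qed

lemma ordered_coeff4:
 assumes "s < t" "t < u" "u < v"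
 shows "F (m, {s, t, u, v}) = ldr s (ldr t (ldr u (ldr v F))) (m, {})"
proof -
 have "{s, t, u, v} = insert v {s, t, u}" by auto
 moreover have "F (m, insert v {s, t, u}) = ldr v F (m, {s, t, u})" by (rule ldr_top) (use assms in auto)
 ultimately show ?thesis using ordered_coeff3[OF assms(1,2), of "ldr v F" m] by simp
qed

text \<open>In degree 4 there are only the monomials P P, P \<zeta> \<zeta> and \<zeta> \<zeta>
  \<zeta> \<zeta>. Each coefficient is a word up to a nonzero factor, which exceeds 1 only for a
  repeated P.\<close>

lemma hom4_zero:
 assumes F: "hom 4 F" "supp (\<lambda>m S. set_mset m \<subseteq> I \<and> S \<subseteq> J) F"
  and PP: "\<And>i j. i \<in> I ==> j \<in> I ==> ev (ldP i (ldP j F)) p = 0"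
  and P: "\<And>i s t. i \<in> I ==> s \<in> J ==> t \<in> J ==> ev (ldP i (ldr s (ldr t F))) p = 0"
  and Q: "\<And>s t u v. s \<in> J ==> t \<in> J ==> u \<in> J ==> v \<in> J ==> ev (ldr s (ldr t (ldr u (ldr v F)))) p = 0"
 shows "F (m, S) p = 0"
proof (rule ccontr)
 assume nz: "F (m, S) p \<noteq> 0"
 have a: "finite S" "2 * size m + card S = 4" using suppD'[OF F(1) nz] by auto
 have b: "set_mset m \<subseteq> I" "S \<subseteq> J" using suppD'[OF F(2) nz] by auto
 define xs where "xs = sorted_list_of_set S"
 have xs: "sorted_wrt (<) xs" "set xs = S" "length xs = card S"
  unfolding xs_def using a(1) by (auto simp: strict_sorted_list_of_set)
 consider "size m = 0" "card S = 4" | "size m = 1" "card S = 2" | "size m = 2" "card S = 0"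
 proof -
  have "size m = 0 \<and> card S = 4 \<or> size m = 1 \<and> card S = 2 \<or> size m = 2 \<and> card S = 0"
   using a(2) by presburger
  then show thesis using that by blast
 qed
 then show False
 proof cases
  case 1
  then obtain s t u v where "xs = [s, t, u, v]"
   using xs(3) by (auto simp: numeral_eq_Suc length_Suc_conv)
  then have S: "S = {s, t, u, v}" "s < t" "t < u" "u < v" using xs by auto
  then show False using Q[of s t u v] b nz 1(1) ordered_coeff4[OF S(2-4), of F "{#}"] by (simp add: ev_def)
 next
  case 2
  then obtain i where i: "m = {#i#}" using size_1_singleton_mset by auto
  from 2 obtain s t where "xs = [s, t]" using xs(3) by (metis (no_types) length_0_conv length_Suc_conv numeral_2_eq_2)
  then have S: "S = {s, t}" "s < t" using xs by auto
  then show False using P[of i s t] b nz i ordered_coeff2[OF S(2), of F "{#i#}"] by (simp add: ev_ldP)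
 next
  case 3
  then obtain i m' where m: "m = add_mset i m'" "size m' = 1" by (metis Suc_1 size_eq_Suc_imp_eq_union nat.inject size_add_mset)
  then obtain j where "m' = {#j#}" using size_1_singleton_mset by auto
  moreover have "ev (ldP j (ldP i F)) p = real (count {#j#} i + 1) * F (add_mset i {#j#}, {}) p" by (simp add: ev_ldP) (simp add: ldP_def)
  moreover have "S = {}" using 3 a by simp
  ultimately show False using PP[of j i] b nz m by simp
 qed
qed

section \<open>The Poisson bracket in one chart\<close>

context adapted_chart begin

definition sm :: "'m set => 'm lfun => bool" where
 "sm W F \<longleftrightarrow> (\<forall>mS. smooth B W (F mS))"

lemma smD: "sm W F ==> smooth B W (F mS)"
 unfolding sm_def by blast

lemma sm_ldr: "open W ==> sm W F ==> sm W (ldr s F)"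
 unfolding sm_def
proof clarify
 fix m :: "nat multiset" and S :: "nat set"
 assume o: "open W" and F: "\<forall>mS. smooth B W (F mS)"
 have "ldr s F (m, S) = (\<lambda>p. (if s \<in> S then 0 else (-1) ^ above s S) * F (m, insert s S) p)"
  by (auto simp: ldr_alt)
 then show "smooth B W (ldr s F (m, S))" using F o by (simp only: smooth_mult smooth_const)
qed

lemma sm_ldP: "open W ==> sm W F ==> sm W (ldP i F)"
 by (auto simp: sm_def ldP_def intro!: smooth_mult smooth_const)

lemma sm_par: "open W ==> sm W F ==> sm W (par F)"
 unfolding sm_def
proof clarify
 fix m :: "nat multiset" and S :: "nat set"
 assume o: "open W" and F: "\<forall>mS. smooth B W (F mS)"
 have "par F (m, S) = (\<lambda>p. (if finite S then (-1) ^ card S else 0) * F (m, S) p)"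
  by (auto simp: par_def)
 then show "smooth B W (par F (m, S))" using F o by (simp only: smooth_mult smooth_const)
qed

lemma sm_add: "open W ==> sm W F ==> sm W G ==> sm W (F + G)"
 by (auto simp: sm_def plus_fun_def intro!: smooth_add)

lemma sm_diff: "open W ==> sm W F ==> sm W G ==> sm W (F - G)"
 by (auto simp: sm_def fun_diff_def intro!: smooth_diff)

lemma sm_zero: "open W ==> sm W 0"
 by (auto simp: sm_def zero_fun_def intro!: smooth_const)

lemma sm_sum: "open W ==> (\<And>j. j \<in> J ==> sm W (F j)) ==> sm W (\<Sum>j\<in>J. F j)"
proof (induction J rule: infinite_finite_induct)
 case (insert j J)
 then have "sm W (F j)" "sm W (sum F J)" by auto
 then show ?case unfolding sum.insert[OF insert.hyps] by (rule sm_add[OF insert.prems(1)])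
qed (simp_all only: sum.infinite sum.empty sm_zero not_False_eq_True)

lemma sm_lmul: "open W ==> sm W F ==> sm W G ==> sm W (lmul F G)"
 unfolding sm_def
proof (clarify)
 fix m :: "nat multiset" and S :: "nat set"
 assume o: "open W" and F: "\<forall>mS. smooth B W (F mS)" and G: "\<forall>mS. smooth B W (G mS)"
 have "lmul F G (m, S) = (\<lambda>p. \<Sum>m'\<in>{m'. m' \<subseteq># m}. \<Sum>T\<in>Pow S.
   (-1) ^ inversions T (S - T) * F (m', T) p * G (m - m', S - T) p)" by (simp add: fun_eq_iff lmul_eq)
 then show "smooth B W (lmul F G (m, S))"
  using F G o by (simp del: Pow_iff) (intro smooth_sum smooth_mult smooth_const; simp)
qed

lemma sm_ldxf: "open W ==> W \<subseteq> Oc ==> i < nn ==> sm W F ==> sm W (ldxf c i F)"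
 by (auto simp: sm_def ldxf_def intro!: smooth_ldx)

lemma sm_ev: "sm W F ==> smooth B W (ev F)"
 by (simp add: sm_def ev_def)

lemma sm_pdiff: "sm W F ==> open W ==> p \<in> W ==> p \<in> Oc ==> i < nn ==> C.pdiff i (F mS) p"
 using smooth_pdiffC smD by blast

text \<open>A constant factor is pulled out of \<open>pd\<close> at a point where the function is
  differentiable, so these operators commute pointwise on a set of smoothness. For nested
  derivatives this pointwise identity is carried inwards by \<open>ldr_cong_at\<close> and
  \<open>ldP_cong_at\<close>.\<close>

lemma ldr_ldxf:
 assumes "sm W F" "open W" "p \<in> W" "W \<subseteq> Oc" "i < nn"
 shows "ldr s (ldxf c i F) mS p = ldxf c i (ldr s F) mS p"
proof -
 obtain m S where mS: "mS = (m, S)" by (cases mS)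
 have p: "p \<in> Oc" using assms by auto
 show ?thesis
  using ldx_cmult[OF p sm_pdiff[OF assms(1,2,3) p assms(5)], of "(-1) ^ above s S" "(m, insert s S)"]
  by (simp add: mS ldr_alt[abs_def] ldxf_def ldx_const)
qed

lemma ldP_ldxf:
 assumes "sm W F" "open W" "p \<in> W" "W \<subseteq> Oc" "i < nn"
 shows "ldP j (ldxf c i F) mS p = ldxf c i (ldP j F) mS p"
proof -
 obtain m S where mS: "mS = (m, S)" by (cases mS)
 have p: "p \<in> Oc" using assms by auto
 show ?thesis
  using ldx_cmult[OF p sm_pdiff[OF assms(1,2,3) p assms(5)], of "real (count m j + 1)" "(add_mset j m, S)"]
  by (simp add: mS ldP_def ldxf_def)
qed

lemma ldr_cong_at: "(\<And>mS. F mS p = G mS p) ==> ldr s F mS p = ldr s G mS p"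
 by (cases mS) (simp add: ldr_def)

lemma ldP_cong_at: "(\<And>mS. F mS p = G mS p) ==> ldP s F mS p = ldP s G mS p"
 by (cases mS) (simp add: ldP_def)

lemma ev_ldxf: "ev (ldxf c i F) p = ldx c i (ev F) p"
 by (simp add: ev_def ldxf_def)

lemma ev_ldr_ldxf:
 assumes "sm W F" "open W" "p \<in> W" "W \<subseteq> Oc" "i < nn"
 shows "ev (ldr s (ldxf c i F)) p = ldx c i (ev (ldr s F)) p"
  "ev (ldr s (ldr t (ldxf c i F))) p = ldx c i (ev (ldr s (ldr t F))) p"
  "ev (ldr s (ldr t (ldr u (ldxf c i F)))) p = ldx c i (ev (ldr s (ldr t (ldr u F)))) p"
  "ev (ldP j (ldr s (ldxf c i F))) p = ldx c i (ev (ldP j (ldr s F))) p"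
proof -
 note A = assms(2-)
 have 1: "ldr s (ldxf c i F) mS p = ldxf c i (ldr s F) mS p" for mS s by (rule ldr_ldxf[OF assms])
 have 2: "ldr s (ldr t (ldxf c i F)) mS p = ldxf c i (ldr s (ldr t F)) mS p" for mS s t
  unfolding ldr_cong_at[where F = "ldr t (ldxf c i F)" and G = "ldxf c i (ldr t F)" and p = p, OF 1] by (rule ldr_ldxf[OF sm_ldr[OF A(1) assms(1)] A])
 have 3: "ldr s (ldr t (ldr u (ldxf c i F))) mS p = ldxf c i (ldr s (ldr t (ldr u F))) mS p" for mS
  unfolding ldr_cong_at[where F = "ldr t (ldr u (ldxf c i F))" and G = "ldxf c i (ldr t (ldr u F))" and p = p, OF 2]
  by (rule ldr_ldxf[OF sm_ldr[OF A(1) sm_ldr[OF A(1) assms(1)]] A])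
 have 4: "ldP j (ldr s (ldxf c i F)) mS p = ldxf c i (ldP j (ldr s F)) mS p" for mS
  unfolding ldP_cong_at[where F = "ldr s (ldxf c i F)" and G = "ldxf c i (ldr s F)" and p = p, OF 1]
  by (rule ldP_ldxf[OF sm_ldr[OF A(1) assms(1)] A])
 show "ev (ldr s (ldxf c i F)) p = ldx c i (ev (ldr s F)) p"
  "ev (ldr s (ldr t (ldxf c i F))) p = ldx c i (ev (ldr s (ldr t F))) p"
  "ev (ldr s (ldr t (ldr u (ldxf c i F)))) p = ldx c i (ev (ldr s (ldr t (ldr u F)))) p"
  "ev (ldP j (ldr s (ldxf c i F))) p = ldx c i (ev (ldP j (ldr s F))) p"
  unfolding ev_def 1 2 3 4 by (simp_all add: ldxf_def)
qed

text \<open>The bracket \<open>pb\<close> in one chart: the \<xi> and \<theta> terms are merged into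
  one sum over dual pairs, and left derivatives are replaced by parities of right ones.\<close>

definition lpb :: "'m lfun => 'm lfun => 'm lfun" where
 "lpb F G = (\<Sum>i<nn. lmul (ldP i F) (ldxf c i G) - lmul (ldxf c i F) (ldP i G)) +
   (\<Sum>s<2 * r. lmul (ldr (dual s) F) (par (ldr s G)))"

lemma pb_lpb: "pb B f g c = lpb (f c) (g c)"
 unfolding pb_def lpb_def sum_even_odd by (simp only: lmul_ldl ldxf_def dual_xi dual_th)

lemma sm_lpb: "open W ==> W \<subseteq> Oc ==> sm W F ==> sm W G ==> sm W (lpb F G)"
 unfolding lpb_def
 by (intro sm_add sm_sum sm_diff sm_lmul sm_ldP sm_ldxf sm_ldr sm_par; simp)

lemma hom_lpb:
 assumes "hom k F" "hom l G"
 shows "hom (k + l - 2) (lpb F G)"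
proof -
 have e: "k - 2 + l = k + l - 2" "k + (l - 2) = k + l - 2" "k - 1 + (l - 1) = k + l - 2" by simp_all
 show ?thesis unfolding lpb_def
  using hom_lmul[OF hom_ldP[OF assms(1)] hom_ldxf[OF assms(2)], unfolded e]
   hom_lmul[OF hom_ldxf[OF assms(1)] hom_ldP[OF assms(2)], unfolded e]
   hom_lmul[OF hom_ldr[OF assms(1)] hom_par[OF hom_ldr[OF assms(2)]], unfolded e]
  by (intro supp_add supp_sum supp_diff)
qed

abbreviation Rc where "Rc Y i s \<equiv> ev (ldP i (ldr s Y))"
abbreviation Cc where "Cc Y s t u \<equiv> ev (ldr s (ldr t (ldr u Y)))"

lemma ldr_lpb: "ldr t (lpb F G) =
  (\<Sum>i<nn. ldr t (lmul (ldP i F) (ldxf c i G) - lmul (ldxf c i F) (ldP i G))) +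
  (\<Sum>s<2 * r. ldr t (lmul (ldr (dual s) F) (par (ldr s G))))"
 unfolding lpb_def by (simp only: ldr_add ldr_sum)

lemma ldP_lpb: "ldP j (lpb F G) =
  (\<Sum>i<nn. ldP j (lmul (ldP i F) (ldxf c i G) - lmul (ldxf c i F) (ldP i G))) +
  (\<Sum>s<2 * r. ldP j (lmul (ldr (dual s) F) (par (ldr s G))))"
 unfolding lpb_def by (simp only: ldP_add ldP_sum)

lemmas lpb_words = ldr_lpb ldP_lpb ldr_add ldr_sum ldP_add ldP_sum ev_pointwise ev_sum

lemma hom_neg_zero: "hom k F ==> k < 0 ==> F = 0"
 unfolding supp_def by (intro ext) (auto simp: fun_eq_iff)

text \<open>As for the other coefficient formulas, the word is expanded by the Leibniz rules and
  every product with a factor of the wrong degree is dropped by \<open>hom_zero\<close>.\<close>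

lemma bracket_section_coeffs:
 assumes Y: "hom 3 Y" and e: "hom 1 e" and W: "sm W e" "open W" "p \<in> W" "W \<subseteq> Oc"
 shows "ev (ldP i (lpb Y e)) p = (\<Sum>s<2 * r. Rc Y i (dual s) p * ev (ldr s e) p)" (is ?A)
  "ev (ldr s (ldr t (lpb Y e))) p =
   (\<Sum>l<nn. Rc Y l s p * ldx c l (ev (ldr t e)) p - Rc Y l t p * ldx c l (ev (ldr s e)) p)
   + (\<Sum>u<2 * r. Cc Y s t (dual u) p * ev (ldr u e) p)" (is ?B)
proof -
 have z: "ldP i e = 0" for i by (rule hom_neg_zero[OF hom_ldP[OF e]]) simp
 note hz = hom_zero[OF Y] hom_zero[OF e] hom_zero[OF hom_ldxf[OF Y]] hom_zero[OF hom_ldxf[OF e]]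
 show ?A unfolding lpb_words
  by (simp add: lcalc ev_lmul hz z)
 have d: "ev (ldr s (ldxf c l e)) p = ldx c l (ev (ldr s e)) p" if "l < nn" for l s
  using ev_ldr_ldxf(1)[OF W that] .
 show ?B unfolding lpb_words
  by (simp add: lcalc ev_lmul hz z d)
qed

lemma derived_coeffs:
 assumes X: "hom 2 X" and e: "hom 1 e" and W: "sm W e" "open W" "p \<in> W" "W \<subseteq> Oc"
 shows "ev (ldr s (lpb X e)) p = (\<Sum>l<nn. ev (ldP l X) p * ldx c l (ev (ldr s e)) p)
   + (\<Sum>t<2 * r. ev (ldr s (ldr (dual t) X)) p * ev (ldr t e) p)"
proof -
 have z: "ldP i e = 0" for i by (rule hom_neg_zero[OF hom_ldP[OF e]]) simp
 note hz = hom_zero[OF X] hom_zero[OF e] hom_zero[OF hom_ldxf[OF X]] hom_zero[OF hom_ldxf[OF e]]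
 have d: "ev (ldr s (ldxf c l e)) p = ldx c l (ev (ldr s e)) p" if "l < nn" for l s
  using ev_ldr_ldxf(1)[OF W that] .
 show ?thesis unfolding lpb_words
  by (simp add: lcalc ev_lmul hz z d)
qed

text \<open>Contraction over dual pairs is symmetric because \<open>dual\<close> is an
  involution.\<close>

lemma sum_dual_swap: "(\<Sum>q<2 * r. f q * g (dual q)) = (\<Sum>q<2 * r. g q * f (dual q))" for f g :: "nat => real"
 by (subst sum_dual[symmetric]) (simp add: mult.commute)

lemma bracket_PP:
 assumes Y: "hom 3 Y" and Z: "hom 3 Z"
 shows "ev (ldP i (ldP j (lpb Y Z))) p = (\<Sum>s<2 * r. Rc Y i (dual s) p * Rc Z j s p) + (\<Sum>s<2 * r. Rc Y j (dual s) p * Rc Z i s p)"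
 unfolding lpb_words
 by (simp add: lcalc ev_lmul sum.distrib hom_zero[OF Y] hom_zero[OF hom_ldxf[OF Y]] hom_zero[OF Z] hom_zero[OF hom_ldxf[OF Z]])

context
 fixes Y Z :: "'m lfun" and W :: "'m set" and p :: 'm
 assumes Y: "hom 3 Y" "sm W Y" and Z: "hom 3 Z" "sm W Z" and W: "open W" "p \<in> W" "W \<subseteq> Oc"
begin

lemma bracket_P: "ev (ldP i (ldr s (ldr t (lpb Y Z)))) p =
  (\<Sum>l<nn. Rc Y l s p * ldx c l (Rc Z i t) p - Rc Y l t p * ldx c l (Rc Z i s) p)
   + (\<Sum>l<nn. Rc Z l s p * ldx c l (Rc Y i t) p - Rc Z l t p * ldx c l (Rc Y i s) p)
   + ((\<Sum>q<2 * r. Cc Y s t (dual q) p * Rc Z i q p) + (\<Sum>q<2 * r. Cc Z s t q p * Rc Y i (dual q) p))"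
proof -
 note hz = hom_zero[OF Y(1)] hom_zero[OF hom_ldxf[OF Y(1)]] hom_zero[OF Z(1)] hom_zero[OF hom_ldxf[OF Z(1)]]
 note d = ev_ldr_ldxf(4)[OF Y(2) W] ev_ldr_ldxf(4)[OF Z(2) W]
 show ?thesis unfolding lpb_words
  by (simp add: lcalc ev_lmul hz d sum.distrib sum_subtractf algebra_simps cong: sum.cong_simp)
qed

lemma bracket_quartic: "ev (ldr s (ldr t (ldr u (ldr v (lpb Y Z))))) p =
  (\<Sum>l<nn. Rc Y l s p * ldx c l (Cc Z t u v) p - Rc Y l t p * ldx c l (Cc Z s u v) p
     + Rc Y l u p * ldx c l (Cc Z s t v) p - Rc Y l v p * ldx c l (Cc Z s t u) p)
  + (\<Sum>l<nn. Rc Z l s p * ldx c l (Cc Y t u v) p - Rc Z l t p * ldx c l (Cc Y s u v) p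
     + Rc Z l u p * ldx c l (Cc Y s t v) p - Rc Z l v p * ldx c l (Cc Y s t u) p)
  + ((\<Sum>q<2 * r. Cc Y s t (dual q) p * Cc Z u v q p) - (\<Sum>q<2 * r. Cc Y s u (dual q) p * Cc Z t v q p)
     + (\<Sum>q<2 * r. Cc Y s v (dual q) p * Cc Z t u q p)
   + ((\<Sum>q<2 * r. Cc Z s t q p * Cc Y u v (dual q) p) - (\<Sum>q<2 * r. Cc Z s u q p * Cc Y t v (dual q) p)
     + (\<Sum>q<2 * r. Cc Z s v q p * Cc Y t u (dual q) p)))"
proof -
 note hz = hom_zero[OF Y(1)] hom_zero[OF hom_ldxf[OF Y(1)]] hom_zero[OF Z(1)] hom_zero[OF hom_ldxf[OF Z(1)]]
 note d = ev_ldr_ldxf(3)[OF Y(2) W] ev_ldr_ldxf(3)[OF Z(2) W]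
 show ?thesis unfolding lpb_words
  by (simp add: lcalc ev_lmul hz d sum.distrib sum_subtractf algebra_simps cong: sum.cong_simp)
qed

end

lemma self_bracket_PP:
 assumes Y: "hom 3 Y"
 shows "ev (ldP i (ldP j (lpb Y Y))) p = 2 * (\<Sum>s<2 * r. Rc Y i (dual s) p * Rc Y j s p)"
 using sum_dual_swap[of "\<lambda>s. Rc Y i s p" "\<lambda>s. Rc Y j s p"] by (simp add: bracket_PP[OF Y Y] mult.commute)

context
 fixes Y :: "'m lfun" and W :: "'m set" and p :: 'm
 assumes Y: "hom 3 Y" and W: "sm W Y" "open W" "p \<in> W" "W \<subseteq> Oc"
begin

lemma self_bracket_P: "ev (ldP i (ldr s (ldr t (lpb Y Y)))) p =
  2 * ((\<Sum>l<nn. Rc Y l s p * ldx c l (Rc Y i t) p - Rc Y l t p * ldx c l (Rc Y i s) p)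
   + (\<Sum>q<2 * r. Cc Y s t (dual q) p * Rc Y i q p))"
 using sum_dual_swap[of "\<lambda>q. Cc Y s t q p" "\<lambda>q. Rc Y i q p"] by (simp add: bracket_P[OF Y W(1) Y W] mult.commute)

text \<open>The derivative terms single out one of the four indices; the contracted products belong
  to the three splittings of s, t, u, v into two pairs.\<close>

lemma self_bracket_quartic: "ev (ldr s (ldr t (ldr u (ldr v (lpb Y Y))))) p =
  2 * ((\<Sum>l<nn. Rc Y l s p * ldx c l (Cc Y t u v) p - Rc Y l t p * ldx c l (Cc Y s u v) p
     + Rc Y l u p * ldx c l (Cc Y s t v) p - Rc Y l v p * ldx c l (Cc Y s t u) p)
   + (\<Sum>q<2 * r. Cc Y s t (dual q) p * Cc Y u v q p - Cc Y s u (dual q) p * Cc Y t v q p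
     + Cc Y s v (dual q) p * Cc Y t u q p))"
 using sum_dual_swap[of "\<lambda>q. Cc Y s t q p" "\<lambda>q. Cc Y u v q p"] sum_dual_swap[of "\<lambda>q. Cc Y s u q p" "\<lambda>q. Cc Y t v q p"]
  sum_dual_swap[of "\<lambda>q. Cc Y s v q p" "\<lambda>q. Cc Y t u q p"]
 by (simp add: bracket_quartic[OF Y W(1) Y W] sum.distrib sum_subtractf mult.commute)

end

abbreviation rng :: "'m lfun => bool" where
 "rng \<equiv> supp (\<lambda>m S. set_mset m \<subseteq> {..<nn} \<and> S \<subseteq> {..<2 * r})"

lemma rng_lpb:
 assumes "rng F" "rng G"
 shows "rng (lpb F G)"
proof -
 have m: "rng (lmul X Y)" if "rng X" "rng Y" for X Y
  using that by (rule supp_lmul) auto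
 have P: "rng (ldP i X)" if "rng X" for i X using that by (rule supp_ldP) auto
 have r: "rng (ldr i X)" if "rng X" for i X using that by (rule supp_ldr) auto
 show ?thesis unfolding lpb_def
  by (intro supp_add supp_sum supp_diff m P r supp_ldxf supp_par assms)
qed

text \<open>Two functions of odd degree commute under the bracket. On each of the three kinds of
  coefficients in degree 4, exchanging Y and Z amounts to \<open>sum_dual_swap\<close>.\<close>

lemma lpb_commute3:
 assumes Y: "hom 3 Y" "rng Y" "sm W Y" and Z: "hom 3 Z" "rng Z" "sm W Z" and W: "open W" "p \<in> W" "W \<subseteq> Oc"
 shows "lpb Y Z mS p = lpb Z Y mS p"
proof -
 have h: "hom 4 (lpb Y Z - lpb Z Y)" using hom_lpb[OF Y(1) Z(1)] hom_lpb[OF Z(1) Y(1)] by (simp add: supp_diff)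
 have "(lpb Y Z - lpb Z Y) (m, S) p = 0" for m S
 proof (rule hom4_zero[OF h supp_diff[OF rng_lpb[OF Y(2) Z(2)] rng_lpb[OF Z(2) Y(2)]]])
  fix i j s t u v
  show "ev (ldP i (ldP j (lpb Y Z - lpb Z Y))) p = 0"
   unfolding ldP_diff ev_pointwise bracket_PP[OF Y(1) Z(1)] bracket_PP[OF Z(1) Y(1)]
   using sum_dual_swap[of "\<lambda>s. Rc Y i s p" "\<lambda>s. Rc Z j s p"] sum_dual_swap[of "\<lambda>s. Rc Y j s p" "\<lambda>s. Rc Z i s p"]
   by (simp add: mult.commute)
  show "ev (ldP i (ldr s (ldr t (lpb Y Z - lpb Z Y)))) p = 0"
   unfolding ldr_diff ldP_diff ev_pointwise bracket_P[OF Y(1,3) Z(1,3) W] bracket_P[OF Z(1,3) Y(1,3) W]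
   using sum_dual_swap[of "\<lambda>q. Cc Y s t q p" "\<lambda>q. Rc Z i q p"] sum_dual_swap[of "\<lambda>q. Cc Z s t q p" "\<lambda>q. Rc Y i q p"]
   by (simp add: mult.commute)
  show "ev (ldr s (ldr t (ldr u (ldr v (lpb Y Z - lpb Z Y))))) p = 0"
   unfolding ldr_diff ev_pointwise bracket_quartic[OF Y(1,3) Z(1,3) W] bracket_quartic[OF Z(1,3) Y(1,3) W]
   using sum_dual_swap[of "\<lambda>q. Cc Y s t q p" "\<lambda>q. Cc Z u v q p"] sum_dual_swap[of "\<lambda>q. Cc Z s t q p" "\<lambda>q. Cc Y u v q p"]
    sum_dual_swap[of "\<lambda>q. Cc Y s u q p" "\<lambda>q. Cc Z t v q p"] sum_dual_swap[of "\<lambda>q. Cc Z s u q p" "\<lambda>q. Cc Y t v q p"]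
    sum_dual_swap[of "\<lambda>q. Cc Y s v q p" "\<lambda>q. Cc Z t u q p"] sum_dual_swap[of "\<lambda>q. Cc Z s v q p" "\<lambda>q. Cc Y t u q p"]
   by (simp add: mult.commute)
 qed
 then show ?thesis by (cases mS) simp
qed

text \<open>F has no P, so the bracket either contracts an index of Y with the matrix of F or
  differentiates F along the anchor of Y.\<close>

lemma twist_coeffs:
 assumes Y: "hom 3 Y" and F: "hom 2 F" "supp (\<lambda>m S. m = {#}) F" and W: "sm W F" "open W" "p \<in> W" "W \<subseteq> Oc"
 shows "Rc (lpb Y F) l s p = (\<Sum>t<2 * r. Rc Y l (dual t) p * ev (ldr t (ldr s F)) p)" (is ?A)
  "Cc (lpb Y F) s t u p =
   (\<Sum>l<nn. Rc Y l s p * ldx c l (ev (ldr t (ldr u F))) p - Rc Y l t p * ldx c l (ev (ldr s (ldr u F))) p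
     + Rc Y l u p * ldx c l (ev (ldr s (ldr t F))) p)
   + (\<Sum>q<2 * r. Cc Y s t (dual q) p * ev (ldr q (ldr u F)) p - Cc Y s u (dual q) p * ev (ldr q (ldr t F)) p
     + Cc Y t u (dual q) p * ev (ldr q (ldr s F)) p)" (is ?B)
proof -
 have z: "ldP i F = 0" for i
 proof -
  have "F (add_mset i m, S) = 0" for m S by (rule suppD[OF F(2)]) simp
  then show ?thesis by (auto simp: ldP_def fun_eq_iff)
 qed
 have zx: "ldP j (ldxf c i F) = 0" for i j
 proof -
  have "ldxf c i F (add_mset j m, S) = 0" for m S by (rule suppD[OF supp_ldxf[OF F(2)]]) simp
  then show ?thesis by (auto simp: ldP_def fun_eq_iff)
 qed
 note hz = hom_zero[OF Y] hom_zero[OF F(1)] hom_zero[OF hom_ldxf[OF Y]] hom_zero[OF hom_ldxf[OF F(1)]]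
 have zr: "ldr s (ldP i F) = 0" for s i by (simp add: z)
 have zr1: "ldP i (ldr s F) = 0" for s i using ldr_ldP[of s i F] by (simp add: z)
 show ?A unfolding lpb_words
  by (simp add: lcalc ev_lmul hz z zx zr1 ev_ldr_swap[of s] cong: sum.cong_simp)
 have d: "ev (ldr s (ldr t (ldxf c l F))) p = ldx c l (ev (ldr s (ldr t F))) p" if "l < nn" for l s t
  using ev_ldr_ldxf(2)[OF W that] .
 have sg: "ev (ldr a (ldr q F)) p = - ev (ldr q (ldr a F)) p" for a q by (rule ev_ldr_swap)
 have "Cc (lpb Y F) s t u p =
   (\<Sum>l<nn. Rc Y l s p * ldx c l (ev (ldr t (ldr u F))) p - Rc Y l t p * ldx c l (ev (ldr s (ldr u F))) p
     + Rc Y l u p * ldx c l (ev (ldr s (ldr t F))) p)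
   + (\<Sum>q<2 * r. Cc Y s t (dual q) p * (- ev (ldr u (ldr q F)) p) - Cc Y s u (dual q) p * (- ev (ldr t (ldr q F)) p)
     + Cc Y t u (dual q) p * (- ev (ldr s (ldr q F)) p))"
  unfolding lpb_words
  by (simp add: lcalc ev_lmul hz z zx zr1 d sum.distrib sum_subtractf sum_negf algebra_simps cong: sum.cong_simp)
 then show ?B unfolding sg[symmetric] .
qed

end

section \<open>Change of adapted charts\<close>

text \<open>A sum over increasing k-tuples below n, taken over subsets because the monomials in
  \<open>transition\<close> are indexed by sets.\<close>

definition ssum :: "nat => nat => (nat list => real) => real" where
 "ssum n k h = (\<Sum>S\<in>Pow {..<n}. if card S = k then h (sorted_list_of_set S) else 0)"

lemma sorted_list_of_set_snoc:
 assumes "S \<subseteq> {..<n :: nat}"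
 shows "sorted_list_of_set (insert n S) = sorted_list_of_set S @ [n]"
proof (rule sorted_distinct_set_unique)
 have fin: "finite S" by (rule finite_subset[OF assms]) simp
 show "sorted (sorted_list_of_set S @ [n])" using assms fin by (auto simp: sorted_append less_imp_le)
 show "distinct (sorted_list_of_set S @ [n])" using assms fin by auto
 have "finite (insert n S)" using fin by simp
 then show "set (sorted_list_of_set (insert n S)) = set (sorted_list_of_set S @ [n])"
  unfolding set_append set_sorted_list_of_set[OF fin] by (simp only: set_sorted_list_of_set) simp
qed (simp_all only: sorted_sorted_list_of_set distinct_sorted_list_of_set)

lemma ssum_0: "ssum n 0 h = h []"
proof -
 have "ssum n 0 h = (\<Sum>S\<in>Pow {..<n}. if S = {} then h [] else 0)"
  unfolding ssum_def by (rule sum.cong) (auto dest: finite_subset[of _ "{..<n}"])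
 then show ?thesis by simp
qed

lemma ssum_zero_Suc: "ssum 0 (Suc k) h = 0"
 by (simp add: ssum_def)

lemma ssum_Suc: "ssum (Suc n) (Suc k) h = ssum n (Suc k) h + ssum n k (\<lambda>xs. h (xs @ [n]))"
proof -
 have "ssum (Suc n) (Suc k) h = (\<Sum>S\<in>Pow {..<n}. (if card S = Suc k then h (sorted_list_of_set S) else 0)
  + (if card (insert n S) = Suc k then h (sorted_list_of_set (insert n S)) else 0))"
  unfolding ssum_def lessThan_Suc by (rule sum_Pow_insert) auto
 also have "\<dots> = (\<Sum>S\<in>Pow {..<n}. (if card S = Suc k then h (sorted_list_of_set S) else 0)
  + (if card S = k then h (sorted_list_of_set S @ [n]) else 0))"
 proof (rule sum.cong[OF refl])
  fix S assume S: "S \<in> Pow {..<n}"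
  then have "finite S" "n \<notin> S" using finite_subset[of S "{..<n}"] by auto
  then show "(if card S = Suc k then h (sorted_list_of_set S) else 0)
   + (if card (insert n S) = Suc k then h (sorted_list_of_set (insert n S)) else 0) =
   (if card S = Suc k then h (sorted_list_of_set S) else 0)
   + (if card S = k then h (sorted_list_of_set S @ [n]) else 0)"
   using S sorted_list_of_set_snoc[of S n] by simp
 qed
 finally show ?thesis by (simp add: ssum_def sum.distrib)
qed

lemma ssum_1: "ssum n 1 h = (\<Sum>t<n. h [t])"
 by (induction n) (simp_all add: ssum_zero_Suc ssum_Suc ssum_0)

text \<open>Passes between sums over monomials, whose variables are sorted, and the unrestricted
  sums of tensor calculus; \<open>triple_sum_ssum\<close> does the same for three indices.\<close>

lemma double_sum_ssum:
 assumes "\<And>a. g a a = 0"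
 shows "(\<Sum>a<n. \<Sum>b<n. g a b) = ssum n 2 (\<lambda>xs. g (xs ! 0) (xs ! 1) + g (xs ! 1) (xs ! 0))"
proof (induction n)
 case 0
 then show ?case by (simp add: numeral_2_eq_2 ssum_zero_Suc)
next
 case (Suc n)
 have "(\<Sum>a<Suc n. \<Sum>b<Suc n. g a b) = (\<Sum>a<n. \<Sum>b<n. g a b) + (\<Sum>t<n. g t n + g n t)"
  using assms by (simp add: sum.distrib)
 moreover have "ssum (Suc n) 2 (\<lambda>xs. g (xs ! 0) (xs ! 1) + g (xs ! 1) (xs ! 0)) =
   ssum n 2 (\<lambda>xs. g (xs ! 0) (xs ! 1) + g (xs ! 1) (xs ! 0)) + (\<Sum>t<n. g t n + g n t)"
  unfolding numeral_2_eq_2 ssum_Suc by (simp add: ssum_1[unfolded One_nat_def])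
 ultimately show ?case using Suc by simp
qed

lemma triple_sum_ssum:
 assumes "\<And>a b. g a a b = 0" "\<And>a b. g a b a = 0" "\<And>a b. g b a a = 0"
 shows "(\<Sum>a<n. \<Sum>b<n. \<Sum>c<n. g a b c) = ssum n 3 (\<lambda>xs.
   g (xs ! 0) (xs ! 1) (xs ! 2) + g (xs ! 1) (xs ! 0) (xs ! 2) +
   (g (xs ! 0) (xs ! 2) (xs ! 1) + g (xs ! 1) (xs ! 2) (xs ! 0)) +
   (g (xs ! 2) (xs ! 0) (xs ! 1) + g (xs ! 2) (xs ! 1) (xs ! 0)))" (is "_ = ssum n 3 ?h")
proof (induction n)
 case 0
 then show ?case by (simp add: numeral_3_eq_3 ssum_zero_Suc)
next
 case (Suc n)
 define g' where "g' = (\<lambda>a b. g a b n + g a n b + g n a b)"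
 have "(\<Sum>a<Suc n. \<Sum>b<Suc n. \<Sum>c<Suc n. g a b c) = (\<Sum>a<n. \<Sum>b<n. \<Sum>c<n. g a b c) + (\<Sum>a<n. \<Sum>b<n. g' a b)"
  using assms by (simp add: sum.distrib g'_def)
 also have "(\<Sum>a<n. \<Sum>b<n. g' a b) = ssum n 2 (\<lambda>xs. g' (xs ! 0) (xs ! 1) + g' (xs ! 1) (xs ! 0))"
  by (rule double_sum_ssum) (simp add: g'_def assms)
 also have "\<dots> = ssum n 2 (\<lambda>xs. ?h (xs @ [n]))"
  unfolding ssum_def
 proof (intro sum.cong refl, rule if_cong[OF refl _ refl])
  fix S assume "S \<in> Pow {..<n}" "card S = 2"
  then have "length (sorted_list_of_set S) = 2" by simp
  then obtain a b where "sorted_list_of_set S = [a, b]"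
   by (metis (no_types) length_0_conv length_Suc_conv numeral_2_eq_2)
  then show "g' (sorted_list_of_set S ! 0) (sorted_list_of_set S ! 1) + g' (sorted_list_of_set S ! 1) (sorted_list_of_set S ! 0)
   = ?h (sorted_list_of_set S @ [n])"
   by (simp add: g'_def nth_append numeral_2_eq_2)
 qed
 finally show ?case using Suc ssum_Suc[of n 2 ?h] by (simp add: numeral_3_eq_3)
qed

lemma ssum_cong:
 assumes "\<And>xs. length xs = k ==> sorted_wrt (<) xs ==> set xs \<subseteq> {..<n} ==> h xs = h' xs"
 shows "ssum n k h = ssum n k h'"
 unfolding ssum_def
proof (intro sum.cong refl, rule if_cong[OF refl _ refl])
 fix S assume S: "S \<in> Pow {..<n}" "card S = k"
 then have "finite S" using finite_subset[of S "{..<n}"] by auto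
 then show "h (sorted_list_of_set S) = h' (sorted_list_of_set S)"
  using S by (intro assms) (auto simp: strict_sorted_list_of_set)
qed

lemma ldr_lcoef: "ldr s (lcoef h F) = lcoef h (ldr s F)"
 and ldP_lcoef: "ldP i (lcoef h F) = lcoef h (ldP i F)"
 by (auto simp: lcoef_def ldr_def ldP_def fun_eq_iff)

lemma ev_lcoef: "ev (lcoef h F) p = h p * ev F p"
 by (simp add: lcoef_def ev_def)

lemma lone_words [simp]: "ev lone p = 1" "ldr s lone = 0" "ldP i lone = 0"
 by (auto simp: ev_def lone_def ldr_def ldP_def fun_eq_iff)

lemma loddvar_words: "ev (loddvar t) p = 0" "ev (ldr s (loddvar t)) p = (if s = t then 1 else 0)"
  "ldP i (loddvar t) = 0"
 by (auto simp: ev_def loddvar_def ldr_def ldP_def fun_eq_iff)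

lemma hom_lone: "hom 0 lone" and hom_loddvar: "hom 1 (loddvar t)" and hom_levenvar: "hom 2 (levenvar i)"
 by (rule suppI; auto simp: lone_def loddvar_def levenvar_def split: if_splits)+

lemma supp_lcoef: "supp Q F ==> supp Q (lcoef h F)"
 by (rule suppI) (auto simp: lcoef_def dest: suppD')

lemma levenvar_words: "ev (levenvar j) p = 0" "ldr s (levenvar j) = 0" "ev (ldP i (levenvar j)) p = (if i = j then 1 else 0)"
 by (auto simp: ev_def levenvar_def ldr_def ldP_def fun_eq_iff)

section \<open>Transformation of coefficients between two charts\<close>

locale chart_pair = split_bundle B A K
 for B :: "('m::{t2_space,second_countable_topology}, 'e::real_vector) qbundle"
  and A K :: "'m => 'e set" +
 fixes c c' :: "('m, 'e) achart" and p :: 'm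
 assumes c1: "c \<in> acharts B A K" and c2: "c' \<in> acharts B A K"
  and p1: "p \<in> cdom c" and p2: "p \<in> cdom c'"
begin

sublocale c1: adapted_chart B A K c using c1 by unfold_locales
sublocale c2: adapted_chart B A K c' using c2 by unfold_locales

abbreviation nn where "nn \<equiv> bdim B"
abbreviation od where "od \<equiv> new_odd B c c'"
abbreviation nP where "nP \<equiv> new_P B c c'"

text \<open>The coefficient of \<open>fr c s\<close> in \<open>fr c' t\<close>, and likewise that of
  the odd variable s in the new odd variable t. As A and K have separate frames, it is 0 for numbers
  of different parity.\<close>

definition M :: "nat => nat => 'm => real" where
 "M s t q = pair B q (fr c' t q) (fr c (dual s) q)"

definition J :: "nat => nat => real" where
 "J l j = ldx c' j (\<lambda>q. coord c q l) p"

definition Q :: "nat => nat => nat => real" where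
 "Q j s t = ev (ldr s (ldr t (nP j))) p"

lemma od_hom: "hom 1 (od t)"
 unfolding new_odd_def
 by (cases "even t") (simp_all only: if_True if_False, (intro supp_sum supp_lcoef hom_loddvar)+)

lemma ev_sum_lcoef_odd: "ev (ldr s (\<Sum>a<k. lcoef (h a) (loddvar (f a)))) p = (\<Sum>a<k. h a p * (if s = f a then 1 else 0))"
 by (simp add: ldr_sum ldr_lcoef ev_sum ev_lcoef loddvar_words)

lemma od_coeff:
 assumes "s < 2 * r" "t < 2 * r"
 shows "ev (ldr s (od t)) p = M s t p"
proof (cases "even t")
 case True
 have "ev (ldr s (od t)) p = (\<Sum>a<r. pair B p (frK c' (t div 2) p) (frA c a p) * (if s = xi a then 1 else 0))"
  using True by (simp add: new_odd_def ev_sum_lcoef_odd)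
 also have "\<dots> = M s t p"
 proof (cases "even s")
  case s: True
  have "(\<Sum>a<r. pair B p (frK c' (t div 2) p) (frA c a p) * (if s = xi a then 1 else 0))
   = (\<Sum>a<r. if a = s div 2 then pair B p (frK c' (t div 2) p) (frA c a p) else 0)"
   using s by (intro sum.cong) (auto simp: xi_def)
  then show ?thesis using s True assms by (auto simp: M_def fr_def)
 next
  case False
  then have "(\<Sum>a<r. pair B p (frK c' (t div 2) p) (frA c a p) * (if s = xi a then 1 else 0)) = 0"
   by (intro sum.neutral) (auto simp: xi_def)
  moreover have "M s t p = 0" unfolding M_def
   using False True assms p1 p2 by (intro K_iso c1.fr_K c2.fr_K) auto
  ultimately show ?thesis by simp
 qed
 finally show ?thesis .
next
 case False
 have "ev (ldr s (od t)) p = (\<Sum>a<r. pair B p (frA c' (t div 2) p) (frK c a p) * (if s = th a then 1 else 0))"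
  using False by (simp add: new_odd_def ev_sum_lcoef_odd)
 also have "\<dots> = M s t p"
 proof (cases "odd s")
  case s: True
  have "(\<Sum>a<r. pair B p (frA c' (t div 2) p) (frK c a p) * (if s = th a then 1 else 0))
   = (\<Sum>a<r. if a = s div 2 then pair B p (frA c' (t div 2) p) (frK c a p) else 0)"
   using s by (intro sum.cong) (auto simp: th_def)
  then show ?thesis using s False assms by (auto simp: M_def fr_def)
 next
  case s: False
  then have "(\<Sum>a<r. pair B p (frA c' (t div 2) p) (frK c a p) * (if s = th a then 1 else 0)) = 0"
   by (intro sum.neutral) (auto simp: th_def)
  moreover have "M s t p = 0" unfolding M_def
   using False s assms p1 p2 by (intro A_iso c1.fr_A c2.fr_A) auto
  ultimately show ?thesis by simp
 qed
 finally show ?thesis .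
qed

lemma od_words: "ldP i (od t) = 0" "ev (od t) p = 0" "ev (ldr s (ldr u (od t))) p = 0"
 "ev (ldr s (ldr u (ldr v (od t)))) p = 0"
 using c1.hom_neg_zero[OF hom_ldP[OF od_hom]] hom_zero[OF od_hom] by simp_all

lemma nP_hom: "hom 2 (nP j)"
 unfolding new_P_def
 by (intro supp_add supp_sum supp_lcoef hom_levenvar hom_lmul[OF hom_loddvar hom_loddvar, unfolded one_add_one])

lemma nP_P: "i < nn ==> ev (ldP i (nP j)) p = J i j"
 unfolding new_P_def
 by (simp add: ldP_add ldP_sum ldP_lcoef ev_sum ev_lcoef levenvar_words lcalc loddvar_words J_def
   if_distrib[of "(*) _"] cong: if_cong)

abbreviation dual_coeff :: "nat => nat => nat => real" where
 "dual_coeff j a b \<equiv> ldx c' j (\<lambda>q. pair B q (frK c a q) (frA c' b q)) p"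

lemma Q_eq: "Q j s t = (\<Sum>a<r. \<Sum>b<r. \<Sum>e<r. dual_coeff j a b * pair B p (frK c' b p) (frA c e p)
  * ((if s = xi e then 1 else 0) * (if t = th a then 1 else 0) - (if s = th a then 1 else 0) * (if t = xi e then 1 else 0)))"
 unfolding Q_def new_P_def
 by (simp add: ldr_add ldr_sum ldr_lcoef ev_sum ev_lcoef levenvar_words lcalc ev_lmul loddvar_words)
   (intro sum.cong refl; simp)

text \<open>w stands for an iterated derivative evaluated at p, which is linear over functions. In
  degree at most 3 a monomial contains at most one P, so two kinds of monomials remain.\<close>

lemma transition_word:
 fixes w :: "'m lfun => real"
 assumes w: "\<And>F G. w (F + G) = w F + w G" "w 0 = 0" "\<And>h F. w (lcoef h F) = h p * w F"
  and F: "hom k F" "k \<le> 3" "supp (\<lambda>m S. set_mset m \<subseteq> {..<nn} \<and> S \<subseteq> {..<2 * r}) F"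
 shows "w (transition B c c' F) =
  (\<Sum>S\<in>Pow {..<2 * r}. F ({#}, S) p * w (lmul lone (lprod (map od (sorted_list_of_set S))))) +
  (\<Sum>j<nn. \<Sum>S\<in>Pow {..<2 * r}. F ({#j#}, S) p * w (lmul (lmul (nP j) lone) (lprod (map od (sorted_list_of_set S)))))"
proof -
 have wsum: "w (\<Sum>x\<in>X. f x) = (\<Sum>x\<in>X. w (f x))" for X and f :: "nat multiset \<times> nat set => 'm lfun"
 proof (induction X rule: infinite_finite_induct)
  case (insert x X)
  then show ?case unfolding sum.insert[OF insert.hyps] w(1) by simp
 qed (simp_all only: sum.infinite sum.empty w(2) not_False_eq_True)
 define g where "g = (\<lambda>mS. case mS of (m, S) => F (m, S) p *
   w (lmul (lprod (map nP (sorted_list_of_multiset m))) (lprod (map od (sorted_list_of_set S)))))"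
 define X where "X = Pair {#} ` Pow {..<2 * r} \<union> (\<lambda>(j, S). ({#j#}, S)) ` ({..<nn} \<times> Pow {..<2 * r})"
 have sub: "{mS. F mS \<noteq> 0} \<subseteq> X"
 proof clarify
  fix m S assume nz: "F (m, S) \<noteq> 0"
  then have a: "finite S \<and> int (2 * size m + card S) = k" using F(1) unfolding supp_def by blast
  have b: "set_mset m \<subseteq> {..<nn} \<and> S \<subseteq> {..<2 * r}" using nz F(3) unfolding supp_def by blast
  have "size m \<le> 1" using a F(2) by linarith
  then consider "m = {#}" | j where "m = {#j#}"
   by (metis One_nat_def le_Suc_eq le_zero_eq size_1_singleton_mset size_eq_0_iff_empty)
  then show "(m, S) \<in> X" using b by cases (auto simp: X_def image_iff)
 qed
 have "w (transition B c c' F) = (\<Sum>mS\<in>{mS. F mS \<noteq> 0}. g mS)"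
  unfolding transition_def wsum by (intro sum.cong refl) (auto simp: g_def w(3) split: prod.splits)
 also have "\<dots> = (\<Sum>mS\<in>X. g mS)"
 proof (rule sum.mono_neutral_left[OF _ sub])
  show "finite X" unfolding X_def by simp
  show "\<forall>mS\<in>X - {mS. F mS \<noteq> 0}. g mS = 0" by (auto simp: g_def split: prod.splits)
 qed
 also have "\<dots> = (\<Sum>mS\<in>Pair {#} ` Pow {..<2 * r}. g mS) + (\<Sum>mS\<in>(\<lambda>(j, S). ({#j#}, S)) ` ({..<nn} \<times> Pow {..<2 * r}). g mS)"
  unfolding X_def by (rule sum.union_disjoint) auto
 also have "(\<Sum>mS\<in>Pair {#} ` Pow {..<2 * r}. g mS) =
  (\<Sum>S\<in>Pow {..<2 * r}. F ({#}, S) p * w (lmul lone (lprod (map od (sorted_list_of_set S)))))"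
  by (subst sum.reindex) (auto simp: inj_on_def g_def lprod_def intro!: sum.cong)
 also have "(\<Sum>mS\<in>(\<lambda>(j, S). ({#j#}, S)) ` ({..<nn} \<times> Pow {..<2 * r}). g mS) =
  (\<Sum>jS\<in>{..<nn} \<times> Pow {..<2 * r}. g ({#fst jS#}, snd jS))"
  by (subst sum.reindex) (auto simp: inj_on_def intro!: sum.cong)
 also have "\<dots> = (\<Sum>j<nn. \<Sum>S\<in>Pow {..<2 * r}. g ({#j#}, S))"
  by (simp add: sum.cartesian_product case_prod_beta)
 finally show ?thesis by (simp add: g_def lprod_def)
qed

lemma hom_transition:
 assumes "hom k F"
 shows "hom k (transition B c c' F)"
 unfolding transition_def
proof (rule supp_sum, clarify)
 fix m S assume nz: "F (m, S) \<noteq> 0"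
 have k: "finite S \<and> int (2 * size m + card S) = k" using nz assms unfolding supp_def by blast
 have 1: "hom (2 * int (length js)) (lprod (map nP js))" for js
 proof (induction js)
  case (Cons j js)
  then show ?case using hom_lmul[OF nP_hom[of j] Cons] by (simp add: lprod_def algebra_simps)
 next
  case Nil
  show ?case using hom_lone by (simp add: lprod_def)
 qed
 have 2: "hom (int (length js)) (lprod (map od js))" for js
 proof (induction js)
  case (Cons j js)
  then show ?case using hom_lmul[OF od_hom[of j] Cons] by (simp add: lprod_def algebra_simps)
 next
  case Nil
  show ?case using hom_lone by (simp add: lprod_def)
 qed
 have "length (sorted_list_of_multiset m) = size m" by (metis mset_sorted_list_of_multiset size_mset)
 then show "hom k (lcoef (F (m, S)) (lmul (lprod (map nP (sorted_list_of_multiset m))) (lprod (map od (sorted_list_of_set S)))))"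
  using hom_lmul[OF 1[of "sorted_list_of_multiset m"] 2[of "sorted_list_of_set S"]] k
  by (intro supp_lcoef) simp
qed

lemma rng_transition:
 shows "supp (\<lambda>m S. set_mset m \<subseteq> {..<nn} \<and> S \<subseteq> {..<2 * r}) (transition B c c' F)"
 unfolding transition_def
proof (rule supp_sum, clarify)
 fix m S
 let ?Q = "\<lambda>m S. set_mset m \<subseteq> {..<nn} \<and> S \<subseteq> {..<2 * r}"
 have l: "supp ?Q (lone :: 'm lfun)" by (rule suppI) (auto simp: lone_def split: if_splits)
 have o: "supp ?Q (loddvar (xi a) :: 'm lfun)" "supp ?Q (loddvar (th a) :: 'm lfun)" if "a < r" for a
  using that by (auto intro!: suppI simp: loddvar_def xi_def th_def split: if_splits)
 have e: "supp ?Q (levenvar i :: 'm lfun)" if "i < nn" for i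
  using that by (auto intro!: suppI simp: levenvar_def split: if_splits)
 have m: "supp ?Q (lmul X Y)" if "supp ?Q X" "supp ?Q Y" for X Y :: "'m lfun"
  using that by (rule supp_lmul) auto
 have od: "supp ?Q (od t)" for t unfolding new_odd_def by (auto intro!: supp_sum supp_lcoef o)
 have nP: "supp ?Q (nP j)" for j unfolding new_P_def
  by (intro supp_add supp_sum supp_lcoef e m o) auto
 have 1: "supp ?Q (lprod (map nP js))" for js
  by (induction js) (simp_all add: lprod_def l m nP)
 have 2: "supp ?Q (lprod (map od js))" for js
  by (induction js) (simp_all add: lprod_def l m od)
 show "supp ?Q (lcoef (F (m, S)) (lmul (lprod (map nP (sorted_list_of_multiset m))) (lprod (map od (sorted_list_of_set S)))))"
  by (intro supp_lcoef m 1 2)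
qed

context
 fixes F :: "'m lfun"
 assumes rng: "supp (\<lambda>m S. set_mset m \<subseteq> {..<nn} \<and> S \<subseteq> {..<2 * r}) F"
begin

lemma hom_sum_Pow:
 assumes "hom (int (2 * size m + k)) F"
 shows "(\<Sum>S\<in>Pow {..<2 * r}. F (m, S) p * g (sorted_list_of_set S)) = ssum (2 * r) k (\<lambda>xs. F (m, set xs) p * g xs)"
 unfolding ssum_def
proof (rule sum.cong[OF refl])
 fix S assume "S \<in> Pow {..<2 * r}"
 then have "finite S" using finite_subset[of S "{..<2 * r}"] by auto
 moreover have "F (m, S) = 0" if "card S \<noteq> k"
  by (rule suppD[OF assms]) (use that in auto)
 ultimately show "F (m, S) p * g (sorted_list_of_set S) =
  (if card S = k then F (m, set (sorted_list_of_set S)) p * g (sorted_list_of_set S) else 0)" by simp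
qed

lemma ssum_zero: "ssum n k (\<lambda>_. 0) = 0"
 by (simp add: ssum_def)

lemma transition_word0: "hom 0 F ==> ev (transition B c c' F) p = ev F p"
proof -
 assume h: "hom 0 F"
 have z: "F ({#j#}, S) = 0" for j S by (rule suppD[OF h]) simp
 show ?thesis
  using transition_word[where w = "\<lambda>F. ev F p" and k = 0, OF _ _ _ h _ rng]
   hom_sum_Pow[of "{#}" 0 "\<lambda>xs. ev (lmul lone (lprod (map od xs))) p"] h
  by (simp add: z ev_lcoef ssum_0 lprod_def ev_lmul) (simp add: ev_def)
qed

lemma transition_word1:
 assumes h: "hom 1 F" and s: "s < 2 * r"
 shows "ev (ldr s (transition B c c' F)) p = (\<Sum>t<2 * r. ev (ldr t F) p * M s t p)"
proof -
 have z: "F ({#j#}, S) = 0" for j S by (rule suppD[OF h]) simp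
 show ?thesis
  using transition_word[where w = "\<lambda>F. ev (ldr s F) p" and k = 1, OF _ _ _ h _ rng]
   hom_sum_Pow[of "{#}" 1 "\<lambda>xs. ev (ldr s (lmul lone (lprod (map od xs)))) p"] h s
  by (simp add: z ldr_lcoef ldr_add ev_lcoef ssum_1[unfolded One_nat_def] ssum_1 lprod_def ev_lmul lcalc od_coeff ev_ldr[of _ F])
qed

lemma transition_word2:
 assumes h: "hom 2 F" and P: "\<And>j S. F ({#j#}, S) = 0" and s: "s < 2 * r" "t < 2 * r"
 shows "ev (ldr s (ldr t (transition B c c' F))) p = (\<Sum>a<2 * r. \<Sum>b<2 * r. ev (ldr a (ldr b F)) p * M s a p * M t b p)"
proof -
 let ?w = "\<lambda>F. ev (ldr s (ldr t F)) p"
 have "?w (transition B c c' F) = ssum (2 * r) 2 (\<lambda>xs. F ({#}, set xs) p * ?w (lmul lone (lprod (map od xs))))"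
  using transition_word[where w = ?w and k = 2, OF _ _ _ h _ rng]
   hom_sum_Pow[of "{#}" 2 "\<lambda>xs. ?w (lmul lone (lprod (map od xs)))"] h
  by (simp add: P ldr_lcoef ldr_add ev_lcoef)
 also have "\<dots> = ssum (2 * r) 2 (\<lambda>xs. ev (ldr (xs ! 0) (ldr (xs ! 1) F)) p * M s (xs ! 0) p * M t (xs ! 1) p
   + ev (ldr (xs ! 1) (ldr (xs ! 0) F)) p * M s (xs ! 1) p * M t (xs ! 0) p)"
 proof (rule ssum_cong)
  fix xs :: "nat list" assume xs: "length xs = 2" "sorted_wrt (<) xs" "set xs \<subseteq> {..<2 * r}"
  then obtain a b where ab: "xs = [a, b]"
   by (metis (no_types) length_0_conv length_Suc_conv numeral_2_eq_2)
  have "a < b" "a < 2 * r" "b < 2 * r" using xs ab by auto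
  then show "F ({#}, set xs) p * ?w (lmul lone (lprod (map od xs))) =
   ev (ldr (xs ! 0) (ldr (xs ! 1) F)) p * M s (xs ! 0) p * M t (xs ! 1) p
   + ev (ldr (xs ! 1) (ldr (xs ! 0) F)) p * M s (xs ! 1) p * M t (xs ! 0) p"
   using ev_ldr_swap[of b a F p] s
   by (simp add: ab lprod_def ordered_coeff2 ev_lmul lcalc od_words od_coeff algebra_simps flip: ev_def)
 qed
 also have "\<dots> = (\<Sum>a<2 * r. \<Sum>b<2 * r. ev (ldr a (ldr b F)) p * M s a p * M t b p)"
  by (rule double_sum_ssum[symmetric]) (simp add: ev_ldr_same)
 finally show ?thesis .
qed

text \<open>Monomials with one P_j and one odd variable contribute as well, through the part of the
  new P_j that is quadratic in the odd variables. The three terms tell which of s, t, u falls on the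
  odd variable.\<close>

lemma transition_word3:
 assumes h: "hom 3 F" and s: "s < 2 * r" "t < 2 * r" "u < 2 * r"
 shows "ev (ldr s (ldr t (ldr u (transition B c c' F)))) p =
  (\<Sum>a<2 * r. \<Sum>b<2 * r. \<Sum>d<2 * r. ev (ldr a (ldr b (ldr d F))) p * M s a p * M t b p * M u d p)
  + (\<Sum>j<nn. \<Sum>a<2 * r. ev (ldP j (ldr a F)) p * (Q j s t * M u a p - Q j s u * M t a p + Q j t u * M s a p))"
proof -
 let ?w = "\<lambda>F. ev (ldr s (ldr t (ldr u F))) p"
 have h1: "hom (int (2 * size {#j#} + 1)) F" for j :: nat using h by simp
 have h3: "hom (int (2 * size {#} + 3)) F" using h by simp
 have "?w (transition B c c' F) = ssum (2 * r) 3 (\<lambda>xs. F ({#}, set xs) p * ?w (lmul lone (lprod (map od xs))))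
  + (\<Sum>j<nn. ssum (2 * r) 1 (\<lambda>xs. F ({#j#}, set xs) p * ?w (lmul (lmul (nP j) lone) (lprod (map od xs)))))"
  using transition_word[where w = ?w and k = 3, OF _ _ _ h _ rng]
   hom_sum_Pow[OF h3, of "\<lambda>xs. ?w (lmul lone (lprod (map od xs)))"]
   hom_sum_Pow[OF h1, of _ "\<lambda>xs. ?w (lmul (lmul (nP _) lone) (lprod (map od xs)))"]
  by (simp add: ldr_lcoef ldr_add ev_lcoef)
 also have "ssum (2 * r) 3 (\<lambda>xs. F ({#}, set xs) p * ?w (lmul lone (lprod (map od xs)))) =
  (\<Sum>a<2 * r. \<Sum>b<2 * r. \<Sum>d<2 * r. ev (ldr a (ldr b (ldr d F))) p * M s a p * M t b p * M u d p)"
 proof (subst triple_sum_ssum)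
  let ?C = "\<lambda>a b d. ev (ldr a (ldr b (ldr d F))) p"
  show "?C a a b * M s a p * M t a p * M u b p = 0" "?C a b a * M s a p * M t b p * M u a p = 0"
   "?C b a a * M s b p * M t a p * M u a p = 0" for a b by (simp_all add: ev_ldr_same)
  show "ssum (2 * r) 3 (\<lambda>xs. F ({#}, set xs) p * ?w (lmul lone (lprod (map od xs)))) =
   ssum (2 * r) 3 (\<lambda>xs.
   ?C (xs ! 0) (xs ! 1) (xs ! 2) * M s (xs ! 0) p * M t (xs ! 1) p * M u (xs ! 2) p +
   ?C (xs ! 1) (xs ! 0) (xs ! 2) * M s (xs ! 1) p * M t (xs ! 0) p * M u (xs ! 2) p +
   (?C (xs ! 0) (xs ! 2) (xs ! 1) * M s (xs ! 0) p * M t (xs ! 2) p * M u (xs ! 1) p +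
   ?C (xs ! 1) (xs ! 2) (xs ! 0) * M s (xs ! 1) p * M t (xs ! 2) p * M u (xs ! 0) p) +
   (?C (xs ! 2) (xs ! 0) (xs ! 1) * M s (xs ! 2) p * M t (xs ! 0) p * M u (xs ! 1) p +
   ?C (xs ! 2) (xs ! 1) (xs ! 0) * M s (xs ! 2) p * M t (xs ! 1) p * M u (xs ! 0) p))"
  proof (rule ssum_cong)
   fix xs :: "nat list" assume xs: "length xs = 3" "sorted_wrt (<) xs" "set xs \<subseteq> {..<2 * r}"
   then obtain a b d where ab: "xs = [a, b, d]"
    by (metis (no_types) length_0_conv length_Suc_conv numeral_3_eq_3)
   have l: "a < b" "b < d" "a < 2 * r" "b < 2 * r" "d < 2 * r" using xs ab by auto
   have p1: "?C b a d = - ?C a b d" "?C a d b = - ?C a b d" "?C b d a = ?C a b d"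
     "?C d a b = ?C a b d" "?C d b a = - ?C a b d"
    using ev_ldr_swap[of b a "ldr d F" p] ev_ldr_swap3[of a d b F p]
     ev_ldr_swap3[of b d a F p] ev_ldr_swap[of d a "ldr b F" p] ev_ldr_swap3[of d b a F p] by auto
   show "F ({#}, set xs) p * ?w (lmul lone (lprod (map od xs))) =
    ?C (xs ! 0) (xs ! 1) (xs ! 2) * M s (xs ! 0) p * M t (xs ! 1) p * M u (xs ! 2) p +
    ?C (xs ! 1) (xs ! 0) (xs ! 2) * M s (xs ! 1) p * M t (xs ! 0) p * M u (xs ! 2) p +
    (?C (xs ! 0) (xs ! 2) (xs ! 1) * M s (xs ! 0) p * M t (xs ! 2) p * M u (xs ! 1) p +
    ?C (xs ! 1) (xs ! 2) (xs ! 0) * M s (xs ! 1) p * M t (xs ! 2) p * M u (xs ! 0) p) +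
    (?C (xs ! 2) (xs ! 0) (xs ! 1) * M s (xs ! 2) p * M t (xs ! 0) p * M u (xs ! 1) p +
    ?C (xs ! 2) (xs ! 1) (xs ! 0) * M s (xs ! 2) p * M t (xs ! 1) p * M u (xs ! 0) p)"
    using s l p1
    by (simp add: ab lprod_def ordered_coeff3 ev_lmul lcalc od_words od_coeff algebra_simps numeral_2_eq_2 flip: ev_def)
  qed
 qed
 also have "(\<Sum>j<nn. ssum (2 * r) 1 (\<lambda>xs. F ({#j#}, set xs) p * ?w (lmul (lmul (nP j) lone) (lprod (map od xs))))) =
  (\<Sum>j<nn. \<Sum>a<2 * r. ev (ldP j (ldr a F)) p * (Q j s t * M u a p - Q j s u * M t a p + Q j t u * M s a p))"
 proof (intro sum.cong refl, unfold ssum_1, intro sum.cong refl)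
  fix j a assume a: "a \<in> {..<2 * r}"
  have "F ({#j#}, {a}) = ev (ldP j (ldr a F))" by (auto simp: ev_def ldP_def ldr_def fun_eq_iff)
  then show "F ({#j#}, set [a]) p * ?w (lmul (lmul (nP j) lone) (lprod (map od [a]))) =
   ev (ldP j (ldr a F)) p * (Q j s t * M u a p - Q j s u * M t a p + Q j t u * M s a p)"
   using s a by (simp add: lprod_def ev_lmul lcalc od_words od_coeff hom_zero[OF nP_hom] flip: Q_def)
 qed
 finally show ?thesis .
qed

lemma transition_wordP:
 assumes h: "hom 3 F" and s: "s < 2 * r" "i < nn"
 shows "ev (ldP i (ldr s (transition B c c' F))) p = (\<Sum>j<nn. \<Sum>a<2 * r. ev (ldP j (ldr a F)) p * J i j * M s a p)"
proof -
 let ?w = "\<lambda>F. ev (ldP i (ldr s F)) p"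
 have h1: "hom (int (2 * size {#j#} + 1)) F" for j :: nat using h by simp
 have h3: "hom (int (2 * size {#} + 3)) F" using h by simp
 have "?w (transition B c c' F) = ssum (2 * r) 3 (\<lambda>xs. F ({#}, set xs) p * ?w (lmul lone (lprod (map od xs))))
  + (\<Sum>j<nn. ssum (2 * r) 1 (\<lambda>xs. F ({#j#}, set xs) p * ?w (lmul (lmul (nP j) lone) (lprod (map od xs)))))"
  using transition_word[where w = ?w and k = 3, OF _ _ _ h _ rng]
   hom_sum_Pow[OF h3, of "\<lambda>xs. ?w (lmul lone (lprod (map od xs)))"]
   hom_sum_Pow[OF h1, of _ "\<lambda>xs. ?w (lmul (lmul (nP _) lone) (lprod (map od xs)))"]
  by (simp add: ldr_lcoef ldr_add ev_lcoef ldP_add ldP_lcoef)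
 also have "ssum (2 * r) 3 (\<lambda>xs. F ({#}, set xs) p * ?w (lmul lone (lprod (map od xs)))) = ssum (2 * r) 3 (\<lambda>xs. 0)"
 proof (rule ssum_cong)
  fix xs :: "nat list" assume xs: "length xs = 3"
  then obtain a b d where ab: "xs = [a, b, d]"
   by (metis (no_types) length_0_conv length_Suc_conv numeral_3_eq_3)
  have z: "ldP i (ldr s (od t)) = 0" for t using ldr_ldP[of s i "od t"] od_words(1) by simp
  show "F ({#}, set xs) p * ?w (lmul lone (lprod (map od xs))) = 0"
   by (simp add: ab lprod_def ev_lmul lcalc od_words z)
 qed
 also have "\<dots> = 0" by (rule ssum_zero)
 also have "(\<Sum>j<nn. ssum (2 * r) 1 (\<lambda>xs. F ({#j#}, set xs) p * ?w (lmul (lmul (nP j) lone) (lprod (map od xs))))) =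
  (\<Sum>j<nn. \<Sum>a<2 * r. ev (ldP j (ldr a F)) p * J i j * M s a p)"
 proof (intro sum.cong refl, unfold ssum_1, intro sum.cong refl)
  fix j a assume a: "a \<in> {..<2 * r}"
  have "F ({#j#}, {a}) = ev (ldP j (ldr a F))" by (auto simp: ev_def ldP_def ldr_def fun_eq_iff)
  then show "F ({#j#}, set [a]) p * ?w (lmul (lmul (nP j) lone) (lprod (map od [a]))) =
   ev (ldP j (ldr a F)) p * J i j * M s a p"
   using s a by (simp add: lprod_def ev_lmul lcalc od_words od_coeff nP_P hom_zero[OF nP_hom])
 qed
 finally show ?thesis by simp
qed

end

end

section \<open>The derived bracket in one chart\<close>

context adapted_chart begin

definition vc :: "'e => nat => 'm => real" where
 "vc v s q = pair B q v (fr c (dual s) q)"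

definition co :: "('m => 'e) => nat => 'm => real" where
 "co e s q = vc (e q) s q"

text \<open>The l-th coordinate of the anchor of v.\<close>

definition an :: "'m lfun => 'e => nat => 'm => real" where
 "an Y v l q = (\<Sum>s<2 * r. Rc Y l (dual s) q * vc v s q)"

text \<open>The componentwise derivative of e, paired with w. It is the flat connection of the frame
  and therefore depends on the chart.\<close>

definition Dl :: "nat => ('m => 'e) => 'e => 'm => real" where
 "Dl l e w q = (\<Sum>s<2 * r. ldx c l (co e s) q * vc w (dual s) q)"

definition C3 :: "'m lfun => 'e => 'e => 'e => 'm => real" where
 "C3 Y u v w q = (\<Sum>s<2 * r. \<Sum>t<2 * r. \<Sum>x<2 * r.
   Cc Y (dual s) (dual t) (dual x) q * vc u s q * vc v t q * vc w x q)"

text \<open>The pairing with \<open>w\<close> of the section \<open>{{Y, e1}, e2}\<close>.\<close>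

definition TT :: "'m lfun => ('m => 'e) => ('m => 'e) => 'e => 'm => real" where
 "TT Y e1 e2 w q = (\<Sum>l<nn. an Y (e1 q) l q * Dl l e2 w q - an Y (e2 q) l q * Dl l e1 w q
   + an Y w l q * Dl l e1 (e2 q) q) + C3 Y w (e2 q) (e1 q) q"

lemma sec_at: "q \<in> Oc ==> sec B A K e c mS q = (\<Sum>s<2 * r. co e s q * loddvar s mS q)"
proof -
 assume q: "q \<in> Oc"
 have "(\<Sum>s<2 * r. co e s q * loddvar s mS q) = (\<Sum>a<r. co e (xi a) q * loddvar (xi a) mS q + co e (th a) q * loddvar (th a) mS q)"
  by (rule sum_even_odd)
 also have "\<dots> = sec B A K e c mS q"
  using q c by (simp add: sec_def co_def vc_def fr_def) (simp add: xi_def th_def add.commute)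
 finally show ?thesis ..
qed

lemma sec_out: "q \<notin> Oc ==> sec B A K e c mS q = 0"
 by (simp add: sec_def)

lemma hom_sec: "hom 1 (sec B A K e c)"
proof (rule suppI)
 fix m S q assume "sec B A K e c (m, S) q \<noteq> 0"
 then have "q \<in> Oc" "(\<Sum>s<2 * r. co e s q * loddvar s (m, S) q) \<noteq> 0" using sec_out sec_at by metis+
 then obtain s where "loddvar s (m, S) q \<noteq> 0"
  by (metis (no_types, lifting) mult_not_zero sum.not_neutral_contains_not_neutral)
 then show "finite S \<and> int (2 * size m + card S) = 1" by (auto simp: loddvar_def split: if_splits)
qed

lemma rng_sec: "supp (\<lambda>m S. set_mset m \<subseteq> {..<nn} \<and> S \<subseteq> {..<2 * r}) (sec B A K e c)"
proof (rule suppI)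
 fix m S q assume "sec B A K e c (m, S) q \<noteq> 0"
 then have "q \<in> Oc" "(\<Sum>s<2 * r. co e s q * loddvar s (m, S) q) \<noteq> 0" using sec_out sec_at by metis+
 then obtain s where "s \<in> {..<2 * r}" "loddvar s (m, S) q \<noteq> 0"
  by (metis (no_types, lifting) mult_not_zero sum.not_neutral_contains_not_neutral)
 then show "set_mset m \<subseteq> {..<nn} \<and> S \<subseteq> {..<2 * r}" by (auto simp: loddvar_def split: if_splits)
qed

lemma sec_coeff: "q \<in> Oc ==> s < 2 * r ==> ev (ldr s (sec B A K e c)) q = co e s q"
proof -
 assume q: "q \<in> Oc" and s: "s < 2 * r"
 have "ev (ldr s (sec B A K e c)) q = (\<Sum>t<2 * r. co e t q * loddvar t ({#}, {s}) q)"
  using q by (simp add: ev_ldr sec_at)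
 also have "\<dots> = (\<Sum>t<2 * r. if t = s then co e t q else 0)"
  by (intro sum.cong) (auto simp: loddvar_def)
 finally show ?thesis using s by simp
qed

lemma smooth_co: "e \<in> sections B D ==> s < 2 * r ==> smooth B Oc (co e s)"
 unfolding co_def vc_def
 by (rule comp_smooth[OF cdata(1) order_refl]) (auto intro: sectionsD(2))

lemma sm_sec:
 assumes "e \<in> sections B D"
 shows "sm Oc (sec B A K e c)"
 unfolding sm_def
proof
 fix mS
 have o: "smooth B Oc (\<lambda>q. loddvar s mS q)" for s
  by (cases mS) (simp add: loddvar_def smooth_const cdata(1))
 have "smooth B Oc (\<lambda>q. \<Sum>s<2 * r. co e s q * loddvar s mS q)"
  by (intro smooth_sum smooth_mult smooth_co[OF assms] o cdata(1)) auto
 then show "smooth B Oc (sec B A K e c mS)"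
  by (rule smooth_cong[OF cdata(1)]) (simp add: sec_at)
qed

lemma ldx_sec: "p \<in> Oc ==> l < nn ==> s < 2 * r ==> ldx c l (ev (ldr s (sec B A K e c))) p = ldx c l (co e s) p"
 by (rule ldx_cong[OF cdata(1)]) (auto simp: sec_coeff)

text \<open>In a frame with constant pairings the bracket is the derivative of e2 along the anchor
  of e1, minus the derivative of e1 along the anchor of e2, plus the adjoint term <D e1, e2>, plus
  the cubic part.\<close>

lemma derived_TT:
 assumes Y: "hom 3 Y" and p: "p \<in> Oc" and e: "e1 \<in> sections B D1" "e2 \<in> sections B D2"
 shows "(\<Sum>s<2 * r. ev (ldr s (lpb (lpb Y (sec B A K e1 c)) (sec B A K e2 c))) p * vc w (dual s) p) = TT Y e1 e2 w p"
proof -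
 let ?X = "lpb Y (sec B A K e1 c)"
 have hX: "hom 2 ?X" using hom_lpb[OF Y hom_sec, of e1] by simp
 note W1 = sm_sec[OF e(1)] cdata(1) p order_refl
 note W2 = sm_sec[OF e(2)] cdata(1) p order_refl
 have X1: "ev (ldP l ?X) p = an Y (e1 p) l p" for l
  unfolding bracket_section_coeffs(1)[OF Y hom_sec W1] an_def
  by (intro sum.cong refl) (use p in \<open>simp add: sec_coeff\<close>, simp add: co_def)
 have X2: "ev (ldr s (ldr t ?X)) p = (\<Sum>l<nn. Rc Y l s p * ldx c l (co e1 t) p - Rc Y l t p * ldx c l (co e1 s) p)
   + (\<Sum>u<2 * r. Cc Y s t (dual u) p * vc (e1 p) u p)" if "s < 2 * r" "t < 2 * r" for s t
  unfolding bracket_section_coeffs(2)[OF Y hom_sec W1]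
  using that p by (intro arg_cong2[of _ _ _ _ "(+)"] sum.cong refl) (simp_all add: ldx_sec sec_coeff, simp add: co_def)
 have D: "ev (ldr s (lpb ?X (sec B A K e2 c))) p = (\<Sum>l<nn. an Y (e1 p) l p * ldx c l (co e2 s) p)
   + (\<Sum>t<2 * r. ((\<Sum>l<nn. Rc Y l s p * ldx c l (co e1 (dual t)) p - Rc Y l (dual t) p * ldx c l (co e1 s) p)
   + (\<Sum>u<2 * r. Cc Y s (dual t) (dual u) p * vc (e1 p) u p)) * vc (e2 p) t p)" if s: "s < 2 * r" for s
  unfolding derived_coeffs[OF hX hom_sec W2] X1
  using s p by (intro arg_cong2[of _ _ _ _ "(+)"] sum.cong refl) (simp_all add: ldx_sec sec_coeff X2, simp add: co_def)
 let ?w = "\<lambda>s. vc w (dual s) p"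
 have "(\<Sum>s<2 * r. ev (ldr s (lpb ?X (sec B A K e2 c))) p * ?w s) =
  (\<Sum>s<2 * r. \<Sum>l<nn. an Y (e1 p) l p * ldx c l (co e2 s) p * ?w s)
  + (\<Sum>s<2 * r. \<Sum>t<2 * r. \<Sum>l<nn. (Rc Y l s p * ?w s) * (ldx c l (co e1 (dual t)) p * vc (e2 p) t p))
  - (\<Sum>s<2 * r. \<Sum>t<2 * r. \<Sum>l<nn. (Rc Y l (dual t) p * vc (e2 p) t p) * (ldx c l (co e1 s) p * ?w s))
  + (\<Sum>s<2 * r. \<Sum>t<2 * r. \<Sum>u<2 * r. Cc Y s (dual t) (dual u) p * ?w s * vc (e2 p) t p * vc (e1 p) u p)"
  (is "_ = ?S1 + ?S2 - ?S3 + ?S4")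
 proof -
  have "(\<Sum>s<2 * r. ev (ldr s (lpb ?X (sec B A K e2 c))) p * ?w s) =
   (\<Sum>s<2 * r. ((\<Sum>l<nn. an Y (e1 p) l p * ldx c l (co e2 s) p)
   + (\<Sum>t<2 * r. ((\<Sum>l<nn. Rc Y l s p * ldx c l (co e1 (dual t)) p - Rc Y l (dual t) p * ldx c l (co e1 s) p)
   + (\<Sum>u<2 * r. Cc Y s (dual t) (dual u) p * vc (e1 p) u p)) * vc (e2 p) t p)) * ?w s)"
   by (rule sum.cong[OF refl]) (simp only: D lessThan_iff)
  also have "\<dots> = ?S1 + ?S2 - ?S3 + ?S4"
   by (simp only: distrib_right sum_distrib_right left_diff_distrib sum.distrib sum_subtractf) (simp add: mult_ac)
  finally show ?thesis .
 qed
 moreover have "?S1 = (\<Sum>l<nn. an Y (e1 p) l p * Dl l e2 w p)"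
  by (subst sum.swap) (simp add: Dl_def sum_distrib_left mult.assoc)
 moreover have "?S2 = (\<Sum>l<nn. an Y w l p * Dl l e1 (e2 p) p)"
 proof -
  have a: "(\<Sum>s<2 * r. Rc Y l s p * ?w s) = an Y w l p" for l
   unfolding an_def by (subst sum_dual[symmetric]) simp
  have b: "(\<Sum>t<2 * r. ldx c l (co e1 (dual t)) p * vc (e2 p) t p) = Dl l e1 (e2 p) p" for l
   unfolding Dl_def by (subst sum_dual[symmetric]) simp
  have "?S2 = (\<Sum>l<nn. (\<Sum>s<2 * r. Rc Y l s p * ?w s) * (\<Sum>t<2 * r. ldx c l (co e1 (dual t)) p * vc (e2 p) t p))"
   by (simp add: sum_product) (subst sum.swap, rule sum.cong[OF refl], subst sum.swap, rule refl)
  then show ?thesis unfolding a b .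
 qed
 moreover have "?S3 = (\<Sum>l<nn. an Y (e2 p) l p * Dl l e1 w p)"
 proof -
  have "?S3 = (\<Sum>l<nn. (\<Sum>t<2 * r. Rc Y l (dual t) p * vc (e2 p) t p) * (\<Sum>s<2 * r. ldx c l (co e1 s) p * ?w s))"
   by (simp add: sum_product)
    (subst sum.swap, rule trans[OF sum.cong[OF refl sum.swap]], subst sum.swap, rule sum.cong[OF refl], rule refl)
  then show ?thesis by (simp add: an_def Dl_def)
 qed
 moreover have "?S4 = C3 Y w (e2 p) (e1 p) p"
  unfolding C3_def by (subst sum_dual[symmetric]) simp
 ultimately show ?thesis by (simp add: TT_def sum.distrib sum_subtractf)
qed

end

section \<open>Global functions\<close>

context split_bundle begin

lemma Cfun_hom: "f \<in> Cfun B A K k ==> hom k (f c)"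
proof (rule suppI)
 fix m S q assume f: "f \<in> Cfun B A K k" and nz: "f c (m, S) q \<noteq> 0"
 have c: "c \<in> acharts B A K"
 proof (rule ccontr)
  assume "c \<notin> acharts B A K"
  then have "f c = 0" using f by (simp add: Cfun_def)
  then show False using nz by simp
 qed
 have "f c (m, S) \<noteq> 0" using nz by (metis zero_fun_apply)
 then have "S \<subseteq> {..<2 * r} \<and> int (2 * size m + card S) = k" using f c unfolding Cfun_def by blast
 then show "finite S \<and> int (2 * size m + card S) = k" using finite_subset by blast
qed

lemma Cfun_rng: "f \<in> Cfun B A K k ==> c \<in> acharts B A K ==>
  supp (\<lambda>m S. set_mset m \<subseteq> {..<bdim B} \<and> S \<subseteq> {..<2 * r}) (f c)"
 unfolding supp_def Cfun_def by blast

lemma Cfun_smooth: "f \<in> Cfun B A K k ==> c \<in> acharts B A K ==> smooth B (cdom c) (f c mS)"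
 unfolding Cfun_def by (cases mS) blast

lemma Cfun_out: "f \<in> Cfun B A K k ==> c \<in> acharts B A K ==> q \<notin> cdom c ==> f c mS q = 0"
 unfolding Cfun_def by (cases mS) blast

lemma Cfun_nochart: "f \<in> Cfun B A K k ==> c \<notin> acharts B A K ==> f c = 0"
 unfolding Cfun_def by blast

lemma Cfun_trans: "f \<in> Cfun B A K k ==> c \<in> acharts B A K ==> c' \<in> acharts B A K ==>
  q \<in> cdom c ==> q \<in> cdom c' ==> f c mS q = transition B c c' (f c') mS q"
 unfolding Cfun_def by blast

end

section \<open>Independence of the derived bracket from the chart\<close>

context chart_pair begin

abbreviation Ov where "Ov \<equiv> cdom c \<inter> cdom c'"

lemma openOv: "open Ov" using c1.cdata(1) c2.cdata(1) by (rule open_Int)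

lemma vc_change:
 assumes "q \<in> Ov" "v \<in> fib B q" "s < 2 * r"
 shows "c1.vc v s q = (\<Sum>t<2 * r. M s t q * c2.vc v t q)"
proof -
 have q: "q \<in> cdom c" "q \<in> cdom c'" using assms by auto
 have f: "fr c (dual s) q \<in> fib B q" using c1.fr_fib q assms by simp
 have "c1.vc v s q = pair B q (\<Sum>t<2 * r. pair B q v (fr c' (dual t) q) *\<^sub>R fr c' t q) (fr c (dual s) q)"
  using c2.fr_expand[OF q(2) assms(2)] by (simp add: c1.vc_def)
 also have "\<dots> = (\<Sum>t<2 * r. pair B q v (fr c' (dual t) q) * pair B q (fr c' t q) (fr c (dual s) q))"
  by (rule pair_sum) (use c2.fr_fib[OF q(2)] f in auto)
 finally show ?thesis by (simp add: M_def c2.vc_def mult.commute)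
qed

lemma M_vc:
 assumes "q \<in> Ov" "v \<in> fib B q" "t < 2 * r"
 shows "(\<Sum>s<2 * r. M (dual s) t q * c1.vc v s q) = c2.vc v (dual t) q"
proof -
 have q: "q \<in> cdom c" "q \<in> cdom c'" using assms by auto
 have f: "fr c' t q \<in> fib B q" using c2.fr_fib q assms by simp
 have "c2.vc v (dual t) q = pair B q v (fr c' t q)" by (simp add: c2.vc_def)
 also have "\<dots> = (\<Sum>s<2 * r. pair B q v (fr c (dual s) q) * pair B q (fr c' t q) (fr c s q))"
  by (rule c1.pair_expand[OF q(1) assms(2) f])
 finally show ?thesis by (simp add: M_def c1.vc_def mult.commute)
qed

lemma M_vc': "q \<in> Ov ==> v \<in> fib B q ==> t < 2 * r ==>
  (\<Sum>s<2 * r. M s t q * c1.vc v (dual s) q) = c2.vc v (dual t) q"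
 using M_vc[of q v t] by (subst sum_dual[symmetric]) simp

lemma M_orth:
 assumes "q \<in> Ov" "s < 2 * r" "t < 2 * r"
 shows "(\<Sum>y<2 * r. M s y q * M t (dual y) q) = (if t = dual s then 1 else 0)"
proof -
 have q: "q \<in> cdom c" "q \<in> cdom c'" and l: "dual s < 2 * r" "dual t < 2 * r" using assms by auto
 note f = c1.fr_fib[OF q(1) l(1)] c1.fr_fib[OF q(1) l(2)]
 have "(\<Sum>y<2 * r. M s y q * M t (dual y) q) = (\<Sum>y<2 * r. M t y q * M s (dual y) q)"
  by (subst sum_dual[symmetric]) (simp add: mult.commute)
 also have "\<dots> = pair B q (fr c (dual s) q) (fr c (dual t) q)"
  unfolding c2.pair_expand[OF q(2) f] M_def
  by (rule sum.cong[OF refl]) (simp add: pair_sym[OF f(1) c2.fr_fib[OF q(2)]] pair_sym[OF f(2) c2.fr_fib[OF q(2)]])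
 finally show ?thesis using c1.fr_pair[OF q(1) l] by (auto simp: dual_eq_iff[of "t", symmetric])
qed

lemma M_parity: "q \<in> Ov ==> s < 2 * r ==> t < 2 * r ==> even s \<noteq> even t ==> M s t q = 0"
 unfolding M_def using K_iso[OF c2.fr_K c1.fr_K] A_iso[OF c2.fr_A c1.fr_A] by (cases "even t") auto

lemma M_smooth: "s < 2 * r ==> t < 2 * r ==> smooth B Ov (M s t)"
 unfolding M_def
 by (rule pair_smooth[OF openOv local_section_subset[OF c2.fr_section] local_section_subset[OF c1.fr_section]]) auto

lemma pOv: "p \<in> Ov" using p1 p2 by simp

lemma M_pdiff: "s < 2 * r ==> t < 2 * r ==> j < nn ==> c2.C.pdiff j (M s t) p"
 by (rule c2.smooth_pdiffC[OF M_smooth openOv pOv p2])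

definition dM :: "nat => nat => nat => real" where
 "dM j s t = ldx c' j (M s t) p"

text \<open>The matrix (dM) M^(-1) of the change of frame, with one index lowered by the pairing: by
  \<open>M_orth\<close>, M with dual indices serves as the inverse.\<close>

definition Wc :: "nat => nat => nat => real" where
 "Wc j s t = (\<Sum>y<2 * r. dM j s y * M t (dual y) p)"

lemma dM_parity: "s < 2 * r ==> t < 2 * r ==> j < nn ==> even s \<noteq> even t ==> dM j s t = 0"
 unfolding dM_def using c2.ldx_cong[OF openOv pOv p2, of j "M s t" "\<lambda>_. 0"] M_parity c2.ldx_const by simp

text \<open>Derivative of the relation \<open>M_orth\<close>, which expresses that M preserves the
  constant pairing.\<close>

lemma Wc_antisym:
 assumes "s < 2 * r" "t < 2 * r" "j < nn"
 shows "Wc j s t = - Wc j t s"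
proof -
 have "0 = ldx c' j (\<lambda>q. if t = dual s then 1 else 0) p" by (simp add: c2.ldx_const)
 also have "\<dots> = ldx c' j (\<lambda>q. \<Sum>y<2 * r. M s y q * M t (dual y) q) p"
  by (rule c2.ldx_cong[OF openOv pOv p2 assms(3)]) (use M_orth[OF _ assms(1,2)] p1 in auto)
 also have "\<dots> = (\<Sum>y<2 * r. dM j s y * M t (dual y) p + M s y p * dM j t (dual y))"
  unfolding dM_def using assms p2 M_pdiff
  by (subst c2.ldx_sum) (auto intro!: c2.pdiff_mult sum.cong c2.ldx_mult)
 also have "\<dots> = Wc j s t + (\<Sum>y<2 * r. M s y p * dM j t (dual y))" by (simp add: sum.distrib Wc_def)
 also have "(\<Sum>y<2 * r. M s y p * dM j t (dual y)) = Wc j t s"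
  unfolding Wc_def by (subst sum_dual[symmetric]) (simp add: mult.commute)
 finally show ?thesis by simp
qed

text \<open>The part of the new P that is quadratic in the odd variables comes from differentiating
  \<xi> as a function of (x', \<xi>') and inserting \<xi>'. This multiplies the derivative of M by
  its inverse, so the coefficients are those of \<open>Wc\<close>.\<close>

lemma Q_W:
 assumes l: "s < 2 * r" "t < 2 * r" "j < nn"
 shows "Q j s t = Wc j t s"
proof -
 have 1: "Q j s t = Wc j t s" if l: "s < 2 * r" "t < 2 * r" and eo: "even s" "odd t" for s t
 proof -
  define e a where "e = s div 2" and "a = t div 2"
  have ea: "s = xi e" "t = th a" "e < r" "a < r" using l eo by (auto simp: e_def a_def xi_def th_def)
  have ne: "xi x \<noteq> th y" for x y by (simp add: xi_def th_def) presburger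
  have inj: "xi x = xi y \<longleftrightarrow> x = y" "th x = th y \<longleftrightarrow> x = y" for x y by (simp_all add: xi_def th_def)
  have "Q j s t = (\<Sum>a'<r. \<Sum>b<r. \<Sum>e'<r. if e' = e then (if a' = a then dual_coeff j a b * pair B p (frK c' b p) (frA c e p) else 0) else 0)"
   unfolding Q_eq ea by (intro sum.cong refl) (auto simp: inj ne ne[symmetric])
  also have "\<dots> = (\<Sum>b<r. dual_coeff j a b * pair B p (frK c' b p) (frA c e p))"
   using ea by (simp add: sum.swap[of _ "{..<r}" "{..<r}"])
  also have "\<dots> = (\<Sum>b<r. dM j t (xi b) * M s (th b) p + dM j t (th b) * M s (xi b) p)"
  proof (rule sum.cong[OF refl])
   fix b assume b: "b \<in> {..<r}"
   then have bl: "xi b < 2 * r" "th b < 2 * r" by (auto simp: xi_def th_def)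
   have "dM j t (xi b) = 0" by (rule dM_parity[OF l(2) bl(1) assms(3)]) (use eo in \<open>simp add: xi_def\<close>)
   moreover have "dM j t (th b) = dual_coeff j a b" unfolding dM_def
   proof (rule c2.ldx_cong[OF openOv pOv p2 assms(3)])
    fix q assume q: "q \<in> Ov"
    have "M t (th b) q = pair B q (fr c (xi a) q) (fr c' (th b) q)"
     unfolding M_def ea dual_th using q ea bl by (intro pair_sym c1.fr_fib c2.fr_fib) (auto simp: xi_def)
    then show "M t (th b) q = pair B q (frK c a q) (frA c' b q)"
     by (simp add: fr_def) (simp add: xi_def th_def)
   qed
   moreover have "M s (xi b) p = pair B p (frK c' b p) (frA c e p)"
    unfolding M_def ea dual_xi by (simp add: fr_def) (simp add: xi_def th_def)
   ultimately show "dual_coeff j a b * pair B p (frK c' b p) (frA c e p) = dM j t (xi b) * M s (th b) p + dM j t (th b) * M s (xi b) p"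
    by simp
  qed
  also have "\<dots> = Wc j t s" by (simp only: Wc_def sum_even_odd dual_xi dual_th)
  finally show ?thesis .
 qed
 have 2: "Q j s t = - Q j t s" by (simp add: Q_def ev_ldr_swap[of s t])
 show ?thesis
 proof (cases "even s \<longleftrightarrow> even t")
  case True
  then have "Q j s t = 0" unfolding Q_eq
   by (intro sum.neutral ballI) (auto simp: xi_def th_def)
  moreover have "Wc j t s = 0" unfolding Wc_def
  proof (rule sum.neutral, rule ballI)
   fix y assume that: "y \<in> {..<2 * r}"
   show "dM j t y * M s (dual y) p = 0"
   using dM_parity[OF l(2) _ l(3), of y] M_parity[OF pOv l(1), of "dual y"] True that by (cases "even t = even y") auto
  qed
  ultimately show ?thesis by simp
 next
  case False
  then show ?thesis using 1[of s t] 1[of t s] 2 Wc_antisym[OF l(2,1,3)] l by (cases "even s") auto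
 qed
qed

text \<open>\<open>Wc\<close> as a 2-form in vectors of the fibre. In this form the contributions of
  the derivative terms and of the cubic term can be compared.\<close>

definition om :: "nat => 'e => 'e => real" where
 "om j v w = (\<Sum>s<2 * r. \<Sum>t<2 * r. Wc j (dual t) (dual s) * c1.vc v s p * c1.vc w t p)"

lemma om_antisym: "j < nn ==> om j v w = - om j w v"
 unfolding om_def sum_negf[symmetric]
 by (subst sum.swap, rule sum.cong[OF refl], rule sum.cong[OF refl]) (subst Wc_antisym; simp)

lemma om_eq:
 assumes "v \<in> fib B p"
 shows "(\<Sum>s<2 * r. \<Sum>t<2 * r. dM j s t * c2.vc v t p * c1.vc w (dual s) p) = om j v w"
proof -
 have "c2.vc v t p = (\<Sum>x<2 * r. M (dual x) (dual t) p * c1.vc v x p)" if "t < 2 * r" for t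
  using M_vc[OF pOv assms, of "dual t"] that by simp
 then have "(\<Sum>s<2 * r. \<Sum>t<2 * r. dM j s t * c2.vc v t p * c1.vc w (dual s) p) =
  (\<Sum>s<2 * r. \<Sum>t<2 * r. \<Sum>x<2 * r. dM j s t * M (dual x) (dual t) p * c1.vc v x p * c1.vc w (dual s) p)"
  by (simp add: sum_distrib_left sum_distrib_right mult_ac)
 also have "\<dots> = (\<Sum>s<2 * r. \<Sum>x<2 * r. Wc j s (dual x) * c1.vc v x p * c1.vc w (dual s) p)"
  unfolding Wc_def sum_distrib_right by (rule sum.cong[OF refl sum.swap])
 also have "\<dots> = (\<Sum>s<2 * r. \<Sum>x<2 * r. Wc j (dual s) (dual x) * c1.vc v x p * c1.vc w s p)"
  by (subst sum_dual[symmetric]) simp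
 also have "\<dots> = om j v w" unfolding om_def by (rule sum.swap)
 finally show ?thesis .
qed

lemma Q_om: "j < nn ==> (\<Sum>s<2 * r. \<Sum>t<2 * r. Q j (dual s) (dual t) * c1.vc v s p * c1.vc w t p) = om j v w"
 unfolding om_def by (intro sum.cong[OF refl]) (simp add: Q_W)

end

context chart_pair begin

lemma sum_three: "(\<Sum>s\<in>X. \<Sum>j\<in>Y. \<Sum>a\<in>Z. f s j a) = (\<Sum>j\<in>Y. \<Sum>a\<in>Z. \<Sum>s\<in>X. f s j a)"
 for f :: "nat => nat => nat => real"
 by (subst sum.swap, rule sum.cong[OF refl], rule sum.swap)

context
 fixes Y Y' :: "'m lfun"
 assumes Y': "hom 3 Y'" and rngY: "supp (\<lambda>m S. set_mset m \<subseteq> {..<nn} \<and> S \<subseteq> {..<2 * r}) Y'"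
  and trans: "\<And>mS. Y mS p = transition B c c' Y' mS p"
begin

lemma Rc_trans: "l < nn ==> s < 2 * r ==>
  ev (ldP l (ldr s Y)) p = (\<Sum>j<nn. \<Sum>a<2 * r. ev (ldP j (ldr a Y')) p * J l j * M s a p)"
proof -
 assume l: "l < nn" "s < 2 * r"
 have "ev (ldP l (ldr s Y)) p = ev (ldP l (ldr s (transition B c c' Y'))) p"
  unfolding ev_def by (intro c1.ldP_cong_at c1.ldr_cong_at trans)
 then show ?thesis using transition_wordP[OF rngY Y' l(2,1)] by simp
qed

lemma Cc_trans: "s < 2 * r ==> t < 2 * r ==> u < 2 * r ==>
  ev (ldr s (ldr t (ldr u Y))) p =
  (\<Sum>a<2 * r. \<Sum>b<2 * r. \<Sum>d<2 * r. ev (ldr a (ldr b (ldr d Y'))) p * M s a p * M t b p * M u d p)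
  + (\<Sum>j<nn. \<Sum>a<2 * r. ev (ldP j (ldr a Y')) p * (Q j s t * M u a p - Q j s u * M t a p + Q j t u * M s a p))"
proof -
 assume l: "s < 2 * r" "t < 2 * r" "u < 2 * r"
 have "ev (ldr s (ldr t (ldr u Y))) p = ev (ldr s (ldr t (ldr u (transition B c c' Y')))) p"
  unfolding ev_def by (intro c1.ldr_cong_at trans)
 then show ?thesis using transition_word3[OF rngY Y' l] by simp
qed

lemma an2: "c2.an Y' x j p = (\<Sum>a<2 * r. ev (ldP j (ldr a Y')) p * c2.vc x (dual a) p)"
 unfolding c2.an_def by (subst sum_dual[symmetric]) simp

lemma an_trans:
 assumes x: "x \<in> fib B p" and l: "l < nn"
 shows "c1.an Y x l p = (\<Sum>j<nn. J l j * c2.an Y' x j p)"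
proof -
 have "c1.an Y x l p = (\<Sum>s<2 * r. \<Sum>j<nn. \<Sum>a<2 * r. ev (ldP j (ldr a Y')) p * J l j * (M (dual s) a p * c1.vc x s p))"
  unfolding c1.an_def using l by (intro sum.cong refl) (simp add: Rc_trans sum_distrib_right mult.assoc)
 also have "\<dots> = (\<Sum>j<nn. \<Sum>a<2 * r. \<Sum>s<2 * r. ev (ldP j (ldr a Y')) p * J l j * (M (dual s) a p * c1.vc x s p))"
  by (rule sum_three)
 also have "\<dots> = (\<Sum>j<nn. \<Sum>a<2 * r. ev (ldP j (ldr a Y')) p * J l j * c2.vc x (dual a) p)"
  by (intro sum.cong refl) (simp add: sum_distrib_left[symmetric] M_vc[OF pOv x])
 also have "\<dots> = (\<Sum>j<nn. J l j * c2.an Y' x j p)"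
  unfolding an2 by (simp add: sum_distrib_left mult_ac)
 finally show ?thesis .
qed

lemma an_ldx:
 assumes x: "x \<in> fib B p" and f: "smooth B W f" "open W" "p \<in> W"
 shows "(\<Sum>l<nn. c1.an Y x l p * ldx c l f p) = (\<Sum>j<nn. c2.an Y' x j p * ldx c' j f p)"
proof -
 have "(\<Sum>l<nn. c1.an Y x l p * ldx c l f p) = (\<Sum>l<nn. \<Sum>j<nn. c2.an Y' x j p * (J l j * ldx c l f p))"
 proof (rule sum.cong[OF refl])
  fix l assume "l \<in> {..<nn}"
  then show "c1.an Y x l p * ldx c l f p = (\<Sum>j<nn. c2.an Y' x j p * (J l j * ldx c l f p))"
   by (simp only: lessThan_iff an_trans[OF x] sum_distrib_right) (simp only: mult_ac)
 qed
 also have "\<dots> = (\<Sum>j<nn. \<Sum>l<nn. c2.an Y' x j p * (J l j * ldx c l f p))" by (rule sum.swap)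
 also have "\<dots> = (\<Sum>j<nn. c2.an Y' x j p * ldx c' j f p)"
  by (intro sum.cong refl)
    (simp add: sum_distrib_left[symmetric] ldx_chain[OF c1 c2 p1 p2 f(2,3,1)] J_def)
 finally show ?thesis .
qed

lemma ldx_co:
 assumes e: "e \<in> sections B (fib B)" and j: "j < nn" and s: "s < 2 * r"
 shows "ldx c' j (c1.co e s) p = (\<Sum>t<2 * r. dM j s t * c2.vc (e p) t p + M s t p * ldx c' j (c2.co e t) p)"
proof -
 have pd: "c2.C.pdiff j (c2.co e t) p" if "t < 2 * r" for t
  by (rule c2.smooth_pdiffC[OF c2.smooth_co[OF e that] c2.cdata(1) p2 p2 j])
 have "ldx c' j (c1.co e s) p = ldx c' j (\<lambda>q. \<Sum>t<2 * r. M s t q * c2.co e t q) p"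
  by (rule c2.ldx_cong[OF openOv pOv p2 j])
    (simp add: c1.co_def c2.co_def vc_change sectionsD(1)[OF e] s)
 also have "\<dots> = (\<Sum>t<2 * r. dM j s t * c2.co e t p + M s t p * ldx c' j (c2.co e t) p)"
  unfolding dM_def using s j pd M_pdiff p2
  by (subst c2.ldx_sum) (auto intro!: c2.pdiff_mult sum.cong c2.ldx_mult)
 finally show ?thesis by (simp add: c2.co_def)
qed

text \<open>The components of e in the two frames differ by M, and differentiating M produces the
  extra term \<open>om\<close>.\<close>

lemma an_Dl:
 assumes x: "x \<in> fib B p" and e: "e \<in> sections B (fib B)" and w: "w \<in> fib B p"
 shows "(\<Sum>l<nn. c1.an Y x l p * c1.Dl l e w p) = (\<Sum>j<nn. c2.an Y' x j p * (om j (e p) w + c2.Dl j e w p))"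
proof -
 have "(\<Sum>l<nn. c1.an Y x l p * c1.Dl l e w p) =
  (\<Sum>s<2 * r. (\<Sum>l<nn. c1.an Y x l p * ldx c l (c1.co e s) p) * c1.vc w (dual s) p)"
  unfolding c1.Dl_def by (simp add: sum_distrib_left sum_distrib_right mult.assoc) (rule sum.swap)
 also have "\<dots> = (\<Sum>s<2 * r. (\<Sum>j<nn. c2.an Y' x j p * ldx c' j (c1.co e s) p) * c1.vc w (dual s) p)"
  by (intro sum.cong refl arg_cong2[of _ _ _ _ "(*)"] an_ldx[OF x c1.smooth_co[OF e] c1.cdata(1) p1]) simp
 also have "\<dots> = (\<Sum>j<nn. c2.an Y' x j p * (\<Sum>s<2 * r. ldx c' j (c1.co e s) p * c1.vc w (dual s) p))"
  by (simp add: sum_distrib_left sum_distrib_right mult.assoc) (rule sum.swap)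
 also have "\<dots> = (\<Sum>j<nn. c2.an Y' x j p * (om j (e p) w + c2.Dl j e w p))"
 proof (rule sum.cong[OF refl])
  fix j assume "j \<in> {..<nn}"
  then have j: "j < nn" by simp
  have "(\<Sum>s<2 * r. ldx c' j (c1.co e s) p * c1.vc w (dual s) p) =
   (\<Sum>s<2 * r. \<Sum>t<2 * r. dM j s t * c2.vc (e p) t p * c1.vc w (dual s) p)
   + (\<Sum>s<2 * r. \<Sum>t<2 * r. ldx c' j (c2.co e t) p * (M s t p * c1.vc w (dual s) p))"
  proof -
   have "(\<Sum>s<2 * r. ldx c' j (c1.co e s) p * c1.vc w (dual s) p) =
    (\<Sum>s<2 * r. (\<Sum>t<2 * r. dM j s t * c2.vc (e p) t p + M s t p * ldx c' j (c2.co e t) p) * c1.vc w (dual s) p)"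
    by (rule sum.cong[OF refl]) (simp only: ldx_co[OF e j] lessThan_iff)
   then show ?thesis
    by (simp only: sum_distrib_right distrib_right sum.distrib) (simp only: mult_ac)
  qed
  also have "(\<Sum>s<2 * r. \<Sum>t<2 * r. ldx c' j (c2.co e t) p * (M s t p * c1.vc w (dual s) p)) = c2.Dl j e w p"
   unfolding c2.Dl_def
   by (subst sum.swap) (simp add: sum_distrib_left[symmetric] M_vc'[OF pOv w])
  finally show "c2.an Y' x j p * (\<Sum>s<2 * r. ldx c' j (c1.co e s) p * c1.vc w (dual s) p) =
   c2.an Y' x j p * (om j (e p) w + c2.Dl j e w p)" by (simp add: om_eq[OF sectionsD(1)[OF e]])
 qed
 finally show ?thesis .
qed

lemma sum_pull: "(\<Sum>t\<in>T. k * h t * m) = k * sum h T * m" "(\<Sum>t\<in>T. k * h t * m * m') = k * sum h T * m * m'"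
 for h :: "nat => real"
 by (simp_all only: sum_distrib_left sum_distrib_right)

text \<open>The three indices of the chart c are contracted independently of each other; each inner
  sum is then evaluated by \<open>M_vc\<close>.\<close>

lemma contract3:
 "(\<Sum>s<2 * r. \<Sum>t<2 * r. \<Sum>x<2 * r. (\<Sum>a<2 * r. \<Sum>b<2 * r. \<Sum>d<2 * r. g a b d * h1 s a * h2 t b * h3 x d))
  = (\<Sum>a<2 * r. \<Sum>b<2 * r. \<Sum>d<2 * r. g a b d * (\<Sum>s<2 * r. h1 s a) * (\<Sum>t<2 * r. h2 t b) * (\<Sum>x<2 * r. h3 x d))"
 for g :: "nat => nat => nat => real"
proof -
 have 1: "(\<Sum>x<2 * r. (\<Sum>a<2 * r. \<Sum>b<2 * r. \<Sum>d<2 * r. g a b d * h1 s a * h2 t b * h3 x d))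
  = (\<Sum>a<2 * r. \<Sum>b<2 * r. \<Sum>d<2 * r. g a b d * h1 s a * h2 t b * (\<Sum>x<2 * r. h3 x d))" for s t
 proof -
  have "(\<Sum>x<2 * r. (\<Sum>a<2 * r. \<Sum>b<2 * r. \<Sum>d<2 * r. g a b d * h1 s a * h2 t b * h3 x d))
   = (\<Sum>a<2 * r. \<Sum>b<2 * r. \<Sum>x<2 * r. \<Sum>d<2 * r. g a b d * h1 s a * h2 t b * h3 x d)"
   by (rule sum_three)
  also have "\<dots> = (\<Sum>a<2 * r. \<Sum>b<2 * r. \<Sum>d<2 * r. \<Sum>x<2 * r. g a b d * h1 s a * h2 t b * h3 x d)"
   by (rule sum.cong[OF refl], rule sum.cong[OF refl], rule sum.swap)
  finally show ?thesis by (simp add: sum_distrib_left)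
 qed
 have 2: "(\<Sum>t<2 * r. (\<Sum>a<2 * r. \<Sum>b<2 * r. \<Sum>d<2 * r. g a b d * h1 s a * h2 t b * (\<Sum>x<2 * r. h3 x d)))
  = (\<Sum>a<2 * r. \<Sum>b<2 * r. \<Sum>d<2 * r. g a b d * h1 s a * (\<Sum>t<2 * r. h2 t b) * (\<Sum>x<2 * r. h3 x d))" for s
 proof -
  have "(\<Sum>t<2 * r. (\<Sum>a<2 * r. \<Sum>b<2 * r. \<Sum>d<2 * r. g a b d * h1 s a * h2 t b * (\<Sum>x<2 * r. h3 x d)))
   = (\<Sum>a<2 * r. \<Sum>b<2 * r. \<Sum>t<2 * r. \<Sum>d<2 * r. g a b d * h1 s a * h2 t b * (\<Sum>x<2 * r. h3 x d))"
   by (rule sum_three)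
  also have "\<dots> = (\<Sum>a<2 * r. \<Sum>b<2 * r. \<Sum>d<2 * r. \<Sum>t<2 * r. g a b d * h1 s a * h2 t b * (\<Sum>x<2 * r. h3 x d))"
   by (rule sum.cong[OF refl], rule sum.cong[OF refl], rule sum.swap)
  also have "\<dots> = (\<Sum>a<2 * r. \<Sum>b<2 * r. \<Sum>d<2 * r. g a b d * h1 s a * (\<Sum>t<2 * r. h2 t b) * (\<Sum>x<2 * r. h3 x d))"
   by (rule sum.cong[OF refl], rule sum.cong[OF refl], rule sum.cong[OF refl], rule sum_pull)
  finally show ?thesis .
 qed
 have "(\<Sum>s<2 * r. (\<Sum>a<2 * r. \<Sum>b<2 * r. \<Sum>d<2 * r. g a b d * h1 s a * (\<Sum>t<2 * r. h2 t b) * (\<Sum>x<2 * r. h3 x d)))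
  = (\<Sum>a<2 * r. \<Sum>b<2 * r. \<Sum>s<2 * r. \<Sum>d<2 * r. g a b d * h1 s a * (\<Sum>t<2 * r. h2 t b) * (\<Sum>x<2 * r. h3 x d))"
  by (rule sum_three)
 also have "\<dots> = (\<Sum>a<2 * r. \<Sum>b<2 * r. \<Sum>d<2 * r. \<Sum>s<2 * r. g a b d * h1 s a * (\<Sum>t<2 * r. h2 t b) * (\<Sum>x<2 * r. h3 x d))"
  by (rule sum.cong[OF refl], rule sum.cong[OF refl], rule sum.swap)
 also have "\<dots> = (\<Sum>a<2 * r. \<Sum>b<2 * r. \<Sum>d<2 * r. g a b d * (\<Sum>s<2 * r. h1 s a) * (\<Sum>t<2 * r. h2 t b) * (\<Sum>x<2 * r. h3 x d))"
  by (rule sum.cong[OF refl], rule sum.cong[OF refl], rule sum.cong[OF refl], rule sum_pull)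
 finally show ?thesis unfolding 1 2 .
qed

lemma contractQ:
 assumes "\<And>j. j < nn ==> (\<Sum>s<2 * r. \<Sum>t<2 * r. q j s t * u s * v t) = om j U V"
  and "\<And>a. a < 2 * r ==> (\<Sum>x<2 * r. m x a * w x) = c2.vc W (dual a) p"
 shows "(\<Sum>s<2 * r. \<Sum>t<2 * r. \<Sum>x<2 * r. (\<Sum>j<nn. \<Sum>a<2 * r. ev (ldP j (ldr a Y')) p * (q j s t * m x a)) * u s * v t * w x)
  = (\<Sum>j<nn. c2.an Y' W j p * om j U V)"
proof -
 have "(\<Sum>s<2 * r. \<Sum>t<2 * r. \<Sum>x<2 * r. (\<Sum>j<nn. \<Sum>a<2 * r. ev (ldP j (ldr a Y')) p * (q j s t * m x a)) * u s * v t * w x)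
  = (\<Sum>s<2 * r. \<Sum>t<2 * r. \<Sum>j<nn. q j s t * u s * v t * c2.an Y' W j p)"
 proof (rule sum.cong[OF refl], rule sum.cong[OF refl])
  fix s t
  have "(\<Sum>x<2 * r. (\<Sum>j<nn. \<Sum>a<2 * r. ev (ldP j (ldr a Y')) p * (q j s t * m x a)) * u s * v t * w x)
   = (\<Sum>x<2 * r. \<Sum>j<nn. \<Sum>a<2 * r. q j s t * u s * v t * (ev (ldP j (ldr a Y')) p * (m x a * w x)))"
   by (simp add: sum_distrib_right sum_distrib_left mult_ac)
  also have "\<dots> = (\<Sum>j<nn. \<Sum>a<2 * r. \<Sum>x<2 * r. q j s t * u s * v t * (ev (ldP j (ldr a Y')) p * (m x a * w x)))"
   by (rule sum_three)
  also have "\<dots> = (\<Sum>j<nn. q j s t * u s * v t * c2.an Y' W j p)"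
   unfolding an2 by (intro sum.cong refl) (simp add: sum_distrib_left[symmetric] assms(2))
  finally show "(\<Sum>x<2 * r. (\<Sum>j<nn. \<Sum>a<2 * r. ev (ldP j (ldr a Y')) p * (q j s t * m x a)) * u s * v t * w x)
   = (\<Sum>j<nn. q j s t * u s * v t * c2.an Y' W j p)" .
 qed
 also have "\<dots> = (\<Sum>j<nn. \<Sum>s<2 * r. \<Sum>t<2 * r. q j s t * u s * v t * c2.an Y' W j p)"
  by (subst sum_three[symmetric]) (rule refl)
 also have "\<dots> = (\<Sum>j<nn. c2.an Y' W j p * om j U V)"
  by (intro sum.cong refl) (simp add: sum_distrib_right[symmetric] assms(1))
 finally show ?thesis .
qed

text \<open>The cubic coefficients transform as a tensor up to the quadratic part of the new P. By
  \<open>Q_om\<close>, contraction turns this part into \<open>om\<close>, multiplied by the anchor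
  of each argument in turn.\<close>

lemma C3_trans:
 assumes x: "x \<in> fib B p" and y: "y \<in> fib B p" and z: "z \<in> fib B p"
 shows "c1.C3 Y x y z p = c2.C3 Y' x y z p +
  (\<Sum>j<nn. c2.an Y' z j p * om j x y - c2.an Y' y j p * om j x z + c2.an Y' x j p * om j y z)"
proof -
 let ?R = "\<lambda>j a. ev (ldP j (ldr a Y')) p"
 let ?C = "\<lambda>a b d. ev (ldr a (ldr b (ldr d Y'))) p"
 let ?x = "\<lambda>s. c1.vc x s p" and ?y = "\<lambda>s. c1.vc y s p" and ?z = "\<lambda>s. c1.vc z s p"
 have "c1.C3 Y x y z p =
  (\<Sum>s<2 * r. \<Sum>t<2 * r. \<Sum>u<2 * r. (\<Sum>a<2 * r. \<Sum>b<2 * r. \<Sum>d<2 * r.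
    ?C a b d * (M (dual s) a p * ?x s) * (M (dual t) b p * ?y t) * (M (dual u) d p * ?z u)))
  + (\<Sum>s<2 * r. \<Sum>t<2 * r. \<Sum>u<2 * r. (\<Sum>j<nn. \<Sum>a<2 * r. ?R j a * (Q j (dual s) (dual t) * M (dual u) a p)) * ?x s * ?y t * ?z u)
  - (\<Sum>s<2 * r. \<Sum>t<2 * r. \<Sum>u<2 * r. (\<Sum>j<nn. \<Sum>a<2 * r. ?R j a * (Q j (dual s) (dual u) * M (dual t) a p)) * ?x s * ?z u * ?y t)
  + (\<Sum>s<2 * r. \<Sum>t<2 * r. \<Sum>u<2 * r. (\<Sum>j<nn. \<Sum>a<2 * r. ?R j a * (Q j (dual t) (dual u) * M (dual s) a p)) * ?y t * ?z u * ?x s)"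
  (is "_ = ?S1 + ?S2 - ?S3 + ?S4")
  unfolding c1.C3_def
 proof -
  have "(\<Sum>s<2 * r. \<Sum>t<2 * r. \<Sum>u<2 * r. ev (ldr (dual s) (ldr (dual t) (ldr (dual u) Y))) p * ?x s * ?y t * ?z u)
   = (\<Sum>s<2 * r. \<Sum>t<2 * r. \<Sum>u<2 * r. (\<Sum>a<2 * r. \<Sum>b<2 * r. \<Sum>d<2 * r.
    ?C a b d * (M (dual s) a p * ?x s) * (M (dual t) b p * ?y t) * (M (dual u) d p * ?z u))
    + (\<Sum>j<nn. \<Sum>a<2 * r. ?R j a * (Q j (dual s) (dual t) * M (dual u) a p)) * ?x s * ?y t * ?z u
    - (\<Sum>j<nn. \<Sum>a<2 * r. ?R j a * (Q j (dual s) (dual u) * M (dual t) a p)) * ?x s * ?z u * ?y t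
    + (\<Sum>j<nn. \<Sum>a<2 * r. ?R j a * (Q j (dual t) (dual u) * M (dual s) a p)) * ?y t * ?z u * ?x s)"
  proof (rule sum.cong[OF refl], rule sum.cong[OF refl], rule sum.cong[OF refl])
   have alg: "(S + (C1 - C2 + C3)) * X * Y * Z = S * (X * Y * Z) + C1 * X * Y * Z - C2 * X * Z * Y + C3 * Y * Z * X"
    for S C1 C2 C3 X Y Z :: real
    by algebra
   fix s t u assume "s \<in> {..<2 * r}" "t \<in> {..<2 * r}" "u \<in> {..<2 * r}"
   then have l: "dual s < 2 * r" "dual t < 2 * r" "dual u < 2 * r" by auto
   have S: "(\<Sum>a<2 * r. \<Sum>b<2 * r. \<Sum>d<2 * r.
    ?C a b d * (M (dual s) a p * ?x s) * (M (dual t) b p * ?y t) * (M (dual u) d p * ?z u))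
    = (\<Sum>a<2 * r. \<Sum>b<2 * r. \<Sum>d<2 * r. ?C a b d * M (dual s) a p * M (dual t) b p * M (dual u) d p) * (?x s * ?y t * ?z u)"
    by (simp only: sum_distrib_right) (simp only: mult_ac)
   have T: "(\<Sum>j<nn. \<Sum>a<2 * r. ?R j a * (Q j (dual s) (dual t) * M (dual u) a p - Q j (dual s) (dual u) * M (dual t) a p + Q j (dual t) (dual u) * M (dual s) a p))
    = (\<Sum>j<nn. \<Sum>a<2 * r. ?R j a * (Q j (dual s) (dual t) * M (dual u) a p))
    - (\<Sum>j<nn. \<Sum>a<2 * r. ?R j a * (Q j (dual s) (dual u) * M (dual t) a p))
    + (\<Sum>j<nn. \<Sum>a<2 * r. ?R j a * (Q j (dual t) (dual u) * M (dual s) a p))"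
    by (simp only: distrib_left right_diff_distrib sum.distrib sum_subtractf)
   show "ev (ldr (dual s) (ldr (dual t) (ldr (dual u) Y))) p * ?x s * ?y t * ?z u =
    (\<Sum>a<2 * r. \<Sum>b<2 * r. \<Sum>d<2 * r.
    ?C a b d * (M (dual s) a p * ?x s) * (M (dual t) b p * ?y t) * (M (dual u) d p * ?z u))
    + (\<Sum>j<nn. \<Sum>a<2 * r. ?R j a * (Q j (dual s) (dual t) * M (dual u) a p)) * ?x s * ?y t * ?z u
    - (\<Sum>j<nn. \<Sum>a<2 * r. ?R j a * (Q j (dual s) (dual u) * M (dual t) a p)) * ?x s * ?z u * ?y t
    + (\<Sum>j<nn. \<Sum>a<2 * r. ?R j a * (Q j (dual t) (dual u) * M (dual s) a p)) * ?y t * ?z u * ?x s"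
    unfolding Cc_trans[OF l] S T by (rule alg)
  qed
  then show "(\<Sum>s<2 * r. \<Sum>t<2 * r. \<Sum>u<2 * r. ev (ldr (dual s) (ldr (dual t) (ldr (dual u) Y))) p * ?x s * ?y t * ?z u)
   = ?S1 + ?S2 - ?S3 + ?S4" by (simp only: sum.distrib sum_subtractf)
 qed
 moreover have "?S1 = c2.C3 Y' x y z p"
 proof -
  have "?S1 = (\<Sum>a<2 * r. \<Sum>b<2 * r. \<Sum>d<2 * r. ?C a b d * c2.vc x (dual a) p * c2.vc y (dual b) p * c2.vc z (dual d) p)"
   unfolding contract3 by (intro sum.cong refl) (simp add: M_vc[OF pOv] x y z)
  also have "\<dots> = c2.C3 Y' x y z p"
  proof -
   have "(\<Sum>a<2 * r. \<Sum>b<2 * r. \<Sum>d<2 * r. g a b d) = (\<Sum>a<2 * r. \<Sum>b<2 * r. \<Sum>d<2 * r. g (dual a) (dual b) (dual d))"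
    for g :: "nat => nat => nat => real"
    by (subst sum_dual[symmetric], rule sum.cong[OF refl], subst sum_dual[symmetric], rule sum.cong[OF refl],
      rule sum_dual[symmetric])
   from this[of "\<lambda>a b d. ?C a b d * c2.vc x (dual a) p * c2.vc y (dual b) p * c2.vc z (dual d) p"]
   show ?thesis by (simp add: c2.C3_def)
  qed
  finally show ?thesis .
 qed
 moreover have "?S2 = (\<Sum>j<nn. c2.an Y' z j p * om j x y)"
  by (rule contractQ) (simp_all add: Q_om M_vc[OF pOv z])
 moreover have "?S3 = (\<Sum>j<nn. c2.an Y' y j p * om j x z)"
 proof -
  have "?S3 = (\<Sum>s<2 * r. \<Sum>u<2 * r. \<Sum>t<2 * r. (\<Sum>j<nn. \<Sum>a<2 * r. ?R j a * (Q j (dual s) (dual u) * M (dual t) a p)) * ?x s * ?z u * ?y t)"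
   by (rule sum.cong[OF refl], rule sum.swap)
  also have "\<dots> = (\<Sum>j<nn. c2.an Y' y j p * om j x z)"
   by (rule contractQ) (simp_all add: Q_om M_vc[OF pOv y])
  finally show ?thesis .
 qed
 moreover have "?S4 = (\<Sum>j<nn. c2.an Y' x j p * om j y z)"
 proof -
  have "?S4 = (\<Sum>t<2 * r. \<Sum>u<2 * r. \<Sum>s<2 * r. (\<Sum>j<nn. \<Sum>a<2 * r. ?R j a * (Q j (dual t) (dual u) * M (dual s) a p)) * ?y t * ?z u * ?x s)"
   by (rule sum_three)
  also have "\<dots> = (\<Sum>j<nn. c2.an Y' x j p * om j y z)"
   by (rule contractQ) (simp_all add: Q_om M_vc[OF pOv x])
  finally show ?thesis .
 qed
 ultimately show ?thesis by (simp add: sum.distrib sum_subtractf)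
qed

text \<open>The derivative terms and the cubic term both depend on the chart, but their extra terms
  differ only by exchanging the arguments of \<open>om\<close>, which is antisymmetric.\<close>

lemma TT_trans:
 assumes e1: "e1 \<in> sections B (fib B)" and e2: "e2 \<in> sections B (fib B)" and w: "w \<in> fib B p"
 shows "c1.TT Y e1 e2 w p = c2.TT Y' e1 e2 w p"
proof -
 have f: "e1 p \<in> fib B p" "e2 p \<in> fib B p" using sectionsD(1) e1 e2 by blast+
 have "c1.TT Y e1 e2 w p = (\<Sum>j<nn. c2.an Y' (e1 p) j p * (om j (e2 p) w + c2.Dl j e2 w p))
   - (\<Sum>j<nn. c2.an Y' (e2 p) j p * (om j (e1 p) w + c2.Dl j e1 w p))
   + (\<Sum>j<nn. c2.an Y' w j p * (om j (e1 p) (e2 p) + c2.Dl j e1 (e2 p) p)) + c1.C3 Y w (e2 p) (e1 p) p"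
  unfolding c1.TT_def sum.distrib sum_subtractf
  by (simp only: an_Dl[OF f(1) e2 w] an_Dl[OF f(2) e1 w] an_Dl[OF w e1 f(2)])
 also have "\<dots> = c2.TT Y' e1 e2 w p +
  (\<Sum>j<nn. c2.an Y' (e1 p) j p * (om j (e2 p) w + om j w (e2 p)) - c2.an Y' (e2 p) j p * (om j (e1 p) w + om j w (e1 p))
   + c2.an Y' w j p * (om j (e1 p) (e2 p) + om j (e2 p) (e1 p)))"
  unfolding C3_trans[OF w f(2,1)] c2.TT_def
  by (simp add: sum.distrib sum_subtractf algebra_simps)
 also have "(\<Sum>j<nn. c2.an Y' (e1 p) j p * (om j (e2 p) w + om j w (e2 p)) - c2.an Y' (e2 p) j p * (om j (e1 p) w + om j w (e1 p))
   + c2.an Y' w j p * (om j (e1 p) (e2 p) + om j (e2 p) (e1 p))) = 0"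
  using om_antisym[of _ w "e2 p"] om_antisym[of _ w "e1 p"] om_antisym[of _ "e2 p" "e1 p"]
  by (intro sum.neutral ballI) simp
 finally show ?thesis by simp
qed

end

end

context adapted_chart begin

lemma hom1_expand:
 assumes "hom 1 F" "rng F"
 shows "F mS q = (\<Sum>s<2 * r. ev (ldr s F) q * loddvar s mS q)"
proof -
 obtain m S where mS: "mS = (m, S)" by (cases mS)
 show ?thesis
 proof (cases "\<exists>s<2 * r. m = {#} \<and> S = {s}")
  case True
  then obtain s where s: "s < 2 * r" "m = {#}" "S = {s}" by blast
  have "(\<Sum>t<2 * r. ev (ldr t F) q * loddvar t mS q) = (\<Sum>t<2 * r. if t = s then F ({#}, {t}) q else 0)"
   by (rule sum.cong) (auto simp: mS s loddvar_def ev_ldr)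
  then show ?thesis using s by (simp add: mS)
 next
  case False
  have "F (m, S) = 0"
  proof (rule ccontr)
   assume nz: "F (m, S) \<noteq> 0"
   then have a: "finite S \<and> int (2 * size m + card S) = 1" using assms(1) unfolding supp_def by blast
   have b: "S \<subseteq> {..<2 * r}" using nz assms(2) unfolding supp_def by blast
   have "2 * size m + card S = 1" using a by linarith
   then have "size m = 0" "card S = 1" by presburger+
   then obtain s where "m = {#}" "S = {s}" by (auto simp: card_1_singleton_iff)
   then show False using False b by auto
  qed
  moreover have "(\<Sum>t<2 * r. ev (ldr t F) q * loddvar t mS q) = 0"
   using False by (intro sum.neutral) (auto simp: mS loddvar_def)
  ultimately show ?thesis by (simp add: mS)
 qed
qed

definition dvec :: "'m lfun => ('m => 'e) => ('m => 'e) => 'm => 'e" where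
 "dvec Y e1 e2 q = (\<Sum>s<2 * r. ev (ldr s (lpb (lpb Y (sec B A K e1 c)) (sec B A K e2 c))) q *\<^sub>R fr c s q)"

lemma pair_dvec:
 assumes "hom 3 Y" "q \<in> Oc" "e1 \<in> sections B D1" "e2 \<in> sections B D2" "w \<in> fib B q"
 shows "pair B q (dvec Y e1 e2 q) w = TT Y e1 e2 w q"
proof -
 have "pair B q (dvec Y e1 e2 q) w = (\<Sum>s<2 * r. ev (ldr s (lpb (lpb Y (sec B A K e1 c)) (sec B A K e2 c))) q * pair B q (fr c s q) w)"
  unfolding dvec_def by (rule pair_sum) (use fr_fib assms in auto)
 also have "\<dots> = (\<Sum>s<2 * r. ev (ldr s (lpb (lpb Y (sec B A K e1 c)) (sec B A K e2 c))) q * vc w (dual s) q)"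
  by (intro sum.cong refl) (simp add: vc_def pair_sym[OF fr_fib assms(5)] assms(2))
 finally show ?thesis by (simp add: derived_TT[OF assms(1-4)])
qed

lemma dvec_section:
 assumes "sm Oc Y" "e1 \<in> sections B D1" "e2 \<in> sections B D2"
 shows "local_section B Oc (dvec Y e1 e2)"
 unfolding dvec_def
 by (rule fr_combination_section[OF cdata(1) order_refl])
   (intro sm_ev sm_ldr sm_lpb sm_sec[OF assms(2)] sm_sec[OF assms(3)] assms(1) cdata(1) order_refl)

end

context split_bundle begin

lemma pb_zero_at:
 assumes "\<And>mS. f c mS q = 0" "\<And>mS. g c mS q = 0"
 shows "pb B f g c mS q = 0"
proof -
 have P: "ldP i (f c) mS q = 0" "ldP i (g c) mS q = 0" for i mS by (cases mS; simp add: ldP_def assms)+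
 have R: "ldr i (f c) mS q = 0" for i mS by (cases mS; simp add: ldr_def assms)
 have m: "lmul X Y mS q = 0" if "(\<forall>mS. X mS q = 0) \<or> (\<forall>mS. Y mS q = 0)" for X Y :: "'m lfun" and mS
  using that by (cases mS) (auto simp: lmul_def intro!: sum.neutral)
 have "lmul (ldP i (f c)) X mS q = 0" "lmul X (ldP i (g c)) mS q = 0" "lmul (ldr i (f c)) X mS q = 0"
  for i X mS by (rule m; simp add: P R)+
 then show ?thesis unfolding pb_def by (simp add: fun_sum_apply)
qed

lemma sec_inj: "inj_on (sec B A K) (sections B (fib B))"
proof (rule inj_onI, rule ext)
 fix e e' p assume e: "e \<in> sections B (fib B)" "e' \<in> sections B (fib B)" and eq: "sec B A K e = sec B A K e'"
 obtain c where cc: "c \<in> acharts B A K" "p \<in> cdom c" using adapted_chart_ex by blast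
 interpret adapted_chart B A K c using cc(1) by unfold_locales
 have "co e s p = co e' s p" if "s < 2 * r" for s
  using sec_coeff[OF cc(2) that, of e] sec_coeff[OF cc(2) that, of e'] eq by simp
 then have "e p = (\<Sum>s<2 * r. pair B p (e' p) (fr c (dual s) p) *\<^sub>R fr c s p)"
  using fr_expand[OF cc(2) sectionsD(1)[OF e(1)]] by (simp add: co_def vc_def)
 then show "e p = e' p" using fr_expand[OF cc(2) sectionsD(1)[OF e(2)]] by simp
qed

text \<open>The derived bracket is a section because \<open>TT\<close>, the pairing of the local derived bracket
 with a vector, does not depend on the adapted chart.\<close>

lemma derived_bracket:
 assumes \<Theta>: "\<Theta> \<in> Cfun B A K 3" and e: "e1 \<in> sections B (fib B)" "e2 \<in> sections B (fib B)"
 shows "derived_bracket B A K \<Theta> e1 e2 \<in> sections B (fib B)"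
  "c \<in> acharts B A K ==> p \<in> cdom c ==> w \<in> fib B p ==>
   pair B p (derived_bracket B A K \<Theta> e1 e2 p) w = adapted_chart.TT B c (\<Theta> c) e1 e2 w p"
proof -
 note hom\<Theta> = Cfun_hom[OF \<Theta>]
 let ?d = "\<lambda>c. adapted_chart.dvec B A K c (\<Theta> c) e1 e2"
 have ac: "adapted_chart B A K c" if "c \<in> acharts B A K" for c using that by unfold_locales
 have df: "?d c q \<in> fib B q" if "c \<in> acharts B A K" "q \<in> cdom c" for c q
  unfolding adapted_chart.dvec_def[OF ac[OF that(1)]] by (rule adapted_chart.fr_sum_fib[OF ac[OF that(1)] that(2)])
 have indep: "?d c q = ?d c' q" if c: "c \<in> acharts B A K" "q \<in> cdom c" "c' \<in> acharts B A K" "q \<in> cdom c'" for c c' q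
 proof -
  interpret chart_pair B A K c c' q using c by unfold_locales
  have "?d c q - ?d c' q = 0"
  proof (rule nondeg)
   show "?d c q - ?d c' q \<in> fib B q" using df c by (intro subspace_diff[OF fib_subspace]) auto
   fix w assume w: "w \<in> fib B q"
   have "pair B q (?d c q - ?d c' q) w = pair B q (?d c q) w - pair B q (?d c' q) w"
    using df c w by (intro pair_diff) auto
   also have "\<dots> = c1.TT (\<Theta> c) e1 e2 w q - c2.TT (\<Theta> c') e1 e2 w q"
    by (simp only: c1.pair_dvec[OF hom\<Theta> c(2) e w] c2.pair_dvec[OF hom\<Theta> c(4) e w])
   also have "\<dots> = 0"
    using TT_trans[where Y = "\<Theta> c" and Y' = "\<Theta> c'", OF hom\<Theta> Cfun_rng[OF \<Theta> c(3)] Cfun_trans[OF \<Theta> c(1,3,2,4)] e w] by simp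
   finally show "pair B q (?d c q - ?d c' q) w = 0" .
  qed
  then show ?thesis by simp
 qed
 \<comment> \<open>A chart is chosen at each point. As the value does not depend on it, E coincides
   on every chart with a smooth local section.\<close>
 define E where "E = (\<lambda>q. ?d (SOME c. c \<in> acharts B A K \<and> q \<in> cdom c) q)"
 have E: "E q = ?d c q" if c: "c \<in> acharts B A K" "q \<in> cdom c" for c q
 proof -
  have "(SOME c. c \<in> acharts B A K \<and> q \<in> cdom c) \<in> acharts B A K \<and> q \<in> cdom (SOME c. c \<in> acharts B A K \<and> q \<in> cdom c)"
   by (rule someI[of _ c]) (use c in blast)
  then show ?thesis unfolding E_def using indep c by blast
 qed
 have Es: "E \<in> sections B (fib B)"
 proof (rule sectionsI)
  show "local_section B UNIV E"
  proof (rule local_section_local[OF open_UNIV])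
   fix p
   obtain c where cc: "c \<in> acharts B A K" "p \<in> cdom c" using adapted_chart_ex by blast
   interpret adapted_chart B A K c using cc(1) by unfold_locales
   have "sm (cdom c) (\<Theta> c)" using Cfun_smooth[OF \<Theta> cc(1)] by (simp add: sm_def)
   then have "local_section B (cdom c) (?d c)" using dvec_section e by blast
   then have "local_section B (cdom c) E" by (rule local_section_cong) (simp add: E[OF cc(1)])
   then show "\<exists>V. open V \<and> p \<in> V \<and> local_section B V E" using cc(2) cdata(1) by blast
  qed
  show "E p \<in> fib B p" for p
  proof -
   obtain c where cc: "c \<in> acharts B A K" "p \<in> cdom c" using adapted_chart_ex by blast
   then show ?thesis using E df by simp
  qed
 qed
 \<comment> \<open>Both sides have degree 1 and equal coefficients on each chart, and both are 0
   elsewhere. Injectivity of \<open>sec\<close> then identifies the derived bracket with E.\<close>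
 have "sec B A K E = pb B (pb B \<Theta> (sec B A K e1)) (sec B A K e2)"
 proof (intro ext)
  fix c mS q
  show "sec B A K E c mS q = pb B (pb B \<Theta> (sec B A K e1)) (sec B A K e2) c mS q"
  proof (cases "c \<in> acharts B A K \<and> q \<in> cdom c")
   case True
   then have cc: "c \<in> acharts B A K" "q \<in> cdom c" by auto
   interpret adapted_chart B A K c using cc(1) by unfold_locales
   let ?G = "lpb (lpb (\<Theta> c) (sec B A K e1 c)) (sec B A K e2 c)"
   have hG: "hom 1 ?G" using hom_lpb[OF hom_lpb[OF hom\<Theta> hom_sec] hom_sec] by simp
   have rG: "rng ?G" by (intro rng_lpb rng_sec Cfun_rng[OF \<Theta> cc(1)])
   have "co E s q = ev (ldr s ?G) q" if s: "s < 2 * r" for s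
    unfolding co_def vc_def E[OF cc] dvec_def using fr_pair_sum[OF cc(2), of "dual s"] s by simp
   then have "sec B A K E c mS q = (\<Sum>s<2 * r. ev (ldr s ?G) q * loddvar s mS q)"
    by (simp add: sec_at[OF cc(2)])
   then show ?thesis by (simp add: hom1_expand[OF hG rG, symmetric] pb_lpb)
  next
   case False
   have s0: "sec B A K e c mS q = 0" for e mS using False by (auto simp: sec_def)
   have t0: "\<Theta> c mS q = 0" for mS
    using False Cfun_out[OF \<Theta>] Cfun_nochart[OF \<Theta>] by (cases "c \<in> acharts B A K") auto
   show ?thesis unfolding s0 by (rule pb_zero_at[symmetric, OF pb_zero_at]) (simp_all add: s0 t0)
  qed
 qed
 then have dE: "derived_bracket B A K \<Theta> e1 e2 = E"
  unfolding derived_bracket_def using the_inv_into_f_f[OF sec_inj Es] by simp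
 show "derived_bracket B A K \<Theta> e1 e2 \<in> sections B (fib B)" unfolding dE by (rule Es)
 assume c: "c \<in> acharts B A K" "p \<in> cdom c" "w \<in> fib B p"
 show "pair B p (derived_bracket B A K \<Theta> e1 e2 p) w = adapted_chart.TT B c (\<Theta> c) e1 e2 w p"
  unfolding dE E[OF c(1,2)] by (rule adapted_chart.pair_dvec[OF ac[OF c(1)] hom\<Theta> c(2) e c(3)])
qed

end

section \<open>Forms as functions\<close>

context split_bundle begin

lemma formsD:
 assumes "\<omega> \<in> forms B D k"
 shows "length vs = k ==> set vs \<subseteq> D p ==> i < k ==> u \<in> D p ==> v \<in> D p ==>
    \<omega> p (vs[i := a *\<^sub>R u + b *\<^sub>R v]) = a * \<omega> p (vs[i := u]) + b * \<omega> p (vs[i := v])"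
  and "length vs = k ==> set vs \<subseteq> D p ==> \<not> distinct vs ==> \<omega> p vs = 0"
  and "open W ==> length ss = k ==> (\<And>s. s \<in> set ss ==> local_section B W s) ==>
    (\<And>s q. s \<in> set ss ==> q \<in> W ==> s q \<in> D q) ==> smooth B W (\<lambda>q. \<omega> q (map (\<lambda>s. s q) ss))"
proof -
 note a = assms[unfolded forms_def mem_Collect_eq]
 show "length vs = k ==> set vs \<subseteq> D p ==> i < k ==> u \<in> D p ==> v \<in> D p ==>
    \<omega> p (vs[i := a *\<^sub>R u + b *\<^sub>R v]) = a * \<omega> p (vs[i := u]) + b * \<omega> p (vs[i := v])"
  by (rule conjunct1[OF a, rule_format], intro conjI)
 show "length vs = k ==> set vs \<subseteq> D p ==> \<not> distinct vs ==> \<omega> p vs = 0"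
  by (rule conjunct1[OF conjunct2[OF a], rule_format], intro conjI)
 show "open W ==> length ss = k ==> (\<And>s. s \<in> set ss ==> local_section B W s) ==>
    (\<And>s q. s \<in> set ss ==> q \<in> W ==> s q \<in> D q) ==> smooth B W (\<lambda>q. \<omega> q (map (\<lambda>s. s q) ss))"
  by (rule conjunct2[OF conjunct2[OF a], rule_format], intro conjI ballI) auto
qed

context
 fixes D :: "'m => 'e set" and k :: nat and \<omega> :: "'m => 'e list => real"
 assumes \<omega>: "\<omega> \<in> forms B D k" and D: "\<And>p. subspace (D p)"
begin

lemma form_sum:
 assumes "length vs = k" "set vs \<subseteq> D p" "i < k" "\<And>a. a \<in> X ==> v a \<in> D p"
 shows "\<omega> p (vs[i := \<Sum>a\<in>X. h a *\<^sub>R v a]) = (\<Sum>a\<in>X. h a * \<omega> p (vs[i := v a]))"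
 using assms(4)
proof (induction X rule: infinite_finite_induct)
 case (insert x X)
 have "(\<Sum>a\<in>insert x X. h a *\<^sub>R v a) = h x *\<^sub>R v x + 1 *\<^sub>R (\<Sum>a\<in>X. h a *\<^sub>R v a)" using insert by simp
 then show ?case using insert
   formsD(1)[OF \<omega> assms(1-3), of "v x" "\<Sum>a\<in>X. h a *\<^sub>R v a" "h x" 1]
  by (simp add: subspace_sum[OF D] subspace_scale[OF D])
next
 case empty
 then show ?case using formsD(1)[OF \<omega> assms(1-3) subspace_0[OF D] subspace_0[OF D], of 0 0] by simp
next
 case (infinite X)
 then show ?case using formsD(1)[OF \<omega> assms(1-3) subspace_0[OF D] subspace_0[OF D], of 0 0] by simp
qed

lemma form_alt2:
 assumes "k = 2" "u \<in> D p" "v \<in> D p"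
 shows "\<omega> p [u, v] = - \<omega> p [v, u]"
proof -
 have s: "u + v \<in> D p" by (intro subspace_add[OF D] assms)
 have l: "\<omega> p [u + v, x] = \<omega> p [u, x] + \<omega> p [v, x]" if "x \<in> D p" for x
  using formsD(1)[OF \<omega>, of "[u, x]" p 0 u v 1 1] assms that by simp
 have m: "\<omega> p [x, u + v] = \<omega> p [x, u] + \<omega> p [x, v]" if "x \<in> D p" for x
  using formsD(1)[OF \<omega>, of "[x, u]" p 1 u v 1 1] assms that by simp
 have z: "\<omega> p [x, x] = 0" if "x \<in> D p" for x using formsD(2)[OF \<omega>, of "[x, x]" p] assms that by simp
 show ?thesis using z[OF s] l[OF s] m[of u] m[of v] z[of u] z[of v] assms by simp
qed

lemma form_alt3:
 assumes "k = 3" "u \<in> D p" "v \<in> D p" "w \<in> D p"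
 shows "\<omega> p [u, v, w] = - \<omega> p [v, u, w]" "\<omega> p [w, u, v] = - \<omega> p [w, v, u]"
proof -
 have s: "u + v \<in> D p" by (intro subspace_add[OF D] assms)
 have z: "\<omega> p [x, x, y] = 0" "\<omega> p [y, x, x] = 0" if "x \<in> D p" "y \<in> D p" for x y
  using formsD(2)[OF \<omega>, of "[x, x, y]" p] formsD(2)[OF \<omega>, of "[y, x, x]" p] assms that by simp_all
 have l: "\<omega> p [u + v, x, w] = \<omega> p [u, x, w] + \<omega> p [v, x, w]" if "x \<in> D p" for x
  using formsD(1)[OF \<omega>, of "[u, x, w]" p 0 u v 1 1] assms that by simp
 have m: "\<omega> p [x, u + v, w] = \<omega> p [x, u, w] + \<omega> p [x, v, w]" if "x \<in> D p" for x
  using formsD(1)[OF \<omega>, of "[x, u, w]" p 1 u v 1 1] assms that by simp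
 have m': "\<omega> p [w, u + v, x] = \<omega> p [w, u, x] + \<omega> p [w, v, x]" if "x \<in> D p" for x
  using formsD(1)[OF \<omega>, of "[w, u, x]" p 1 u v 1 1] assms that by simp
 have n: "\<omega> p [w, x, u + v] = \<omega> p [w, x, u] + \<omega> p [w, x, v]" if "x \<in> D p" for x
  using formsD(1)[OF \<omega>, of "[w, x, u]" p 2 u v 1 1] assms that by (simp add: numeral_2_eq_2)
 show "\<omega> p [u, v, w] = - \<omega> p [v, u, w]"
  using z(1)[OF s assms(4)] l[OF s] m[of u] m[of v] z[of u w] z[of v w] assms by simp
 show "\<omega> p [w, u, v] = - \<omega> p [w, v, u]"
  using z(2)[OF s assms(4)] m'[OF s] n[of u] n[of v] z[of u w] z[of v w] assms by simp
qed

end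

end

lemma alternating2_eq:
 fixes f g :: "nat => nat => real"
 assumes "\<And>s t. f s t = - f t s" "\<And>s t. g s t = - g t s" "\<And>s t. s < t ==> f s t = g s t"
 shows "f s t = g s t"
 using assms(1)[of s t] assms(2)[of s t] assms(3)[of s t] assms(3)[of t s]
 by (cases s t rule: linorder_cases) auto

text \<open>An array with these two sign rules vanishes at repeated indices, and adjacent exchanges
  sort all the others.\<close>

lemma alternating3_eq:
 fixes f g :: "nat => nat => nat => real"
 assumes f: "\<And>s t u. f s t u = - f t s u" "\<And>s t u. f s t u = - f s u t"
  and g: "\<And>s t u. g s t u = - g t s u" "\<And>s t u. g s t u = - g s u t"
  and "\<And>s t u. s < t ==> t < u ==> f s t u = g s t u"
 shows "f s t u = g s t u"
proof -
 have 1: "f s t u = g s t u" if "s < t" for s t u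
 proof -
  have z: "f s t t = 0" "g s t t = 0" "f s t s = 0" "g s t s = 0"
   using f(2)[of s t t] g(2)[of s t t] f(2)[of s t s] g(2)[of s t s] f(1)[of s s t] g(1)[of s s t] by auto
  consider "t < u" | "u = t" | "s < u" "u < t" | "u = s" | "u < s" by linarith
  then show ?thesis
  proof cases
   case 1 then show ?thesis using assms(5) that by blast
  next
   case 3 then show ?thesis using f(2)[of s t u] g(2)[of s t u] assms(5)[of s u t] by simp
  next
   case 5
   then show ?thesis using f(2)[of s t u] g(2)[of s t u] f(1)[of s u t] g(1)[of s u t] assms(5)[of u s t] that by simp
  qed (use z in simp_all)
 qed
 show ?thesis
  using 1[of s t u] 1[of t s u] f(1)[of s t u] g(1)[of s t u]
  by (cases s t rule: linorder_cases) auto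
qed

context adapted_chart begin

text \<open>The frame vector on which a form is evaluated for the odd variable s: the conjugate
  vector if s is of kind q. The default 0 for the other kind makes the formulas
  \<open>emb_word1\<close> to \<open>emb_word3\<close> valid for all indices.\<close>

definition fd :: "nat => nat => 'm => 'e" where
 "fd q s p = (if s < 2 * r \<and> s mod 2 = q then fr c (dual s) p else 0)"

context
 fixes D :: "'m => 'e set" and q k :: nat and \<omega> :: "'m => 'e list => real"
 assumes qD: "q = 0 \<and> D = A \<or> q = 1 \<and> D = K" and \<omega>: "\<omega> \<in> forms B D k"
begin

lemma DS: "subspace (D p)" using qD A_subspace K_subspace by auto

lemma fd_D: "p \<in> Oc ==> fd q s p \<in> D p"
 using qD fr_A[of p "dual s"] fr_K[of p "dual s"] subspace_0[OF DS, of p]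
 by (auto simp: fd_def odd_iff_mod_2_eq_one)

lemma emb_at:
 assumes "p \<in> Oc" "S \<subseteq> {..<2 * r}" "card S = k"
 shows "emb B A K q k \<omega> c ({#}, S) p = \<omega> p (map (\<lambda>s. fd q s p) (sorted_list_of_set S))"
proof (cases "\<forall>s\<in>S. s mod 2 = q")
 case True
 have fin: "finite S" using finite_subset assms by blast
 have "(if q = 0 then frA c else frK c) (s div 2) p = fd q s p" if "s \<in> S" for s
 proof -
  have s: "s < 2 * r" "s mod 2 = q" using that True assms by auto
  then have "even (dual s) \<longleftrightarrow> q \<noteq> 0" unfolding dual_parity by presburger
  then show ?thesis using s by (simp add: fd_def fr_def)
 qed
 then have "map (\<lambda>s. (if q = 0 then frA c else frK c) (s div 2) p) (sorted_list_of_set S)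
  = map (\<lambda>s. fd q s p) (sorted_list_of_set S)" using fin by (intro map_cong refl) simp
 moreover have "emb B A K q k \<omega> c ({#}, S) p =
   \<omega> p (map (\<lambda>s. (if q = 0 then frA c else frK c) (s div 2) p) (sorted_list_of_set S))"
  unfolding emb_def prod.case using True assms c by (intro if_P) auto
 ultimately show ?thesis by (simp only:)
next
 case False
 then obtain s where s: "s \<in> S" "s mod 2 \<noteq> q" by blast
 have fin: "finite S" using finite_subset assms by blast
 let ?vs = "map (\<lambda>s. fd q s p) (sorted_list_of_set S)"
 obtain i where i: "i < length (sorted_list_of_set S)" "sorted_list_of_set S ! i = s"
  using s(1) fin by (metis in_set_conv_nth set_sorted_list_of_set)
 have len: "length ?vs = k" using assms fin by simp
 \<comment> \<open>A variable of the wrong kind puts a 0 into the list of arguments, and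
   multilinearity with coefficients 0 makes the form vanish.\<close>
 have "?vs[i := 0 *\<^sub>R 0 + 0 *\<^sub>R 0] = ?vs"
  using i s by (simp add: list_update_same_conv fd_def)
 moreover have "\<omega> p (?vs[i := 0 *\<^sub>R 0 + 0 *\<^sub>R 0]) = 0 * \<omega> p (?vs[i := 0]) + 0 * \<omega> p (?vs[i := 0])"
  by (rule formsD(1)[OF \<omega> len _ _ subspace_0[OF DS] subspace_0[OF DS]]) (use fd_D assms(1) i len in auto)
 ultimately have "\<omega> p ?vs = 0" by simp
 moreover have "emb B A K q k \<omega> c ({#}, S) p = 0" using False by (auto simp: emb_def)
 ultimately show ?thesis by simp
qed

lemma emb_supp: "supp (\<lambda>m S. m = {#} \<and> S \<subseteq> {..<2 * r} \<and> card S = k \<and> (\<forall>s\<in>S. s mod 2 = q)) (emb B A K q k \<omega> c)"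
 by (rule suppI) (auto simp: emb_def split: if_splits)

lemma emb_hom: "hom (int k) (emb B A K q k \<omega> c)" and emb_rng: "rng (emb B A K q k \<omega> c)"
 by (auto intro!: supp_mono[OF emb_supp] dest: finite_subset)

lemma emb_smooth: "smooth B Oc (emb B A K q k \<omega> c (m, S))"
proof (cases "m = {#} \<and> S \<subseteq> {..<2 * r} \<and> card S = k")
 case True
 then have fin: "finite S" using finite_subset by blast
 have fs: "local_section B Oc (fd q s)" for s
 proof (cases "s < 2 * r \<and> s mod 2 = q")
  case True
  then show ?thesis using fr_section[of "dual s"] by (simp add: fd_def[abs_def])
 next
  case False
  then have "fd q s = (\<lambda>_. 0)" by (auto simp: fd_def)
  then show ?thesis using local_section_zero[OF cdata(1)] by simp
 qed
 have "smooth B Oc (\<lambda>p. \<omega> p (map (\<lambda>s. s p) (map (fd q) (sorted_list_of_set S))))"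
  by (rule formsD(3)[OF \<omega> cdata(1)]) (use True fin fs fd_D in auto)
 then show ?thesis by (rule smooth_cong[OF cdata(1)]) (use True emb_at in \<open>auto simp: o_def\<close>)
next
 case False
 then have "emb B A K q k \<omega> c (m, S) = (\<lambda>_. 0)" by (auto simp: emb_def fun_eq_iff)
 then show ?thesis using smooth_const[OF cdata(1)] by simp
qed

lemma emb_word0: "k = 0 ==> p \<in> Oc ==> ev (emb B A K q k \<omega> c) p = \<omega> p []"
 using emb_at[of p "{}"] by (simp add: ev_def)

lemma emb_word1: "k = 1 ==> p \<in> Oc ==> s < 2 * r ==> ev (ldr s (emb B A K q k \<omega> c)) p = \<omega> p [fd q s p]"
 using emb_at[of p "{s}"] by (simp add: ev_ldr)

lemma emb_word2:
 assumes k: "k = 2" and p: "p \<in> Oc" and st: "s < 2 * r" "t < 2 * r"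
 shows "ev (ldr s (ldr t (emb B A K q k \<omega> c))) p = \<omega> p [fd q s p, fd q t p]"
proof -
 \<comment> \<open>Continued by 0 outside the range, so that both arrays are alternating on all
   numbers and \<open>alternating2_eq\<close> applies.\<close>
 define f where "f s t = (if s < 2 * r \<and> t < 2 * r then ev (ldr s (ldr t (emb B A K q k \<omega> c))) p else 0)" for s t
 define g where "g s t = (if s < 2 * r \<and> t < 2 * r then \<omega> p [fd q s p, fd q t p] else 0)" for s t
 have "f s t = g s t"
 proof (rule alternating2_eq)
  show "f s t = - f t s" for s t unfolding f_def by (simp add: ev_ldr_swap[of s t])
  show "g s t = - g t s" for s t unfolding g_def by (simp add: form_alt2[OF \<omega> DS k fd_D fd_D, OF p p, of s t])
  fix s t :: nat assume "s < t"
  then show "f s t = g s t" unfolding f_def g_def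
   using emb_at[OF p, of "{s, t}"] ordered_coeff2[of s t "emb B A K q k \<omega> c" "{#}"] k
   by (auto simp: ev_def)
 qed
 then show ?thesis using st by (simp add: f_def g_def)
qed

lemma emb_word3:
 assumes k: "k = 3" and p: "p \<in> Oc" and st: "s < 2 * r" "t < 2 * r" "u < 2 * r"
 shows "ev (ldr s (ldr t (ldr u (emb B A K q k \<omega> c)))) p = \<omega> p [fd q s p, fd q t p, fd q u p]"
proof -
 define f where "f s t u = (if s < 2 * r \<and> t < 2 * r \<and> u < 2 * r then ev (ldr s (ldr t (ldr u (emb B A K q k \<omega> c)))) p else 0)" for s t u
 define g where "g s t u = (if s < 2 * r \<and> t < 2 * r \<and> u < 2 * r then \<omega> p [fd q s p, fd q t p, fd q u p] else 0)" for s t u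
 have "f s t u = g s t u"
 proof (rule alternating3_eq)
  show "f s t u = - f t s u" for s t u unfolding f_def by (simp add: ev_ldr_swap[of s t])
  show "f s t u = - f s u t" for s t u unfolding f_def by (simp add: ev_ldr_swap3[of s t])
  show "g s t u = - g t s u" for s t u
   using form_alt3(1)[OF \<omega> DS k fd_D[OF p, of s] fd_D[OF p, of t] fd_D[OF p, of u]] unfolding g_def by simp
  show "g s t u = - g s u t" for s t u
   using form_alt3(2)[OF \<omega> DS k fd_D[OF p, of t] fd_D[OF p, of u] fd_D[OF p, of s]] unfolding g_def by simp
  fix s t u :: nat assume "s < t" "t < u"
  then show "f s t u = g s t u" unfolding f_def g_def
   using emb_at[OF p, of "{s, t, u}"] ordered_coeff3[of s t u "emb B A K q k \<omega> c" "{#}"] k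
   by (auto simp: ev_def)
 qed
 then show ?thesis using st by (simp add: f_def g_def)
qed

end

end

section \<open>Forms under change of charts\<close>

context chart_pair begin

lemma fd_change:
 assumes "q = 0 \<or> q = 1" "s < 2 * r"
 shows "c1.fd q s p = (\<Sum>a<2 * r. M s a p *\<^sub>R c2.fd q a p)"
proof -
 have e: "fr c (dual s) p = (\<Sum>a<2 * r. M s a p *\<^sub>R fr c' (dual a) p)"
 proof -
  have "fr c (dual s) p = (\<Sum>a<2 * r. pair B p (fr c (dual s) p) (fr c' (dual a) p) *\<^sub>R fr c' a p)"
   by (rule c2.fr_expand[OF p2 c1.fr_fib[OF p1]]) (use assms in simp)
  also have "\<dots> = (\<Sum>a<2 * r. pair B p (fr c (dual s) p) (fr c' a p) *\<^sub>R fr c' (dual a) p)"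
   by (subst sum_dual[symmetric]) simp
  also have "\<dots> = (\<Sum>a<2 * r. M s a p *\<^sub>R fr c' (dual a) p)"
   by (rule sum.cong[OF refl]) (simp add: M_def pair_sym[OF c1.fr_fib[OF p1] c2.fr_fib[OF p2]] assms)
  finally show ?thesis .
 qed
 have "M s a p *\<^sub>R c2.fd q a p = (if s mod 2 = q then M s a p *\<^sub>R fr c' (dual a) p else 0)" if "a < 2 * r" for a
  using that M_parity[OF pOv assms(2) that] assms(1) unfolding c2.fd_def
  by (cases "even s"; cases "even a") (auto simp: odd_iff_mod_2_eq_one even_iff_mod_2_eq_zero)
 then have "(\<Sum>a<2 * r. M s a p *\<^sub>R c2.fd q a p) = (\<Sum>a<2 * r. if s mod 2 = q then M s a p *\<^sub>R fr c' (dual a) p else 0)"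
  by (intro sum.cong refl) auto
 then show ?thesis using e assms(2) by (simp add: c1.fd_def)
qed

lemma transition_no_P:
 assumes "supp (\<lambda>m S. m = {#}) F"
 shows "supp (\<lambda>m S. m = {#}) (transition B c c' F)"
 unfolding transition_def
proof (rule supp_sum, clarify)
 fix m S assume nz: "F (m, S) \<noteq> 0"
 let ?Q = "\<lambda>m (S :: nat set). m = {#}"
 have m: "m = {#}" using nz assms unfolding supp_def by blast
 have l: "supp ?Q (lone :: 'm lfun)" by (rule suppI) (auto simp: lone_def split: if_splits)
 have o: "supp ?Q (loddvar s :: 'm lfun)" for s by (rule suppI) (auto simp: loddvar_def split: if_splits)
 have od: "supp ?Q (od t)" for t unfolding new_odd_def by (auto intro!: supp_sum supp_lcoef o)
 have mul: "supp ?Q (lmul X Y)" if "supp ?Q X" "supp ?Q Y" for X Y :: "'m lfun"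
  using that by (rule supp_lmul) auto
 have "supp ?Q (lprod (map od js))" for js
  by (induction js) (simp_all add: lprod_def l mul od)
 then show "supp ?Q (lcoef (F (m, S)) (lmul (lprod (map nP (sorted_list_of_multiset m))) (lprod (map od (sorted_list_of_set S)))))"
  unfolding m by (intro supp_lcoef mul) (simp_all add: lprod_def l)
qed

lemma eq_by_words:
 assumes F: "hom (int k) F" "c1.rng F" "supp (\<lambda>m S. m = {#}) F" and k: "k \<le> 3"
  and G: "hom (int k) G" "c1.rng G" "supp (\<lambda>m S. m = {#}) G"
  and "k = 0 ==> ev F p = ev G p"
  and "\<And>s. k = 1 ==> s < 2 * r ==> ev (ldr s F) p = ev (ldr s G) p"
  and "\<And>s t. k = 2 ==> s < 2 * r ==> t < 2 * r ==> ev (ldr s (ldr t F)) p = ev (ldr s (ldr t G)) p"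
  and "\<And>s t u. k = 3 ==> s < 2 * r ==> t < 2 * r ==> u < 2 * r ==>
    ev (ldr s (ldr t (ldr u F))) p = ev (ldr s (ldr t (ldr u G))) p"
 shows "F (m, S) p = G (m, S) p"
proof (cases "m = {#} \<and> S \<subseteq> {..<2 * r} \<and> card S = k")
 case False
 have z: "H (m, S) = 0" if "hom (int k) H" "c1.rng H" "supp (\<lambda>m S. m = {#}) H" for H
 proof (rule ccontr)
  assume nz: "H (m, S) \<noteq> 0"
  then have "finite S \<and> int (2 * size m + card S) = int k" "m = {#}" "S \<subseteq> {..<2 * r}"
   using that unfolding supp_def by blast+
  then show False using False by simp
 qed
 show ?thesis using z[OF F] z[OF G] by simp
next
 case True
 have fin: "finite S" using True finite_subset by blast
 define xs where "xs = sorted_list_of_set S"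
 have xs: "sorted_wrt (<) xs" "set xs = S" "length xs = k"
  unfolding xs_def using fin True by (auto simp: strict_sorted_list_of_set)
 consider "k = 0" | "k = 1" | "k = 2" | "k = 3" using k by linarith
 then show ?thesis
 proof cases
  case 1 then show ?thesis using assms(8) True fin by (simp add: ev_def)
 next
  case 2
  then obtain s where "xs = [s]" using xs by (metis One_nat_def length_0_conv length_Suc_conv)
  then have "S = {s}" using xs by auto
  then show ?thesis using assms(9)[OF 2, of s] True by (simp add: ev_ldr)
 next
  case 3
  then obtain s t where "xs = [s, t]" using xs by (metis (no_types) length_0_conv length_Suc_conv numeral_2_eq_2)
  then have "S = {s, t}" "s < t" using xs by auto
  then show ?thesis using assms(10)[OF 3, of s t] True by (simp add: ev_def ordered_coeff2)
 next
  case 4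
  then obtain s t u where "xs = [s, t, u]" using xs by (metis (no_types) length_0_conv length_Suc_conv numeral_3_eq_3)
  then have "S = {s, t, u}" "s < t" "t < u" using xs by auto
  then show ?thesis using assms(11)[OF 4, of s t u] True by (simp add: ev_def ordered_coeff3)
 qed
qed

text \<open>The words of \<open>emb\<close> are values of the form on frame vectors. By
  multilinearity they transform with M in each index, which is the rule of \<open>transition\<close>
  in the absence of P.\<close>

lemma emb_transition:
 assumes qD: "q = 0 \<and> D = A \<or> q = 1 \<and> D = K" and \<omega>: "\<omega> \<in> forms B D k" and k: "k \<le> 3"
 shows "emb B A K q k \<omega> c (m, S) p = transition B c c' (emb B A K q k \<omega> c') (m, S) p"
proof -
 let ?F = "emb B A K q k \<omega> c" and ?G = "emb B A K q k \<omega> c'"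
 have q: "q = 0 \<or> q = 1" using qD by auto
 note h = c2.emb_hom[OF qD \<omega>] and rn = c2.emb_rng[OF qD \<omega>]
 have np: "supp (\<lambda>m S. m = {#}) ?F" "supp (\<lambda>m S. m = {#}) ?G"
  by (rule supp_mono[OF c1.emb_supp[OF qD \<omega>]], simp) (rule supp_mono[OF c2.emb_supp[OF qD \<omega>]], simp)
 note DS = c1.DS[OF qD \<omega>]
 note fD = c2.fd_D[OF qD \<omega> p2]
 have fD': "(\<Sum>a<2 * r. M s a p *\<^sub>R c2.fd q a p) \<in> D p" for s
  by (intro subspace_sum[OF DS] subspace_scale[OF DS] fD)
 note fs = form_sum[OF \<omega> DS]
 show ?thesis
 proof (rule eq_by_words[OF c1.emb_hom[OF qD \<omega>] c1.emb_rng[OF qD \<omega>] np(1) k hom_transition[OF h] rng_transition transition_no_P[OF np(2)]])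
  show "ev ?F p = ev (transition B c c' ?G) p" if "k = 0"
   using c1.emb_word0[OF qD \<omega> that p1] c2.emb_word0[OF qD \<omega> that p2] transition_word0[OF rn] h that by simp
  show "ev (ldr s ?F) p = ev (ldr s (transition B c c' ?G)) p" if k1: "k = 1" and s: "s < 2 * r" for s
  proof -
   have "ev (ldr s ?F) p = (\<Sum>a<2 * r. M s a p * \<omega> p [c2.fd q a p])"
    using c1.emb_word1[OF qD \<omega> k1 p1 s] fs[of "[0]" p 0 "{..<2 * r}" "\<lambda>a. c2.fd q a p" "\<lambda>a. M s a p"]
     fD k1 subspace_0[OF DS]
    by (simp add: fd_change[OF q s])
   also have "\<dots> = (\<Sum>a<2 * r. ev (ldr a ?G) p * M s a p)"
    by (rule sum.cong[OF refl]) (simp add: c2.emb_word1[OF qD \<omega> k1 p2])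
   finally show ?thesis using transition_word1[OF rn _ s] h k1 by simp
  qed
  show "ev (ldr s (ldr t ?F)) p = ev (ldr s (ldr t (transition B c c' ?G))) p"
   if k1: "k = 2" and s: "s < 2 * r" "t < 2 * r" for s t
  proof -
   have 1: "\<omega> p [\<Sum>a<2 * r. M s a p *\<^sub>R c2.fd q a p, v] = (\<Sum>a<2 * r. M s a p * \<omega> p [c2.fd q a p, v])"
    if "v \<in> D p" for v
    using fs[of "[0, v]" p 0 "{..<2 * r}" "\<lambda>a. c2.fd q a p" "\<lambda>a. M s a p"] fD k1 subspace_0[OF DS] that by simp
   have 2: "\<omega> p [v, \<Sum>a<2 * r. M t a p *\<^sub>R c2.fd q a p] = (\<Sum>a<2 * r. M t a p * \<omega> p [v, c2.fd q a p])"
    if "v \<in> D p" for v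
    using fs[of "[v, 0]" p 1 "{..<2 * r}" "\<lambda>a. c2.fd q a p" "\<lambda>a. M t a p"] fD k1 subspace_0[OF DS] that by simp
   have "ev (ldr s (ldr t ?F)) p = (\<Sum>a<2 * r. \<Sum>b<2 * r. ev (ldr a (ldr b ?G)) p * M s a p * M t b p)"
    unfolding c1.emb_word2[OF qD \<omega> k1 p1 s] fd_change[OF q s(1)] fd_change[OF q s(2)] 1[OF fD'] 2[OF fD] sum_distrib_left
    by (rule sum.cong[OF refl], rule sum.cong[OF refl]) (simp add: c2.emb_word2[OF qD \<omega> k1 p2])
   moreover have "?G ({#j#}, S) = 0" for j S by (rule suppD[OF np(2)]) simp
   ultimately show ?thesis using transition_word2[OF rn _ _ s] h k1 by simp
  qed
  show "ev (ldr s (ldr t (ldr u ?F))) p = ev (ldr s (ldr t (ldr u (transition B c c' ?G)))) p"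
   if k1: "k = 3" and s: "s < 2 * r" "t < 2 * r" "u < 2 * r" for s t u
  proof -
   have 1: "\<omega> p [\<Sum>a<2 * r. M s a p *\<^sub>R c2.fd q a p, v, w] = (\<Sum>a<2 * r. M s a p * \<omega> p [c2.fd q a p, v, w])"
    if "v \<in> D p" "w \<in> D p" for v w
    using fs[of "[0, v, w]" p 0 "{..<2 * r}" "\<lambda>a. c2.fd q a p" "\<lambda>a. M s a p"] fD k1 subspace_0[OF DS] that by simp
   have 2: "\<omega> p [v, \<Sum>a<2 * r. M t a p *\<^sub>R c2.fd q a p, w] = (\<Sum>a<2 * r. M t a p * \<omega> p [v, c2.fd q a p, w])"
    if "v \<in> D p" "w \<in> D p" for v w
    using fs[of "[v, 0, w]" p 1 "{..<2 * r}" "\<lambda>a. c2.fd q a p" "\<lambda>a. M t a p"] fD k1 subspace_0[OF DS] that by simp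
   have 3: "\<omega> p [v, w, \<Sum>a<2 * r. M u a p *\<^sub>R c2.fd q a p] = (\<Sum>a<2 * r. M u a p * \<omega> p [v, w, c2.fd q a p])"
    if "v \<in> D p" "w \<in> D p" for v w
    using fs[of "[v, w, 0]" p 2 "{..<2 * r}" "\<lambda>a. c2.fd q a p" "\<lambda>a. M u a p"] fD k1 subspace_0[OF DS] that
    by (simp add: numeral_2_eq_2)
   have "ev (ldr s (ldr t (ldr u ?F))) p =
     (\<Sum>a<2 * r. \<Sum>b<2 * r. \<Sum>d<2 * r. ev (ldr a (ldr b (ldr d ?G))) p * M s a p * M t b p * M u d p)"
    unfolding c1.emb_word3[OF qD \<omega> k1 p1 s] fd_change[OF q s(1)] fd_change[OF q s(2)] fd_change[OF q s(3)]
     1[OF fD' fD'] 2[OF fD fD'] 3[OF fD fD] sum_distrib_left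
    by (rule sum.cong[OF refl], rule sum.cong[OF refl], rule sum.cong[OF refl]) (simp add: c2.emb_word3[OF qD \<omega> k1 p2])
   moreover have "ev (ldP j (ldr a ?G)) p = 0" for j a
    using suppD[OF np(2), of "{#j#}" "{a}"] by (simp add: ev_def ldP_def ldr_def)
   ultimately show ?thesis using transition_word3[OF rn _ s] h k1 by simp
  qed
 qed
qed

end

context split_bundle begin

lemma emb_basic:
 assumes qD: "q = 0 \<and> D = A \<or> q = 1 \<and> D = K" and \<omega>: "\<omega> \<in> forms B D k" and k: "k \<le> 3"
 shows "emb B A K q k \<omega> \<in> basic B A K q (int k)"
proof -
 let ?f = "emb B A K q k \<omega>"
 have ac: "adapted_chart B A K c" if "c \<in> acharts B A K" for c using that by unfold_locales
 have nz: "m = {#} \<and> S \<subseteq> {..<2 * r} \<and> card S = k \<and> (\<forall>s\<in>S. s mod 2 = q)" if "?f c (m, S) \<noteq> 0" for c m S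
  using that by (auto simp: emb_def fun_eq_iff split: if_splits)
 have "?f \<in> Cfun B A K (int k)"
  unfolding Cfun_def mem_Collect_eq
 proof (intro conjI allI ballI impI)
  fix c assume "c \<notin> acharts B A K"
  then show "?f c = 0" by (auto simp: emb_def fun_eq_iff)
 next
  fix c m S assume cc: "c \<in> acharts B A K"
  show "smooth B (cdom c) (?f c (m, S))" by (rule adapted_chart.emb_smooth[OF ac[OF cc] qD \<omega>])
  show "?f c (m, S) p = 0" if "p \<notin> cdom c" for p using that by (simp add: emb_def)
  assume "?f c (m, S) \<noteq> 0"
  from nz[OF this] show "set_mset m \<subseteq> {..<bdim B}" "S \<subseteq> {..<2 * r}" "int (2 * size m + card S) = int k" by auto
 next
  fix c c' p mS assume "c \<in> acharts B A K" "c' \<in> acharts B A K" "p \<in> cdom c \<inter> cdom c'"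
  then interpret chart_pair B A K c c' p by unfold_locales auto
  show "?f c mS p = transition B c c' (?f c') mS p"
   using emb_transition[OF qD \<omega> k] by (cases mS) simp
 qed
 then show ?thesis unfolding basic_def using nz by blast
qed

end

section \<open>The function of the given Courant algebroid\<close>

locale courant_split = split_bundle B A K
 for B :: "('m::{t2_space,second_countable_topology}, 'e::real_vector) qbundle"
  and A K :: "'m => 'e set" +
 fixes \<rho> :: "('m, 'e) anchor" and br :: "('m, 'e) sbracket"
 assumes ca: "courant_algebroid B \<rho> br"
begin

abbreviation \<Gamma> where "\<Gamma> \<equiv> sections B (fib B)"

lemma ca_facts:
 shows bundle_map: "bundle_map_to_tangent B \<rho>"
  and br_sec: "e1 \<in> \<Gamma> ==> e2 \<in> \<Gamma> ==> br e1 e2 \<in> \<Gamma>"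
  and br_lin: "e1 \<in> \<Gamma> ==> e2 \<in> \<Gamma> ==> e3 \<in> \<Gamma> ==> br (a *\<^sub>R e1 + b *\<^sub>R e2) e3 = a *\<^sub>R br e1 e3 + b *\<^sub>R br e2 e3 \<and>
     br e3 (a *\<^sub>R e1 + b *\<^sub>R e2) = a *\<^sub>R br e3 e1 + b *\<^sub>R br e3 e2"
  and jacobi: "e1 \<in> \<Gamma> ==> e2 \<in> \<Gamma> ==> e3 \<in> \<Gamma> ==> br e1 (br e2 e3) = br (br e1 e2) e3 + br e2 (br e1 e3)"
  and metric: "e1 \<in> \<Gamma> ==> e2 \<in> \<Gamma> ==> e3 \<in> \<Gamma> ==>
     act \<rho> e1 (spair B e2 e3) = spair B (br e1 e2) e3 + spair B e2 (br e1 e3)"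
  and br_diag: "e1 \<in> \<Gamma> ==> e2 \<in> \<Gamma> ==> spair B (br e1 e1) e2 = (1 / 2) *\<^sub>R act \<rho> e2 (spair B e1 e1)"
proof -
 note a = ca[unfolded courant_algebroid_def Let_def]
 note b = a[THEN conjunct2, THEN conjunct2, THEN conjunct2]
 note c = b[THEN conjunct2]
 note d = c[THEN conjunct2]
 note e = d[THEN conjunct2]
 show "bundle_map_to_tangent B \<rho>" by (rule a[THEN conjunct2, THEN conjunct2, THEN conjunct1])
 show "e1 \<in> \<Gamma> ==> e2 \<in> \<Gamma> ==> br e1 e2 \<in> \<Gamma>" by (rule b[THEN conjunct1, rule_format])
 show "e1 \<in> \<Gamma> ==> e2 \<in> \<Gamma> ==> e3 \<in> \<Gamma> ==> br (a *\<^sub>R e1 + b *\<^sub>R e2) e3 = a *\<^sub>R br e1 e3 + b *\<^sub>R br e2 e3 \<and>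
     br e3 (a *\<^sub>R e1 + b *\<^sub>R e2) = a *\<^sub>R br e3 e1 + b *\<^sub>R br e3 e2"
  by (rule c[THEN conjunct1, rule_format])
 show "e1 \<in> \<Gamma> ==> e2 \<in> \<Gamma> ==> e3 \<in> \<Gamma> ==> br e1 (br e2 e3) = br (br e1 e2) e3 + br e2 (br e1 e3)"
  by (rule d[THEN conjunct1, rule_format])
 show "e1 \<in> \<Gamma> ==> e2 \<in> \<Gamma> ==> e3 \<in> \<Gamma> ==>
     act \<rho> e1 (spair B e2 e3) = spair B (br e1 e2) e3 + spair B e2 (br e1 e3)"
  by (rule e[THEN conjunct1, rule_format])
 show "e1 \<in> \<Gamma> ==> e2 \<in> \<Gamma> ==> spair B (br e1 e1) e2 = (1 / 2) *\<^sub>R act \<rho> e2 (spair B e1 e1)"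
  by (rule e[THEN conjunct2, rule_format])
qed

lemma sec_fib: "e \<in> \<Gamma> ==> e p \<in> fib B p" by (rule sectionsD(1))

lemma sec_add: "e1 \<in> \<Gamma> ==> e2 \<in> \<Gamma> ==> e1 + e2 \<in> \<Gamma>"
 unfolding plus_fun_def
 by (rule sectionsI, rule local_section_add[OF open_UNIV sectionsD(2) sectionsD(2)])
   (simp_all add: subspace_add[OF fib_subspace sec_fib sec_fib])

lemma br_add: "e1 \<in> \<Gamma> ==> e2 \<in> \<Gamma> ==> e3 \<in> \<Gamma> ==> br (e1 + e2) e3 = br e1 e3 + br e2 e3"
 "e1 \<in> \<Gamma> ==> e2 \<in> \<Gamma> ==> e3 \<in> \<Gamma> ==> br e3 (e1 + e2) = br e3 e1 + br e3 e2"
 using br_lin[of e1 e2 e3 1 1] by simp_all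

lemma spair_smooth: "e1 \<in> \<Gamma> ==> e2 \<in> \<Gamma> ==> smooth B UNIV (spair B e1 e2)"
 unfolding spair_def by (rule pair_smooth[OF open_UNIV sectionsD(2) sectionsD(2)])

lemma metric_at: "e1 \<in> \<Gamma> ==> e2 \<in> \<Gamma> ==> e3 \<in> \<Gamma> ==>
  \<rho> p (e1 p) (spair B e2 e3) = pair B p (br e1 e2 p) (e3 p) + pair B p (e2 p) (br e1 e3 p)"
 using fun_cong[OF metric, of e1 e2 e3 p] by (simp add: act_def spair_def)

lemma anchor_lin: "u \<in> fib B p ==> v \<in> fib B p ==> smooth B UNIV f ==>
  \<rho> p (a *\<^sub>R u + b *\<^sub>R v) f = a * \<rho> p u f + b * \<rho> p v f"
 using bundle_map unfolding bundle_map_to_tangent_def by blast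

lemma anchor_smooth: "e \<in> \<Gamma> ==> smooth B UNIV f ==> smooth B UNIV (act \<rho> e f)"
 using bundle_map unfolding bundle_map_to_tangent_def by blast

lemma anchor_sum: "smooth B UNIV f ==> (\<And>i. i \<in> I ==> v i \<in> fib B p) ==>
  \<rho> p (\<Sum>i\<in>I. k i *\<^sub>R v i) f = (\<Sum>i\<in>I. k i * \<rho> p (v i) f)"
proof (induction I rule: infinite_finite_induct)
 case (insert i I)
 then have "(\<Sum>i\<in>I. k i *\<^sub>R v i) \<in> fib B p"
  by (auto intro!: subspace_sum subspace_scale fib_subspace)
 then show ?case using insert anchor_lin[of "v i" p "\<Sum>i\<in>I. k i *\<^sub>R v i" f "k i" 1] by simp
qed (use anchor_lin[OF subspace_0 subspace_0, OF fib_subspace fib_subspace, of f p 0 0] in simp_all)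

lemma anchor_chart:
 assumes cc: "c \<in> acharts B A K" "p \<in> cdom c" and u: "u \<in> fib B p"
 shows "\<exists>k. \<forall>f. smooth B UNIV f \<longrightarrow> \<rho> p u f = (\<Sum>i<bdim B. k i * ldx c i f p)"
proof -
 interpret adapted_chart B A K c using cc(1) by unfold_locales
 obtain U where U: "(U, coord c) \<in> atlas B" "Oc \<subseteq> U" using cdata(2) by (elim exE conjE)
 have "\<rho> p u \<in> tangent_space B p" using bundle_map u unfolding bundle_map_to_tangent_def by blast
 then obtain k where "\<forall>f. smooth B UNIV f \<longrightarrow> \<rho> p u f = (\<Sum>i<bdim B. k i * pd U (coord c) i f p)"
  unfolding tangent_space_def using U cc(2) by blast
 moreover have "ldx c i f p = pd U (coord c) i f p" if "i < bdim B" for i f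
  by (rule pd_restrict[OF chart[OF U(1)] cdata(1) U(2) cc(2) that])
 ultimately show ?thesis by auto
qed

text \<open>The anchor acts through the coordinate derivatives at p, so it sees only the germ of the
  function. This allows cut-off functions in place of local ones.\<close>

lemma anchor_local:
 assumes "u \<in> fib B p" "smooth B UNIV f" "smooth B UNIV g" "open W" "p \<in> W" "\<And>q. q \<in> W ==> f q = g q"
 shows "\<rho> p u f = \<rho> p u g"
proof -
 obtain c where cc: "c \<in> acharts B A K" "p \<in> cdom c" using adapted_chart_ex by blast
 interpret adapted_chart B A K c using cc(1) by unfold_locales
 obtain k where k: "\<forall>f. smooth B UNIV f \<longrightarrow> \<rho> p u f = (\<Sum>i<bdim B. k i * ldx c i f p)"
  using anchor_chart[OF cc assms(1)] by (elim exE)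
 have "ldx c i f p = ldx c i g p" if "i < bdim B" for i
  by (rule ldx_cong[OF assms(4,5) cc(2) that]) (rule assms(6))
 then show ?thesis using k assms(2,3) by simp
qed

lemma anchor_const: "u \<in> fib B p ==> \<rho> p u (\<lambda>_. k) = 0"
proof -
 assume u: "u \<in> fib B p"
 obtain c where cc: "c \<in> acharts B A K" "p \<in> cdom c" using adapted_chart_ex by blast
 interpret adapted_chart B A K c using cc(1) by unfold_locales
 show ?thesis using anchor_chart[OF cc u] smooth_const[of UNIV k] by (auto simp: ldx_const)
qed

lemma anchor_add: "u \<in> fib B p ==> smooth B UNIV f ==> smooth B UNIV g ==>
  \<rho> p u (\<lambda>q. f q + g q) = \<rho> p u f + \<rho> p u g"
proof -
 assume u: "u \<in> fib B p" and f: "smooth B UNIV f" and g: "smooth B UNIV g"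
 obtain c where cc: "c \<in> acharts B A K" "p \<in> cdom c" using adapted_chart_ex by blast
 interpret adapted_chart B A K c using cc(1) by unfold_locales
 obtain k where k: "\<forall>f. smooth B UNIV f \<longrightarrow> \<rho> p u f = (\<Sum>i<bdim B. k i * ldx c i f p)"
  using anchor_chart[OF cc u] by (elim exE)
 have "ldx c i (\<lambda>q. f q + g q) p = ldx c i f p + ldx c i g p" if "i < bdim B" for i
  by (intro ldx_add[OF cc(2)] smooth_pdiffC[OF f] smooth_pdiffC[OF g] that cc(2)) auto
 then show ?thesis using k f g smooth_add[OF open_UNIV f g]
  by (simp add: distrib_left sum.distrib)
qed

text \<open>Polarisation of the axiom on the bracket of a section with itself.\<close>

lemma polar:
 assumes e: "e1 \<in> \<Gamma>" "e2 \<in> \<Gamma>" "x \<in> \<Gamma>"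
 shows "pair B p (br e1 e2 p) (x p) + pair B p (br e2 e1 p) (x p) = \<rho> p (x p) (spair B e1 e2)"
proof -
 have d: "2 * pair B p (br e e p) (x p) = \<rho> p (x p) (spair B e e)" if "e \<in> \<Gamma>" for e
  using fun_cong[OF br_diag[OF that e(3)], of p] by (simp add: act_def spair_def scaleR_fun_def)
 have s: "spair B (e1 + e2) (e1 + e2) = (\<lambda>q. spair B e1 e1 q + (spair B e2 e2 q + (spair B e1 e2 q + spair B e1 e2 q)))"
 proof
  fix q
  have f: "e1 q \<in> fib B q" "e2 q \<in> fib B q" "e1 q + e2 q \<in> fib B q"
   using e sec_fib subspace_add[OF fib_subspace] by auto
  show "spair B (e1 + e2) (e1 + e2) q = spair B e1 e1 q + (spair B e2 e2 q + (spair B e1 e2 q + spair B e1 e2 q))"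
   using f pair_sym[OF f(1,3)] pair_sym[OF f(2,3)] pair_sym[OF f(2,1)] by (simp add: spair_def pair_add)
 qed
 have b: "br (e1 + e2) (e1 + e2) p = br e1 e1 p + (br e1 e2 p + (br e2 e1 p + br e2 e2 p))"
  using e by (simp add: br_add sec_add)
 have f: "br e1 e1 p \<in> fib B p" "br e1 e2 p \<in> fib B p" "br e2 e1 p \<in> fib B p" "br e2 e2 p \<in> fib B p" "x p \<in> fib B p"
  by (intro sec_fib br_sec e)+
 have sm: "smooth B UNIV (spair B a b)" if "a \<in> {e1, e2}" "b \<in> {e1, e2}" for a b
  using that e by (intro spair_smooth) auto
 have "\<rho> p (x p) (spair B (e1 + e2) (e1 + e2)) = \<rho> p (x p) (spair B e1 e1) + (\<rho> p (x p) (spair B e2 e2)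
   + (\<rho> p (x p) (spair B e1 e2) + \<rho> p (x p) (spair B e1 e2)))"
  unfolding s by (subst anchor_add[OF f(5)], (intro smooth_add open_UNIV sm; simp)+)+ simp
 moreover have "2 * pair B p (br (e1 + e2) (e1 + e2) p) (x p) = 2 * pair B p (br e1 e1 p) (x p)
   + (2 * (pair B p (br e1 e2 p) (x p) + pair B p (br e2 e1 p) (x p)) + 2 * pair B p (br e2 e2 p) (x p))"
  unfolding b using f by (simp add: pair_add subspace_add[OF fib_subspace])
 ultimately show ?thesis using d[OF sec_add[OF e(1,2)]] d[OF e(1)] d[OF e(2)] by simp
qed

text \<open>Invariance of the pairing turns each anchor into brackets, and the Jacobi identity for z
  and for w closes the computation. The anchor is thus seen to respect brackets on functions that
  are pairings.\<close>

lemma anchor_bracket: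
 assumes e: "x \<in> \<Gamma>" "y \<in> \<Gamma>" "z \<in> \<Gamma>" "w \<in> \<Gamma>"
 shows "\<rho> p (br x y p) (spair B z w) = \<rho> p (x p) (act \<rho> y (spair B z w)) - \<rho> p (y p) (act \<rho> x (spair B z w))"
proof -
 have sm: "smooth B UNIV (spair B a b)" if "a \<in> \<Gamma>" "b \<in> \<Gamma>" for a b using that by (rule spair_smooth)
 have a: "\<rho> p (u p) (act \<rho> v (spair B z w)) =
   (pair B p (br u (br v z) p) (w p) + pair B p (br v z p) (br u w p))
   + (pair B p (br u z p) (br v w p) + pair B p (z p) (br u (br v w) p))"
  if uv: "u \<in> \<Gamma>" "v \<in> \<Gamma>" for u v
 proof -
  have "act \<rho> v (spair B z w) = (\<lambda>q. spair B (br v z) w q + spair B z (br v w) q)"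
   using metric[OF uv(2) e(3,4)] by (simp add: plus_fun_def)
  then have "\<rho> p (u p) (act \<rho> v (spair B z w)) = \<rho> p (u p) (spair B (br v z) w) + \<rho> p (u p) (spair B z (br v w))"
   using anchor_add[OF sec_fib[OF uv(1)] sm sm, OF br_sec e(4) e(3) br_sec] uv e by simp
  then show ?thesis using metric_at[OF uv(1) br_sec[OF uv(2) e(3)] e(4)] metric_at[OF uv(1) e(3) br_sec[OF uv(2) e(4)]] by simp
 qed
 have j: "br (br x y) v p = br x (br y v) p - br y (br x v) p" if "v \<in> \<Gamma>" for v
  using fun_cong[OF jacobi[OF e(1,2) that], of p] by simp
 have s: "pair B p (br u v p) (br u' v' p) = pair B p (br u' v' p) (br u v p)"
  if "u \<in> \<Gamma>" "v \<in> \<Gamma>" "u' \<in> \<Gamma>" "v' \<in> \<Gamma>" for u v u' v'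
  by (intro pair_sym sec_fib br_sec that)
 have l: "pair B p (br (br x y) z p) (w p) = pair B p (br x (br y z) p) (w p) - pair B p (br y (br x z) p) (w p)"
  unfolding j[OF e(3)] by (intro pair_diff sec_fib br_sec e)
 have l': "pair B p (z p) (br (br x y) w p) = pair B p (z p) (br x (br y w) p) - pair B p (z p) (br y (br x w) p)"
 proof -
  have f: "z p \<in> fib B p" "br x (br y w) p \<in> fib B p" "br y (br x w) p \<in> fib B p"
   by (intro sec_fib br_sec e)+
  show ?thesis unfolding j[OF e(4)]
   using pair_diff[OF f(2,3,1)] pair_sym[OF f(1,2)] pair_sym[OF f(1,3)]
    pair_sym[OF f(1) subspace_diff[OF fib_subspace f(2,3)]] by simp
 qed
 show ?thesis unfolding a[OF e(1,2)] a[OF e(2,1)] metric_at[OF br_sec[OF e(1,2)] e(3,4)] l l'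
  by simp
qed

text \<open>By the Jacobi identity the symmetric part of the bracket acts trivially from the left,
  so by invariance of the pairing its anchor annihilates pairings.\<close>

lemma anchor_exact:
 assumes e: "x \<in> \<Gamma>" "y \<in> \<Gamma>" "z \<in> \<Gamma>" "w \<in> \<Gamma>"
 shows "\<rho> p (br x y p + br y x p) (spair B z w) = 0"
proof -
 have j: "br (br x y + br y x) v = 0" if v: "v \<in> \<Gamma>" for v
 proof -
  have "br (br x y + br y x) v = br (br x y) v + br (br y x) v"
   by (intro br_add br_sec e v)
  then show ?thesis using jacobi[OF e(1,2) v] jacobi[OF e(2,1) v] by simp
 qed
 have X: "br x y + br y x \<in> \<Gamma>" by (intro sec_add br_sec e)
 have "\<rho> p ((br x y + br y x) p) (spair B z w) = 0"
  unfolding metric_at[OF X e(3,4)] j[OF e(3)] j[OF e(4)]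
  using pair_zero[OF sec_fib[OF e(4)]] pair_sym[OF sec_fib[OF e(3)] subspace_0[OF fib_subspace]]
   pair_zero[OF sec_fib[OF e(3)]] by simp
 then show ?thesis by simp
qed

text \<open>Pairing the Jacobi identity with e4 removes the nested brackets: each becomes
  derivatives of pairings <[e, e'], e''> and products <[e, e'], [e'', e''']>. These are the terms of
  \<open>self_bracket_quartic\<close>.\<close>

lemma jacobi_paired:
 assumes e: "e1 \<in> \<Gamma>" "e2 \<in> \<Gamma>" "e3 \<in> \<Gamma>" "e4 \<in> \<Gamma>"
 shows "\<rho> p (e1 p) (spair B (br e2 e3) e4) - pair B p (br e2 e3 p) (br e1 e4 p) =
  \<rho> p (e4 p) (spair B (br e1 e2) e3) - \<rho> p (e3 p) (spair B (br e1 e2) e4)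
   + pair B p (br e1 e2 p) (br e3 e4 p)
   + \<rho> p (e2 p) (spair B (br e1 e3) e4) - pair B p (br e1 e3 p) (br e2 e4 p)"
proof -
 have "pair B p (br e1 (br e2 e3) p) (e4 p) = pair B p (br (br e1 e2) e3 p) (e4 p) + pair B p (br e2 (br e1 e3) p) (e4 p)"
  unfolding jacobi[OF e(1-3)] plus_fun_apply by (intro pair_add sec_fib br_sec e)
 then show ?thesis
  using metric_at[OF e(1) br_sec[OF e(2,3)] e(4), of p] metric_at[OF e(2) br_sec[OF e(1,3)] e(4), of p]
   polar[OF br_sec[OF e(1,2)] e(3,4), of p] metric_at[OF e(3) br_sec[OF e(1,2)] e(4), of p]
  by simp
qed

end

text \<open>Global sections that agree on V with the adapted frame. The sections \<open>z l\<close>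
  and w express the coordinates on V as pairings, because \<open>anchor_bracket\<close> and
  \<open>anchor_exact\<close> speak about pairings.\<close>

locale courant_frame = courant_split B A K \<rho> br + adapted_chart B A K c
 for B :: "('m::{t2_space,second_countable_topology}, 'e::real_vector) qbundle"
  and A K :: "'m => 'e set" and \<rho> br c +
 fixes V :: "'m set" and E :: "nat => 'm => 'e" and z :: "nat => 'm => 'e" and w :: "'m => 'e"
 assumes V: "open V" "V \<subseteq> cdom c"
  and E: "\<And>s. s < 2 * hrk B ==> E s \<in> sections B (fib B)"
   "\<And>s. s < 2 * hrk B ==> odd s ==> E s \<in> sections B A"
   "\<And>s. s < 2 * hrk B ==> even s ==> E s \<in> sections B K"
  and E_fr: "\<And>s q. s < 2 * hrk B ==> q \<in> V ==> E s q = fr c s q"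
  and zw: "\<And>l. l < bdim B ==> z l \<in> sections B (fib B)" "w \<in> sections B (fib B)"
  and zw_coord: "\<And>l q. l < bdim B ==> q \<in> V ==> spair B (z l) w q = coord c q l"
begin

abbreviation h where "h l \<equiv> spair B (z l) w"
abbreviation T where "T s t u \<equiv> spair B (br (E s) (E t)) (E u)"

lemma VO: "q \<in> V ==> q \<in> Oc" using V by blast

lemma h_smooth: "l < nn ==> smooth B UNIV (h l)" by (rule spair_smooth[OF zw])

lemma T_smooth: "s < 2 * r ==> t < 2 * r ==> u < 2 * r ==> smooth B UNIV (T s t u)"
 by (rule spair_smooth[OF br_sec]) (rule E; assumption)+

text \<open>The anchor of u is a tangent vector, and its components are its values on
  \<open>h l\<close>, which agrees on V with the l-th coordinate.\<close>

lemma anchor_coord: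
 assumes "q \<in> V" "u \<in> fib B q" "smooth B UNIV f"
 shows "\<rho> q u f = (\<Sum>l<nn. \<rho> q u (h l) * ldx c l f q)"
proof -
 obtain k where k: "\<forall>f. smooth B UNIV f \<longrightarrow> \<rho> q u f = (\<Sum>i<nn. k i * ldx c i f q)"
  using anchor_chart[OF c VO[OF assms(1)] assms(2)] by (elim exE)
 have d: "ldx c i (h l) q = (if i = l then 1 else 0)" if "i < nn" "l < nn" for i l
 proof -
  have "ldx c i (h l) q = ldx c i (\<lambda>q. coord c q l) q"
   by (rule ldx_cong[OF V(1) assms(1) VO[OF assms(1)] that(1)]) (use zw_coord that in auto)
  then show ?thesis using ldx_coord[OF VO[OF assms(1)] that(1)] by simp
 qed
 have "\<rho> q u (h l) = k l" if "l < nn" for l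
 proof -
  have "\<rho> q u (h l) = (\<Sum>i<nn. k i * ldx c i (h l) q)" using k h_smooth[OF that] by blast
  also have "\<dots> = (\<Sum>i<nn. if i = l then k i else 0)" by (rule sum.cong) (auto simp: d that)
  finally show ?thesis using that by simp
 qed
 then show ?thesis using k assms(3) by simp
qed

lemma anchor_frame_pair:
 assumes "q \<in> V" "u \<in> fib B q" "s < 2 * r" "t < 2 * r"
 shows "\<rho> q u (spair B (E s) (E t)) = 0"
proof -
 have "\<rho> q u (spair B (E s) (E t)) = \<rho> q u (\<lambda>_. if t = dual s then 1 else 0)"
  by (rule anchor_local[OF assms(2) spair_smooth[OF E(1) E(1), OF assms(3,4)] smooth_const[OF open_UNIV] V(1) assms(1)])
    (use E_fr fr_pair VO assms in \<open>simp add: spair_def\<close>)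
 then show ?thesis using anchor_const[OF assms(2)] by simp
qed

lemma E_fib: "s < 2 * r ==> E s q \<in> fib B q" by (rule sec_fib[OF E(1)])

lemma br_fib: "s < 2 * r ==> t < 2 * r ==> br (E s) (E t) q \<in> fib B q" by (rule sec_fib[OF br_sec[OF E(1) E(1)]])

text \<open>The pairings of the frame are constant on V, so the derivative terms in
  \<open>polar\<close> and in the invariance of the pairing vanish.\<close>

lemma T_antisym:
 assumes "q \<in> V" "s < 2 * r" "t < 2 * r" "u < 2 * r"
 shows "T s t u q = - T t s u q" "T s t u q = - T s u t q"
proof -
 show "T s t u q = - T t s u q"
  using polar[OF E(1) E(1) E(1), OF assms(2-4), of q] anchor_frame_pair[OF assms(1) E_fib assms(2,3), OF assms(4)]
  by (simp add: spair_def)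
 show "T s t u q = - T s u t q"
  using metric_at[OF E(1) E(1) E(1), OF assms(2-4), of q] anchor_frame_pair[OF assms(1) E_fib assms(3,4), OF assms(2)]
   pair_sym[OF E_fib br_fib, OF assms(3) assms(2) assms(4), of q] by (simp add: spair_def)
qed

lemma pair_brackets:
 assumes "q \<in> V" "s < 2 * r" "t < 2 * r" "u < 2 * r" "v < 2 * r"
 shows "pair B q (br (E s) (E t) q) (br (E u) (E v) q) = (\<Sum>x<2 * r. T s t (dual x) q * T u v x q)"
 unfolding pair_expand[OF VO[OF assms(1)] br_fib[OF assms(2,3)] br_fib[OF assms(4,5)]]
 by (rule sum.cong[OF refl]) (simp add: spair_def E_fr assms(1))

context
 fixes Y :: "'m lfun"
 assumes Y: "hom 3 Y" "rng Y" "sm V Y"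
  and R: "\<And>l s q. l < nn ==> s < 2 * r ==> q \<in> V ==> Rc Y l (dual s) q = \<rho> q (E s q) (h l)"
  and CT: "\<And>s t u q. s < 2 * r ==> t < 2 * r ==> u < 2 * r ==> q \<in> V ==> Cc Y (dual s) (dual t) (dual u) q = - T s t u q"
begin

lemma anchor_sum_Rc:
 assumes "q \<in> V" "s < 2 * r" "smooth B UNIV g" "\<And>x. x \<in> V ==> f x = g x"
 shows "(\<Sum>l<nn. Rc Y l (dual s) q * ldx c l f q) = \<rho> q (E s q) g"
proof -
 have "ldx c l f q = ldx c l g q" if "l < nn" for l
  by (rule ldx_cong[OF V(1) assms(1) VO[OF assms(1)] that]) (use assms(4) in auto)
 then show ?thesis
  unfolding anchor_coord[OF assms(1) E_fib[OF assms(2)] assms(3)]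
  by (intro sum.cong refl) (simp add: R assms)
qed

text \<open>The three kinds of coefficients of degree 4 are the identities
  \<open>anchor_exact\<close>, \<open>anchor_bracket\<close> and \<open>jacobi_paired\<close> for
  the extended frame.\<close>

lemma self_bracket_zero:
 assumes q: "q \<in> V"
 shows "lpb Y Y mS q = 0"
proof (cases mS)
 case (Pair m S)
 note W = Y(3) V(1) q V(2)
 have h4: "hom 4 (lpb Y Y)" using hom_lpb[OF Y(1) Y(1)] by simp
 have "lpb Y Y (m, S) q = 0"
 proof (rule hom4_zero[OF h4 rng_lpb[OF Y(2) Y(2)]])
  fix i j assume ij: "i \<in> {..<nn}" "j \<in> {..<nn}"
  \<comment> \<open>By \<open>polar\<close> this vector is the gradient of the i-th coordinate under
    the pairing, so its components are the \<open>Rc Y i s\<close>; \<open>anchor_exact\<close> says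
    that its anchor annihilates the j-th coordinate.\<close>
  let ?X = "br (z i) w q + br w (z i) q"
  have l: "i < nn" "j < nn" using ij by auto
  note s = zw(1)[OF l(1)] zw(2)
  have f: "br (z i) w q \<in> fib B q" "br w (z i) q \<in> fib B q" by (intro sec_fib br_sec s)+
  have "?X = (\<Sum>s<2 * r. pair B q ?X (fr c (dual s) q) *\<^sub>R fr c s q)"
   by (rule fr_expand[OF VO[OF q] subspace_add[OF fib_subspace f]])
  also have "\<dots> = (\<Sum>s<2 * r. Rc Y i s q *\<^sub>R E s q)"
  proof (rule sum.cong[OF refl])
   fix s assume s': "s \<in> {..<2 * r}"
   then have d: "dual s < 2 * r" "s < 2 * r" by auto
   show "pair B q ?X (fr c (dual s) q) *\<^sub>R fr c s q = Rc Y i s q *\<^sub>R E s q"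
    using R[OF l(1) d(1) q] polar[OF s E(1)[OF d(1)], of q] E_fr[OF d(2) q] E_fr[OF d(1) q]
     pair_add[OF f fr_fib[OF VO[OF q] d(1)]] by simp
  qed
  finally have "(\<Sum>s<2 * r. Rc Y i s q * \<rho> q (E s q) (h j)) = 0"
   using anchor_exact[OF s zw(1)[OF l(2)] zw(2), of q]
    anchor_sum[OF h_smooth[OF l(2)], of "{..<2 * r}" "\<lambda>s. E s q" q] E_fib by simp
  moreover have "(\<Sum>s<2 * r. Rc Y i (dual s) q * Rc Y j s q) = (\<Sum>s<2 * r. Rc Y i s q * \<rho> q (E s q) (h j))"
   by (subst sum_dual[symmetric]) (auto intro!: sum.cong simp: R l q)
  ultimately show "ev (ldP i (ldP j (lpb Y Y))) q = 0" by (simp add: self_bracket_PP[OF Y(1)])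
 next
  fix i s t assume "i \<in> {..<nn}" "s \<in> {..<2 * r}" "t \<in> {..<2 * r}"
  then have l: "i < nn" "dual s < 2 * r" "dual t < 2 * r" by auto
  \<comment> \<open>Near q, \<open>Rc Y i t\<close> coincides with a globally smooth function,
    namely the anchor of \<open>E (dual t)\<close> applied to \<open>h i\<close>; the sum is again
    an anchor acting on it.\<close>
  have d: "(\<Sum>l<nn. Rc Y l s q * ldx c l (Rc Y i t) q) = \<rho> q (E (dual s) q) (act \<rho> (E (dual t)) (h i))"
   if "dual s < 2 * r" "dual t < 2 * r" for s t
   using anchor_sum_Rc[OF q that(1) anchor_smooth[OF E(1)[OF that(2)] h_smooth[OF l(1)]], of "Rc Y i t"]
    R[OF l(1) that(2)] by (simp add: act_def)
  have "(\<Sum>x<2 * r. Cc Y s t (dual x) q * Rc Y i x q) = - (\<Sum>x<2 * r. T (dual s) (dual t) (dual x) q * \<rho> q (E x q) (h i))"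
   unfolding sum_negf[symmetric]
   by (subst sum_dual[symmetric], rule sum.cong[OF refl])
     (use CT[OF l(2,3) dual_less[THEN iffD2] q] R[OF l(1) _ q] in \<open>simp\<close>)
  also have "(\<Sum>x<2 * r. T (dual s) (dual t) (dual x) q * \<rho> q (E x q) (h i))
   = \<rho> q (br (E (dual s)) (E (dual t)) q) (h i)"
  proof -
   have "br (E (dual s)) (E (dual t)) q = (\<Sum>x<2 * r. T (dual s) (dual t) (dual x) q *\<^sub>R E x q)"
    by (subst fr_expand[OF VO[OF q] br_fib[OF l(2,3)]]) (auto intro!: sum.cong simp: spair_def E_fr q)
   then show ?thesis using anchor_sum[OF h_smooth[OF l(1)], of "{..<2 * r}" "\<lambda>s. E s q" q] E_fib by simp
  qed
  also have "\<dots> = \<rho> q (E (dual s) q) (act \<rho> (E (dual t)) (h i)) - \<rho> q (E (dual t) q) (act \<rho> (E (dual s)) (h i))"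
   by (rule anchor_bracket[OF E(1)[OF l(2)] E(1)[OF l(3)] zw(1)[OF l(1)] zw(2)])
  finally show "ev (ldP i (ldr s (ldr t (lpb Y Y)))) q = 0"
   using d[OF l(2,3)] d[OF l(3,2)] by (simp add: self_bracket_P[OF Y(1) W] sum_subtractf)
 next
  fix s t u v assume "s \<in> {..<2 * r}" "t \<in> {..<2 * r}" "u \<in> {..<2 * r}" "v \<in> {..<2 * r}"
  then have l: "dual s < 2 * r" "dual t < 2 * r" "dual u < 2 * r" "dual v < 2 * r" by auto
  have CT': "Cc Y s t u x = - T (dual s) (dual t) (dual u) x"
   if "dual s < 2 * r" "dual t < 2 * r" "dual u < 2 * r" "x \<in> V" for s t u x
   using CT[OF that] by simp
  have d: "(\<Sum>l<nn. Rc Y l s q * ldx c l (Cc Y t u v) q) = - \<rho> q (E (dual s) q) (T (dual t) (dual u) (dual v))"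
   if b: "dual s < 2 * r" "dual t < 2 * r" "dual u < 2 * r" "dual v < 2 * r" for s t u v
  proof -
   have "(\<Sum>l<nn. Rc Y l s q * ldx c l (\<lambda>x. - Cc Y t u v x) q) = \<rho> q (E (dual s) q) (T (dual t) (dual u) (dual v))"
    using anchor_sum_Rc[OF q b(1) T_smooth[OF b(2-4)], of "\<lambda>x. - Cc Y t u v x"] CT'[OF b(2-4)] by simp
   moreover have "ldx c l (\<lambda>x. - Cc Y t u v x) q = - ldx c l (Cc Y t u v) q" if "l < nn" for l
    by (intro ldx_uminus[OF VO[OF q]] smooth_pdiffC[OF sm_ev V(1) q VO[OF q] that] sm_ldr V Y)
   ultimately show ?thesis by (simp add: sum_negf)
  qed
  have x: "(\<Sum>x<2 * r. Cc Y s t (dual x) q * Cc Y u v x q) =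
    pair B q (br (E (dual s)) (E (dual t)) q) (br (E (dual u)) (E (dual v)) q)"
   if b: "dual s < 2 * r" "dual t < 2 * r" "dual u < 2 * r" "dual v < 2 * r" for s t u v
   unfolding pair_brackets[OF q b]
   by (subst sum_dual[symmetric], rule sum.cong[OF refl]) (use b in \<open>simp add: CT' q\<close>)
  show "ev (ldr s (ldr t (ldr u (ldr v (lpb Y Y))))) q = 0"
   unfolding self_bracket_quartic[OF Y(1) W] sum.distrib sum_subtractf d[OF l] x[OF l]
    d[OF l(2,1,3,4)] d[OF l(3,1,2,4)] d[OF l(4,1,2,3)] x[OF l(1,3,2,4)] x[OF l(1,4,2,3)]
   using jacobi_paired[OF E(1) E(1) E(1) E(1), OF l, of q]
    pair_sym[OF br_fib[OF l(1,4)] br_fib[OF l(2,3)], of q] by simp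
 qed
 then show ?thesis using Pair by simp
qed

end

end

lemma word3_nonzero:
 assumes "ev (ldr s (ldr t (ldr u F))) p \<noteq> 0"
 shows "F ({#}, {s, t, u}) p \<noteq> 0" "distinct [s, t, u]"
 using assms by (auto simp: ev_def ldr_def insert_commute split: if_splits)

lemma proj_along_eq:
 assumes "subspace V" "subspace W" "V \<inter> W = {0}" "a \<in> V" "k \<in> W"
 shows "proj_along V W (a + k) = a"
 unfolding proj_along_def
proof (rule the_equality)
 show "a \<in> V \<and> a + k - a \<in> W" using assms by simp
 fix u assume u: "u \<in> V \<and> a + k - u \<in> W"
 have "(a + k - u) - k \<in> W" by (rule subspace_diff[OF assms(2) _ assms(5)]) (use u in simp)
 moreover have "a - u \<in> V" by (rule subspace_diff[OF assms(1,4)]) (use u in simp)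
 ultimately have "a - u \<in> V \<inter> W" by simp
 then show "u = a" using assms(3) by simp
qed

section \<open>The coefficients of the summands of \<Delta>\<close>

context split_bundle begin

lemma proj_along_A:
 assumes "v \<in> fib B p"
 shows "\<exists>k\<in>K p. v = proj_along (A p) (K p) v + k" "\<exists>a\<in>A p. v = proj_along (K p) (A p) v + a"
  and "proj_along (A p) (K p) v \<in> A p" "proj_along (K p) (A p) v \<in> K p"
proof -
 obtain a k where v: "v = a + k" "a \<in> A p" "k \<in> K p" using fib_split[OF assms] by (elim exE conjE)
 have i: "A p \<inter> K p = {0}" using A_Int_K subspace_0[OF A_subspace] subspace_0[OF K_subspace] by blast
 have "proj_along (A p) (K p) v = a" unfolding v(1)
  by (rule proj_along_eq[OF A_subspace K_subspace i v(2,3)])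
 moreover have "proj_along (K p) (A p) v = k" unfolding v(1) add.commute[of a]
  by (rule proj_along_eq[OF K_subspace A_subspace _ v(3,2)]) (use i in blast)
 ultimately show "\<exists>k\<in>K p. v = proj_along (A p) (K p) v + k" "\<exists>a\<in>A p. v = proj_along (K p) (A p) v + a"
  "proj_along (A p) (K p) v \<in> A p" "proj_along (K p) (A p) v \<in> K p"
  using v by auto
qed

text \<open>Treats \<open>dA\<close> and \<open>dK\<close>, as well as \<phi> and \<psi>, at once; q
  is the kind of the variables that represent forms on D.\<close>

definition sides :: "nat => ('m => 'e set) => ('m => 'e set) => bool" where
 "sides q D D' \<longleftrightarrow> q = 0 \<and> D = A \<and> D' = K \<or> q = 1 \<and> D = K \<and> D' = A"

lemma sides_qD: "sides q D D' ==> q = 0 \<and> D = A \<or> q = 1 \<and> D = K"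
 unfolding sides_def by blast

lemma sides_facts:
 assumes "sides q D D'"
 shows "u \<in> D p ==> u \<in> fib B p" "u \<in> D' p ==> u \<in> fib B p"
  and "u \<in> D p ==> v \<in> D p ==> pair B p u v = 0" "u \<in> D' p ==> v \<in> D' p ==> pair B p u v = 0"
  and "u \<in> fib B p ==> v \<in> D' p ==> pair B p (proj_along (D p) (D' p) u) v = pair B p u v"
  and "u \<in> fib B p ==> v \<in> D p ==> pair B p (proj_along (D' p) (D p) u) v = pair B p u v"
  and "u \<in> fib B p ==> proj_along (D p) (D' p) u \<in> fib B p"
proof -
 show f: "u \<in> D p ==> u \<in> fib B p" "u \<in> D' p ==> u \<in> fib B p" for u
  using assms A_fib K_fib unfolding sides_def by auto
 show i: "u \<in> D p ==> v \<in> D p ==> pair B p u v = 0" "u \<in> D' p ==> v \<in> D' p ==> pair B p u v = 0" for u v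
  using assms A_iso K_iso unfolding sides_def by auto
 have d: "\<exists>k\<in>D' p. u = proj_along (D p) (D' p) u + k" "\<exists>k\<in>D p. u = proj_along (D' p) (D p) u + k"
   "proj_along (D p) (D' p) u \<in> D p" "proj_along (D' p) (D p) u \<in> D' p" if "u \<in> fib B p"
  using assms proj_along_A[OF that] unfolding sides_def by auto
 show "proj_along (D p) (D' p) u \<in> fib B p" if "u \<in> fib B p" using d that f by blast
 show "pair B p (proj_along (D p) (D' p) u) v = pair B p u v" if u: "u \<in> fib B p" "v \<in> D' p"
 proof -
  obtain k where k: "k \<in> D' p" "u = proj_along (D p) (D' p) u + k" using d(1)[OF u(1)] by (elim bexE)
  then have "pair B p u v = pair B p (proj_along (D p) (D' p) u) v + pair B p k v"
   using pair_add[OF f(1)[OF d(3)[OF u(1)]] f(2)[OF k(1)] f(2)[OF u(2)]] by simp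
  then show ?thesis using i(2)[OF k(1) u(2)] by simp
 qed
 show "pair B p (proj_along (D' p) (D p) u) v = pair B p u v" if u: "u \<in> fib B p" "v \<in> D p"
 proof -
  obtain k where k: "k \<in> D p" "u = proj_along (D' p) (D p) u + k" using d(2)[OF u(1)] by (elim bexE)
  then have "pair B p u v = pair B p (proj_along (D' p) (D p) u) v + pair B p k v"
   using pair_add[OF f(2)[OF d(4)[OF u(1)]] f(1)[OF k(1)] f(1)[OF u(2)]] by simp
  then show ?thesis using i(1)[OF k(1) u(2)] by simp
 qed
qed

lemma function_form: "smooth B UNIV f ==> (\<lambda>p _. f p) \<in> forms B D 0"
 unfolding forms_def by (auto intro: smooth_subset)

lemma pairing_form:
 assumes "sides q D D'" "e \<in> sections B (fib B)"
 shows "(\<lambda>p vs. pair B p (e p) (hd vs)) \<in> forms B D 1"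
 unfolding forms_def mem_Collect_eq
proof (intro conjI allI impI)
 fix p and vs :: "'e list" and i :: nat and u v :: 'e and a b :: real
 assume a: "length vs = 1 \<and> set vs \<subseteq> D p \<and> i < 1 \<and> u \<in> D p \<and> v \<in> D p"
 then obtain x where x: "vs = [x]" by (cases vs) auto
 have f: "u \<in> fib B p" "v \<in> fib B p" "e p \<in> fib B p"
  using a sides_facts(1)[OF assms(1)] sectionsD(1)[OF assms(2)] by auto
 have "pair B p (e p) (a *\<^sub>R u + b *\<^sub>R v) = a * pair B p (e p) u + b * pair B p (e p) v"
  using pair_lin[OF f, of a b] pair_sym[OF f(1,3)] pair_sym[OF f(2,3)]
   pair_sym[OF subspace_add[OF fib_subspace subspace_scale[OF fib_subspace f(1)] subspace_scale[OF fib_subspace f(2)]] f(3)]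
  by simp
 then show "pair B p (e p) (hd (vs[i := a *\<^sub>R u + b *\<^sub>R v])) =
  a * pair B p (e p) (hd (vs[i := u])) + b * pair B p (e p) (hd (vs[i := v]))"
  using a x by simp
next
 fix p and vs :: "'e list"
 assume "length vs = 1 \<and> set vs \<subseteq> D p \<and> \<not> distinct vs"
 then show "pair B p (e p) (hd vs) = 0" by (cases vs) auto
next
 fix W ss assume a: "open W \<and> length ss = 1 \<and> (\<forall>s\<in>set ss. local_section B W s \<and> (\<forall>p\<in>W. s p \<in> D p))"
 then obtain s where s: "ss = [s]" by (cases ss) auto
 have "smooth B W (\<lambda>p. pair B p (e p) (s p))"
  by (rule pair_smooth[OF _ sectionsD(2)[OF assms(2)]]) (use a s in auto)
 then show "smooth B W (\<lambda>p. pair B p (e p) (hd (map (\<lambda>s. s p) ss)))" using s by simp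
qed

end

context adapted_chart begin

lemma bracket_function_coeffs:
 assumes Y: "hom 3 Y" and e: "hom 0 e"
 shows "ev (ldr s (lpb Y e)) p = (\<Sum>l<nn. Rc Y l s p * ldx c l (ev e) p)"
proof -
 have z: "ldP i e = 0" "ldr i e = 0" for i
  by (rule hom_neg_zero[OF hom_ldP[OF e]], simp) (rule hom_neg_zero[OF hom_ldr[OF e]], simp)
 note hz = hom_zero[OF Y] hom_zero[OF hom_ldxf[OF Y]] hom_zero[OF hom_ldxf[OF e]]
 have p0: "par (0 :: 'm lfun) = 0" by (auto simp: par_def fun_eq_iff)
 show ?thesis unfolding lpb_words
  by (simp add: lcalc ev_lmul hz z p0 ev_ldxf)
qed

end

context courant_frame begin

lemma E_side:
 assumes "sides q D D'" "s < 2 * r"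
 shows "s mod 2 = q ==> E s \<in> sections B D'" "s mod 2 \<noteq> q ==> E s \<in> sections B D"
 using assms E unfolding sides_def by (auto simp: even_iff_mod_2_eq_zero odd_iff_mod_2_eq_one)

lemma fd_E: "x \<in> V ==> s < 2 * r ==> fd q s x = (if s mod 2 = q then E (dual s) x else 0)"
 using E_fr[of "dual s"] by (simp add: fd_def)

lemma dual_side: "sides q D D' ==> dual s mod 2 = q \<longleftrightarrow> s mod 2 \<noteq> q"
 unfolding sides_def dual_def by (auto; presburger)

context
 fixes q :: nat and D D' :: "'m => 'e set" and d :: "('m, 'e) gfun => ('m, 'e) gfun" and H :: "('m, 'e) gfun"
 assumes sides: "sides q D D'" and d: "algebroid_differential B A K \<rho> br q D D' d"
  and H: "hamiltonian_of B A K q d H"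
begin

lemma H_facts:
 shows H_Cfun: "H \<in> Cfun B A K 3"
  and H_weight: "H cc (m, S) \<noteq> 0 ==> size m + card {s\<in>S. s mod 2 \<noteq> q} = 1"
  and H_d: "f \<in> basic B A K q k ==> pb B H f = d f"
 using H unfolding hamiltonian_of_def by blast+

text \<open>The equation {H, f} = d f is evaluated on \<open>h l\<close>, whose coordinate
  derivatives on V are 0 and 1, so that a single coefficient is left.\<close>

lemma H_anchor:
 assumes x: "x \<in> V" and l: "l < nn" and s: "s < 2 * r"
 shows "Rc (H c) l s x = (if s mod 2 = q then \<rho> x (E (dual s) x) (h l) else 0)"
proof -
 let ?e = "emb B A K q 0 (\<lambda>p _. h l p)"
 note qD = sides_qD[OF sides]
 note form = function_form[OF h_smooth[OF l], of D]
 have "pb B H ?e c = emb B A K q 1 (\<lambda>p vs. \<rho> p (hd vs) (h l)) c"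
  using H_d[OF emb_basic[OF qD form]] d[unfolded algebroid_differential_def] h_smooth[OF l] by simp
 then have "ev (ldr s (lpb (H c) (?e c))) x = emb B A K q 1 (\<lambda>p vs. \<rho> p (hd vs) (h l)) c ({#}, {s}) x"
  by (simp add: pb_lpb ev_ldr)
 also have "\<dots> = (if s mod 2 = q then \<rho> x (E (dual s) x) (h l) else 0)"
 proof (cases "s mod 2 = q")
  case True
  then have "even (dual s) \<longleftrightarrow> q \<noteq> 0" unfolding dual_parity by presburger
  then have "(if q = 0 then frA c else frK c) (s div 2) x = E (dual s) x"
   using s E_fr[of "dual s" x] x by (simp add: fr_def)
  moreover have "emb B A K q 1 (\<lambda>p vs. \<rho> p (hd vs) (h l)) c ({#}, {s}) x
    = \<rho> x ((if q = 0 then frA c else frK c) (s div 2) x) (h l)"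
   unfolding emb_def prod.case using c VO[OF x] s True by simp
  ultimately show ?thesis using True by (simp only: if_True simp_thms)
 next
  case False
  then show ?thesis unfolding emb_def prod.case by simp
 qed
 finally have "(\<Sum>j<nn. Rc (H c) j s x * ldx c j (ev (?e c)) x) = (if s mod 2 = q then \<rho> x (E (dual s) x) (h l) else 0)"
  unfolding bracket_function_coeffs[OF Cfun_hom[OF H_Cfun] emb_hom[OF qD form, unfolded of_nat_0]] .
 moreover have "ldx c j (ev (?e c)) x = (if j = l then 1 else 0)" if "j < nn" for j
 proof -
  have "ldx c j (ev (?e c)) x = ldx c j (\<lambda>q. coord c q l) x"
   by (rule ldx_cong[OF V(1) x VO[OF x] that])
     (use emb_word0[OF qD form] zw_coord[OF l] in simp)
  then show ?thesis using ldx_coord[OF VO[OF x] that] by simp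
 qed
 moreover have "(\<Sum>j<nn. Rc (H c) j s x * (if j = l then 1 else 0)) = Rc (H c) l s x"
  using l by (simp add: if_distrib[of "(*) _"] cong: if_cong)
 ultimately show ?thesis by simp
qed

text \<open>The equation {H, \<eta>} = d \<eta> is evaluated on the 1-form given by pairing with
  \<open>E (dual u)\<close>. Its components are constant on V, so the derivative terms vanish on
  both sides; the minus sign is that of - \<eta>([a1, a2]) in the formula for d.\<close>

lemma H_bracket_ordered:
 assumes x: "x \<in> V" and s: "s < 2 * r" "t < 2 * r" "u < 2 * r" "s mod 2 = q" "t mod 2 = q" "u mod 2 \<noteq> q"
 shows "Cc (H c) s t u x = - T (dual s) (dual t) (dual u) x"
proof -
 let ?\<eta> = "\<lambda>p vs. pair B p (E (dual u) p) (hd vs)"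
 let ?e = "emb B A K q 1 ?\<eta>"
 note qD = sides_qD[OF sides]
 have l: "dual s < 2 * r" "dual t < 2 * r" "dual u < 2 * r" using s by auto
 have ku: "dual u mod 2 = q" using s dual_side[OF sides] by simp
 note form = pairing_form[OF sides E(1)[OF l(3)]]
 have sec: "E (dual s) \<in> sections B D" "E (dual t) \<in> sections B D" "E (dual u) \<in> sections B D'"
  using E_side[OF sides l(1)] E_side[OF sides l(2)] E_side[OF sides l(3)] ku dual_side[OF sides] s by auto
 obtain \<omega> where \<omega>: "\<omega> \<in> forms B D 2" "d ?e = emb B A K q 2 \<omega>"
  "\<forall>a1\<in>sections B D. \<forall>a2\<in>sections B D. \<forall>p. \<omega> p [a1 p, a2 p] =
      act \<rho> a1 (\<lambda>x. ?\<eta> x [a2 x]) p - act \<rho> a2 (\<lambda>x. ?\<eta> x [a1 x]) p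
      - ?\<eta> p [proj_along (D p) (D' p) (br a1 a2 p)]"
  using d[unfolded algebroid_differential_def, THEN conjunct2, THEN conjunct2, THEN conjunct2, THEN conjunct2,
    rule_format, OF form] by (elim bexE conjE)
 have e1: "ev (ldr j (?e c)) y = (if j = dual u then 1 else 0)" if "j < 2 * r" "y \<in> V" for j y
 proof -
  have "ev (ldr j (?e c)) y = pair B y (E (dual u) y) (fd q j y)"
   using emb_word1[OF qD form refl VO[OF that(2)] that(1)] by simp
  also have "\<dots> = (if j = dual u then 1 else 0)"
  proof (cases "j mod 2 = q")
   case True
   have "dual j < 2 * r" using that by simp
   then have "pair B y (E (dual u) y) (E (dual j) y) = (if dual j = dual (dual u) then 1 else 0)"
    unfolding E_fr[OF l(3) that(2)] E_fr[OF \<open>dual j < 2 * r\<close> that(2)] by (rule fr_pair[OF VO[OF that(2)] l(3)])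
   then show ?thesis using True unfolding dual_eq_iff by (simp add: fd_E[OF that(2,1)])
  next
   case False
   then have "j \<noteq> dual u" using ku by auto
   moreover have "pair B y (E (dual u) y) 0 = 0"
    using pair_zero[OF E_fib[OF l(3)]] pair_sym[OF E_fib[OF l(3)] subspace_0[OF fib_subspace]] by simp
   ultimately show ?thesis using False by (simp add: fd_E[OF that(2,1)])
  qed
  finally show ?thesis .
 qed
 have z: "ldx c i (ev (ldr j (?e c))) x = 0" if "i < nn" "j < 2 * r" for i j
 proof -
  have "ldx c i (ev (ldr j (?e c))) x = ldx c i (\<lambda>_. if j = dual u then 1 else 0) x"
   by (rule ldx_cong[OF V(1) x VO[OF x] that(1)]) (rule e1[OF that(2)])
  then show ?thesis by (simp only: ldx_const)
 qed
 have sme: "sm V (?e c)"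
 proof -
  have "smooth B V (?e c mS)" for mS
   by (cases mS) (simp only:, rule smooth_subset[OF emb_smooth[OF qD form] V(2)])
  then show ?thesis by (simp add: sm_def)
 qed
 have "Cc (H c) s t u x = (\<Sum>v<2 * r. Cc (H c) s t (dual v) x * ev (ldr v (?e c)) x)"
 proof -
  have "(\<Sum>v<2 * r. Cc (H c) s t (dual v) x * ev (ldr v (?e c)) x) = (\<Sum>v<2 * r. if v = dual u then Cc (H c) s t (dual v) x else 0)"
  proof (rule sum.cong[OF refl])
   fix v assume "v \<in> {..<2 * r}"
   then have v: "v < 2 * r" by simp
   show "Cc (H c) s t (dual v) x * ev (ldr v (?e c)) x = (if v = dual u then Cc (H c) s t (dual v) x else 0)"
    unfolding e1[OF v x] by simp
  qed
  then show ?thesis using l by simp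
 qed
 also have "\<dots> = ev (ldr s (ldr t (lpb (H c) (?e c)))) x"
  unfolding bracket_section_coeffs(2)[OF Cfun_hom[OF H_Cfun] emb_hom[OF qD form, unfolded of_nat_1] sme V(1) x V(2)]
 proof -
  have "(\<Sum>l<nn. Rc (H c) l s x * ldx c l (ev (ldr t (?e c))) x - Rc (H c) l t x * ldx c l (ev (ldr s (?e c))) x) = 0"
   by (rule sum.neutral, rule ballI) (simp only: lessThan_iff z[OF _ s(2)] z[OF _ s(1)] mult_zero_right diff_self)
  then show "(\<Sum>v<2 * r. Cc (H c) s t (dual v) x * ev (ldr v (?e c)) x) =
   (\<Sum>l<nn. Rc (H c) l s x * ldx c l (ev (ldr t (?e c))) x - Rc (H c) l t x * ldx c l (ev (ldr s (?e c))) x)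
   + (\<Sum>v<2 * r. Cc (H c) s t (dual v) x * ev (ldr v (?e c)) x)" by (simp only: add_0_left)
 qed
 also have "lpb (H c) (?e c) = emb B A K q 2 \<omega> c"
  using H_d[OF emb_basic[OF qD form]] \<omega>(2) by (simp flip: pb_lpb)
 also have "ev (ldr s (ldr t (emb B A K q 2 \<omega> c))) x = \<omega> x [E (dual s) x, E (dual t) x]"
  using emb_word2[OF qD \<omega>(1) refl VO[OF x] s(1,2)] s fd_E[OF x] by simp
 also have "\<dots> = - pair B x (E (dual u) x) (proj_along (D x) (D' x) (br (E (dual s)) (E (dual t)) x))"
  using \<omega>(3)[rule_format, OF sec(1,2), of x] anchor_frame_pair[OF x E_fib l(3,2), OF l(1)]
   anchor_frame_pair[OF x E_fib l(3,1), OF l(2)] by (simp add: act_def spair_def)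
 also have "\<dots> = - T (dual s) (dual t) (dual u) x"
  using sides_facts(5)[OF sides br_fib[OF l(1,2), of x] sectionsD(1)[OF sec(3)]]
   pair_sym[OF E_fib[OF l(3)] sides_facts(7)[OF sides br_fib[OF l(1,2)]]]
  by (simp add: spair_def)
 finally show ?thesis .
qed

text \<open>Linearity in the fibre variables admits exactly one index of the other kind, and
  antisymmetry of both sides moves it to the last place.\<close>

lemma H_bracket:
 assumes x: "x \<in> V" and s: "s < 2 * r" "t < 2 * r" "u < 2 * r"
 shows "Cc (H c) s t u x = (if length (filter (\<lambda>s. s mod 2 \<noteq> q) [s, t, u]) = 1 then - T (dual s) (dual t) (dual u) x else 0)"
proof -
 have l: "dual s < 2 * r" "dual t < 2 * r" "dual u < 2 * r" using s by auto
 have 1: "length (filter (\<lambda>s. s mod 2 \<noteq> q) [s, t, u]) = 1" if "Cc (H c) s t u x \<noteq> 0"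
 proof -
  have "H c ({#}, {s, t, u}) \<noteq> 0" using word3_nonzero(1)[OF that] by (metis zero_fun_apply)
  then have "card {y \<in> {s, t, u}. y mod 2 \<noteq> q} = 1" using H_weight by fastforce
  moreover have "card {y \<in> {s, t, u}. y mod 2 \<noteq> q} = length (filter (\<lambda>s. s mod 2 \<noteq> q) [s, t, u])"
  proof -
   have "{y \<in> {s, t, u}. y mod 2 \<noteq> q} = set (filter (\<lambda>s. s mod 2 \<noteq> q) [s, t, u])" by auto
   then show ?thesis by (simp only: distinct_card[OF distinct_filter[OF word3_nonzero(2)[OF that]]])
  qed
  ultimately show ?thesis by simp
 qed
 show ?thesis
 proof (cases "length (filter (\<lambda>s. s mod 2 \<noteq> q) [s, t, u]) = 1")
  case False then show ?thesis using 1 by auto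
 next
  case True
  then consider "s mod 2 = q" "t mod 2 = q" "u mod 2 \<noteq> q" | "s mod 2 = q" "u mod 2 = q" "t mod 2 \<noteq> q"
   | "t mod 2 = q" "u mod 2 = q" "s mod 2 \<noteq> q" by (auto split: if_splits)
  then have "Cc (H c) s t u x = - T (dual s) (dual t) (dual u) x"
  proof cases
   case 1 then show ?thesis using H_bracket_ordered x s by blast
  next
   case 2
   then show ?thesis using H_bracket_ordered[OF x s(1,3,2)] ev_ldr_swap3[of s t u "H c" x]
    T_antisym(2)[OF x l] by simp
  next
   case 3
   then show ?thesis using H_bracket_ordered[OF x s(2,3,1)] ev_ldr_swap3[of t s u "H c" x]
     ev_ldr_swap[of s t "ldr u (H c)" x] T_antisym(1)[OF x l] T_antisym(2)[OF x l(2,1,3)] by simp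
  qed
  then show ?thesis using True by simp
 qed
qed

end

text \<open>The sign is opposite to that in \<open>H_bracket\<close>, which explains the minus signs
  of \<phi> and \<psi> in \<Delta>.\<close>

lemma curvature_coeffs:
 assumes sides: "sides q D D'" and w: "curvature_form B br D D' \<omega>"
  and x: "x \<in> V" and s: "s < 2 * r" "t < 2 * r" "u < 2 * r"
 shows "Cc (emb B A K q 3 \<omega> c) s t u x =
  (if length (filter (\<lambda>s. s mod 2 \<noteq> q) [s, t, u]) = 0 then T (dual s) (dual t) (dual u) x else 0)"
proof -
 note qD = sides_qD[OF sides]
 have form: "\<omega> \<in> forms B D 3" using w by (simp add: curvature_form_def)
 have l: "dual s < 2 * r" "dual t < 2 * r" "dual u < 2 * r" using s by auto
 show ?thesis
 proof (cases "s mod 2 = q \<and> t mod 2 = q \<and> u mod 2 = q")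
  case True
  have sec: "E (dual s) \<in> sections B D" "E (dual t) \<in> sections B D" "E (dual u) \<in> sections B D"
   using E_side[OF sides l(1)] E_side[OF sides l(2)] E_side[OF sides l(3)] dual_side[OF sides] True by auto
  have "Cc (emb B A K q 3 \<omega> c) s t u x = \<omega> x [E (dual s) x, E (dual t) x, E (dual u) x]"
   using emb_word3[OF qD form refl VO[OF x] s] True s fd_E[OF x] by simp
  also have "\<dots> = T (dual s) (dual t) (dual u) x"
   using w sec sectionsD(1)[OF sec(3), of x] sides_facts(6)[OF sides br_fib[OF l(1,2), of x] sectionsD(1)[OF sec(3)]]
   unfolding curvature_form_def by (simp add: spair_def)
  finally show ?thesis using True by simp
 next
  case False
  have "Cc (emb B A K q 3 \<omega> c) s t u x = 0"
  proof (rule ccontr)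
   assume "Cc (emb B A K q 3 \<omega> c) s t u x \<noteq> 0"
   from suppD'[OF emb_supp[OF qD form] word3_nonzero(1)[OF this]] show False using False by auto
  qed
  moreover have "length (filter (\<lambda>s. s mod 2 \<noteq> q) [s, t, u]) \<noteq> 0" using False by auto
  ultimately show ?thesis by simp
 qed
qed

end

lemma finite_small_support:
 assumes "hom 3 F" "supp (\<lambda>m S. set_mset m \<subseteq> {..<n} \<and> S \<subseteq> {..<k}) F"
 shows "finite {mS. F mS \<noteq> 0}"
proof (rule finite_subset)
 define X where "X = Pair {#} ` Pow {..<k} \<union> (\<lambda>(j, S). ({#j#}, S)) ` ({..<n} \<times> Pow {..<k})"
 show "finite X" unfolding X_def by simp
 show "{mS. F mS \<noteq> 0} \<subseteq> X"
 proof clarify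
  fix m S assume nz: "F (m, S) \<noteq> 0"
  then have a: "finite S \<and> int (2 * size m + card S) = 3" using assms(1) unfolding supp_def by blast
  have b: "set_mset m \<subseteq> {..<n} \<and> S \<subseteq> {..<k}" using nz assms(2) unfolding supp_def by blast
  have "size m \<le> 1" using a by linarith
  then consider "m = {#}" | j where "m = {#j#}"
   by (metis One_nat_def le_Suc_eq le_zero_eq size_1_singleton_mset size_eq_0_iff_empty)
  then show "(m, S) \<in> X" using b by cases (auto simp: X_def image_iff)
 qed
qed

lemma length_3: "length xs = 3 ==> \<exists>s t u. xs = [s, t, u]"
 by (auto simp: numeral_eq_Suc length_Suc_conv)

lemma lcoef_at: "lcoef h F mS p = h p * F mS p"
 by (simp add: lcoef_def)

text \<open>The supports are enclosed in one common finite set, because \<open>transition\<close>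
  sums over the support and a sum over an infinite set is 0 by convention.\<close>

lemma transition_lin:
 assumes "finite {mS. F mS \<noteq> 0}" "finite {mS. G mS \<noteq> 0}"
 shows "transition B c c' (a *\<^sub>R F + b *\<^sub>R G) mS p = a * transition B c c' F mS p + b * transition B c c' G mS p"
proof -
 let ?X = "{mS. F mS \<noteq> 0} \<union> {mS. G mS \<noteq> 0}"
 let ?W = "\<lambda>(m, S). lmul (lprod (map (new_P B c c') (sorted_list_of_multiset m))) (lprod (map (new_odd B c c') (sorted_list_of_set S)))"
 have t: "transition B c c' H mS p = (\<Sum>x\<in>?X. H x p * ?W x mS p)"
  if "{mS. H mS \<noteq> 0} \<subseteq> ?X" for H
 proof -
  have "transition B c c' H mS p = (\<Sum>x\<in>{mS. H mS \<noteq> 0}. H x p * ?W x mS p)"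
   unfolding transition_def fun_sum_apply by (rule sum.cong) (auto simp: lcoef_at)
  also have "\<dots> = (\<Sum>x\<in>?X. H x p * ?W x mS p)"
   by (rule sum.mono_neutral_left) (use assms that in auto)
  finally show ?thesis .
 qed
 have l: "(a *\<^sub>R F + b *\<^sub>R G) x p = a * F x p + b * G x p" for x by (simp add: scaleR_fun_def)
 have s: "{mS. (a *\<^sub>R F + b *\<^sub>R G) mS \<noteq> 0} \<subseteq> ?X"
  by (auto simp: scaleR_fun_def fun_eq_iff)
 show ?thesis unfolding t[OF s] t[OF Un_upper1] t[OF Un_upper2]
  by (simp only: l distrib_right sum.distrib sum_distrib_left mult.assoc)
qed

context split_bundle begin

lemma Cfun_lin:
 assumes f: "f \<in> Cfun B A K 3" and g: "g \<in> Cfun B A K 3"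
 shows "a *\<^sub>R f + b *\<^sub>R g \<in> Cfun B A K 3"
proof -
 have l: "(a *\<^sub>R f + b *\<^sub>R g) c mS p = a * f c mS p + b * g c mS p" for c mS p by (simp add: scaleR_fun_def)
 have l': "(a *\<^sub>R f + b *\<^sub>R g) c = a *\<^sub>R f c + b *\<^sub>R g c" for c by (simp add: scaleR_fun_def)
 show ?thesis unfolding Cfun_def mem_Collect_eq
 proof (intro conjI allI ballI impI)
  show "(a *\<^sub>R f + b *\<^sub>R g) c = 0" if "c \<notin> acharts B A K" for c
   unfolding l' Cfun_nochart[OF f that] Cfun_nochart[OF g that] by simp
  fix c assume cc: "c \<in> acharts B A K"
  then interpret adapted_chart B A K c by unfold_locales
  fix m S
  have "smooth B Oc (\<lambda>p. a * f c (m, S) p + b * g c (m, S) p)"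
   by (intro smooth_add smooth_mult smooth_const cdata(1) Cfun_smooth[OF f cc] Cfun_smooth[OF g cc])
  then show "smooth B (cdom c) ((a *\<^sub>R f + b *\<^sub>R g) c (m, S))" by (rule smooth_cong[OF cdata(1)]) (simp only: l)
  show "(a *\<^sub>R f + b *\<^sub>R g) c (m, S) p = 0" if "p \<notin> cdom c" for p
   unfolding l Cfun_out[OF f cc that] Cfun_out[OF g cc that] by simp
  assume nz: "(a *\<^sub>R f + b *\<^sub>R g) c (m, S) \<noteq> 0"
  have "f c (m, S) \<noteq> 0 \<or> g c (m, S) \<noteq> 0"
   using nz unfolding l' by (auto simp: scaleR_fun_def fun_eq_iff)
  then have "set_mset m \<subseteq> {..<bdim B} \<and> S \<subseteq> {..<2 * r} \<and> int (2 * size m + card S) = 3"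
   using f g cc unfolding Cfun_def by blast
  then show "set_mset m \<subseteq> {..<bdim B}" "S \<subseteq> {..<2 * r}" "int (2 * size m + card S) = 3" by auto
 next
  fix c c' p mS assume cc: "c \<in> acharts B A K" "c' \<in> acharts B A K" "p \<in> cdom c \<inter> cdom c'"
  have p: "p \<in> cdom c" "p \<in> cdom c'" using cc by auto
  show "(a *\<^sub>R f + b *\<^sub>R g) c mS p = transition B c c' ((a *\<^sub>R f + b *\<^sub>R g) c') mS p"
   unfolding l l'[of c'] Cfun_trans[OF f cc(1,2) p, of mS] Cfun_trans[OF g cc(1,2) p, of mS]
    transition_lin[OF finite_small_support[OF Cfun_hom[OF f] Cfun_rng[OF f cc(2)]]
     finite_small_support[OF Cfun_hom[OF g] Cfun_rng[OF g cc(2)]]] ..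
 qed
qed

lemma Cfun_add: "f \<in> Cfun B A K 3 ==> g \<in> Cfun B A K 3 ==> f + g \<in> Cfun B A K 3"
 and Cfun_diff: "f \<in> Cfun B A K 3 ==> g \<in> Cfun B A K 3 ==> f - g \<in> Cfun B A K 3"
 and Cfun_minus: "f \<in> Cfun B A K 3 ==> - f \<in> Cfun B A K 3"
proof -
 show "f + g \<in> Cfun B A K 3" if "f \<in> Cfun B A K 3" "g \<in> Cfun B A K 3"
  using Cfun_lin[OF that, of 1 1] by (simp only: scaleR_one)
 show "f - g \<in> Cfun B A K 3" if "f \<in> Cfun B A K 3" "g \<in> Cfun B A K 3"
  using Cfun_lin[OF that, of 1 "-1"] by (simp only: scaleR_one scaleR_minus_left add_uminus_conv_diff)
 show "- f \<in> Cfun B A K 3" if "f \<in> Cfun B A K 3"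
  using Cfun_lin[OF that that, of "-1" 0] by (simp only: scaleR_one scaleR_minus_left scaleR_zero_left add_0_right)
qed

end

section \<open>The self-bracket and the base projection of \<Delta>\<close>

context courant_split begin

text \<open>In positive rank the frame vectors number 0 and 1 form a dual pair, so the l-th
  coordinate is the pairing of its product with the latter and the former. Everything is then cut
  off and extended by \<open>extend_section\<close>.\<close>

lemma courant_frame_ex:
 assumes cc: "c \<in> acharts B A K" "p \<in> cdom c" and r: "0 < r"
 shows "\<exists>V E z w. p \<in> V \<and> courant_frame B A K \<rho> br c V E z w"
proof -
 interpret adapted_chart B A K c using cc(1) by unfold_locales
 obtain V ext where V: "open V" "p \<in> V" "V \<subseteq> Oc"
  "\<forall>s D. local_section B Oc s \<longrightarrow> (\<forall>q\<in>Oc. s q \<in> D q) \<longrightarrow> (\<forall>q. subspace (D q)) \<longrightarrow>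
    ext s \<in> sections B D"
  "\<forall>s. \<forall>q\<in>V. ext s q = s q"
  using extend_section[OF cdata(1) cc(2)] by (elim exE conjE)
 have e: "ext s \<in> sections B D" if "local_section B Oc s" "\<And>q. q \<in> Oc ==> s q \<in> D q" "\<And>q. subspace (D q)" for s D
  using V(4) that by simp
 have l: "0 < 2 * r" "Suc 0 < 2 * r" using r by auto
 have cl: "local_section B Oc (\<lambda>q. coord c q i *\<^sub>R fr c (Suc 0) q)" for i
  by (rule local_section_scale[OF cdata(1) smooth_coordC fr_section[OF l(2)]])
 have "courant_frame B A K \<rho> br c V (\<lambda>s. ext (fr c s)) (\<lambda>i. ext (\<lambda>q. coord c q i *\<^sub>R fr c (Suc 0) q)) (ext (fr c 0))"
 proof
  show "open V" "V \<subseteq> cdom c" by fact+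
  show "ext (fr c 0) \<in> sections B (fib B)" by (rule e[OF fr_section[OF l(1)] fr_fib[OF _ l(1)] fib_subspace])
  fix l assume "l < bdim B"
  show "ext (\<lambda>q. coord c q l *\<^sub>R fr c (Suc 0) q) \<in> sections B (fib B)"
   by (rule e[OF cl subspace_scale[OF fib_subspace fr_fib[OF _ l(2)]] fib_subspace])
  fix q assume q: "q \<in> V"
  then have "q \<in> Oc" using V by blast
  then have "pair B q (coord c q l *\<^sub>R fr c (Suc 0) q) (fr c 0 q) = coord c q l"
   using pair_scale[OF fr_fib[OF _ l(2)] fr_fib[OF _ l(1)]] fr_pair[OF _ l(2,1)] by (simp add: dual_def)
  then show "spair B (ext (\<lambda>q. coord c q l *\<^sub>R fr c (Suc 0) q)) (ext (fr c 0)) q = coord c q l"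
   using V(5) q by (simp add: spair_def)
 next
  fix s q assume s: "s < 2 * r"
  show "ext (fr c s) \<in> sections B (fib B)" by (rule e[OF fr_section[OF s] fr_fib[OF _ s] fib_subspace])
  show "ext (fr c s) \<in> sections B A" if "odd s" by (rule e[OF fr_section[OF s] fr_A[OF _ s that] A_subspace])
  show "ext (fr c s) \<in> sections B K" if "even s" by (rule e[OF fr_section[OF s] fr_K[OF _ s that] K_subspace])
  show "ext (fr c s) q = fr c s q" if "q \<in> V" using V(5) that by blast
 qed
 then show ?thesis using V(2) by (intro exI conjI)
qed

context
 fixes \<phi> \<psi> dA dK hA hK \<Delta>
 assumes dirac: "dirac_structure B br A"
  and \<phi>: "curvature_form B br A K \<phi>" and \<psi>: "curvature_form B br K A \<psi>"
  and dA: "algebroid_differential B A K \<rho> br 0 A K dA" and dK: "algebroid_differential B A K \<rho> br 1 K A dK"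
  and hA: "hamiltonian_of B A K 0 dA hA" and hK: "hamiltonian_of B A K 1 dK hK"
  and \<Delta>: "\<Delta> = - emb B A K 0 3 \<phi> + hA + hK - emb B A K 1 3 \<psi>"
begin

lemma sides01: "sides 0 A K" "sides 1 K A"
 by (simp_all add: sides_def)

lemma curvature_basic: "emb B A K 0 3 \<phi> \<in> basic B A K 0 3" "emb B A K 1 3 \<psi> \<in> basic B A K 1 3"
proof -
 have "\<phi> \<in> forms B A 3" "\<psi> \<in> forms B K 3" using \<phi> \<psi> by (simp_all add: curvature_form_def)
 then show "emb B A K 0 3 \<phi> \<in> basic B A K 0 3" "emb B A K 1 3 \<psi> \<in> basic B A K 1 3"
  using emb_basic[of 0 A \<phi> 3] emb_basic[of 1 K \<psi> 3] by simp_all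
qed

lemma \<Delta>_Cfun: "\<Delta> \<in> Cfun B A K 3"
 unfolding \<Delta> using curvature_basic hA hK
 by (intro Cfun_diff Cfun_add Cfun_minus) (simp_all add: basic_def hamiltonian_of_def)

lemma \<Delta>_at: "\<Delta> c = - emb B A K 0 3 \<phi> c + hA c + hK c - emb B A K 1 3 \<psi> c"
 unfolding \<Delta> by simp

lemma \<Delta>_self: "pb B \<Delta> \<Delta> = 0"
proof (intro ext)
 fix c mS q
 show "pb B \<Delta> \<Delta> c mS q = (0 :: ('m, 'e) gfun) c mS q"
 proof (cases "c \<in> acharts B A K \<and> q \<in> cdom c")
  case False
  have "\<Delta> c mS q = 0" for mS
   using False Cfun_out[OF \<Delta>_Cfun] Cfun_nochart[OF \<Delta>_Cfun] by (cases "c \<in> acharts B A K") auto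
  then show ?thesis using pb_zero_at[of \<Delta> c q \<Delta>] by simp
 next
  case True
  then have cc: "c \<in> acharts B A K" "q \<in> cdom c" by auto
  interpret adapted_chart B A K c using cc(1) by unfold_locales
  note hom3 = Cfun_hom[OF \<Delta>_Cfun, of c] and rngc = Cfun_rng[OF \<Delta>_Cfun cc(1)]
  have "lpb (\<Delta> c) (\<Delta> c) mS q = 0"
  \<comment> \<open>In rank 0 there are no pairings that could yield the coordinates. But there are
    no odd variables either, and the coefficients of P P are sums over the empty range.\<close>
  proof (cases "r = 0")
   case True
   have h4: "hom 4 (lpb (\<Delta> c) (\<Delta> c))" using hom_lpb[OF hom3 hom3] by simp
   have "lpb (\<Delta> c) (\<Delta> c) (m, S) q = 0" for m S
    by (rule hom4_zero[OF h4 rng_lpb[OF rngc rngc]]) (simp_all add: True self_bracket_PP[OF hom3])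
   then show ?thesis by (cases mS) simp
  next
   case False
   then have "0 < r" by simp
   then obtain V E z w where qV: "q \<in> V" and cf: "courant_frame B A K \<rho> br c V E z w"
    by (elim courant_frame_ex[OF cc, THEN exE] exE conjE)
   interpret cf: courant_frame B A K \<rho> br c V E z w by (rule cf)
   show ?thesis
   proof (rule cf.self_bracket_zero[OF hom3 rngc _ _ _ qV])
    have "smooth B V (\<Delta> c mS)" for mS by (rule smooth_subset[OF Cfun_smooth[OF \<Delta>_Cfun cc(1)] cf.V(2)])
    then show "sm V (\<Delta> c)" by (simp add: sm_def)
    fix s t u x assume s: "s < 2 * r" and x: "x \<in> V"
    have ds: "dual s < 2 * r" using s by simp
    have noP: "Rc (emb B A K 0 3 \<phi> c) l s x = 0" "Rc (emb B A K 1 3 \<psi> c) l s x = 0" for l s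
     by (simp_all add: ev_def ldP_def ldr_def emb_def)
    show "Rc (\<Delta> c) l (dual s) x = \<rho> x (E s x) (cf.h l)" if l: "l < nn" for l
     unfolding \<Delta>_at using cf.H_anchor[OF sides01(1) dA hA x l ds] cf.H_anchor[OF sides01(2) dK hK x l ds]
     by (simp add: ldr_add ldr_diff ldr_minus ldP_add ldP_diff ldP_minus ev_pointwise noP noP[unfolded One_nat_def])
    assume tu: "t < 2 * r" "u < 2 * r"
    have l: "dual s < 2 * r" "dual t < 2 * r" "dual u < 2 * r" using s tu by auto
    show "Cc (\<Delta> c) (dual s) (dual t) (dual u) x = - cf.T s t u x"
    proof -
     have v: "Cc (\<Delta> c) (dual s) (dual t) (dual u) x = - Cc (emb B A K 0 3 \<phi> c) (dual s) (dual t) (dual u) x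
       + Cc (hA c) (dual s) (dual t) (dual u) x + Cc (hK c) (dual s) (dual t) (dual u) x
       - Cc (emb B A K 1 3 \<psi> c) (dual s) (dual t) (dual u) x"
      unfolding \<Delta>_at by (simp only: ldr_add ldr_diff ldr_minus ev_pointwise)
     \<comment> \<open>A triple has 0, 1, 2 or 3 odd members, and exactly one of \<phi>,
       \<open>hA\<close>, \<open>hK\<close>, \<psi> contributes in each of these cases.\<close>
     have m: "i mod 2 = 0 \<or> i mod 2 = 1" for i :: nat by presburger
     show ?thesis
      unfolding v cf.H_bracket[OF sides01(1) dA hA x l] cf.H_bracket[OF sides01(2) dK hK x l]
       cf.curvature_coeffs[OF sides01(1) \<phi> x l] cf.curvature_coeffs[OF sides01(2) \<psi> x l] dual_dual
      using m[of "dual s"] m[of "dual t"] m[of "dual u"] by (elim disjE) simp_all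
    qed
   qed
  qed
  then show ?thesis by (simp add: pb_lpb)
 qed
qed

text \<open>On the base only products of three \<xi> remain. They do not occur in \<open>hA\<close>,
  \<open>hK\<close> and \<psi>, and \<phi> vanishes because sections of the Dirac structure A are
  closed under the bracket.\<close>

lemma base_proj_\<Delta>: "base_proj \<Delta> = 0"
proof (intro ext)
 fix c and mS :: "nat multiset \<times> nat set" and q
 obtain m S where mS: "mS = (m, S)" by (cases mS)
 have "\<Delta> c ({#}, S) q = 0" if ev: "\<forall>s\<in>S. even s"
 proof (rule ccontr)
  assume nz: "\<Delta> c ({#}, S) q \<noteq> 0"
  have cc: "c \<in> acharts B A K" "q \<in> cdom c"
   using nz Cfun_out[OF \<Delta>_Cfun, of c q] Cfun_nochart[OF \<Delta>_Cfun, of c] by (metis zero_fun_apply)+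
  have S: "finite S" "card S = 3" "S \<subseteq> {..<2 * r}"
   using suppD'[OF Cfun_hom[OF \<Delta>_Cfun] nz] suppD'[OF Cfun_rng[OF \<Delta>_Cfun cc(1)] nz] by auto
  have ne: "S \<noteq> {}" using S by auto
  have e: "{s \<in> S. s mod 2 \<noteq> 0} = {}" "{s \<in> S. s mod 2 \<noteq> 1} = S" using ev by (auto simp: even_iff_mod_2_eq_zero)
  have "hA c ({#}, S) \<noteq> 0 ==> size ({#} :: nat multiset) + card {s \<in> S. s mod 2 \<noteq> 0} = 1"
   "hK c ({#}, S) \<noteq> 0 ==> size ({#} :: nat multiset) + card {s \<in> S. s mod 2 \<noteq> 1} = 1"
   using hA hK unfolding hamiltonian_of_def by blast+
  then have "hA c ({#}, S) = 0" "hK c ({#}, S) = 0" unfolding e using S by auto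
  moreover have "emb B A K 1 3 \<psi> c ({#}, S) = 0"
   using curvature_basic(2) ne ev unfolding basic_def by (auto simp: even_iff_mod_2_eq_zero)
  ultimately have nz': "emb B A K 0 3 \<phi> c ({#}, S) q \<noteq> 0" using nz unfolding \<Delta>_at by simp
  have "0 < r" using S ne by (cases "r = 0") auto
  then obtain V E z w where qV: "q \<in> V" and cf: "courant_frame B A K \<rho> br c V E z w"
   by (elim courant_frame_ex[OF cc, THEN exE] exE conjE)
  interpret cf: courant_frame B A K \<rho> br c V E z w by (rule cf)
  have "length (sorted_list_of_set S) = 3" using S by simp
  then obtain s t u where xs: "sorted_list_of_set S = [s, t, u]"
   by (elim length_3[THEN exE] exE)
  then have st: "S = {s, t, u}" "s < t" "t < u"
   using S strict_sorted_list_of_set[of S] set_sorted_list_of_set[OF S(1)] by auto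
  have l: "s < 2 * r" "t < 2 * r" "u < 2 * r" using S st by auto
  have ds: "dual s < 2 * r" "dual t < 2 * r" "dual u < 2 * r" using l by auto
  have o: "odd (dual s)" "odd (dual t)" "odd (dual u)" using ev st by auto
  have "emb B A K 0 3 \<phi> c ({#}, S) q = ev (ldr s (ldr t (ldr u (emb B A K 0 3 \<phi> c)))) q"
   unfolding st(1) ordered_coeff3[OF st(2,3)] ev_def ..
  also have "\<dots> = cf.T (dual s) (dual t) (dual u) q"
   using cf.curvature_coeffs[OF sides01(1) \<phi> qV l] ev st by simp
  also have "\<dots> = 0"
  proof -
   have "br (E (dual s)) (E (dual t)) \<in> sections B A"
    using dirac cf.E(2)[OF ds(1) o(1)] cf.E(2)[OF ds(2) o(2)] unfolding dirac_structure_def by blast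
   then show ?thesis using A_iso[OF sectionsD(1) sectionsD(1)[OF cf.E(2)[OF ds(3) o(3)]]] by (simp add: spair_def)
  qed
  finally show False using nz' by simp
 qed
 then show "base_proj \<Delta> c mS q = (0 :: ('m, 'e) gfun) c mS q" by (simp add: base_proj_def mS)
qed

end

end

section \<open>Twisting by a 2-form\<close>

text \<open>Contraction of the matrix f into the first index, and into the second and third for
  \<open>n2\<close> and \<open>n3\<close>. The sum of the three is the action of {., F} on cubic
  coefficients as far as F is not differentiated.\<close>

definition n1 :: "nat => (nat => nat => real) => (nat => nat => nat => real) => nat => nat => nat => real" where
 "n1 k f g s t u = (\<Sum>x<2 * k. f x s * g (dual x) t u)"
definition n2 :: "nat => (nat => nat => real) => (nat => nat => nat => real) => nat => nat => nat => real" where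
 "n2 k f g s t u = (\<Sum>x<2 * k. f x t * g s (dual x) u)"
definition n3 :: "nat => (nat => nat => real) => (nat => nat => nat => real) => nat => nat => nat => real" where
 "n3 k f g s t u = (\<Sum>x<2 * k. f x u * g s t (dual x))"

lemma n_add: "n1 k f (\<lambda>s t u. g s t u + h s t u) s t u = n1 k f g s t u + n1 k f h s t u"
 "n2 k f (\<lambda>s t u. g s t u + h s t u) s t u = n2 k f g s t u + n2 k f h s t u"
 "n3 k f (\<lambda>s t u. g s t u + h s t u) s t u = n3 k f g s t u + n3 k f h s t u"
 by (simp_all add: n1_def n2_def n3_def distrib_left sum.distrib)

lemma n_commute: "n2 k f (n1 k f g) = n1 k f (n2 k f g)" "n3 k f (n1 k f g) = n1 k f (n3 k f g)"
 "n3 k f (n2 k f g) = n2 k f (n3 k f g)"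
proof -
 have sw: "(\<Sum>x<2 * k. a x * (\<Sum>y<2 * k. b y * h x y)) = (\<Sum>y<2 * k. b y * (\<Sum>x<2 * k. a x * h x y))"
  for a b :: "nat => real" and h
  unfolding sum_distrib_left by (subst sum.swap) (simp only: mult.left_commute)
 show "n2 k f (n1 k f g) = n1 k f (n2 k f g)" "n3 k f (n1 k f g) = n1 k f (n3 k f g)"
  "n3 k f (n2 k f g) = n2 k f (n3 k f g)"
  by (intro ext; simp only: n1_def n2_def n3_def; rule sw)+
qed

lemma n_zero: "n1 k f (\<lambda>s t u. 0) s t u = 0" "n2 k f (\<lambda>s t u. 0) s t u = 0" "n3 k f (\<lambda>s t u. 0) s t u = 0"
 by (simp_all add: n1_def n2_def n3_def)

context
 fixes k :: nat and f :: "nat => nat => real"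
 assumes even_f: "\<And>s t. odd s \<or> odd t ==> f s t = 0"
begin

lemma n_odd: "odd s ==> n1 k f g s t u = 0" "odd t ==> n2 k f g s t u = 0" "odd u ==> n3 k f g s t u = 0"
 by (simp_all add: n1_def n2_def n3_def even_f)

lemma n_cong_odd:
 "(\<And>x. odd x ==> g x t u = h x t u) ==> n1 k f g s t u = n1 k f h s t u"
 "(\<And>x. odd x ==> g s x u = h s x u) ==> n2 k f g s t u = n2 k f h s t u"
 "(\<And>x. odd x ==> g s t x = h s t x) ==> n3 k f g s t u = n3 k f h s t u"
 unfolding n1_def n2_def n3_def
 by (rule sum.cong[OF refl]; metis even_f dual_parity mult_zero_left)+

text \<open>Each contraction reads its index at odd numbers and writes it at even ones, so a second
  contraction of the same index finds nothing.\<close>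

lemma n_square: "n1 k f (n1 k f g) s t u = 0" "n2 k f (n2 k f g) s t u = 0" "n3 k f (n3 k f g) s t u = 0"
 by (rule trans[OF n_cong_odd(1) n_zero(1)] trans[OF n_cong_odd(2) n_zero(2)] trans[OF n_cong_odd(3) n_zero(3)];
   simp add: n_odd)+

end

context adapted_chart begin

text \<open>The anchor of Y acting on the coefficients of F, alternated: the part of {Y, F} in which
  F is differentiated.\<close>

definition Dd :: "'m lfun => 'm lfun => 'm => nat => nat => nat => real" where
 "Dd F Y p s t u = (\<Sum>l<nn. Rc Y l s p * ldx c l (ev (ldr t (ldr u F))) p - Rc Y l t p * ldx c l (ev (ldr s (ldr u F))) p
     + Rc Y l u p * ldx c l (ev (ldr s (ldr t F))) p)"

text \<open>A \<open>\<xi>\<xi>\<xi>\<close>-coefficient of \<open>exp {\<cdot>, F} Y\<close>: on such coefficients, the exponential of the derivation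
 \<open>n1 + n2 + n3\<close> is the product of the \<open>1 + n\<^sub>i\<close>, because each \<open>n\<^sub>i\<close> has square 0.\<close>

definition Tw :: "'m lfun => 'm lfun => 'm => nat => nat => nat => real" where
 "Tw F Y p s t u = (let f = (\<lambda>s t. ev (ldr s (ldr t F)) p); C = (\<lambda>s t u. Cc Y s t u p) in
   Dd F Y p s t u + Dd F (lpb Y F) p s t u + C s t u + n1 r f C s t u + n2 r f C s t u + n3 r f C s t u
   + n1 r f (n2 r f C) s t u + n1 r f (n3 r f C) s t u + n2 r f (n3 r f C) s t u + n1 r f (n2 r f (n3 r f C)) s t u)"

context
 fixes F :: "'m lfun" and p :: 'm
 assumes F: "hom 2 F" "supp (\<lambda>m S. m = {#} \<and> (\<forall>s\<in>S. even s)) F" and sm: "sm Oc F" and p: "p \<in> Oc"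
begin

abbreviation f where "f s t \<equiv> ev (ldr s (ldr t F)) p"
abbreviation CC where "CC Y \<equiv> \<lambda>s t u. Cc Y s t u p"

lemma F_noP: "supp (\<lambda>m S. m = {#}) F"
 by (rule supp_mono[OF F(2)]) simp

lemma f_fun_odd: "odd s \<or> odd t ==> ev (ldr s (ldr t F)) = (\<lambda>_. 0)"
 using suppD[OF F(2), of "{#}" "insert t {s}"] by (auto simp: ev_def ldr_def fun_eq_iff)

lemma f_odd: "odd s \<or> odd t ==> f s t = 0"
 using f_fun_odd by simp

lemma df_odd: "odd s \<or> odd t ==> ldx c l (ev (ldr s (ldr t F))) p = 0"
 using f_fun_odd ldx_const[of l 0 p] by simp

lemma twist_C:
 assumes Y: "hom 3 Y"
 shows "Cc (lpb Y F) s t u p = Dd F Y p s t u + (n1 r f (CC Y) s t u + (n2 r f (CC Y) s t u + n3 r f (CC Y) s t u))"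
proof -
 have a: "(\<Sum>q<2 * r. Cc Y t u (dual q) p * f q s) = n1 r f (CC Y) s t u"
  unfolding n1_def
  by (rule sum.cong[OF refl]) (simp add: ev_ldr_swap3[of t u _ Y] ev_ldr_swap[of t _ "ldr u Y"])
 have b: "(\<Sum>q<2 * r. Cc Y s u (dual q) p * f q t) = - n2 r f (CC Y) s t u"
  unfolding n2_def sum_negf[symmetric]
  by (rule sum.cong[OF refl]) (simp add: ev_ldr_swap3[of s u _ Y])
 have c': "(\<Sum>q<2 * r. Cc Y s t (dual q) p * f q u) = n3 r f (CC Y) s t u"
  unfolding n3_def by (rule sum.cong[OF refl]) (rule mult.commute)
 show ?thesis
  unfolding twist_coeffs(2)[OF Y F(1) F_noP sm cdata(1) p order_refl] sum.distrib sum_subtractf a b c'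
  by (simp add: Dd_def sum.distrib sum_subtractf)
qed

lemma twist_R:
 assumes Y: "hom 3 Y"
 shows "Rc (lpb Y F) l s p = (\<Sum>t<2 * r. Rc Y l (dual t) p * f t s)"
 by (rule twist_coeffs(1)[OF Y F(1) F_noP sm cdata(1) p order_refl])

lemma twist_R_odd: "hom 3 Y ==> odd s ==> Rc (lpb Y F) l s p = 0"
 by (simp add: twist_R f_odd)

lemma hom_twist: "hom 3 Y ==> hom 3 (lpb Y F)"
 using hom_lpb[OF _ F(1), of 3 Y] by simp

text \<open>One bracket with F leaves only even indices in the anchor part, while the next bracket
  contracts an odd one. So the anchor enters the exponential series only at orders 0 and 1.\<close>

lemma twist_R_square: "hom 3 Y ==> Rc (lpb (lpb Y F) F) l s p = 0"
proof -
 assume Y: "hom 3 Y"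
 have z: "Rc (lpb Y F) l (dual t) p * f t s = 0" for t
  using twist_R_odd[OF Y, of "dual t"] f_odd[of t s] by (cases "even t") auto
 show ?thesis unfolding twist_R[OF hom_twist[OF Y]] by (rule sum.neutral, rule ballI, rule z)
qed

text \<open>F has even indices only. Hence contracting an index of \<open>Dd\<close> at an odd
  number keeps just the term in which this index belongs to the anchor, and no term survives two
  contractions.\<close>

lemma n_Dd:
 assumes Y: "hom 3 Y" and s: "even s" "even t" "even u"
 shows "n1 r f (Dd F Y p) s t u + n2 r f (Dd F Y p) s t u + n3 r f (Dd F Y p) s t u = Dd F (lpb Y F) p s t u"
  "n1 r f (n2 r f (Dd F Y p)) s t u = 0" "n1 r f (n3 r f (Dd F Y p)) s t u = 0" "n2 r f (n3 r f (Dd F Y p)) s t u = 0"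
proof -
 let ?d = "\<lambda>l s t. ldx c l (ev (ldr s (ldr t F))) p"
 have g1: "Dd F Y p x t u = (\<Sum>l<nn. Rc Y l x p * ?d l t u)" if "odd x" for x t u
  using that by (simp add: Dd_def df_odd)
 have g2: "Dd F Y p s x u = - (\<Sum>l<nn. Rc Y l x p * ?d l s u)" if "odd x" for x s u
  using that by (simp add: Dd_def df_odd sum_negf)
 have g3: "Dd F Y p s t x = (\<Sum>l<nn. Rc Y l x p * ?d l s t)" if "odd x" for x s t
  using that by (simp add: Dd_def df_odd)
 have sw: "(\<Sum>x<2 * r. f x s * (\<Sum>l<nn. Rc Y l (dual x) p * g l)) = (\<Sum>l<nn. Rc (lpb Y F) l s p * g l)" for s and g :: "nat => real"
  unfolding twist_R[OF Y] sum_distrib_left sum_distrib_right by (subst sum.swap) (simp only: mult_ac)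
 have a: "n1 r f (Dd F Y p) s t u = (\<Sum>l<nn. Rc (lpb Y F) l s p * ?d l t u)"
 proof -
  have "n1 r f (Dd F Y p) s t u = n1 r f (\<lambda>x t u. \<Sum>l<nn. Rc Y l x p * ?d l t u) s t u"
   by (rule n_cong_odd(1), rule f_odd, assumption, rule g1)
  then show ?thesis by (simp only: n1_def sw)
 qed
 have b: "n2 r f (Dd F Y p) s t u = - (\<Sum>l<nn. Rc (lpb Y F) l t p * ?d l s u)"
 proof -
  have "n2 r f (Dd F Y p) s t u = n2 r f (\<lambda>s x u. - (\<Sum>l<nn. Rc Y l x p * ?d l s u)) s t u"
   by (rule n_cong_odd(2), rule f_odd, assumption, rule g2)
  then show ?thesis by (simp only: n2_def sw mult_minus_right sum_negf)
 qed
 have c': "n3 r f (Dd F Y p) s t u = (\<Sum>l<nn. Rc (lpb Y F) l u p * ?d l s t)"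
 proof -
  have "n3 r f (Dd F Y p) s t u = n3 r f (\<lambda>s t x. \<Sum>l<nn. Rc Y l x p * ?d l s t) s t u"
   by (rule n_cong_odd(3), rule f_odd, assumption, rule g3)
  then show ?thesis by (simp only: n3_def sw)
 qed
 show "n1 r f (Dd F Y p) s t u + n2 r f (Dd F Y p) s t u + n3 r f (Dd F Y p) s t u = Dd F (lpb Y F) p s t u"
  unfolding a b c' by (simp add: Dd_def sum.distrib sum_subtractf)
 have z: "Dd F Y p x y u = 0" "Dd F Y p x t y = 0" "Dd F Y p s x y = 0" if "odd x" "odd y" for x y s t u
  using that by (simp_all add: Dd_def df_odd)
 show "n1 r f (n2 r f (Dd F Y p)) s t u = 0"
  by (rule trans[OF n_cong_odd(1) n_zero(1)], rule f_odd, assumption,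
    rule trans[OF n_cong_odd(2) n_zero(2)], rule f_odd, assumption, erule (1) z(1))
 show "n1 r f (n3 r f (Dd F Y p)) s t u = 0"
  by (rule trans[OF n_cong_odd(1) n_zero(1)], rule f_odd, assumption,
    rule trans[OF n_cong_odd(3) n_zero(3)], rule f_odd, assumption, erule (1) z(2))
 show "n2 r f (n3 r f (Dd F Y p)) s t u = 0"
  by (rule trans[OF n_cong_odd(2) n_zero(2)], rule f_odd, assumption,
    rule trans[OF n_cong_odd(3) n_zero(3)], rule f_odd, assumption, erule (1) z(3))
qed

lemma Dd_twist_square: "hom 3 Y ==> Dd F (lpb (lpb Y F) F) p s t u = 0"
 unfolding Dd_def by (simp add: twist_R_square)

text \<open>The contractions commute and have square 0, so the square of their sum is twice the sum
  over pairs and the cube is six times the triple product; the factorials cancel. The derivative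
  part occurs once at order 1, as twice \<open>Dd F (lpb Y F)\<close> at order 2, and not at order
  3.\<close>

lemma twist_exponential:
 assumes Y: "hom 3 Y" and s: "even s" "even t" "even u"
 shows "Cc Y s t u p + Cc (lpb Y F) s t u p + Cc (lpb (lpb Y F) F) s t u p / 2
  + Cc (lpb (lpb (lpb Y F) F) F) s t u p / 6 = Tw F Y p s t u"
proof -
 note h = hom_twist[OF Y]
 note hh = hom_twist[OF h]
 define C D0 D1 where "C = CC Y" and "D0 = Dd F Y p" and "D1 = Dd F (lpb Y F) p"
 have C1: "CC (lpb Y F) = (\<lambda>s t u. D0 s t u + (n1 r f C s t u + (n2 r f C s t u + n3 r f C s t u)))"
  by (intro ext) (simp only: twist_C[OF Y] C_def D0_def)
 note sq = n_square[of f, OF f_odd]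
 have sqf: "n1 r f (n1 r f g) = (\<lambda>s t u. 0)" "n2 r f (n2 r f g) = (\<lambda>s t u. 0)" "n3 r f (n3 r f g) = (\<lambda>s t u. 0)" for g
  by (intro ext; simp only: sq)+
 have C2: "CC (lpb (lpb Y F) F) = (\<lambda>s t u. D1 s t u + ((n1 r f D0 s t u + (n2 r f D0 s t u + n3 r f D0 s t u))
   + ((n1 r f (n2 r f C) s t u + (n1 r f (n3 r f C) s t u + n2 r f (n3 r f C) s t u))
   + (n1 r f (n2 r f C) s t u + (n1 r f (n3 r f C) s t u + n2 r f (n3 r f C) s t u)))))"
  by (intro ext) (simp only: twist_C[OF h] C1 D1_def n_add n_commute sq add_0_left add_0_right add_ac)
 have C3: "Cc (lpb (lpb (lpb Y F) F) F) s t u p =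
   (n1 r f D1 s t u + n2 r f D1 s t u + n3 r f D1 s t u)
   + 2 * (n1 r f (n2 r f D0) s t u + n1 r f (n3 r f D0) s t u + n2 r f (n3 r f D0) s t u)
   + 6 * n1 r f (n2 r f (n3 r f C)) s t u"
  unfolding twist_C[OF hh] C2 Dd_twist_square[OF Y]
  by (simp only: n_add n_commute sqf n_zero) simp
 have z: "n1 r f D1 s t u + n2 r f D1 s t u + n3 r f D1 s t u = 0"
  unfolding D1_def n_Dd(1)[OF h s] by (rule Dd_twist_square[OF Y])
 have z': "n1 r f D0 s t u + n2 r f D0 s t u + n3 r f D0 s t u = D1 s t u"
  unfolding D0_def D1_def by (rule n_Dd(1)[OF Y s])
 show ?thesis
  unfolding C3 fun_cong[OF fun_cong[OF fun_cong[OF C2]], of s t u] fun_cong[OF fun_cong[OF fun_cong[OF C1]], of s t u]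
   Tw_def Let_def z
  using n_Dd(2-4)[OF Y s] z' by (simp add: C_def D0_def D1_def)
qed

end

end

lemma sum_bilinear_collect:
 fixes X Y Z :: "nat => real"
 shows "(\<Sum>l<n. X l * (\<Sum>k\<in>I. a k * D k l) - Y l * (\<Sum>k\<in>I. a k * D' k l) + Z l * (\<Sum>k\<in>I. a k * D'' k l)) + (\<Sum>k\<in>I. a k * C k)
  = (\<Sum>k\<in>I. a k * ((\<Sum>l<n. X l * D k l - Y l * D' k l + Z l * D'' k l) + C k))"
proof -
 have s: "(\<Sum>l<n. X l * (\<Sum>k\<in>I. a k * D k l)) = (\<Sum>k\<in>I. a k * (\<Sum>l<n. X l * D k l))" for X :: "nat => real" and D
  unfolding sum_distrib_left by (subst sum.swap) (simp only: mult.left_commute)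
 show ?thesis by (simp only: sum.distrib sum_subtractf s distrib_left right_diff_distrib)
qed

section \<open>The derived bracket on isotropic families\<close>

context adapted_chart begin

lemma an_sum:
 fixes I :: "nat set"
 assumes "q \<in> Oc" "\<And>i. i \<in> I ==> v i \<in> fib B q"
 shows "an Y (\<Sum>i\<in>I. a i *\<^sub>R v i) l q = (\<Sum>i\<in>I. a i * an Y (v i) l q)"
proof -
 have "vc (\<Sum>i\<in>I. a i *\<^sub>R v i) s q = (\<Sum>i\<in>I. a i * vc (v i) s q)" if "s < 2 * r" for s
  unfolding vc_def by (rule pair_sum) (use assms fr_fib that in auto)
 then show ?thesis unfolding an_def sum_distrib_left
  by (subst sum.swap) (simp add: sum_distrib_left mult.left_commute)
qed

lemma Dl_sum:
 fixes I :: "nat set"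
 assumes "q \<in> Oc" "\<And>i. i \<in> I ==> v i \<in> fib B q"
 shows "Dl l e (\<Sum>i\<in>I. a i *\<^sub>R v i) q = (\<Sum>i\<in>I. a i * Dl l e (v i) q)"
proof -
 have "vc (\<Sum>i\<in>I. a i *\<^sub>R v i) s q = (\<Sum>i\<in>I. a i * vc (v i) s q)" if "s < 2 * r" for s
  unfolding vc_def by (rule pair_sum) (use assms fr_fib that in auto)
 then show ?thesis unfolding Dl_def sum_distrib_left
  by (subst sum.swap) (simp add: sum_distrib_left mult.left_commute)
qed

lemma C3_sum:
 fixes I :: "nat set"
 assumes q: "q \<in> Oc" and v: "\<And>i. i \<in> I ==> v i \<in> fib B q"
 shows "C3 Y (\<Sum>i\<in>I. a i *\<^sub>R v i) x y q = (\<Sum>i\<in>I. a i * C3 Y (v i) x y q)"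
  "C3 Y x (\<Sum>i\<in>I. a i *\<^sub>R v i) y q = (\<Sum>i\<in>I. a i * C3 Y x (v i) y q)"
  "C3 Y x y (\<Sum>i\<in>I. a i *\<^sub>R v i) q = (\<Sum>i\<in>I. a i * C3 Y x y (v i) q)"
proof -
 have vs: "vc (\<Sum>i\<in>I. a i *\<^sub>R v i) s q = (\<Sum>i\<in>I. a i * vc (v i) s q)" if "s < 2 * r" for s
  unfolding vc_def by (rule pair_sum) (use assms fr_fib that in auto)
 have sw: "(\<Sum>s<2 * r. \<Sum>t<2 * r. \<Sum>x<2 * r. \<Sum>i\<in>I. g s t x i) = (\<Sum>i\<in>I. \<Sum>s<2 * r. \<Sum>t<2 * r. \<Sum>x<2 * r. g s t x i)"
  for g :: "nat => nat => nat => nat => real"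
  by (simp only: sum.swap[of _ I])
 show "C3 Y (\<Sum>i\<in>I. a i *\<^sub>R v i) x y q = (\<Sum>i\<in>I. a i * C3 Y (v i) x y q)"
  unfolding C3_def sum_distrib_left sw[symmetric]
  by (intro sum.cong[OF refl]) (simp add: vs sum_distrib_left sum_distrib_right mult_ac)
 show "C3 Y x (\<Sum>i\<in>I. a i *\<^sub>R v i) y q = (\<Sum>i\<in>I. a i * C3 Y x (v i) y q)"
  unfolding C3_def sum_distrib_left sw[symmetric]
  by (intro sum.cong[OF refl]) (simp add: vs sum_distrib_left sum_distrib_right mult_ac)
 show "C3 Y x y (\<Sum>i\<in>I. a i *\<^sub>R v i) q = (\<Sum>i\<in>I. a i * C3 Y x y (v i) q)"
  unfolding C3_def sum_distrib_left sw[symmetric]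
  by (intro sum.cong[OF refl]) (simp add: vs sum_distrib_left sum_distrib_right mult_ac)
qed

text \<open>Derivatives of the coefficients come multiplied by the pairing of \<open>b i\<close>
  with w, which is 0 at q.\<close>

lemma Dl_combination:
 fixes I :: "nat set"
 assumes q: "q \<in> Oc" and l: "l < nn" and b: "\<And>i. i \<in> I ==> local_section B Oc (b i)"
  and a: "\<And>i. i \<in> I ==> smooth B Oc (a i)" and iso: "\<And>i. i \<in> I ==> pair B q (b i q) w = 0" and w: "w \<in> fib B q"
 shows "Dl l (\<lambda>x. \<Sum>i\<in>I. a i x *\<^sub>R b i x) w q = (\<Sum>i\<in>I. a i q * Dl l (b i) w q)"
proof -
 have bf: "b i x \<in> fib B x" if "x \<in> Oc" "i \<in> I" for i x using local_section_fib[OF b[OF that(2)] that(1)] .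
 have pd: "C.pdiff l (co (b i) s) q" if "i \<in> I" "s < 2 * r" for i s
  unfolding co_def vc_def
  by (rule smooth_pdiffC[OF comp_smooth[OF cdata(1) order_refl b[OF that(1)]] cdata(1) q q l]) (use that in simp)
 have pa: "C.pdiff l (a i) q" if "i \<in> I" for i
  by (rule smooth_pdiffC[OF a[OF that] cdata(1) q q l])
 have d: "ldx c l (co (\<lambda>x. \<Sum>i\<in>I. a i x *\<^sub>R b i x) s) q =
   (\<Sum>i\<in>I. ldx c l (a i) q * vc (b i q) s q + a i q * ldx c l (co (b i) s) q)" if s: "s < 2 * r" for s
 proof -
  have "ldx c l (co (\<lambda>x. \<Sum>i\<in>I. a i x *\<^sub>R b i x) s) q = ldx c l (\<lambda>x. \<Sum>i\<in>I. a i x * co (b i) s x) q"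
  proof (rule ldx_cong[OF cdata(1) q q l])
   fix x assume "x \<in> Oc"
   then show "co (\<lambda>x. \<Sum>i\<in>I. a i x *\<^sub>R b i x) s x = (\<Sum>i\<in>I. a i x * co (b i) s x)"
    unfolding co_def vc_def by (intro pair_sum bf fr_fib) (use s in auto)
  qed
  also have "\<dots> = (\<Sum>i\<in>I. ldx c l (\<lambda>x. a i x * co (b i) s x) q)"
   by (rule ldx_sum[OF q pdiff_mult[OF q pa pd]]) (use s in auto)
  also have "\<dots> = (\<Sum>i\<in>I. ldx c l (a i) q * vc (b i q) s q + a i q * ldx c l (co (b i) s) q)"
  proof (rule sum.cong[OF refl])
   fix i assume i: "i \<in> I"
   show "ldx c l (\<lambda>x. a i x * co (b i) s x) q = ldx c l (a i) q * vc (b i q) s q + a i q * ldx c l (co (b i) s) q"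
    unfolding ldx_mult[OF q pa[OF i] pd[OF i s]] by (simp add: co_def)
  qed
  finally show ?thesis .
 qed
 have "Dl l (\<lambda>x. \<Sum>i\<in>I. a i x *\<^sub>R b i x) w q =
  (\<Sum>s<2 * r. \<Sum>i\<in>I. ldx c l (a i) q * (vc (b i q) s q * vc w (dual s) q) + a i q * (ldx c l (co (b i) s) q * vc w (dual s) q))"
  unfolding Dl_def by (rule sum.cong[OF refl]) (simp add: d sum_distrib_right distrib_right mult.assoc)
 also have "\<dots> = (\<Sum>i\<in>I. ldx c l (a i) q * (\<Sum>s<2 * r. vc (b i q) s q * vc w (dual s) q) + a i q * Dl l (b i) w q)"
  unfolding Dl_def by (subst sum.swap) (simp only: sum.distrib sum_distrib_left)
 also have "\<dots> = (\<Sum>i\<in>I. a i q * Dl l (b i) w q)"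
 proof (rule sum.cong[OF refl])
  fix i assume i: "i \<in> I"
  have "(\<Sum>s<2 * r. vc (b i q) s q * vc w (dual s) q) = 0"
   using pair_expand[OF q bf[OF q i] w] iso[OF i] by (simp add: vc_def)
  then show "ldx c l (a i) q * (\<Sum>s<2 * r. vc (b i q) s q * vc w (dual s) q) + a i q * Dl l (b i) w q = a i q * Dl l (b i) w q" by simp
 qed
 finally show ?thesis .
qed

lemma TT_cong:
 assumes "open W" "q \<in> W" "q \<in> Oc" "\<And>x. x \<in> W ==> e1 x = e1' x" "\<And>x. x \<in> W ==> e2 x = e2' x"
 shows "TT Y e1 e2 w q = TT Y e1' e2' w q"
proof -
 have "Dl l e v q = Dl l e' v q" if "l < nn" "\<And>x. x \<in> W ==> e x = e' x" for l e e' v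
  unfolding Dl_def by (rule sum.cong[OF refl], rule arg_cong2[where f = "(*)", OF ldx_cong[OF assms(1-3) that(1)] refl])
    (simp add: co_def that)
 then have "Dl l e1 v q = Dl l e1' v q" "Dl l e2 v q = Dl l e2' v q" if "l < nn" for l v
  using that assms(4,5) by blast+
 then show ?thesis unfolding TT_def using assms(2,4,5) by simp
qed

lemma TT_comb3:
 fixes I :: "nat set"
 assumes q: "q \<in> Oc" and v: "\<And>i. i \<in> I ==> v i \<in> fib B q"
 shows "TT Y e1 e2 (\<Sum>i\<in>I. a i *\<^sub>R v i) q = (\<Sum>i\<in>I. a i * TT Y e1 e2 (v i) q)"
proof -
 have S: "an Y (\<Sum>i\<in>I. a i *\<^sub>R v i) l q = (\<Sum>i\<in>I. a i * an Y (v i) l q)"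
  "Dl l e (\<Sum>i\<in>I. a i *\<^sub>R v i) q = (\<Sum>i\<in>I. a i * Dl l e (v i) q)"
  "C3 Y (\<Sum>i\<in>I. a i *\<^sub>R v i) x y q = (\<Sum>i\<in>I. a i * C3 Y (v i) x y q)" for l e x y
  by (rule an_sum[OF q v] Dl_sum[OF q v] C3_sum(1)[OF q v]; assumption)+
 have "TT Y e1 e2 (\<Sum>i\<in>I. a i *\<^sub>R v i) q = (\<Sum>l<nn. an Y (e1 q) l q * (\<Sum>i\<in>I. a i * Dl l e2 (v i) q)
    - an Y (e2 q) l q * (\<Sum>i\<in>I. a i * Dl l e1 (v i) q)
    + Dl l e1 (e2 q) q * (\<Sum>i\<in>I. a i * an Y (v i) l q)) + (\<Sum>i\<in>I. a i * C3 Y (v i) (e2 q) (e1 q) q)"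
  unfolding TT_def S by (simp only: mult.commute)
 also have "\<dots> = (\<Sum>i\<in>I. a i * TT Y e1 e2 (v i) q)"
  unfolding sum_bilinear_collect TT_def by (simp only: mult.commute)
 finally show ?thesis .
qed

context
 fixes I :: "nat set" and b :: "nat => 'm => 'e" and a :: "nat => 'm => real" and q :: 'm
 assumes q: "q \<in> Oc" and b: "\<And>i. i \<in> I ==> local_section B Oc (b i)" and a: "\<And>i. i \<in> I ==> smooth B Oc (a i)"
begin

lemma bf: "i \<in> I ==> b i q \<in> fib B q" using local_section_fib[OF b q] .

lemma b_sums:
 "an Y (\<Sum>i\<in>I. a i q *\<^sub>R b i q) l q = (\<Sum>i\<in>I. a i q * an Y (b i q) l q)"
 "Dl l e (\<Sum>i\<in>I. a i q *\<^sub>R b i q) q = (\<Sum>i\<in>I. a i q * Dl l e (b i q) q)"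
 "C3 Y x (\<Sum>i\<in>I. a i q *\<^sub>R b i q) y q = (\<Sum>i\<in>I. a i q * C3 Y x (b i q) y q)"
 "C3 Y x y (\<Sum>i\<in>I. a i q *\<^sub>R b i q) q = (\<Sum>i\<in>I. a i q * C3 Y x y (b i q) q)"
 by (rule an_sum[OF q bf] Dl_sum[OF q bf] C3_sum(2,3)[OF q bf]; assumption)+

lemma TT_comb1:
 assumes w: "w \<in> fib B q" "e2 q \<in> fib B q" and iso: "\<And>i. i \<in> I ==> pair B q (b i q) w = 0" "\<And>i. i \<in> I ==> pair B q (b i q) (e2 q) = 0"
 shows "TT Y (\<lambda>x. \<Sum>i\<in>I. a i x *\<^sub>R b i x) e2 w q = (\<Sum>i\<in>I. a i q * TT Y (b i) e2 w q)"
proof -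
 let ?e = "\<lambda>x. \<Sum>i\<in>I. a i x *\<^sub>R b i x"
 have D: "Dl l ?e w q = (\<Sum>i\<in>I. a i q * Dl l (b i) w q)"
   "Dl l ?e (e2 q) q = (\<Sum>i\<in>I. a i q * Dl l (b i) (e2 q) q)" if "l < nn" for l
  by (rule Dl_combination[OF q that b a iso(1) w(1)]; assumption)
    (rule Dl_combination[OF q that b a iso(2) w(2)]; assumption)
 have "TT Y ?e e2 w q = (\<Sum>l<nn. Dl l e2 w q * (\<Sum>i\<in>I. a i q * an Y (b i q) l q)
   - an Y (e2 q) l q * (\<Sum>i\<in>I. a i q * Dl l (b i) w q)
   + an Y w l q * (\<Sum>i\<in>I. a i q * Dl l (b i) (e2 q) q)) + (\<Sum>i\<in>I. a i q * C3 Y w (e2 q) (b i q) q)"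
  unfolding TT_def b_sums
  by (rule arg_cong2[where f = "(+)", OF sum.cong[OF refl] refl]) (simp only: lessThan_iff D mult.commute)
 also have "\<dots> = (\<Sum>i\<in>I. a i q * TT Y (b i) e2 w q)"
  unfolding sum_bilinear_collect TT_def by (simp only: mult.commute)
 finally show ?thesis .
qed

lemma TT_comb2:
 assumes w: "w \<in> fib B q" and iso: "\<And>i. i \<in> I ==> pair B q (b i q) w = 0"
 shows "TT Y e1 (\<lambda>x. \<Sum>i\<in>I. a i x *\<^sub>R b i x) w q = (\<Sum>i\<in>I. a i q * TT Y e1 (b i) w q)"
proof -
 let ?e = "\<lambda>x. \<Sum>i\<in>I. a i x *\<^sub>R b i x"
 have D: "Dl l ?e w q = (\<Sum>i\<in>I. a i q * Dl l (b i) w q)" if "l < nn" for l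
  by (rule Dl_combination[OF q that b a iso w]; assumption)
 have "TT Y e1 ?e w q = (\<Sum>l<nn. an Y (e1 q) l q * (\<Sum>i\<in>I. a i q * Dl l (b i) w q)
   - Dl l e1 w q * (\<Sum>i\<in>I. a i q * an Y (b i q) l q)
   + an Y w l q * (\<Sum>i\<in>I. a i q * Dl l e1 (b i q) q)) + (\<Sum>i\<in>I. a i q * C3 Y w (b i q) (e1 q) q)"
  unfolding TT_def b_sums
  by (rule arg_cong2[where f = "(+)", OF sum.cong[OF refl] refl]) (simp only: lessThan_iff D mult.commute)
 also have "\<dots> = (\<Sum>i\<in>I. a i q * TT Y e1 (b i) w q)"
  unfolding sum_bilinear_collect TT_def by (simp only: mult.commute)
 finally show ?thesis .
qed

end

text \<open>On an isotropic family \<open>TT\<close> is linear over functions in all three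
  arguments, being the Courant tensor of the family. Vanishing on the members therefore extends to
  all combinations.\<close>

lemma TT_isotropic_zero:
 fixes I :: "nat set"
 assumes q: "q \<in> Oc" and b: "\<And>i. i \<in> I ==> local_section B Oc (b i)"
  and iso: "\<And>i j. i \<in> I ==> j \<in> I ==> pair B q (b i q) (b j q) = 0"
  and a: "\<And>i. i \<in> I ==> smooth B Oc (a i)" "\<And>i. i \<in> I ==> smooth B Oc (a' i)"
  and z: "\<And>i j k. i \<in> I ==> j \<in> I ==> k \<in> I ==> TT Y (b i) (b j) (b k q) q = 0"
 shows "TT Y (\<lambda>x. \<Sum>i\<in>I. a i x *\<^sub>R b i x) (\<lambda>x. \<Sum>i\<in>I. a' i x *\<^sub>R b i x) (\<Sum>i\<in>I. d i *\<^sub>R b i q) q = 0"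
proof -
 let ?e = "\<lambda>x. \<Sum>i\<in>I. a i x *\<^sub>R b i x" and ?e' = "\<lambda>x. \<Sum>i\<in>I. a' i x *\<^sub>R b i x"
 have f: "b i q \<in> fib B q" if "i \<in> I" for i using local_section_fib[OF b[OF that] q] .
 have 1: "TT Y ?e (b j) (b k q) q = 0" if jk: "j \<in> I" "k \<in> I" for j k
 proof -
  have "TT Y ?e (b j) (b k q) q = (\<Sum>i\<in>I. a i q * TT Y (b i) (b j) (b k q) q)"
   by (rule TT_comb1) (use q b a(1) f jk iso in auto)
  then show ?thesis using z jk by simp
 qed
 have 2: "TT Y ?e ?e' (b k q) q = 0" if k: "k \<in> I" for k
 proof -
  have "TT Y ?e ?e' (b k q) q = (\<Sum>j\<in>I. a' j q * TT Y ?e (b j) (b k q) q)"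
   by (rule TT_comb2) (use q b a(2) f k iso in auto)
  then show ?thesis using 1[OF _ k] by simp
 qed
 have "TT Y ?e ?e' (\<Sum>i\<in>I. d i *\<^sub>R b i q) q = (\<Sum>i\<in>I. d i * TT Y ?e ?e' (b i q) q)"
  by (rule TT_comb3[OF q f])
 then show ?thesis using 2 by simp
qed

text \<open>For even s this is the frame of the graph: the vector of A conjugate to the variable s
  minus its contraction with the 2-form.\<close>

definition bt :: "'m lfun => nat => 'm => 'e" where
 "bt F s q = (\<Sum>t<2 * r. ((if t = dual s then 1 else 0) - ev (ldr s (ldr t F)) q) *\<^sub>R fr c t q)"

lemma bt_section: "sm Oc F ==> local_section B Oc (bt F s)"
 unfolding bt_def
 by (rule fr_combination_section[OF cdata(1) order_refl])
   (intro smooth_diff smooth_const sm_ev sm_ldr cdata(1); assumption)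

lemma vc_bt: "q \<in> Oc ==> x < 2 * r ==> vc (bt F s q) x q = (if x = dual s then 1 else 0) - ev (ldr s (ldr x F)) q"
 unfolding vc_def bt_def by (subst fr_pair_sum) simp_all

context
 fixes F :: "'m lfun" and p :: 'm
 assumes F: "hom 2 F" "supp (\<lambda>m S. m = {#} \<and> (\<forall>s\<in>S. even s)) F" and sm: "sm Oc F" and p: "p \<in> Oc"
begin

text \<open>Contraction with the components of \<open>bt F s\<close> is the identity plus
  contraction with the matrix of F, i.e. one factor 1 + n_i of the twist.\<close>

lemma bt_contract:
 assumes "s < 2 * r"
 shows "(\<Sum>x<2 * r. g (dual x) * vc (bt F s p) x p) = g s + (\<Sum>x<2 * r. ev (ldr x (ldr s F)) p * g (dual x))"
proof -
 have "(\<Sum>x<2 * r. g (dual x) * vc (bt F s p) x p) = (\<Sum>x<2 * r. (if x = dual s then g (dual x) else 0) + ev (ldr x (ldr s F)) p * g (dual x))"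
  by (rule sum.cong[OF refl]) (simp add: vc_bt[OF p] ev_ldr_swap[of s] algebra_simps)
 then show ?thesis using assms by (simp add: sum.distrib)
qed

lemma an_bt:
 assumes Y: "hom 3 Y" and s: "s < 2 * r"
 shows "an Y (bt F s p) l p = Rc Y l s p + Rc (lpb Y F) l s p"
 unfolding an_def twist_R[OF F sm p Y] using bt_contract[OF s, of "\<lambda>x. Rc Y l x p"] by (simp only: mult.commute)

lemma Dl_bt:
 assumes l: "l < nn" and s: "s < 2 * r" "t < 2 * r"
 shows "Dl l (bt F s) (bt F t p) p = - ldx c l (ev (ldr s (ldr t F))) p"
proof -
 have d: "ldx c l (co (bt F s) x) p = - ldx c l (ev (ldr s (ldr x F))) p" if x: "x < 2 * r" for x
 proof -
  have pd: "C.pdiff l (ev (ldr s (ldr x F))) p"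
   by (rule smooth_pdiffC[OF sm_ev cdata(1) p p l]) (intro sm_ldr cdata(1) sm)
  have "ldx c l (co (bt F s) x) p = ldx c l (\<lambda>q. (if x = dual s then 1 else 0) + (- 1) * ev (ldr s (ldr x F)) q) p"
   by (rule ldx_cong[OF cdata(1) p p l]) (simp add: co_def vc_bt x)
  also have "\<dots> = ldx c l (\<lambda>q. (if x = dual s then 1 else 0)) p + ldx c l (\<lambda>q. (- 1) * ev (ldr s (ldr x F)) q) p"
   by (rule ldx_add[OF p pdiff_const pdiff_mult[OF p pdiff_const pd]])
  also have "\<dots> = - ldx c l (ev (ldr s (ldr x F))) p"
   unfolding ldx_const ldx_cmult[OF p pd] by simp
  finally show ?thesis .
 qed
 have "Dl l (bt F s) (bt F t p) p = (\<Sum>x<2 * r. if x = t then - ldx c l (ev (ldr s (ldr x F))) p else 0)"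
  unfolding Dl_def
 proof (rule sum.cong[OF refl])
  fix x assume "x \<in> {..<2 * r}"
  then have x: "x < 2 * r" "dual x < 2 * r" by auto
  \<comment> \<open>x and \<open>dual x\<close> have opposite parity while F has even variables
    only, so the term quadratic in F drops out.\<close>
  have z: "ldx c l (ev (ldr s (ldr x F))) p * ev (ldr t (ldr (dual x) F)) p = 0"
   using df_odd[OF F sm p, of s x l] f_odd[OF F sm p, of t "dual x"] by (cases "even x") auto
  have "ldx c l (co (bt F s) x) p * vc (bt F t p) (dual x) p
   = (if x = t then - ldx c l (ev (ldr s (ldr x F))) p else 0) + ldx c l (ev (ldr s (ldr x F))) p * ev (ldr t (ldr (dual x) F)) p"
   unfolding d[OF x(1)] vc_bt[OF p x(2)] by (simp add: algebra_simps)
  then show "ldx c l (co (bt F s) x) p * vc (bt F t p) (dual x) p = (if x = t then - ldx c l (ev (ldr s (ldr x F))) p else 0)"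
   unfolding z by simp
 qed
 then show ?thesis using s by simp
qed

text \<open>By \<open>bt_contract\<close> each of the three arguments contributes a factor 1 + n_i,
  and their product is the cubic part of \<open>Tw\<close>. The sign comes from the reversed order
  u, t, s of the arguments of \<open>C3\<close>.\<close>

lemma C3_bt:
 assumes s: "s < 2 * r" "t < 2 * r" "u < 2 * r"
 shows "C3 Y (bt F u p) (bt F t p) (bt F s p) p = - (Tw F Y p s t u - Dd F Y p s t u - Dd F (lpb Y F) p s t u)"
proof -
 let ?f = "\<lambda>s t. ev (ldr s (ldr t F)) p" and ?C = "\<lambda>s t u. Cc Y s t u p"
 let ?v = "\<lambda>s x. vc (bt F s p) x p"
 have c1: "(\<Sum>x<2 * r. g s t (dual x) * ?v u x) = g s t u + n3 r ?f g s t u" for g s t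
  using bt_contract[OF s(3), of "\<lambda>x. g s t x"] by (simp add: n3_def)
 have c2: "(\<Sum>x<2 * r. g s (dual x) u * ?v t x) = g s t u + n2 r ?f g s t u" for g s
  using bt_contract[OF s(2), of "\<lambda>x. g s x u"] by (simp add: n2_def)
 have c3: "(\<Sum>x<2 * r. g (dual x) t u * ?v s x) = g s t u + n1 r ?f g s t u" for g
  using bt_contract[OF s(1), of "\<lambda>x. g x t u"] by (simp add: n1_def)
 have sw: "Cc Y a b d p = - Cc Y d b a p" for a b d
  using ev_ldr_swap[of a b "ldr d Y" p] ev_ldr_swap3[of b a d Y p] ev_ldr_swap[of b d "ldr a Y" p] by simp
 have "C3 Y (bt F u p) (bt F t p) (bt F s p) p =
   - (\<Sum>x<2 * r. \<Sum>y<2 * r. \<Sum>z<2 * r. ?C (dual z) (dual y) (dual x) * ?v u x * ?v t y * ?v s z)"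
  unfolding C3_def sum_negf[symmetric]
  by (rule sum.cong[OF refl], rule sum.cong[OF refl], rule sum.cong[OF refl]) (subst sw, simp)
 also have "(\<Sum>x<2 * r. \<Sum>y<2 * r. \<Sum>z<2 * r. ?C (dual z) (dual y) (dual x) * ?v u x * ?v t y * ?v s z)
  = (\<Sum>z<2 * r. (\<Sum>y<2 * r. (\<Sum>x<2 * r. ?C (dual z) (dual y) (dual x) * ?v u x) * ?v t y) * ?v s z)"
 proof -
  have "(\<Sum>x<2 * r. \<Sum>y<2 * r. \<Sum>z<2 * r. h x y z) = (\<Sum>z<2 * r. \<Sum>y<2 * r. \<Sum>x<2 * r. h x y z)"
   for h :: "nat => nat => nat => real"
   by (subst sum.swap, subst (2) sum.swap, subst sum.swap) (rule refl)
  then show ?thesis by (simp only: sum_distrib_right)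
 qed
 also have "\<dots> = (\<Sum>z<2 * r. (\<Sum>y<2 * r. (?C (dual z) (dual y) u + n3 r ?f ?C (dual z) (dual y) u) * ?v t y) * ?v s z)"
  by (simp only: c1[of ?C])
 also have "\<dots> = (\<Sum>z<2 * r. ((?C (dual z) t u + n3 r ?f ?C (dual z) t u)
   + n2 r ?f (\<lambda>s t u. ?C s t u + n3 r ?f ?C s t u) (dual z) t u) * ?v s z)"
  by (simp only: c2[of "\<lambda>s t u. ?C s t u + n3 r ?f ?C s t u"])
 also have "\<dots> = ?C s t u + n3 r ?f ?C s t u + n2 r ?f (\<lambda>s t u. ?C s t u + n3 r ?f ?C s t u) s t u
   + n1 r ?f (\<lambda>s t u. (?C s t u + n3 r ?f ?C s t u)
   + n2 r ?f (\<lambda>s t u. ?C s t u + n3 r ?f ?C s t u) s t u) s t u"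
  by (simp only: c3[of "\<lambda>s t u. (?C s t u + n3 r ?f ?C s t u)
   + n2 r ?f (\<lambda>s t u. ?C s t u + n3 r ?f ?C s t u) s t u"])
 also have "\<dots> = Tw F Y p s t u - Dd F Y p s t u - Dd F (lpb Y F) p s t u"
  by (simp add: Tw_def Let_def n_add)
 finally show ?thesis .
qed

lemma TT_bt:
 assumes Y: "hom 3 Y" and s: "s < 2 * r" "t < 2 * r" "u < 2 * r"
 shows "TT Y (bt F s) (bt F t) (bt F u p) p = - Tw F Y p s t u"
proof -
 have "(\<Sum>l<nn. an Y (bt F s p) l p * Dl l (bt F t) (bt F u p) p - an Y (bt F t p) l p * Dl l (bt F s) (bt F u p) p
   + an Y (bt F u p) l p * Dl l (bt F s) (bt F t p) p) = - (Dd F Y p s t u + Dd F (lpb Y F) p s t u)"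
  unfolding Dd_def sum.distrib[symmetric] sum_negf[symmetric]
 proof (rule sum.cong[OF refl])
  fix l assume "l \<in> {..<nn}"
  then have l: "l < nn" by simp
  show "an Y (bt F s p) l p * Dl l (bt F t) (bt F u p) p - an Y (bt F t p) l p * Dl l (bt F s) (bt F u p) p
   + an Y (bt F u p) l p * Dl l (bt F s) (bt F t p) p =
   - (Rc Y l s p * ldx c l (ev (ldr t (ldr u F))) p - Rc Y l t p * ldx c l (ev (ldr s (ldr u F))) p
     + Rc Y l u p * ldx c l (ev (ldr s (ldr t F))) p
    + (Rc (lpb Y F) l s p * ldx c l (ev (ldr t (ldr u F))) p - Rc (lpb Y F) l t p * ldx c l (ev (ldr s (ldr u F))) p
     + Rc (lpb Y F) l u p * ldx c l (ev (ldr s (ldr t F))) p))"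
   unfolding Dl_bt[OF l s(2,3)] Dl_bt[OF l s(1,3)] Dl_bt[OF l s(1,2)] an_bt[OF Y s(1)] an_bt[OF Y s(2)] an_bt[OF Y s(3)]
   by (simp add: algebra_simps)
 qed
 then show ?thesis unfolding TT_def C3_bt[OF s] by simp
qed

end

end

section \<open>The graph of the negative 2-form\<close>

locale two_form = split_bundle B A K
 for B :: "('m::{t2_space,second_countable_topology}, 'e::real_vector) qbundle"
  and A K :: "'m => 'e set" +
 fixes \<Phi> :: "'m => 'e list => real"
 assumes \<Phi>: "\<Phi> \<in> forms B A 2"
begin

abbreviation G where "G \<equiv> graph_of B A K (- \<Phi>)"

abbreviation F where "F \<equiv> emb B A K 0 2 \<Phi>"

lemma graph_mem: "v \<in> G p \<longleftrightarrow>
  (\<exists>X \<kappa>. v = X + \<kappa> \<and> X \<in> A p \<and> \<kappa> \<in> K p \<and> (\<forall>Y\<in>A p. pair B p \<kappa> Y = - \<Phi> p [X, Y]))"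
 by (simp add: graph_of_def)

lemma \<Phi>_lin: "u \<in> A p ==> v \<in> A p ==> y \<in> A p ==> \<Phi> p [a *\<^sub>R u + b *\<^sub>R v, y] = a * \<Phi> p [u, y] + b * \<Phi> p [v, y]"
 using formsD(1)[OF \<Phi>, of "[u, y]" p 0 u v a b] by simp

lemma \<Phi>_alt: "u \<in> A p ==> v \<in> A p ==> \<Phi> p [u, v] = - \<Phi> p [v, u]"
 by (rule form_alt2[OF \<Phi> A_subspace refl])

lemma graph_lin:
 assumes "v \<in> G p" "v' \<in> G p"
 shows "a *\<^sub>R v + b *\<^sub>R v' \<in> G p"
proof -
 obtain X \<kappa> where v: "v = X + \<kappa>" "X \<in> A p" "\<kappa> \<in> K p" "\<forall>Y\<in>A p. pair B p \<kappa> Y = - \<Phi> p [X, Y]"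
  using assms(1) unfolding graph_mem by (elim exE conjE)
 obtain X' \<kappa>' where v': "v' = X' + \<kappa>'" "X' \<in> A p" "\<kappa>' \<in> K p" "\<forall>Y\<in>A p. pair B p \<kappa>' Y = - \<Phi> p [X', Y]"
  using assms(2) unfolding graph_mem by (elim exE conjE)
 show ?thesis unfolding graph_mem
 proof (intro exI conjI ballI)
  show "a *\<^sub>R v + b *\<^sub>R v' = (a *\<^sub>R X + b *\<^sub>R X') + (a *\<^sub>R \<kappa> + b *\<^sub>R \<kappa>')"
   using v v' by (simp add: scaleR_add_right)
  show "a *\<^sub>R X + b *\<^sub>R X' \<in> A p"
   by (intro subspace_add[OF A_subspace] subspace_scale[OF A_subspace] v v')
  show "a *\<^sub>R \<kappa> + b *\<^sub>R \<kappa>' \<in> K p"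
   by (intro subspace_add[OF K_subspace] subspace_scale[OF K_subspace] v v')
  fix Y assume Y: "Y \<in> A p"
  show "pair B p (a *\<^sub>R \<kappa> + b *\<^sub>R \<kappa>') Y = - \<Phi> p [a *\<^sub>R X + b *\<^sub>R X', Y]"
   using pair_lin[OF K_fib[OF v(3)] K_fib[OF v'(3)] A_fib[OF Y], of a b] v(4) v'(4) Y
   by (simp add: \<Phi>_lin[OF v(2) v'(2) Y])
 qed
qed

lemma graph_zero: "0 \<in> G p"
 unfolding graph_mem
 using subspace_0[OF A_subspace] subspace_0[OF K_subspace] pair_zero[OF A_fib]
  \<Phi>_lin[OF subspace_0[OF A_subspace] subspace_0[OF A_subspace], of _ p 0 0]
 by (intro exI[of _ 0]) simp

lemma graph_subspace: "subspace (G p)"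
 using graph_zero graph_lin[of _ p _ 1 1] graph_lin[of _ p 0 _ 1] by (simp add: subspace_def)

lemma graph_fib: "v \<in> G p ==> v \<in> fib B p"
 unfolding graph_mem by (elim exE conjE) (simp add: subspace_add[OF fib_subspace A_fib K_fib])

lemma pair_split:
 assumes "X \<in> A p" "k \<in> K p" "X' \<in> A p" "k' \<in> K p"
 shows "pair B p (X + k) (X' + k') = pair B p k' X + pair B p k X'"
proof -
 note f = A_fib[OF assms(1)] K_fib[OF assms(2)] A_fib[OF assms(3)] K_fib[OF assms(4)]
 have f': "X' + k' \<in> fib B p" by (rule subspace_add[OF fib_subspace f(3,4)])
 have "pair B p (X + k) (X' + k') = pair B p X (X' + k') + pair B p k (X' + k')" by (rule pair_add[OF f(1,2) f'])
 also have "\<dots> = (pair B p X' X + pair B p k' X) + (pair B p X' k + pair B p k' k)"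
  using pair_sym[OF f(1) f'] pair_sym[OF f(2) f'] pair_add[OF f(3,4)] f by simp
 finally show ?thesis using A_iso[OF assms(3,1)] K_iso[OF assms(4,2)] pair_sym[OF f(3,2)] by simp
qed

lemma graph_iso:
 assumes "v \<in> G p" "w \<in> G p"
 shows "pair B p v w = 0"
proof -
 obtain X \<kappa> where v: "v = X + \<kappa>" "X \<in> A p" "\<kappa> \<in> K p" "\<forall>Y\<in>A p. pair B p \<kappa> Y = - \<Phi> p [X, Y]"
  using assms(1) unfolding graph_mem by (elim exE conjE)
 obtain X' \<kappa>' where w: "w = X' + \<kappa>'" "X' \<in> A p" "\<kappa>' \<in> K p" "\<forall>Y\<in>A p. pair B p \<kappa>' Y = - \<Phi> p [X', Y]"
  using assms(2) unfolding graph_mem by (elim exE conjE)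
 show ?thesis unfolding v(1) w(1) pair_split[OF v(2,3) w(2,3)]
  using v(4) w(4) v(2) w(2) \<Phi>_alt[OF v(2) w(2)] by simp
qed

end

locale two_form_chart = two_form B A K \<Phi> + adapted_chart B A K c
 for B :: "('m::{t2_space,second_countable_topology}, 'e::real_vector) qbundle" and A K \<Phi> c
begin

lemma fd0_A: "q \<in> Oc ==> fd 0 s q \<in> A q"
 using fd_D[OF _ \<Phi>, of 0 q s] by simp

lemma fd_expand:
 assumes "q \<in> Oc" "Y \<in> A q"
 shows "Y = (\<Sum>t<2 * r. pair B q Y (fr c t q) *\<^sub>R fd 0 t q)"
proof -
 have "Y = (\<Sum>t<2 * r. pair B q Y (fr c (dual (dual t)) q) *\<^sub>R fr c (dual t) q)"
  unfolding sum_dual[of "\<lambda>s. pair B q Y (fr c (dual s) q) *\<^sub>R fr c s q"] by (rule fr_expand[OF assms(1) A_fib[OF assms(2)]])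
 also have "\<dots> = (\<Sum>t<2 * r. pair B q Y (fr c t q) *\<^sub>R fd 0 t q)"
 proof (rule sum.cong[OF refl])
  fix t assume "t \<in> {..<2 * r}"
  then have t: "t < 2 * r" by simp
  show "pair B q Y (fr c (dual (dual t)) q) *\<^sub>R fr c (dual t) q = pair B q Y (fr c t q) *\<^sub>R fd 0 t q"
   using A_iso[OF assms(2) fr_A[OF assms(1) t]] t by (cases "even t") (simp_all add: fd_def even_iff_mod_2_eq_zero)
 qed
 finally show ?thesis .
qed

text \<open>The contraction of - \<Phi> with X, as a vector of K written in the frame.\<close>

definition kap :: "'e => 'm => 'e" where
 "kap X q = (\<Sum>t<2 * r. (- \<Phi> q [X, fd 0 t q]) *\<^sub>R fr c t q)"

lemma \<Phi>_right_sum: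
 assumes "q \<in> Oc" "X \<in> A q"
 shows "\<Phi> q [X, \<Sum>t<2 * r. h t *\<^sub>R fd 0 t q] = (\<Sum>t<2 * r. h t * \<Phi> q [X, fd 0 t q])"
 using form_sum[OF \<Phi> A_subspace, of "[X, X]" q 1 "{..<2 * r}" "\<lambda>t. fd 0 t q" h] assms fd0_A[OF assms(1)] by simp

lemma kap_facts:
 assumes q: "q \<in> Oc" and X: "X \<in> A q"
 shows "kap X q \<in> K q" "Y \<in> A q ==> pair B q (kap X q) Y = - \<Phi> q [X, Y]" "X + kap X q \<in> G q"
proof -
 have z: "\<Phi> q [X, 0] = 0"
  using formsD(1)[OF \<Phi>, of "[X, X]" q 1 X X 0 0] X by simp
 show k: "kap X q \<in> K q" unfolding kap_def
 proof (rule subspace_sum[OF K_subspace])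
  fix t assume "t \<in> {..<2 * r}"
  then have t: "t < 2 * r" by simp
  show "(- \<Phi> q [X, fd 0 t q]) *\<^sub>R fr c t q \<in> K q"
  proof (cases "even t")
   case True
   then show ?thesis by (intro subspace_scale[OF K_subspace] fr_K[OF q t])
  next
   case False
   then have "fd 0 t q = 0" by (simp add: fd_def odd_iff_mod_2_eq_one)
   then show ?thesis using z subspace_0[OF K_subspace] by simp
  qed
 qed
 show p: "pair B q (kap X q) Y = - \<Phi> q [X, Y]" if Y: "Y \<in> A q" for Y
 proof -
  have "pair B q (kap X q) Y = (\<Sum>t<2 * r. (- \<Phi> q [X, fd 0 t q]) * pair B q (fr c t q) Y)"
   unfolding kap_def by (rule pair_sum) (use fr_fib[OF q] A_fib[OF Y] in auto)
  also have "\<dots> = - (\<Sum>t<2 * r. pair B q Y (fr c t q) * \<Phi> q [X, fd 0 t q])"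
   unfolding sum_negf[symmetric]
   by (rule sum.cong[OF refl]) (simp add: pair_sym[OF fr_fib[OF q] A_fib[OF Y]])
  also have "\<dots> = - \<Phi> q [X, Y]"
   unfolding \<Phi>_right_sum[OF q X, symmetric] fd_expand[OF q Y, symmetric] ..
  finally show ?thesis .
 qed
 show "X + kap X q \<in> G q" unfolding graph_mem using k p X by blast
qed

lemma F_facts: "hom 2 (F c)" "supp (\<lambda>m S. m = {#} \<and> (\<forall>s\<in>S. even s)) (F c)" "sm Oc (F c)"
proof -
 have q: "0 = (0::nat) \<and> A = A \<or> (0::nat) = 1 \<and> A = K" by simp
 show "hom 2 (F c)" using emb_hom[OF q \<Phi>] by simp
 show "supp (\<lambda>m S. m = {#} \<and> (\<forall>s\<in>S. even s)) (F c)"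
  by (rule supp_mono[OF emb_supp[OF q \<Phi>]]) (auto simp: even_iff_mod_2_eq_zero)
 show "sm Oc (F c)" unfolding sm_def using emb_smooth[OF q \<Phi>] by (metis surj_pair)
qed

lemma F_word: "q \<in> Oc ==> s < 2 * r ==> t < 2 * r ==> ev (ldr s (ldr t (F c))) q = \<Phi> q [fd 0 s q, fd 0 t q]"
 by (rule emb_word2[OF _ \<Phi> refl]) simp_all

abbreviation \<beta> where "\<beta> \<equiv> bt (F c)"

lemma \<beta>_kap:
 assumes q: "q \<in> Oc" and s: "s < 2 * r" "even s"
 shows "\<beta> s q = fd 0 s q + kap (fd 0 s q) q"
proof -
 have "\<beta> s q = (\<Sum>t<2 * r. (if t = dual s then fr c t q else 0) + (- \<Phi> q [fd 0 s q, fd 0 t q]) *\<^sub>R fr c t q)"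
  unfolding bt_def by (rule sum.cong[OF refl]) (simp add: F_word q s scaleR_diff_left)
 also have "\<dots> = (\<Sum>t<2 * r. if t = dual s then fr c t q else 0) + kap (fd 0 s q) q"
  unfolding sum.distrib kap_def ..
 also have "(\<Sum>t<2 * r. if t = dual s then fr c t q else 0) = fd 0 s q"
  using s by (simp add: fd_def even_iff_mod_2_eq_zero)
 finally show ?thesis .
qed

lemma \<beta>_graph: "q \<in> Oc ==> s < 2 * r ==> even s ==> \<beta> s q \<in> G q"
 unfolding \<beta>_kap by (rule kap_facts(3)[OF _ fd0_A])

lemma \<beta>_pair:
 assumes "q \<in> Oc" "i < r" "j < r"
 shows "pair B q (\<beta> (xi i) q) (fr c (xi j) q) = (if i = j then 1 else 0)"
proof -
 have "dual (xi j) < 2 * r" using assms by (simp add: xi_def del: dual_xi)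
 then have "pair B q (\<beta> (xi i) q) (fr c (xi j) q) = (if dual (xi j) = dual (xi i) then 1 else 0) - ev (ldr (xi i) (ldr (dual (xi j)) (F c))) q"
  using vc_bt[OF assms(1), of "dual (xi j)" "F c" "xi i"] by (simp add: vc_def del: dual_xi)
 also have "ev (ldr (xi i) (ldr (dual (xi j)) (F c))) q = 0"
  by (rule f_odd[OF F_facts assms(1)]) (simp add: xi_def del: dual_xi)
 finally show ?thesis unfolding dual_eq_iff by (auto simp: xi_def)
qed

text \<open>The difference of the two sides lies in the graph and pairs to 0 with the frame of K, so
  its component in A vanishes; an element of the graph is determined by that component.\<close>

lemma graph_expand:
 assumes q: "q \<in> Oc" and v: "v \<in> G q"
 shows "v = (\<Sum>i<r. pair B q v (fr c (xi i) q) *\<^sub>R \<beta> (xi i) q)"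
proof -
 let ?u = "v - (\<Sum>i<r. pair B q v (fr c (xi i) q) *\<^sub>R \<beta> (xi i) q)"
 have xr: "xi i < 2 * r" if "i < r" for i using that by (simp add: xi_def)
 have bG: "\<beta> (xi i) q \<in> G q" if "i < r" for i by (rule \<beta>_graph[OF q xr[OF that]]) (simp add: xi_def)
 have S: "(\<Sum>i<r. pair B q v (fr c (xi i) q) *\<^sub>R \<beta> (xi i) q) \<in> G q"
  by (intro subspace_sum[OF graph_subspace] subspace_scale[OF graph_subspace] bG) simp
 then have "?u \<in> G q" by (intro subspace_diff[OF graph_subspace] v)
 then obtain X \<kappa> where X: "?u = X + \<kappa>" "X \<in> A q" "\<kappa> \<in> K q" "\<forall>Y\<in>A q. pair B q \<kappa> Y = - \<Phi> q [X, Y]"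
  unfolding graph_mem by (elim exE conjE)
 have Xz: "pair B q X (fr c t q) = 0" if t: "t < 2 * r" for t
 proof (cases "even t")
  case False
  then show ?thesis by (intro A_iso[OF X(2)] fr_A[OF q t])
 next
  case True
  define j where "j = t div 2"
  have j: "t = xi j" "j < r" using True t by (auto simp: j_def xi_def)
  have fj: "fr c t q \<in> fib B q" by (rule fr_fib[OF q t])
  have "pair B q (\<Sum>i<r. pair B q v (fr c (xi i) q) *\<^sub>R \<beta> (xi i) q) (fr c t q) =
   (\<Sum>i<r. pair B q v (fr c (xi i) q) * pair B q (\<beta> (xi i) q) (fr c t q))"
   by (rule pair_sum) (use graph_fib bG fj in auto)
  also have "\<dots> = (\<Sum>i<r. if i = j then pair B q v (fr c (xi i) q) else 0)"
   by (rule sum.cong[OF refl]) (simp add: j \<beta>_pair[OF q])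
  finally have "pair B q ?u (fr c t q) = 0"
   using pair_diff[OF graph_fib[OF v] graph_fib[OF S] fj] j by simp
  then have "pair B q X (fr c t q) + pair B q \<kappa> (fr c t q) = 0"
   unfolding X(1) using pair_add[OF A_fib[OF X(2)] K_fib[OF X(3)] fj] by simp
  then show ?thesis using K_iso[OF X(3) fr_K[OF q t True]] by simp
 qed
 have "X = (\<Sum>t<2 * r. pair B q X (fr c t q) *\<^sub>R fd 0 t q)" by (rule fd_expand[OF q X(2)])
 also have "\<dots> = 0" by (rule sum.neutral) (simp add: Xz)
 finally have X0: "X = 0" .
 have "\<kappa> = 0"
 proof (rule nondeg_K[OF X(3)])
  fix Y assume Y: "Y \<in> A q"
  then show "pair B q \<kappa> Y = 0" using X(4) X0 \<Phi>_lin[OF X(2,2) Y, of 0 0] by simp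
 qed
 then show ?thesis using X(1) X0 by simp
qed

text \<open>Testing v against \<open>Y + kap Y q\<close> for Y in A recovers the equation that
  defines the graph.\<close>

lemma graph_perp:
 assumes q: "q \<in> Oc" and v: "v \<in> fib B q" "\<And>w. w \<in> G q ==> pair B q v w = 0"
 shows "v \<in> G q"
proof -
 obtain X k where X: "v = X + k" "X \<in> A q" "k \<in> K q" using fib_split[OF v(1)] by (elim exE conjE)
 have "pair B q k Y = - \<Phi> q [X, Y]" if Y: "Y \<in> A q" for Y
  using v(2)[OF kap_facts(3)[OF q Y]] pair_split[OF X(2,3) Y kap_facts(1)[OF q Y]]
   kap_facts(2)[OF q Y X(2)] \<Phi>_alt[OF X(2) Y] unfolding X(1) by simp
 then show ?thesis unfolding graph_mem using X by blast
qed

lemma graph_basis: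
 assumes q: "q \<in> Oc"
 shows "basis_of r (\<lambda>i. \<beta> (xi i) q) (G q)"
proof -
 have xr: "xi i < 2 * r" "even (xi i)" if "i < r" for i using that by (simp_all add: xi_def)
 have "indep_family r (\<lambda>i. \<beta> (xi i) q)" unfolding indep_family_def
 proof (intro allI impI)
  fix a :: "nat => real" and j assume s: "(\<Sum>i<r. a i *\<^sub>R \<beta> (xi i) q) = 0" and j: "j < r"
  have fj: "fr c (xi j) q \<in> fib B q" by (rule fr_fib[OF q xr(1)[OF j]])
  have "0 = pair B q (\<Sum>i<r. a i *\<^sub>R \<beta> (xi i) q) (fr c (xi j) q)" unfolding s using pair_zero[OF fj] by simp
  also have "\<dots> = (\<Sum>i<r. a i * pair B q (\<beta> (xi i) q) (fr c (xi j) q))"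
   by (rule pair_sum) (use graph_fib \<beta>_graph[OF q] xr fj in auto)
  also have "\<dots> = (\<Sum>i<r. if i = j then a i else 0)" by (rule sum.cong[OF refl]) (simp add: \<beta>_pair[OF q] j)
  finally show "a j = 0" using j by simp
 qed
 moreover have "G q = {\<Sum>i<r. a i *\<^sub>R \<beta> (xi i) q | a. True}"
 proof (intro set_eqI iffI)
  fix v assume "v \<in> G q"
  then show "v \<in> {\<Sum>i<r. a i *\<^sub>R \<beta> (xi i) q | a. True}"
   unfolding mem_Collect_eq
   by (intro exI[of _ "\<lambda>i. pair B q v (fr c (xi i) q)"] conjI graph_expand[OF q] TrueI)
 next
  fix v assume "v \<in> {\<Sum>i<r. a i *\<^sub>R \<beta> (xi i) q | a. True}"
  then obtain a where "v = (\<Sum>i<r. a i *\<^sub>R \<beta> (xi i) q)"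
   unfolding mem_Collect_eq by (elim exE conjE)
  then show "v \<in> G q"
   by (simp only:) (intro subspace_sum[OF graph_subspace] subspace_scale[OF graph_subspace] \<beta>_graph[OF q] xr; simp)
 qed
 ultimately show ?thesis unfolding basis_of_iff by blast
qed

end

context two_form begin

lemma chart_ex: "\<exists>c. two_form_chart B A K \<Phi> c \<and> p \<in> cdom c"
proof -
 obtain c where "c \<in> acharts B A K" "p \<in> cdom c" using adapted_chart_ex by blast
 then show ?thesis by (intro exI[of _ c] conjI) unfold_locales
qed

lemma graph_subbundle: "subbundle B G"
 unfolding subbundle_def
proof (rule exI[of _ r], rule allI)
 fix p :: 'm
 obtain c where t: "two_form_chart B A K \<Phi> c" and p: "p \<in> cdom c" using chart_ex[of p] by (elim exE conjE)
 interpret two_form_chart B A K \<Phi> c by (rule t)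
 show "\<exists>W s. open W \<and> p \<in> W \<and> (\<forall>i<r. local_section B W (s i)) \<and> (\<forall>q\<in>W. basis_of r (\<lambda>i. s i q) (G q))"
  by (intro exI[of _ Oc] exI[of _ "\<lambda>i. \<beta> (xi i)"] conjI allI impI ballI cdata(1) p bt_section[OF F_facts(3)] graph_basis)
qed

lemma graph_orthogonal: "G p = {v \<in> fib B p. \<forall>w\<in>G p. pair B p v w = 0}"
proof -
 obtain c where t: "two_form_chart B A K \<Phi> c" and p: "p \<in> cdom c" using chart_ex[of p] by (elim exE conjE)
 interpret two_form_chart B A K \<Phi> c by (rule t)
 show ?thesis using graph_fib graph_iso graph_perp[OF p] by blast
qed

text \<open>The graph is a subbundle equal to its own orthogonal for every \<Theta>, so only
  closedness depends on \<Theta>. A bracket lies in the graph iff it pairs to 0 with it, and by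
  \<open>TT_isotropic_zero\<close> the frame suffices, where the pairing is the negative of
  \<open>Tw\<close>.\<close>

lemma graph_dirac:
 assumes \<Theta>: "\<Theta> \<in> Cfun B A K 3"
 shows "dirac_structure B (derived_bracket B A K \<Theta>) G \<longleftrightarrow>
  (\<forall>c\<in>acharts B A K. \<forall>p\<in>cdom c. \<forall>s<2 * r. \<forall>t<2 * r. \<forall>u<2 * r.
    even s \<longrightarrow> even t \<longrightarrow> even u \<longrightarrow> adapted_chart.Tw B c (F c) (\<Theta> c) p s t u = 0)"
  (is "_ \<longleftrightarrow> ?R")
proof
 assume D: "dirac_structure B (derived_bracket B A K \<Theta>) G"
 show ?R
 proof (intro ballI allI impI)
  fix c p s t u assume cc: "c \<in> acharts B A K" "p \<in> cdom c"
   and s: "s < 2 * r" "t < 2 * r" "u < 2 * r" "even s" "even t" "even u"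
  interpret two_form_chart B A K \<Phi> c using cc(1) by unfold_locales
  obtain V ext where V: "open V" "p \<in> V" "V \<subseteq> Oc"
   "\<forall>s D. local_section B Oc s \<longrightarrow> (\<forall>q\<in>Oc. s q \<in> D q) \<longrightarrow> (\<forall>q. subspace (D q)) \<longrightarrow> ext s \<in> sections B D"
   "\<forall>s. \<forall>q\<in>V. ext s q = s q"
   using extend_section[OF cdata(1) cc(2)] by (elim exE conjE)
  have e: "ext (\<beta> i) \<in> sections B G" if "i < 2 * r" "even i" for i
   by (rule V(4)[rule_format, OF bt_section[OF F_facts(3)] \<beta>_graph[OF _ that] graph_subspace])
  have ef: "ext (\<beta> i) \<in> sections B (fib B)" if "i < 2 * r" "even i" for i
   by (rule V(4)[rule_format, OF bt_section[OF F_facts(3)] graph_fib[OF \<beta>_graph[OF _ that]] fib_subspace])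
  have u: "\<beta> u p \<in> G p" by (rule \<beta>_graph[OF cc(2) s(3,6)])
  have "derived_bracket B A K \<Theta> (ext (\<beta> s)) (ext (\<beta> t)) \<in> sections B G"
   using D e[OF s(1,4)] e[OF s(2,5)] unfolding dirac_structure_def by blast
  then have "pair B p (derived_bracket B A K \<Theta> (ext (\<beta> s)) (ext (\<beta> t)) p) (\<beta> u p) = 0"
   by (rule graph_iso[OF sectionsD(1)[where D = G] u])
  then have "TT (\<Theta> c) (ext (\<beta> s)) (ext (\<beta> t)) (\<beta> u p) p = 0"
   using derived_bracket(2)[OF \<Theta> ef[OF s(1,4)] ef[OF s(2,5)] cc graph_fib[OF u]] by simp
  moreover have "TT (\<Theta> c) (ext (\<beta> s)) (ext (\<beta> t)) (\<beta> u p) p = TT (\<Theta> c) (\<beta> s) (\<beta> t) (\<beta> u p) p"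
   by (rule TT_cong[OF V(1,2) cc(2)]) (use V(5) in auto)
  ultimately show "Tw (F c) (\<Theta> c) p s t u = 0"
   unfolding TT_bt[OF F_facts cc(2) Cfun_hom[OF \<Theta>] s(1-3)] by simp
 qed
next
 assume R: ?R
 have "derived_bracket B A K \<Theta> e1 e2 \<in> sections B G" if e: "e1 \<in> sections B G" "e2 \<in> sections B G" for e1 e2
 proof (rule sectionsI)
  have ef: "e \<in> sections B (fib B)" if "e \<in> sections B G" for e
   by (rule sectionsI[OF sectionsD(2)[OF that] graph_fib[OF sectionsD(1)[OF that]]])
  note db = derived_bracket[OF \<Theta> ef[OF e(1)] ef[OF e(2)]]
  show "local_section B UNIV (derived_bracket B A K \<Theta> e1 e2)" by (rule sectionsD(2)[OF db(1)])
  fix p :: 'm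
  obtain c where t: "two_form_chart B A K \<Phi> c" and p: "p \<in> cdom c" using chart_ex[of p] by (elim exE conjE)
  interpret two_form_chart B A K \<Phi> c by (rule t)
  have xr: "xi i < 2 * r" "even (xi i)" if "i < r" for i using that by (simp_all add: xi_def)
  show "derived_bracket B A K \<Theta> e1 e2 p \<in> G p"
  proof (rule graph_perp[OF p sectionsD(1)[OF db(1)]])
   fix w assume w: "w \<in> G p"
   let ?x = "\<lambda>e i q. pair B q (e q) (fr c (xi i) q)"
   have ex: "e q = (\<Sum>i<r. ?x e i q *\<^sub>R \<beta> (xi i) q)" if "q \<in> Oc" "e \<in> sections B G" for e q
    by (rule graph_expand[OF that(1) sectionsD(1)[OF that(2)]])
   have sx: "smooth B Oc (?x e i)" if "e \<in> sections B G" "i < r" for e i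
    by (rule comp_smooth[OF cdata(1) order_refl sectionsD(2)[OF that(1)] xr(1)[OF that(2)]])
   have "pair B p (derived_bracket B A K \<Theta> e1 e2 p) w = TT (\<Theta> c) e1 e2 w p"
    by (rule db(2)[OF c p graph_fib[OF w]])
   also have "\<dots> = TT (\<Theta> c) (\<lambda>q. \<Sum>i<r. ?x e1 i q *\<^sub>R \<beta> (xi i) q) (\<lambda>q. \<Sum>i<r. ?x e2 i q *\<^sub>R \<beta> (xi i) q) w p"
    by (rule TT_cong[OF cdata(1) p p]) (rule ex[OF _ e(1)], assumption, rule ex[OF _ e(2)], assumption)
   also have "\<dots> = TT (\<Theta> c) (\<lambda>q. \<Sum>i<r. ?x e1 i q *\<^sub>R \<beta> (xi i) q) (\<lambda>q. \<Sum>i<r. ?x e2 i q *\<^sub>R \<beta> (xi i) q)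
     (\<Sum>i<r. pair B p w (fr c (xi i) p) *\<^sub>R \<beta> (xi i) p) p"
    by (rule arg_cong[where f = "\<lambda>w. TT (\<Theta> c) _ _ w p", OF graph_expand[OF p w]])
   also have "TT (\<Theta> c) (\<lambda>q. \<Sum>i<r. ?x e1 i q *\<^sub>R \<beta> (xi i) q) (\<lambda>q. \<Sum>i<r. ?x e2 i q *\<^sub>R \<beta> (xi i) q)
     (\<Sum>i<r. pair B p w (fr c (xi i) p) *\<^sub>R \<beta> (xi i) p) p = 0"
   proof (rule TT_isotropic_zero[OF p])
    fix i j k assume "i \<in> {..<r}" "j \<in> {..<r}" "k \<in> {..<r}"
    then have l: "i < r" "j < r" "k < r" by auto
    show "TT (\<Theta> c) (\<beta> (xi i)) (\<beta> (xi j)) (\<beta> (xi k) p) p = 0"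
     unfolding TT_bt[OF F_facts p Cfun_hom[OF \<Theta>] xr(1)[OF l(1)] xr(1)[OF l(2)] xr(1)[OF l(3)]]
     using R c p xr l by simp
   next
    fix i j assume "i \<in> {..<r}" "j \<in> {..<r}"
    then show "pair B p (\<beta> (xi i) p) (\<beta> (xi j) p) = 0" by (intro graph_iso \<beta>_graph p xr) auto
   qed (simp_all add: sx e bt_section[OF F_facts(3)])
   finally show "pair B p (derived_bracket B A K \<Theta> e1 e2 p) w = 0" .
  qed
 qed
 then show "dirac_structure B (derived_bracket B A K \<Theta>) G"
  unfolding dirac_structure_def using graph_subbundle graph_orthogonal by blast
qed

end

section \<open>The Maurer-Cartan equation\<close>

lemma foldl_replicate: "foldl g y (replicate n a) = ((\<lambda>y. g y a) ^^ n) y"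
 by (induction n arbitrary: y) (simp_all add: funpow_swap1[of "\<lambda>y. g y a"])

lemma take_drop_replicate: "j < n ==> take j (replicate n a) @ drop (Suc j) (replicate n a) = replicate (n - 1) a"
 by (simp add: replicate_add[symmetric])

text \<open>All arguments have degree 0, so the Koszul signs are 1 and the n places of x contribute
  equally. The sign of \<open>g x x\<close> comes from x having degree 1 in L.\<close>

lemma voronov_bracket_replicate:
 fixes g :: "'v::real_vector => 'v => 'v"
 assumes "n \<ge> 2"
 shows "voronov_bracket g P \<Delta> (replicate n (0, x, a)) =
  (if n = 2 then - g x x else 0, real n *\<^sub>R P (((\<lambda>y. g y a) ^^ (n - 1)) x) + P (((\<lambda>y. g y a) ^^ n) \<Delta>))"
proof -
 obtain k where n: "n = Suc (Suc k)" using assms by (metis add_2_eq_Suc le_Suc_ex)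
 have "(\<Sum>j<n. P (foldl g x (take j (replicate n a) @ drop (Suc j) (replicate n a)))) = real n *\<^sub>R P (((\<lambda>y. g y a) ^^ (n - 1)) x)"
  by (simp add: take_drop_replicate foldl_replicate sum_constant_scaleR del: take_replicate drop_replicate)
 moreover have "(\<Sum>j<n. (if even ((0::int) * (\<Sum>l<j. fst (replicate n (0::int, x, a) ! l))) then 1 else -1 :: real) *\<^sub>R
   P (foldl g (fst (snd (replicate n (0::int, x, a) ! j))) (take j (replicate n a) @ drop (Suc j) (replicate n a))))
  = (\<Sum>j<n. P (foldl g x (take j (replicate n a) @ drop (Suc j) (replicate n a))))"
  by (rule sum.cong) (simp_all del: take_replicate drop_replicate)
 moreover have "foldl g (g \<Delta> a) (replicate (n - 1) a) = ((\<lambda>y. g y a) ^^ n) \<Delta>"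
  by (simp add: n foldl_replicate funpow_swap1[of "\<lambda>y. g y a"])
 moreover have "voronov_bracket g P \<Delta> (replicate n (0, x, a)) =
   (if n = 2 then - g x x else 0,
   (\<Sum>j<n. (if even ((0::int) * (\<Sum>l<j. fst (replicate n (0::int, x, a) ! l))) then 1 else -1 :: real) *\<^sub>R
    P (foldl g (fst (snd (replicate n (0::int, x, a) ! j))) (take j (replicate n a) @ drop (Suc j) (replicate n a))))
   + P (foldl g (g \<Delta> a) (replicate (n - 1) a)))"
 proof -
  have r: "replicate n (0::int, x, a) = (0, x, a) # (0, x, a) # replicate k (0, x, a)" by (simp add: n)
  have m: "map (\<lambda>w. snd (snd w)) (replicate n (0::int, x, a)) = replicate n a" by simp
  have d: "fst (replicate n (0::int, x, a) ! j) = 0" if "j < n" for j using that by simp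
  have "voronov_bracket g P \<Delta> (replicate n (0, x, a)) =
   (if replicate k (0::int, x, a) = [] then (if even (fst (replicate n (0::int, x, a) ! 0) + 1) then 1 else -1 :: real) *\<^sub>R
     g (fst (snd (replicate n (0::int, x, a) ! 0))) (fst (snd (replicate n (0::int, x, a) ! 1))) else 0,
   (\<Sum>j<length (replicate n (0::int, x, a)). (if even (fst (replicate n (0::int, x, a) ! j) * (\<Sum>l<j. fst (replicate n (0::int, x, a) ! l))) then 1 else -1 :: real) *\<^sub>R
    P (foldl g (fst (snd (replicate n (0::int, x, a) ! j))) (take j (replicate n a) @ drop (Suc j) (replicate n a))))
   + P (foldl g (g \<Delta> (hd (replicate n a))) (tl (replicate n a))))"
   unfolding m[symmetric] by (simp only: r voronov_bracket.simps Let_def)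
  also have "\<dots> = (if n = 2 then - g x x else 0,
   (\<Sum>j<n. (if even ((0::int) * (\<Sum>l<j. fst (replicate n (0::int, x, a) ! l))) then 1 else -1 :: real) *\<^sub>R
    P (foldl g (fst (snd (replicate n (0::int, x, a) ! j))) (take j (replicate n a) @ drop (Suc j) (replicate n a))))
   + P (foldl g (g \<Delta> a) (replicate (n - 1) a)))"
   by (rule arg_cong2[where f = Pair], simp add: n,
     rule arg_cong2[where f = "(+)"], rule sum.cong, simp, simp only: lessThan_iff length_replicate d, simp add: n)
  finally show ?thesis .
 qed
 ultimately show ?thesis by simp
qed

text \<open>In the n-th bracket x meets n - 1 copies of a, and n / n! = 1 / (n - 1)!. So x and
  \<Delta> each yield an exponential series; the missing term of order 0 for \<Delta> is supplied by
  \<open>P \<Delta> = 0\<close>, and the series stop after order 3.\<close>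

lemma voronov_MC_iff:
 fixes g :: "'v::real_vector => 'v => 'v" and P :: "'v => 'v" and a :: 'v
 defines "N n y \<equiv> ((\<lambda>y. g y a) ^^ n) y"
 assumes add: "\<And>y z. P (y + z) = P y + P z" and \<Delta>: "P \<Delta> = 0"
  and nil: "\<And>n. n \<ge> 4 ==> N n x = 0" "\<And>n. n \<ge> 4 ==> N n \<Delta> = 0"
 shows "(x, a) \<in> MC (voronov L g \<aa> P \<Delta>) \<longleftrightarrow> x \<in> L 1 \<and> a \<in> \<aa> 0 \<and> g \<Delta> x + (1 / 2) *\<^sub>R g x x = 0 \<and>
  (P x + P \<Delta>) + (P (N 1 x) + P (N 1 \<Delta>)) + (1 / 2) *\<^sub>R (P (N 2 x) + P (N 2 \<Delta>)) + (1 / 6) *\<^sub>R (P (N 3 x) + P (N 3 \<Delta>)) = 0"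
  (is "_ \<longleftrightarrow> _ \<and> _ \<and> ?A = 0 \<and> ?B = 0")
proof -
 let ?t = "\<lambda>n. (1 / fact n :: real) *\<^sub>R voronov_bracket g P \<Delta> (replicate n (0, x, a))"
 have P0: "P 0 = 0" using add[of 0 0] by simp
 have t: "?t n = (if n = 2 then - (1 / 2) *\<^sub>R g x x else 0, (1 / fact n) *\<^sub>R (real n *\<^sub>R P (N (n - 1) x) + P (N n \<Delta>)))" if "n \<ge> 2" for n
  unfolding voronov_bracket_replicate[OF that] N_def by simp
 have t1: "?t 1 = (- g \<Delta> x, P x + P (N 1 \<Delta>))"
  by (simp add: add N_def)
 have t2: "?t 2 = (- (1 / 2) *\<^sub>R g x x, P (N 1 x) + (1 / 2) *\<^sub>R P (N 2 \<Delta>))"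
  by (subst t) (simp_all add: scaleR_add_right)
 have t3: "?t 3 = (0, (1 / 2) *\<^sub>R P (N 2 x) + (1 / 6) *\<^sub>R P (N 3 \<Delta>))"
  by (subst t) (simp_all add: scaleR_add_right fact_numeral)
 have t4: "?t 4 = (0, (1 / 6) *\<^sub>R P (N 3 x))"
  by (subst t) (simp_all add: nil(2) P0 fact_numeral)
 have z: "?t n = 0" if "n \<ge> 5" for n
 proof -
  have "n \<ge> 2" "n \<noteq> 2" "n \<ge> 4" "n - 1 \<ge> 4" using that by auto
  then show ?thesis using t[of n] by (simp add: nil P0 zero_prod_def)
 qed
 have S: "(\<Sum>n = 1..m. ?t n) = (- ?A, ?B)" if m: "m \<ge> 5" for m
 proof -
  have "(\<Sum>n = 1..m. ?t n) = (\<Sum>n\<in>{1, 2, 3, 4}. ?t n)"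
   by (rule sum.mono_neutral_right) (use m z in \<open>auto intro: z\<close>)
  also have "\<dots> = ?t 1 + (?t 2 + (?t 3 + ?t 4))" by (simp del: voronov_bracket.simps)
  also have "\<dots> = (- ?A, ?B)"
   unfolding t1 t2 t3 t4 by (simp add: \<Delta> scaleR_add_right)
  finally show ?thesis .
 qed
 have "(\<exists>N. \<forall>m\<ge>N. (\<Sum>n = 1..m. ?t n) = 0) \<longleftrightarrow> ?A = 0 \<and> ?B = 0"
 proof
  assume "\<exists>N. \<forall>m\<ge>N. (\<Sum>n = 1..m. ?t n) = 0"
  then obtain M where M: "\<forall>m\<ge>M. (\<Sum>n = 1..m. ?t n) = 0" by (elim exE)
  have "(\<Sum>n = 1..max M 5. ?t n) = 0" by (rule M[rule_format]) simp
  then have "(- ?A, ?B) = 0" using S[of "max M 5"] by simp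
  then show "?A = 0 \<and> ?B = 0" by (simp only: zero_prod_def prod.inject neg_equal_0_iff_equal)
 next
  assume "?A = 0 \<and> ?B = 0"
  then have "(- ?A, ?B) = 0" by (simp only: zero_prod_def minus_zero)
  then show "\<exists>N. \<forall>m\<ge>N. (\<Sum>n = 1..m. ?t n) = 0" using S by (intro exI[of _ 5]) simp
 qed
 then show ?thesis unfolding MC_def voronov_def shift_def by simp
qed

lemma lmul_cong_at:
 "(\<And>mS. F mS q = F' mS q) ==> (\<And>mS. G mS q = G' mS q) ==> lmul F G mS q = lmul F' G' mS q"
 by (cases mS) (simp add: lmul_eq)

section \<open>Brackets of global functions\<close>

context split_bundle begin

text \<open>Smoothness in every chart and vanishing off the charts, without a gluing condition. This
  is kept by brackets and is enough for additivity, also of iterated brackets.\<close>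

definition good :: "('m, 'e) gfun => bool" where
 "good f \<longleftrightarrow> (\<forall>c\<in>acharts B A K. \<forall>mS. smooth B (cdom c) (f c mS)) \<and>
  (\<forall>c q mS. \<not> (c \<in> acharts B A K \<and> q \<in> cdom c) \<longrightarrow> f c mS q = 0)"

lemma good_smooth: "good f ==> c \<in> acharts B A K ==> smooth B (cdom c) (f c mS)"
 and good_out: "good f ==> \<not> (c \<in> acharts B A K \<and> q \<in> cdom c) ==> f c mS q = 0"
 unfolding good_def by blast+

lemma Cfun_good: "f \<in> Cfun B A K k ==> good f"
 unfolding good_def
proof (intro conjI ballI allI impI)
 fix c q mS assume f: "f \<in> Cfun B A K k" and n: "\<not> (c \<in> acharts B A K \<and> q \<in> cdom c)"
 show "f c mS q = 0"
  using n Cfun_out[OF f, of c q mS] Cfun_nochart[OF f, of c] by (cases "c \<in> acharts B A K") auto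
qed (rule Cfun_smooth)

lemma good_pb:
 assumes "good f" "good g"
 shows "good (pb B f g)"
 unfolding good_def
proof (intro conjI ballI allI impI)
 fix c mS assume cc: "c \<in> acharts B A K"
 interpret adapted_chart B A K c using cc by unfold_locales
 have "sm Oc (lpb (f c) (g c))"
  by (rule sm_lpb[OF cdata(1) order_refl]) (simp_all add: sm_def good_smooth[OF assms(1) cc] good_smooth[OF assms(2) cc])
 then show "smooth B (cdom c) (pb B f g c mS)" unfolding pb_lpb by (rule smD)
next
 fix c q mS assume n: "\<not> (c \<in> acharts B A K \<and> q \<in> cdom c)"
 show "pb B f g c mS q = 0" by (rule pb_zero_at; rule good_out[OF _ n]; fact)
qed

lemma good_add:
 assumes f: "good f" "good g"
 shows "good (f + g)"
 unfolding good_def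
proof (intro conjI ballI allI impI)
 fix c mS assume cc: "c \<in> acharts B A K"
 interpret adapted_chart B A K c using cc by unfold_locales
 have "smooth B Oc (\<lambda>q. f c mS q + g c mS q)"
  by (rule smooth_add[OF cdata(1) good_smooth[OF f(1) cc] good_smooth[OF f(2) cc]])
 then show "smooth B (cdom c) ((f + g) c mS)" by (simp add: plus_fun_def)
next
 fix c q mS assume n: "\<not> (c \<in> acharts B A K \<and> q \<in> cdom c)"
 show "(f + g) c mS q = 0" using good_out[OF f(1) n] good_out[OF f(2) n] by simp
qed

text \<open>Smoothness enters because \<open>pd\<close> is additive at points of differentiability;
  off the charts all brackets are 0.\<close>

lemma pb_add:
 assumes f: "good f" "good f'" and g: "good g"
 shows "pb B (f + f') g = pb B f g + pb B f' g"
proof (intro ext)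
 fix c mS q
 show "pb B (f + f') g c mS q = (pb B f g + pb B f' g) c mS q"
 proof (cases "c \<in> acharts B A K \<and> q \<in> cdom c")
  case False
  then show ?thesis using good_out[OF good_pb[OF good_add[OF f] g] False] good_out[OF good_pb[OF f(1) g] False]
   good_out[OF good_pb[OF f(2) g] False] by simp
 next
  case True
  then have cc: "c \<in> acharts B A K" "q \<in> cdom c" by auto
  interpret adapted_chart B A K c using cc(1) by unfold_locales
  have d: "ldxf c i (f c + f' c) mS q = (ldxf c i (f c) + ldxf c i (f' c)) mS q" if i: "i < nn" for i mS
  proof -
   have pd: "C.pdiff i (h c mS) q" if "good h" for h
    by (rule smooth_pdiffC[OF good_smooth[OF that cc(1)] cdata(1) cc(2) cc(2) i])
   show ?thesis using ldx_add[OF cc(2) pd[OF f(1)] pd[OF f(2)]] by (simp add: ldxf_def plus_fun_def)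
  qed
  have l: "lmul (ldxf c i (f c + f' c)) X mS q = lmul (ldxf c i (f c)) X mS q + lmul (ldxf c i (f' c)) X mS q"
   if "i < nn" for i X
   using lmul_cong_at[of "ldxf c i (f c + f' c)" q "ldxf c i (f c) + ldxf c i (f' c)" X X mS] d[OF that]
   by (simp add: lmul_add)
  have "lpb (f c + f' c) (g c) mS q = lpb (f c) (g c) mS q + lpb (f' c) (g c) mS q"
   by (simp add: lpb_def fun_sum_apply l ldP_add ldr_add lmul_add sum.distrib sum_subtractf)
  then show ?thesis by (simp add: pb_lpb)
 qed
qed

lemma pb_commute3:
 assumes f: "f \<in> Cfun B A K 3" and g: "g \<in> Cfun B A K 3"
 shows "pb B f g = pb B g f"
proof (intro ext)
 fix c mS q
 show "pb B f g c mS q = pb B g f c mS q"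
 proof (cases "c \<in> acharts B A K \<and> q \<in> cdom c")
  case False
  show ?thesis using good_out[OF good_pb[OF Cfun_good[OF f] Cfun_good[OF g]] False]
   good_out[OF good_pb[OF Cfun_good[OF g] Cfun_good[OF f]] False] by simp
 next
  case True
  then interpret adapted_chart B A K c by unfold_locales simp
  have cc: "c \<in> acharts B A K" "q \<in> Oc" using True by auto
  show ?thesis unfolding pb_lpb
   by (rule lpb_commute3[OF Cfun_hom[OF f] Cfun_rng[OF f cc(1)] _ Cfun_hom[OF g] Cfun_rng[OF g cc(1)] _ cdata(1) cc(2) order_refl])
     (simp_all add: sm_def Cfun_smooth[OF f cc(1)] Cfun_smooth[OF g cc(1)])
 qed
qed

text \<open>Functions of degree 3 commute under the bracket, so the square of the sum is twice the
  Maurer-Cartan expression.\<close>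

lemma master_equation:
 assumes f: "f \<in> Cfun B A K 3" "g \<in> Cfun B A K 3" and z: "pb B f f = 0"
 shows "pb B (f + g) (f + g) = 0 \<longleftrightarrow> pb B f g + (1 / 2) *\<^sub>R pb B g g = 0"
proof -
 note gd = Cfun_good[OF f(1)] Cfun_good[OF f(2)]
 have e: "pb B h (f + g) = pb B f h + pb B g h" if "h \<in> Cfun B A K 3" for h
  using pb_commute3[OF that Cfun_add[OF f]] pb_add[OF gd Cfun_good[OF that]] by simp
 have "pb B (f + g) (f + g) = pb B f (f + g) + pb B g (f + g)"
  by (rule pb_add[OF gd good_add[OF gd]])
 also have "\<dots> = pb B f g + pb B f g + pb B g g"
  unfolding e[OF f(1)] e[OF f(2)] pb_commute3[OF f(2,1)] z by simp
 also have "\<dots> = (2 :: real) *\<^sub>R (pb B f g + (1 / 2) *\<^sub>R pb B g g)"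
  by (simp add: scaleR_add_right scaleR_2)
 finally show ?thesis by simp
qed

end

section \<open>Iterated brackets with the 2-form\<close>

context two_form begin

definition N :: "nat => ('m, 'e) gfun => ('m, 'e) gfun" where
 "N n y = ((\<lambda>y. pb B y F) ^^ n) y"

lemma N_Suc: "N (Suc n) y = pb B (N n y) F"
 by (simp add: N_def)

lemma F_basic: "F \<in> basic B A K 0 2"
 using emb_basic[OF _ \<Phi>, of 0] by simp

lemma F_good: "good F"
 by (rule Cfun_good[of _ 2]) (use F_basic in \<open>simp add: basic_def\<close>)

lemma N_good: "good f ==> good (N n f)"
 by (induction n) (simp add: N_def, simp add: N_Suc good_pb[OF _ F_good])

lemma N_add:
 assumes "good f" "good g"
 shows "N n (f + g) = N n f + N n g"
proof (induction n)
 case (Suc n)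
 show ?case unfolding N_Suc Suc by (rule pb_add[OF N_good[OF assms(1)] N_good[OF assms(2)] F_good])
qed (simp add: N_def)

end

context two_form_chart begin

abbreviation low :: "nat => nat multiset => nat set => bool" where
 "low n m S \<equiv> finite S \<and> size m + card {s\<in>S. odd s} + n \<le> 3"

text \<open>F contains neither P nor \<theta>, so every surviving term of the bracket removes one of
  these from Y. In degree 3 there are at most three of them, and the fourth bracket with F is
  0.\<close>

lemma supp_twist:
 assumes Y: "supp (low n) Y"
 shows "supp (low (Suc n)) (lpb Y (F c))"
proof -
 have F: "supp (\<lambda>m S. m = {#} \<and> (\<forall>s\<in>S. even s)) (F c)" by (rule F_facts)
 have no: "supp (low (Suc n)) (lmul X Z)" if "supp (\<lambda>m S. False) Z" for X Z :: "'m lfun"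
  by (rule supp_lmul[of "\<lambda>m S. True" X "\<lambda>m S. False" Z]) (use that in \<open>auto simp: supp_def\<close>)
 have m: "supp (low (Suc n)) (lmul X Z)" if X: "supp (low (Suc n)) X" and Z: "supp (\<lambda>m S. m = {#} \<and> (\<forall>s\<in>S. even s)) Z" for X Z :: "'m lfun"
 proof (rule supp_lmul[OF X Z])
  fix m1 m2 :: "nat multiset" and S1 S2 :: "nat set"
  assume a: "finite S2" "low (Suc n) m1 S1" "m2 = {#} \<and> (\<forall>s\<in>S2. even s)"
  then have "{s \<in> S1 \<union> S2. odd s} = {s \<in> S1. odd s}" by auto
  then show "low (Suc n) (m1 + m2) (S1 \<union> S2)" using a by simp
 qed
 have r: "supp (low (Suc n)) (lmul (ldr (dual s) Y) (par (ldr s (F c))))" for s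
 proof (cases "even s")
  case True
  show ?thesis
  proof (rule m)
   show "supp (low (Suc n)) (ldr (dual s) Y)"
   proof (rule supp_ldr[OF Y])
    fix m S assume a: "dual s \<notin> S" "low n m (insert (dual s) S)"
    have "{x \<in> insert (dual s) S. odd x} = insert (dual s) {x \<in> S. odd x}" using True by auto
    moreover have "card (insert (dual s) {x \<in> S. odd x}) = Suc (card {x \<in> S. odd x})"
     by (rule card_insert_disjoint) (use a in auto)
    ultimately show "low (Suc n) m S" using a by simp
   qed
   show "supp (\<lambda>m S. m = {#} \<and> (\<forall>s\<in>S. even s)) (par (ldr s (F c)))"
    by (rule supp_par[OF supp_ldr[OF F]]) simp
  qed
 next
  case False
  then show ?thesis by (intro no supp_par supp_ldr[OF F]) simp
 qed
 have "supp (low (Suc n)) (lmul (ldP i Y) (ldxf c i (F c)))" for i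
  by (rule m[OF supp_ldP[OF Y] supp_ldxf[OF F]]) simp
 moreover have "supp (low (Suc n)) (lmul (ldxf c i Y) (ldP i (F c)))" for i
  by (rule no[OF supp_ldP[OF F]]) simp
 ultimately show ?thesis unfolding lpb_def by (intro supp_add supp_sum supp_diff r)
qed

lemma N_low: "hom 3 (y c) ==> supp (low n) (N n y c)"
proof (induction n)
 case 0
 have "low 0 m S" if "finite S \<and> int (2 * size m + card S) = 3" for m :: "nat multiset" and S :: "nat set"
  using that card_mono[of S "{s\<in>S. odd s}"] by auto
 then show ?case using 0 by (simp add: N_def supp_mono)
next
 case (Suc n)
 then show ?case unfolding N_Suc pb_lpb by (intro supp_twist)
qed

lemma N_hom: "hom 3 (y c) ==> hom 3 (N n y c)"
proof (induction n)
 case (Suc n)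
 then show ?case unfolding N_Suc pb_lpb using hom_lpb[OF _ F_facts(1), of 3] by simp
qed (simp add: N_def)

lemma N_rng: "rng (y c) ==> rng (N n y c)"
proof (induction n)
 case (Suc n)
 have "rng (F c)" using emb_rng[OF _ \<Phi>, of 0] by simp
 then show ?case unfolding N_Suc pb_lpb using Suc by (intro rng_lpb)
qed (simp add: N_def)

lemma N_words:
 assumes y: "hom 3 (y c)" and p: "p \<in> Oc" and s: "even s" "even t" "even u"
 shows "Cc (y c) s t u p + Cc (N 1 y c) s t u p + Cc (N 2 y c) s t u p / 2 + Cc (N 3 y c) s t u p / 6 = Tw (F c) (y c) p s t u"
 using twist_exponential[OF F_facts p y s] by (simp add: N_def pb_lpb numeral_2_eq_2 numeral_3_eq_3)

end

context two_form begin

lemma N_nil: "y \<in> Cfun B A K 3 ==> n \<ge> 4 ==> N n y = 0"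
proof (intro ext)
 fix c and mS :: "nat multiset \<times> nat set" and q
 assume y: "y \<in> Cfun B A K 3" and n: "n \<ge> 4"
 show "N n y c mS q = (0 :: ('m, 'e) gfun) c mS q"
 proof (cases "c \<in> acharts B A K \<and> q \<in> cdom c")
  case False
  show ?thesis using good_out[OF N_good[OF Cfun_good[OF y]] False] by simp
 next
  case True
  then interpret two_form_chart B A K \<Phi> c by unfold_locales simp
  have "N n y c (m, S) q = 0" for m S
   using suppD'[OF N_low[of y n, OF Cfun_hom[OF y]], of m S q] n by (cases "N n y c (m, S) q = 0") auto
  then show ?thesis by (cases mS) simp
 qed
qed

text \<open>On the base only products of three \<xi> remain, and by \<open>N_words\<close> their
  coefficients in the exponential series are the values of \<open>Tw\<close> at even
  numbers.\<close>

lemma base_proj_exponential: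
 assumes y: "y \<in> Cfun B A K 3"
 shows "base_proj y + base_proj (N 1 y) + (1 / 2) *\<^sub>R base_proj (N 2 y) + (1 / 6) *\<^sub>R base_proj (N 3 y) = 0 \<longleftrightarrow>
  (\<forall>c\<in>acharts B A K. \<forall>p\<in>cdom c. \<forall>s<2 * r. \<forall>t<2 * r. \<forall>u<2 * r.
    even s \<longrightarrow> even t \<longrightarrow> even u \<longrightarrow> adapted_chart.Tw B c (F c) (y c) p s t u = 0)"
  (is "?Z = 0 \<longleftrightarrow> ?R")
proof -
 have Z: "?Z c (m, S) p = (if m = {#} \<and> (\<forall>s\<in>S. even s)
   then y c (m, S) p + N 1 y c (m, S) p + N 2 y c (m, S) p / 2 + N 3 y c (m, S) p / 6 else 0)" for c m S p
  by (simp add: base_proj_def scaleR_fun_def)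
 note hf = Cfun_hom[OF y]
 show ?thesis
 proof
  assume z: "?Z = 0"
  show ?R
  proof (intro ballI allI impI)
   fix c p s t u assume cc: "c \<in> acharts B A K" "p \<in> cdom c"
    and s: "s < 2 * r" "t < 2 * r" "u < 2 * r" "even s" "even t" "even u"
   interpret two_form_chart B A K \<Phi> c using cc(1) by unfold_locales
   \<comment> \<open>Set to 0 unless all three numbers are even, which makes it alternating on all
     numbers. It is then determined by increasing triples, the ones that are coefficients of
     monomials.\<close>
   define g where "g s t u = (if even s \<and> even t \<and> even u then
     Cc (y c) s t u p + Cc (N 1 y c) s t u p + Cc (N 2 y c) s t u p / 2 + Cc (N 3 y c) s t u p / 6 else 0)" for s t u
   have "g s t u = (\<lambda>s t u. 0) s t u"
   proof (rule alternating3_eq)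
    show "g s t u = - g t s u" for s t u unfolding g_def by (simp add: ev_ldr_swap[of s t])
    show "g s t u = - g s u t" for s t u unfolding g_def by (simp add: ev_ldr_swap3[of s t])
    fix s t u :: nat assume l: "s < t" "t < u"
    have w: "Cc X s t u p = X ({#}, {s, t, u}) p" for X by (simp add: ordered_coeff3[OF l] ev_def)
    have "?Z c ({#}, {s, t, u}) p = 0" unfolding z by simp
    then show "g s t u = 0" unfolding Z g_def w by (simp split: if_splits)
   qed simp_all
   then show "Tw (F c) (y c) p s t u = 0" using N_words[of y, OF hf cc(2) s(4-6)] s by (simp add: g_def)
  qed
 next
  assume R: ?R
  show "?Z = 0"
  proof (intro ext)
   fix c and mS :: "nat multiset \<times> nat set" and p
   obtain m S where mS: "mS = (m, S)" by (cases mS)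
   have "?Z c (m, S) p = 0"
   proof (cases "c \<in> acharts B A K \<and> p \<in> cdom c")
    case False
    have "N n y c (m, S) p = 0" for n by (rule good_out[OF N_good[OF Cfun_good[OF y]] False])
    moreover have "y c (m, S) p = 0" by (rule good_out[OF Cfun_good[OF y] False])
    ultimately show ?thesis unfolding Z by (auto simp del: One_nat_def)
   next
    case True
    then have cc: "c \<in> acharts B A K" "p \<in> cdom c" by auto
    interpret two_form_chart B A K \<Phi> c using cc(1) by unfold_locales
    show ?thesis
    proof (cases "m = {#} \<and> (\<forall>s\<in>S. even s) \<and> S \<subseteq> {..<2 * r} \<and> card S = 3")
     case False
     have z: "X (m, S) p = 0" if "hom 3 X" "rng X" "m = {#}" "\<forall>s\<in>S. even s" for X
      using suppD'[OF that(1), of m S p] suppD'[OF that(2), of m S p] that(3,4) False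
      by (cases "X (m, S) p = 0") auto
     note h = N_hom[of y, OF hf] and rn = N_rng[of y, OF Cfun_rng[OF y cc(1)]]
     show ?thesis unfolding Z
      using z[OF h[of 1] rn[of 1]] z[OF h[of 2] rn[of 2]] z[OF h[of 3] rn[of 3]] z[OF hf Cfun_rng[OF y cc(1)]]
      by auto
    next
     case True
     then have fin: "finite S" using finite_subset[of S "{..<2 * r}"] by auto
     have "length (sorted_list_of_set S) = 3" using True by simp
     then obtain s t u where xs: "sorted_list_of_set S = [s, t, u]" by (elim length_3[THEN exE] exE)
     then have st: "S = {s, t, u}" "s < t" "t < u"
      using strict_sorted_list_of_set[of S] set_sorted_list_of_set[OF fin] by auto
     have w: "Cc X s t u p = X ({#}, S) p" for X by (simp add: ordered_coeff3[OF st(2,3)] st(1) ev_def)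
     have l: "s < 2 * r" "t < 2 * r" "u < 2 * r" "even s" "even t" "even u" using True st by auto
     have "Tw (F c) (y c) p s t u = 0" using R cc l by simp
     then show ?thesis using N_words[of y, OF hf cc(2) l(4-6)] True unfolding Z w by simp
    qed
   qed
   then show "?Z c mS p = (0 :: ('m, 'e) gfun) c mS p" by (simp add: mS)
  qed
 qed
qed

end

theorem corollary2p7:
  fixes B :: "('m::{t2_space,second_countable_topology}, 'e::real_vector) qbundle"
    and \<rho> :: "('m, 'e) anchor"
    and br :: "('m, 'e) sbracket"
    and A K :: "'m \<Rightarrow> 'e set"
    and \<phi> \<psi> \<Phi> :: "'m \<Rightarrow> 'e list \<Rightarrow> real"
    and dA dK :: "('m, 'e) gfun \<Rightarrow> ('m, 'e) gfun"
    and hA hK \<Delta> \<Delta>' :: "('m, 'e) gfun"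
  assumes "courant_algebroid B \<rho> br"
    and "dirac_structure B br A"
    and "isotropic_complement B A K"
    and "curvature_form B br A K \<phi>"
    and "curvature_form B br K A \<psi>"
    and "algebroid_differential B A K \<rho> br 0 A K dA"
    and "algebroid_differential B A K \<rho> br 1 K A dK"
    and "hamiltonian_of B A K 0 dA hA"
    and "hamiltonian_of B A K 1 dK hK"
    and "\<Delta> = - emb B A K 0 3 \<phi> + hA + hK - emb B A K 1 3 \<psi>"
    and "\<Delta>' \<in> Cfun B A K 3"
    and "\<Phi> \<in> forms B A 2"
  shows "(defines_courant B A K (\<Delta> + \<Delta>') \<and>
          dirac_structure B (derived_bracket B A K (\<Delta> + \<Delta>')) (graph_of B A K (- \<Phi>)))
     \<longleftrightarrow>
         (\<Delta>', emb B A K 0 2 \<Phi>) \<in>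
           MC (voronov (shift 2 (Cfun B A K)) (pb B) (shift 2 (basic B A K 0)) base_proj \<Delta>)"
proof -
 have ca: "vector_bundle B" "smooth_pairing B"
  using assms(1) unfolding courant_algebroid_def by simp_all
 have di: "subbundle B A" "\<And>p. A p = {v \<in> fib B p. \<forall>w\<in>A p. pair B p v w = 0}"
  using assms(2) unfolding dirac_structure_def by blast+
 interpret courant_split B A K \<rho> br
  by unfold_locales (fact ca di assms)+
 interpret two_form B A K \<Phi> by unfold_locales (fact assms)
 note dat = assms(2,4-10)
 note D = \<Delta>_Cfun[OF dat] and D' = assms(11)
 have base_add: "base_proj (f + g) = base_proj f + base_proj g" for f g :: "('m, 'e) gfun"
  by (intro ext) (auto simp: base_proj_def)
 have nil: "\<And>n. n \<ge> 4 \<Longrightarrow> N n \<Delta>' = 0" "\<And>n. n \<ge> 4 \<Longrightarrow> N n \<Delta> = 0"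
  by (rule N_nil[OF D'], assumption) (rule N_nil[OF D], assumption)
 have e: "base_proj (N n \<Delta>') + base_proj (N n \<Delta>) = base_proj (N n (\<Delta> + \<Delta>'))" for n
  unfolding N_add[OF Cfun_good[OF D] Cfun_good[OF D']] base_add by simp
 have e0: "base_proj \<Delta>' + base_proj \<Delta> = base_proj (\<Delta> + \<Delta>')"
  unfolding base_add by simp
 have mc: "(\<Delta>', F) \<in> MC (voronov (shift 2 (Cfun B A K)) (pb B) (shift 2 (basic B A K 0)) base_proj \<Delta>) \<longleftrightarrow>
   \<Delta>' \<in> shift 2 (Cfun B A K) 1 \<and> F \<in> shift 2 (basic B A K 0) 0 \<and> pb B \<Delta> \<Delta>' + (1 / 2) *\<^sub>R pb B \<Delta>' \<Delta>' = 0 \<and>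
   (base_proj \<Delta>' + base_proj \<Delta>) + (base_proj (N 1 \<Delta>') + base_proj (N 1 \<Delta>)) +
   (1 / 2) *\<^sub>R (base_proj (N 2 \<Delta>') + base_proj (N 2 \<Delta>)) + (1 / 6) *\<^sub>R (base_proj (N 3 \<Delta>') + base_proj (N 3 \<Delta>)) = 0"
  unfolding N_def
  by (rule voronov_MC_iff[OF base_add base_proj_\<Delta>[OF dat]]; fold N_def; rule nil; assumption)
 \<comment> \<open>The second component of the equation and the Dirac condition both become the
   vanishing of \<open>Tw\<close> for even numbers in all charts; the first component is the master
   equation, given that \<Delta> has self-bracket 0.\<close>
 have "(\<Delta>', F) \<in> MC (voronov (shift 2 (Cfun B A K)) (pb B) (shift 2 (basic B A K 0)) base_proj \<Delta>)
  \<longleftrightarrow> pb B (\<Delta> + \<Delta>') (\<Delta> + \<Delta>') = 0 \<and> dirac_structure B (derived_bracket B A K (\<Delta> + \<Delta>')) G"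
  unfolding mc e e0 base_proj_exponential[OF Cfun_add[OF D D']] graph_dirac[OF Cfun_add[OF D D']]
   master_equation[OF D D' \<Delta>_self[OF dat]]
  using D' F_basic by (simp add: shift_def)
 then show ?thesis using Cfun_add[OF D D'] by (simp add: defines_courant_def)
qed

end
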